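(* Let $n\ge1$ and $d\ge1$ be integers, let $W(B_n)$ be realised as below with Coxeter element $c=[1,2,\dots,n]$, and let all types have combined rank $\operatorname{rk}T_1+\operatorname{rk}T_2+\dots+\operatorname{rk}T_d=n$. (i) Suppose that for some $j\in\{1,\dots,d\}$ and some $\alpha\ge1$, $T_i=A_1^{m_1^{(i)}}*A_2^{m_2^{(i)}}*\dots*A_n^{m_n^{(i)}}$ for $i\ne j$, and $T_j=B_\alpha*A_1^{m_1^{(j)}}*A_2^{m_2^{(j)}}*\dots*A_n^{m_n^{(j)}}$. Then $$N_{B_n}^{\text{comb}}(T_1,\dots,T_d)=n^{d-1}\binom{n-\operatorname{rk}T_j}{m_1^{(j)},m_2^{(j)},\dots,m_n^{(j)}}\prod_{i\ne j}\frac{1}{n-\operatorname{rk}T_i}\binom{n-\operatorname{rk}T_i}{m_1^{(i)},m_2^{(i)},\dots,m_n^{(i)}}.$$ If $\alpha\ge2$, then $N_{B_n}(T_1,\dots,T_d)$ (with $T_j$ read as a group-theoretic type) is given by the same formula. (ii) Suppose $T_i=A_1^{m_1^{(i)}}*\dots*A_n^{m_n^{(i)}}$ for all $i=1,\dots,d$. Then $$N_{B_n}(T_1,\dots,T_d)=n^{d-1}\Bigg(\prod_{i=1}^{d}\frac{1}{n-\operatorname{rk}T_i}\binom{n-\operatorname{rk}T_i}{m_1^{(i)},\dots,m_n^{(i)}}\Bigg)\sum_{j=1}^{d}\frac{m_1^{(j)}(n-\operatorname{rk}T_j)}{m_0^{(j)}+1},$$ where $m_0^{(j)}=n-\operatorname{rk}T_j-\sum_{s=1}^{n}m_s^{(j)}$.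 (iii) All other decomposition numbers $N_{B_n}(T_1,\dots,T_d)$ and $N^{\text{comb}}_{B_n}(T_1,\dots,T_d)$ with $\operatorname{rk}T_1+\dots+\operatorname{rk}T_d=n$ (i.e. those for types not of the form covered by the formulas in (i) and (ii); in particular $N^{\text{comb}}_{B_n}$ for types all of the form in (ii)) are zero.
   Context: For a finite reflection group $W$ with set of reflections $T$, the absolute length $\ell_T(w)$ is the minimal number of reflections whose product is $w$, and the absolute order is $u\le_T w$ iff $\ell_T(w)=\ell_T(u)+\ell_T(u^{-1}w)$. Every element $u\le_T c$ ($c$ a Coxeter element) is a Coxeter element of a parabolic subgroup, and its (group-theoretic) type is the type of that parabolic subgroup. Types are written as orthogonal products, e.g. $A_1^{m_1}*A_2^{m_2}*\cdots$ means $m_k$ copies of $A_k$; $\operatorname{rk}T$ is the rank of the root system of type $T$. The decomposition number $N_{B_n}(T_1,\dots,T_d)$ is the number of tuples $(c_1,\dots,c_d)$ with $c_1c_2\cdots c_d\le_T c$, $\ell_T(c_1)+\dots+\ell_T(c_d)=\ell_T(c_1\cdots c_d)$, and $c_i$ of type $T_i$ for each $i$. Realisation of $W(B_n)$: the permutations $\pi$ of $\{1,\dots,n,\bar1,\dots,\bar n\}$ with $\pi(\bar i)=\overline{\pi(i)}$ (with $\bar{\bar i}=i$). A type $A$ cycle is $((a_1,\dots,a_k)):=(a_1,\dots,a_k)(\bar a_1,\dots,\bar a_k)$, a type $B$ cycle is $[a_1,\dots,a_k]:=(a_1,\dots,a_k,\bar a_1,\dots,\bar a_k)$; $k$ is the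 length. Every element is uniquely (up to order) a product of disjoint such cycles. The combinatorial type of an element is the product of $A_{k-1}$ over its type $A$ cycles of length $k\ge2$ and of $B_k$ over its type $B$ cycles of length $k\ge1$ (so $B_1$, i.e. $[i]=(i,\bar i)$, is distinguished from $A_1$); $\operatorname{rk}A_k=\operatorname{rk}B_k=k$, additive over products. $N^{\text{comb}}_{B_n}(T_1,\dots,T_d)$ is defined like $N_{B_n}$ but with $c=[1,2,\dots,n]$ and with "combinatorial type" in place of type. The multinomial coefficient is $\binom{M}{m_1,\dots,m_r}=\frac{M!}{m_1!\cdots m_r!\,(M-m_1-\dots-m_r)!}$.
   Formalization: In (ii) the displayed formula is 0/0 when some rk T_j = n or m_0^(j) = −1 (e.g. n=1, T_1=A_1); it is stated where no denominator vanishes, and for all exponents with the factor n−rk T_j cancelled and 1/(m_0!(m_0+1)) read as 1/(m_0+1)!. *)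

theory Defs
  imports Complex_Main "HOL-Library.Multiset" "HOL-Combinatorics.Cycles"
begin

section \<open>The group \<open>W(B\<^sub>n)\<close>\<close>

text \<open>
  The letter \<open>\<bar>i\<close> (i bar) is encoded as the integer \<open>- i\<close>, so that the underlying set is
  \<open>{-n..n} - {0}\<close>. Permutations are functions on all integers that fix everything else, and
  products are compositions of functions, \<open>(u v) i = u (v i)\<close>.
\<close>

definition signed_letters :: "nat \<Rightarrow> int set" where
  "signed_letters n = {- int n..int n} - {0}"

definition W_B :: "nat \<Rightarrow> (int \<Rightarrow> int) set" where
  "W_B n = {w. w permutes signed_letters n \<and> (\<forall>i. w (- i) = - w i)}"

definition cycle_A :: "int list \<Rightarrow> int \<Rightarrow> int" where
  "cycle_A as = cycle_of_list as \<circ> cycle_of_list (map uminus as)"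

definition cycle_B :: "int list \<Rightarrow> int \<Rightarrow> int" where
  "cycle_B as = cycle_of_list (as @ map uminus as)"

definition prod_perm :: "(int \<Rightarrow> int) list \<Rightarrow> int \<Rightarrow> int" where
  "prod_perm ws = foldr (\<circ>) ws id"

definition cox :: "nat \<Rightarrow> int \<Rightarrow> int" where
  "cox n = cycle_B [1..int n]"

definition simple_reflections :: "nat \<Rightarrow> (int \<Rightarrow> int) set" where
  "simple_reflections n =
     (if n = 0 then {} else insert (cycle_B [1]) ((\<lambda>i. cycle_A [i, i + 1]) ` {1..<int n}))"

definition reflections :: "nat \<Rightarrow> (int \<Rightarrow> int) set" where
  "reflections n = {w \<circ> s \<circ> inv w | w s. w \<in> W_B n \<and> s \<in> simple_reflections n}"

definition abs_length :: "nat \<Rightarrow> (int \<Rightarrow> int) \<Rightarrow> nat" where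
  "abs_length n w =
     (LEAST k. \<exists>ts. length ts = k \<and> set ts \<subseteq> reflections n \<and> prod_perm ts = w)"

definition abs_le :: "nat \<Rightarrow> (int \<Rightarrow> int) \<Rightarrow> (int \<Rightarrow> int) \<Rightarrow> bool" where
  "abs_le n u w \<longleftrightarrow> abs_length n w = abs_length n u + abs_length n (inv u \<circ> w)"


section \<open>Types\<close>

text \<open>
  A type is a multiset of irreducible types. The same labels serve for combinatorial types
  and for group-theoretic types; the admissible labels differ (see \<open>is_comb_type\<close> and
  \<open>is_group_type\<close> below).
\<close>

datatype irr_type =
  Type_A nat | Type_B nat | Type_D nat | Type_E nat | Type_F4 | Type_H nat | Type_I nat

type_synonym refl_type = "irr_type multiset"

fun irr_rank :: "irr_type \<Rightarrow> nat" where
  "irr_rank (Type_A k) = k"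
| "irr_rank (Type_B k) = k"
| "irr_rank (Type_D k) = k"
| "irr_rank (Type_E k) = k"
| "irr_rank Type_F4 = 4"
| "irr_rank (Type_H k) = k"
| "irr_rank (Type_I m) = 2"

definition rk :: "refl_type \<Rightarrow> nat" where
  "rk T = (\<Sum>X\<in>#T. irr_rank X)"

definition is_comb_type :: "refl_type \<Rightarrow> bool" where
  "is_comb_type T \<longleftrightarrow> (\<forall>X\<in>#T. \<exists>k\<ge>1. X = Type_A k \<or> X = Type_B k)"

text \<open>
  The irreducible finite Coxeter groups, each listed once: the labels \<open>B\<^sub>1 = A\<^sub>1\<close>,
  \<open>D\<^sub>2 = A\<^sub>1 * A\<^sub>1\<close>, \<open>D\<^sub>3 = A\<^sub>3\<close>, \<open>I\<^sub>2(3) = A\<^sub>2\<close>, \<open>I\<^sub>2(4) = B\<^sub>2\<close> are excluded;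
  \<open>I\<^sub>2(6)\<close> is \<open>G\<^sub>2\<close>.
\<close>

fun is_group_irr :: "irr_type \<Rightarrow> bool" where
  "is_group_irr (Type_A k) \<longleftrightarrow> k \<ge> 1"
| "is_group_irr (Type_B k) \<longleftrightarrow> k \<ge> 2"
| "is_group_irr (Type_D k) \<longleftrightarrow> k \<ge> 4"
| "is_group_irr (Type_E k) \<longleftrightarrow> k \<in> {6, 7, 8}"
| "is_group_irr Type_F4 \<longleftrightarrow> True"
| "is_group_irr (Type_H k) \<longleftrightarrow> k \<in> {3, 4}"
| "is_group_irr (Type_I m) \<longleftrightarrow> m \<ge> 5"

definition is_group_type :: "refl_type \<Rightarrow> bool" where
  "is_group_type T \<longleftrightarrow> (\<forall>X\<in>#T. is_group_irr X)"


subsection \<open>Group-theoretic type\<close>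

text \<open>
  \<open>cox_bond X i j\<close>, for \<open>i < j\<close>, is the label of the pair of nodes \<open>i, j\<close> in the Coxeter
  diagram of type \<open>X\<close> on the nodes \<open>0, ..., rk X - 1\<close>, with \<open>2\<close> for non-adjacent nodes. In
  type \<open>D\<close> the nodes \<open>0\<close> and \<open>1\<close> are the two short arms at the branch node \<open>2\<close>; in type \<open>E\<close>
  node \<open>0\<close> is attached to node \<open>3\<close> of the path \<open>1, 2, 3, ...\<close>.
\<close>

fun cox_bond :: "irr_type \<Rightarrow> nat \<Rightarrow> nat \<Rightarrow> nat" where
  "cox_bond (Type_A k) i j = (if j = Suc i then 3 else 2)"
| "cox_bond (Type_B k) i j = (if j = Suc i then if i = 0 then 4 else 3 else 2)"
| "cox_bond (Type_D k) i j = (if i = 0 \<and> j = 2 \<or> i \<ge> 1 \<and> j = Suc i then 3 else 2)"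
| "cox_bond (Type_E k) i j = (if i = 0 \<and> j = 3 \<or> i \<ge> 1 \<and> j = Suc i then 3 else 2)"
| "cox_bond Type_F4 i j = (if j = Suc i then if i = 1 then 4 else 3 else 2)"
| "cox_bond (Type_H k) i j = (if j = Suc i then if i = 0 then 5 else 3 else 2)"
| "cox_bond (Type_I m) i j = m"

definition cox_matrix :: "irr_type \<Rightarrow> nat \<Rightarrow> nat \<Rightarrow> nat" where
  "cox_matrix X i j = (if i = j then 1 else cox_bond X (min i j) (max i j))"

definition perm_order :: "(int \<Rightarrow> int) \<Rightarrow> nat" where
  "perm_order w = (LEAST k. k > 0 \<and> w ^^ k = id)"

definition diagram_nodes :: "irr_type list \<Rightarrow> (nat \<times> nat) set" where
  "diagram_nodes Xs = (SIGMA i:{..<length Xs}. {..<irr_rank (Xs ! i)})"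

definition has_diagram :: "(int \<Rightarrow> int) set \<Rightarrow> refl_type \<Rightarrow> bool" where
  "has_diagram R T \<longleftrightarrow>
     (\<exists>Xs f. mset Xs = T \<and> bij_betw f (diagram_nodes Xs) R \<and>
        (\<forall>(i, a)\<in>diagram_nodes Xs. \<forall>(j, b)\<in>diagram_nodes Xs.
           perm_order (f (i, a) \<circ> f (j, b)) = (if i = j then cox_matrix (Xs ! i) a b else 2)))"

text \<open>The subgroup generated by \<open>R\<close>; no inverses are needed in a finite group.\<close>

definition gen_by :: "(int \<Rightarrow> int) set \<Rightarrow> (int \<Rightarrow> int) set" where
  "gen_by R = {prod_perm ws | ws. set ws \<subseteq> R}"

definition parabolic_systems :: "nat \<Rightarrow> (int \<Rightarrow> int) set set" where
  "parabolic_systems n =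
     {(\<lambda>s. w \<circ> s \<circ> inv w) ` J | w J. w \<in> W_B n \<and> J \<subseteq> simple_reflections n}"

text \<open>
  A parabolic subgroup is a conjugate of a standard parabolic subgroup. All its simple systems
  are conjugate under it, so they are exactly the members of \<open>parabolic_systems n\<close> that
  generate it.
\<close>

definition parabolic_subgroups :: "nat \<Rightarrow> (int \<Rightarrow> int) set set" where
  "parabolic_subgroups n = gen_by ` parabolic_systems n"

definition simple_systems :: "nat \<Rightarrow> (int \<Rightarrow> int) set \<Rightarrow> (int \<Rightarrow> int) set set" where
  "simple_systems n P = {R \<in> parabolic_systems n. gen_by R = P}"

definition coxeter_elements :: "nat \<Rightarrow> (int \<Rightarrow> int) set \<Rightarrow> (int \<Rightarrow> int) set" where
  "coxeter_elements n P = {prod_perm ss | ss. distinct ss \<and> set ss \<in> simple_systems n P}"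

definition subgroup_has_type :: "nat \<Rightarrow> (int \<Rightarrow> int) set \<Rightarrow> refl_type \<Rightarrow> bool" where
  "subgroup_has_type n P T \<longleftrightarrow> (\<exists>R\<in>simple_systems n P. has_diagram R T)"

definition has_group_type :: "nat \<Rightarrow> (int \<Rightarrow> int) \<Rightarrow> refl_type \<Rightarrow> bool" where
  "has_group_type n u T \<longleftrightarrow>
     (\<exists>P\<in>parabolic_subgroups n. u \<in> coxeter_elements n P \<and> subgroup_has_type n P T)"


subsection \<open>Combinatorial type\<close>

text \<open>
  \<open>As\<close> and \<open>Bs\<close> are the nontrivial cycles of type \<open>A\<close> and \<open>B\<close>. Distinctness of all letters
  together with their negatives says that the cycles are genuine and disjoint, and excludes
  the letter \<open>0\<close>.
\<close>

definition has_comb_type :: "(int \<Rightarrow> int) \<Rightarrow> refl_type \<Rightarrow> bool" where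
  "has_comb_type w T \<longleftrightarrow>
     (\<exists>As Bs. (\<forall>as\<in>set As. length as \<ge> 2) \<and> (\<forall>bs\<in>set Bs. length bs \<ge> 1) \<and>
        distinct (concat (As @ Bs) @ map uminus (concat (As @ Bs))) \<and>
        w = prod_perm (map cycle_A As @ map cycle_B Bs) \<and>
        T = mset (map (\<lambda>as. Type_A (length as - 1)) As @ map (\<lambda>bs. Type_B (length bs)) Bs))"


section \<open>Decomposition numbers\<close>

definition decompositions ::
    "nat \<Rightarrow> ((int \<Rightarrow> int) \<Rightarrow> refl_type \<Rightarrow> bool) \<Rightarrow> refl_type list \<Rightarrow> (int \<Rightarrow> int) list set" where
  "decompositions n has_type Ts =
     {cs. length cs = length Ts \<and> set cs \<subseteq> W_B n \<and>
          abs_le n (prod_perm cs) (cox n) \<and>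
          (\<Sum>c\<leftarrow>cs. abs_length n c) = abs_length n (prod_perm cs) \<and>
          (\<forall>i<length Ts. has_type (cs ! i) (Ts ! i))}"

definition N_B :: "nat \<Rightarrow> refl_type list \<Rightarrow> nat" where
  "N_B n Ts = card (decompositions n (has_group_type n) Ts)"

definition N_B_comb :: "nat \<Rightarrow> refl_type list \<Rightarrow> nat" where
  "N_B_comb n Ts = card (decompositions n has_comb_type Ts)"


section \<open>Ingredients of the formulas\<close>

definition A_type :: "nat \<Rightarrow> (nat \<Rightarrow> nat) \<Rightarrow> refl_type" where
  "A_type n m = (\<Sum>s = 1..n. replicate_mset (m s) (Type_A s))"

text \<open>Factors are indexed from \<open>0\<close>, and \<open>m i s\<close> is the exponent of \<open>A\<^sub>s\<close> in the \<open>i\<close>-th type.\<close>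

definition types_one_B :: "nat \<Rightarrow> nat \<Rightarrow> nat \<Rightarrow> (nat \<Rightarrow> nat \<Rightarrow> nat) \<Rightarrow> refl_type list \<Rightarrow> bool" where
  "types_one_B n j \<alpha> m Ts \<longleftrightarrow>
     j < length Ts \<and>
     (\<forall>i<length Ts. Ts ! i = (if i = j then {#Type_B \<alpha>#} else {#}) + A_type n (m i))"

definition types_all_A :: "nat \<Rightarrow> (nat \<Rightarrow> nat \<Rightarrow> nat) \<Rightarrow> refl_type list \<Rightarrow> bool" where
  "types_all_A n m Ts \<longleftrightarrow> (\<forall>i<length Ts. Ts ! i = A_type n (m i))"

text \<open>\<open>1 / k!\<close>, with the usual value \<open>0\<close> at the negative integers.\<close>

definition recip_fact :: "int \<Rightarrow> real" where
  "recip_fact k = (if k < 0 then 0 else 1 / fact (nat k))"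

definition multinomial :: "nat \<Rightarrow> nat \<Rightarrow> (nat \<Rightarrow> nat) \<Rightarrow> real" where
  "multinomial M r m =
     fact M / (\<Prod>s = 1..r. fact (m s)) * recip_fact (int M - int (\<Sum>s = 1..r. m s))"

definition m0 :: "nat \<Rightarrow> refl_type \<Rightarrow> (nat \<Rightarrow> nat) \<Rightarrow> int" where
  "m0 n T m = int n - int (rk T) - int (\<Sum>s = 1..n. m s)"

end

theory Submission
  imports Defs "HOL-Combinatorics.Orbits"
begin

text \<open>
  Record a signed permutation by the partition of \<open>{1, ..., n}\<close> into the supports of its cycles,
  with the supports of the type \<open>B\<close> cycles flagged. If the absolute lengths of the factors add up
  to \<open>n\<close> and the product is a type \<open>B\<close> cycle of length \<open>n\<close>, then exactly one type \<open>B\<close> cycle occurs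
  and the supports connect \<open>{1, ..., n}\<close> like the edges of a tree. The converse holds too, and all
  type \<open>B\<close> cycles of length \<open>n\<close> are conjugate, so it suffices to count tree-like tuples. Given two
  blocks \<open>a\<close> and \<open>b\<close>, exactly \<open>\<bar>a\<bar> - 1\<close> letters of \<open>a\<close> can be moved to \<open>b\<close> without destroying
  the tree; counting these moves from both sides tells how the number of tuples depends on the types,
  and reduces everything to one full type \<open>B\<close> cycle and identities.

  Group-theoretic types come from the same data: all Coxeter elements of a parabolic subgroup have
  the same cycle structure, and a connected subdiagram of the diagram of \<open>B\<^sub>n\<close> is an interval. So
  \<open>u\<close> has a group-theoretic type iff it has at most one type \<open>B\<close> cycle, and the type is the
  combinatorial one with \<open>B\<^sub>1\<close> read as \<open>A\<^sub>1\<close>. Hence (ii) is the sum over \<open>j\<close> of (i) with one of the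
  \<open>A\<^sub>1\<close> in \<open>T\<^sub>j\<close> turned into \<open>B\<^sub>1\<close>.
\<close>

section \<open>Connected families of sets\<close>

text \<open>A move compares two numbers of tuples without any arithmetic in the block sizes: a block
  with a + 1 letters can give away a of them, and each fits into 2 b signed places of a block with b
  letters; backwards these are b letters and 2 a places. The factor 2 a b cancels, and only the
  numbers of block pairs with the prescribed labels remain. Inside one factor these are quotients of
  products of factorials of multiplicities (\<open>weight\<close>), the denominators of the
  multinomial coefficients. Between two factors the moved letter must be fixed by the receiving one.
  For general factors this depends on the tuple, so each factor is first contracted to a single
  block and fixed letters (a \<open>hub\<close>); moves between hubs then supply the powers of n.
  Connectedness is expressed by colourings instead of paths. A colouring is constant on the blocks
  of w iff it is invariant under w, and invariance passes to products. The same language gives the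
  lower bound for the absolute length, by odd colourings, and shows that the blocks of a Coxeter
  element of a parabolic subgroup depend on the subgroup only.\<close>

definition compatible :: "int set multiset \<Rightarrow> (int \<Rightarrow> int) \<Rightarrow> bool" where
  "compatible H r \<longleftrightarrow> (\<forall>S\<in>#H. \<forall>u\<in>S. \<forall>v\<in>S. r u = r v)"

text \<open>Connectedness of the hypergraph with edge multiset H on the vertices U. The form by
  colourings fits permutations, whose invariant colourings are those constant on the blocks.\<close>

definition hconn :: "int set multiset \<Rightarrow> int set \<Rightarrow> bool" where
  "hconn H U \<longleftrightarrow> (\<forall>r. compatible H r \<longrightarrow> (\<forall>u\<in>U. \<forall>v\<in>U. r u = r v))"

lemma compatible_add: "compatible (add_mset S H) r \<longleftrightarrow> (\<forall>u\<in>S. \<forall>v\<in>S. r u = r v) \<and> compatible H r"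
  by (auto simp: compatible_def)

text \<open>Start from the injective colouring and add the edges one at a time. An edge S identifies
  at most card S colours, so it costs at most card S - 1 of them.\<close>

lemma compatible_colouring_exists:
  assumes "finite U" "\<forall>S\<in>#H. S \<noteq> {} \<and> S \<subseteq> U"
  shows "\<exists>r. compatible H r \<and> card U \<le> card (r ` U) + (\<Sum>S\<in>#H. card S - 1)"
  using assms(2)
proof (induction H)
  case empty
  show ?case by (rule exI[of _ id]) (auto simp: compatible_def)
next
  case (add S H)
  then obtain r where r: "compatible H r" "card U \<le> card (r ` U) + (\<Sum>S\<in>#H. card S - 1)"
    by auto
  from add.prems have S: "S \<noteq> {}" "S \<subseteq> U" by auto
  then obtain s where s: "s \<in> S" by auto
  define r' where "r' = (\<lambda>u. if r u \<in> r ` S then r s else r u)"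
  have fin: "finite (r ` U)" "finite S" using assms(1) finite_subset[OF S(2)] by auto
  have comp: "compatible (add_mset S H) r'"
    unfolding compatible_def
  proof (intro ballI)
    fix T u v assume T: "T \<in># add_mset S H" "u \<in> T" "v \<in> T"
    show "r' u = r' v"
    proof (cases "T = S")
      case False
      then have "T \<in># H" using T by simp
      then have "r u = r v" using T r(1) unfolding compatible_def by blast
      then show ?thesis by (simp add: r'_def)
    qed (use T in \<open>simp add: r'_def\<close>)
  qed
  have "r ` U \<subseteq> r' ` U \<union> (r ` S - {r s})"
  proof
    fix c assume "c \<in> r ` U"
    then obtain u where u: "u \<in> U" "c = r u" by auto
    show "c \<in> r' ` U \<union> (r ` S - {r s})"
    proof (cases "c \<in> r ` S - {r s}")
      case False
      then have "r' u = c" using u by (auto simp: r'_def)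
      then have "c \<in> r' ` U" using u(1) by (metis imageI)
      then show ?thesis by simp
    qed auto
  qed
  then have "card (r ` U) \<le> card (r' ` U \<union> (r ` S - {r s}))"
    using fin assms(1) by (intro card_mono) auto
  also have "\<dots> \<le> card (r' ` U) + card (r ` S - {r s})" by (rule card_Un_le)
  also have "card (r ` S - {r s}) = card (r ` S) - 1" using fin s by simp
  also have "\<dots> \<le> card S - 1" using card_image_le[OF fin(2), of r] by simp
  finally have "card (r ` U) \<le> card (r' ` U) + (card S - 1)" by simp
  then show ?case using r(2) comp by (intro exI[of _ r']) auto
qed

text \<open>A connected hypergraph leaves a single colour. Equality in this bound is what being a
  tree means in all that follows.\<close>

lemma hconn_card_bound:
  assumes "finite U" "\<forall>S\<in>#H. S \<noteq> {} \<and> S \<subseteq> U" "hconn H U"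
  shows "card U \<le> 1 + (\<Sum>S\<in>#H. card S - 1)"
proof -
  obtain r where r: "compatible H r" "card U \<le> card (r ` U) + (\<Sum>S\<in>#H. card S - 1)"
    using compatible_colouring_exists[OF assms(1,2)] by auto
  have "card (r ` U) \<le> 1"
  proof (cases "U = {}")
    case False
    then obtain u where "u \<in> U" by auto
    then have "r ` U = {r u}" using assms(3) r(1) unfolding hconn_def by blast
    then show ?thesis by simp
  qed auto
  then show ?thesis using r(2) by simp
qed

text \<open>Exactly one element of \<open>a\<close> is the gate towards \<open>b\<close>; all the others can be moved.\<close>

lemma card_movable:
  assumes "finite U" and sub: "\<forall>S\<in>#add_mset a (add_mset b G). S \<noteq> {} \<and> S \<subseteq> U"
    and conn: "hconn (add_mset a (add_mset b G)) U"
    and tree: "(\<Sum>S\<in>#add_mset a (add_mset b G). card S - 1) + 1 = card U"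
    and "card a \<ge> 2"
  shows "card {x\<in>a. hconn (add_mset (a - {x}) (add_mset (insert x b) G)) U} = card a - 1"
proof -
  \<comment> \<open>K is the part of U that the edges other than a join to b. The gate is the unique
    common element of a and K.\<close>
  define K where "K = {u\<in>U. \<forall>r. compatible (add_mset b G) r \<longrightarrow> (\<forall>v\<in>b. r u = r v)}"
  have a: "a \<noteq> {}" "a \<subseteq> U" and b: "b \<noteq> {}" "b \<subseteq> U" and G: "\<forall>S\<in>#G. S \<noteq> {} \<and> S \<subseteq> U"
    using sub by auto
  have fa: "finite a" using finite_subset[OF a(2) assms(1)] .
  \<comment> \<open>A mere deletion of x from a lowers the tree sum by one, below the bound for
    connected hypergraphs.\<close>
  have small: "\<not> hconn (add_mset (a - {x}) (add_mset b G)) U" if x: "x \<in> a" for x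
  proof
    assume h: "hconn (add_mset (a - {x}) (add_mset b G)) U"
    have "a - {x} \<noteq> {}"
    proof
      assume "a - {x} = {}"
      then have "a = {x}" using x by auto
      then show False using \<open>card a \<ge> 2\<close> by simp
    qed
    then have "card U \<le> 1 + (\<Sum>S\<in>#add_mset (a - {x}) (add_mset b G). card S - 1)"
      using a b G by (intro hconn_card_bound[OF assms(1) _ h]) auto
    then show False using tree x fa \<open>card a \<ge> 2\<close> by simp
  qed
  have K: "b \<subseteq> K" using b unfolding K_def compatible_add by blast
  \<comment> \<open>If a missed K, the indicator function of K would be a nonconstant compatible
    colouring.\<close>
  have ne: "a \<inter> K \<noteq> {}"
  proof
    assume e: "a \<inter> K = {}"
    define r where "r = (\<lambda>u. if u \<in> K then 1 else 0 :: int)"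
    have KK: "r u = r v" if S: "S \<in># add_mset b G" "u \<in> S" "v \<in> S" for S u v
    proof -
      have "r u = r v" if "compatible (add_mset b G) r" for r
        using that S unfolding compatible_def by blast
      moreover have "u \<in> U" "v \<in> U" using S b G by auto
      ultimately have "(u \<in> K) = (v \<in> K)" unfolding K_def by (smt (verit) mem_Collect_eq)
      then show ?thesis unfolding r_def by argo
    qed
    then have "compatible (add_mset b G) r" unfolding compatible_def by blast
    moreover have "r u = 0" if "u \<in> a" for u using that e by (auto simp: r_def)
    ultimately have "compatible (add_mset a (add_mset b G)) r" unfolding compatible_add[of a] by metis
    then have "\<forall>u\<in>U. \<forall>v\<in>U. r u = r v" using conn unfolding hconn_def by blast
    then have "r u = r v" if "u \<in> a" "v \<in> b" for u v using that a b by blast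
    moreover obtain u v where "u \<in> a" "v \<in> b" using a b by blast
    ultimately have "r u = r v" "u \<notin> K" "v \<in> K" using e K by blast+
    then show False by (simp add: r_def)
  qed
  \<comment> \<open>If x and y in a were both joined to b by the other edges, then x could be
    deleted from a without disconnecting anything, against \<open>small\<close>.\<close>
  have le1: "x = y" if "x \<in> a \<inter> K" "y \<in> a \<inter> K" for x y
  proof (rule ccontr)
    assume "x \<noteq> y"
    have "hconn (add_mset (a - {x}) (add_mset b G)) U"
      unfolding hconn_def
    proof (intro allI impI)
      fix r assume r: "compatible (add_mset (a - {x}) (add_mset b G)) r"
      then have "compatible (add_mset b G) r" by (simp only: compatible_add[of "a - {x}"])
      then have "\<forall>v\<in>b. r x = r v" "\<forall>v\<in>b. r y = r v" using that unfolding K_def by blast+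
      then have "r x = r y" using b(1) by (metis all_not_in_conv)
      then have "compatible (add_mset a (add_mset b G)) r" using r \<open>x \<noteq> y\<close> that
        unfolding compatible_add[of a] compatible_add[of "a - {x}"]
        by (metis DiffI IntE empty_iff insert_iff)
      then show "\<forall>u\<in>U. \<forall>v\<in>U. r u = r v" using conn unfolding hconn_def by blast
    qed
    then show False using small that by auto
  qed
  obtain g where g: "a \<inter> K = {g}" using ne le1 by blast
  \<comment> \<open>Adding the gate to b changes nothing, as it is joined to b anyway, so moving it
    amounts to deleting it from a. If x is not the gate, the gate stays in a and keeps the rest of a
    joined to b, while x is joined to b by the new edge.\<close>
  have mov: "hconn (add_mset (a - {x}) (add_mset (insert x b) G)) U \<longleftrightarrow> x \<noteq> g" if x: "x \<in> a" for x
  proof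
    assume h: "hconn (add_mset (a - {x}) (add_mset (insert x b) G)) U"
    show "x \<noteq> g"
    proof
      assume "x = g"
      then have "x \<in> K" using g by auto
      have "hconn (add_mset (a - {x}) (add_mset b G)) U"
        unfolding hconn_def
      proof (intro allI impI)
        fix r assume r: "compatible (add_mset (a - {x}) (add_mset b G)) r"
        then have "compatible (add_mset b G) r" by (simp only: compatible_add[of "a - {x}"])
        then have "\<forall>v\<in>b. r x = r v" using \<open>x \<in> K\<close> unfolding K_def by blast
        then have "compatible (add_mset (a - {x}) (add_mset (insert x b) G)) r" using r
          unfolding compatible_add by (metis insert_iff)
        then show "\<forall>u\<in>U. \<forall>v\<in>U. r u = r v" using h unfolding hconn_def by blast
      qed
      then show False using small x by auto
    qed
  next
    assume "x \<noteq> g"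
    show "hconn (add_mset (a - {x}) (add_mset (insert x b) G)) U"
      unfolding hconn_def
    proof (intro allI impI)
      fix r assume r: "compatible (add_mset (a - {x}) (add_mset (insert x b) G)) r"
      then have rb: "compatible (add_mset b G) r" unfolding compatible_add by blast
      obtain v where v: "v \<in> b" using b by auto
      have "r x = r v" using r v unfolding compatible_add by blast
      moreover have "r g = r v" using g rb v unfolding K_def by blast
      moreover have "\<forall>u\<in>a - {x}. r u = r g" using r g \<open>x \<noteq> g\<close>
        unfolding compatible_add by blast
      ultimately have "\<forall>u\<in>a. r u = r v" by (metis DiffI singletonD)
      then have "compatible (add_mset a (add_mset b G)) r" using rb
        unfolding compatible_add[of a] by metis
      then show "\<forall>u\<in>U. \<forall>v\<in>U. r u = r v" using conn unfolding hconn_def by blast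
    qed
  qed
  have "{x\<in>a. hconn (add_mset (a - {x}) (add_mset (insert x b) G)) U} = a - {g}"
    using mov by auto
  moreover have "g \<in> a" using g by blast
  ultimately show ?thesis using fa by simp
qed

section \<open>Orbits and transpositions\<close>

lemma orbit_closed_subset:
  assumes "u \<in> S" "\<And>v. v \<in> S \<Longrightarrow> f v \<in> S"
  shows "orbit f u \<subseteq> S"
proof
  fix y assume "y \<in> orbit f u" then show "y \<in> S" by induct (auto simp: assms)
qed

lemma orbit_eq_or_disjoint:
  assumes "permutation f" "x \<in> orbit f u" "x \<in> orbit f v"
  shows "orbit f u = orbit f v"
  using orbit_cyclic_eq3[OF cyclic_on_orbit'[OF assms(1)] assms(2)]
    orbit_cyclic_eq3[OF cyclic_on_orbit'[OF assms(1)] assms(3)] by simp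

text \<open>The arrow into z is redirected to x, and the loop at x becomes an arrow to z: x is
  spliced into the cycle of z just before z, and all other orbits stay.\<close>

lemma orbit_transpose_insert:
  assumes f: "permutation f" and x: "f x = x" and z: "z \<noteq> x"
  shows "orbit (transpose x z \<circ> f) u =
    (if u \<in> insert x (orbit f z) then insert x (orbit f z) else orbit f u)"
proof -
  let ?g = "transpose x z \<circ> f"
  have g: "permutation ?g" using f by (intro permutation_compose permutation_swap_id)
  have bf: "inj f" using f by (simp add: permutation_bijective bij_is_inj)
  have zz: "z \<in> orbit f z" by (rule permutation_self_in_orbit[OF f])
  have ox: "orbit f x = {x}" using x by (simp add: orbit_eq_singleton_iff)
  have fo: "f v \<in> orbit f w \<longleftrightarrow> v \<in> orbit f w" for v w
    using orbit_eq_or_disjoint[OF f orbit.base, of v w] permutation_self_in_orbit[OF f, of v]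
      permutation_orbit_step[OF f, of v] by (auto intro: orbit.step)
  have xnz: "x \<notin> orbit f z" using orbit_eq_or_disjoint[OF f, of x z x] ox z zz by auto
  have gx: "?g x = z" using x by simp
  have other: "orbit ?g u = orbit f u" if "u \<notin> insert x (orbit f z)" for u
  proof (rule orbit_cong)
    show "u \<in> orbit f u" by (rule permutation_self_in_orbit[OF f])
    fix s assume s: "s \<in> orbit f u"
    have "f s \<in> orbit f u" using s by (rule orbit.step)
    then have "f s \<noteq> x" "f s \<noteq> z" 
      using that orbit_eq_or_disjoint[OF f, of x u x] orbit_eq_or_disjoint[OF f, of z u z] ox zz
        permutation_self_in_orbit[OF f, of u] by auto
    then show "?g s = f s" by simp
  qed
  have main: "orbit ?g x = insert x (orbit f z)"
  proof
    show "orbit ?g x \<subseteq> insert x (orbit f z)"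
    proof (rule orbit_closed_subset)
      fix v assume v: "v \<in> insert x (orbit f z)"
      show "?g v \<in> insert x (orbit f z)"
      proof (cases "v = x")
        case True then show ?thesis using gx zz by auto
      next
        case False
        then have "f v \<in> orbit f z" using v fo by auto
        then show ?thesis using zz xnz by (auto simp: transpose_def)
      qed
    qed auto
    have x': "x \<in> orbit ?g x" by (rule permutation_self_in_orbit[OF g])
    have "f v \<in> orbit ?g x - {x}" if v: "v \<in> orbit ?g x - {x}" for v
    proof -
      have "f v \<noteq> x" using v x bf by (metis DiffD2 injD singletonI)
      moreover have "f v \<in> orbit ?g x"
      proof (cases "f v = z")
        case True then show ?thesis using gx orbit.base[of ?g x] by simp
      next
        case False
        then have "?g v = f v" using \<open>f v \<noteq> x\<close> by simp
        then show ?thesis using v by (metis DiffD1 orbit.step)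
      qed
      ultimately show ?thesis by simp
    qed
    moreover have "z \<in> orbit ?g x - {x}" using gx z by (metis Diff_iff orbit.base singletonD)
    ultimately have "orbit f z \<subseteq> orbit ?g x - {x}" by (intro orbit_closed_subset) auto
    then show "insert x (orbit f z) \<subseteq> orbit ?g x" using x' by auto
  qed
  show ?thesis
  proof (cases "u \<in> insert x (orbit f z)")
    case True
    then have "orbit ?g u = orbit ?g x"
      using main by (intro orbit_cyclic_eq3[OF cyclic_on_orbit'[OF g]]) auto
    then show ?thesis using main True by simp
  next
    case False
    show ?thesis unfolding if_not_P[OF False] by (rule other[OF False])
  qed
qed

text \<open>Walking along the orbit of \<open>x\<close> under \<open>f\<close>, the colour can only change on entering \<open>x\<close> or \<open>z\<close>.\<close>

lemma invariant_transpose_merge: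
  assumes f: "permutation f" and xz: "z \<notin> orbit f x"
    and U: "\<And>u. u \<in> U \<Longrightarrow> f u \<in> U" "x \<in> U" "z \<in> U"
    and s: "\<And>u. u \<in> U \<Longrightarrow> s (transpose x z (f u)) = s u"
  shows "s x = s z" "\<And>u. u \<in> U \<Longrightarrow> s (f u) = s u"
proof -
  have xx: "x \<in> orbit f x" by (rule permutation_self_in_orbit[OF f])
  \<comment> \<open>p is the last point of the orbit before the return to x. The colour is carried
    unchanged from x to p, and the transposition sends f p = x to z.\<close>
  obtain p where p: "f p = x" using f by (metis permutation_bijective bij_pointE)
  have po: "p \<in> orbit f x"
    using permutation_orbit_step[OF f, of p] permutation_self_in_orbit[OF f, of p] p by simp
  have "orbit f x \<subseteq> {v \<in> U. s v = s x \<and> v \<in> orbit f x}"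
  proof (rule orbit_closed_subset)
    fix v assume v: "v \<in> {v \<in> U. s v = s x \<and> v \<in> orbit f x}"
    then have fo: "f v \<in> orbit f x" by (auto intro: orbit.step)
    then have "f v \<noteq> z" using xz by auto
    then have "s (f v) = s x" using s[of v] v by (cases "f v = x") auto
    then show "f v \<in> {v \<in> U. s v = s x \<and> v \<in> orbit f x}" using v U(1)[of v] fo by auto
  qed (use U(2) xx in auto)
  then have "p \<in> U" "s p = s x" using po by auto
  then show xz': "s x = s z" using s[of p] p by simp
  show "s (f u) = s u" if "u \<in> U" for u
    using s[OF that] xz' by (auto simp: transpose_def split: if_splits)
qed

section \<open>Signed permutations\<close>

abbreviation pos :: "nat \<Rightarrow> int set" where "pos n \<equiv> {1..int n}"

text \<open>The cycles ((x, z)) and [x], written with transpositions because this is the form in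
  which letters get inserted; by \<open>reflections_eq\<close> they are all the reflections.\<close>

definition refl_A :: "int \<Rightarrow> int \<Rightarrow> int \<Rightarrow> int" where
  "refl_A x z = transpose x z \<circ> transpose (- x) (- z)"

definition refl_B :: "int \<Rightarrow> int \<Rightarrow> int" where
  "refl_B x = transpose x (- x)"

lemma W_B_permutes: "w \<in> W_B n \<Longrightarrow> w permutes signed_letters n"
  by (simp add: W_B_def)

lemma W_B_odd: "w \<in> W_B n \<Longrightarrow> w (- i) = - w i"
  by (simp add: W_B_def)

lemma W_BI: "w permutes signed_letters n \<Longrightarrow> (\<And>i. w (- i) = - w i) \<Longrightarrow> w \<in> W_B n"
  by (simp add: W_B_def)

lemma W_B_id: "id \<in> W_B n"
  by (simp add: W_B_def permutes_id)

lemma W_B_comp: "u \<in> W_B n \<Longrightarrow> v \<in> W_B n \<Longrightarrow> u \<circ> v \<in> W_B n"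
  by (auto simp: W_B_def intro: permutes_compose)

lemma W_B_bij: "w \<in> W_B n \<Longrightarrow> bij w"
  using W_B_permutes permutes_bij by blast

lemma W_B_inj: "w \<in> W_B n \<Longrightarrow> w x = w y \<longleftrightarrow> x = y"
  using W_B_bij by (metis bij_def injD)

lemma W_B_inv_cancel:
  assumes "w \<in> W_B n"
  shows "inv w \<circ> w = id" "w \<circ> inv w = id" "inv w (w x) = x" "w (inv w x) = x" "inv (inv w) = w"
  by (simp_all only: permutes_inv_o[OF W_B_permutes[OF assms]]
    permutes_inverses[OF W_B_permutes[OF assms]] permutes_inv_inv[OF W_B_permutes[OF assms]])

lemma W_B_inv: assumes "w \<in> W_B n" shows "inv w \<in> W_B n"
proof (rule W_BI)
  show "inv w permutes signed_letters n" using W_B_permutes[OF assms] by (rule permutes_inv)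
  fix i
  have "w (inv w (- i)) = w (- inv w i)" 
    by (simp add: W_B_inv_cancel[OF assms] W_B_odd[OF assms])
  then show "inv w (- i) = - inv w i" by (simp add: W_B_inj[OF assms])
qed

lemma W_B_letter: "w \<in> W_B n \<Longrightarrow> w u \<in> signed_letters n \<longleftrightarrow> u \<in> signed_letters n"
  using W_B_permutes permutes_in_image by metis

lemma W_B_outside: "w \<in> W_B n \<Longrightarrow> u \<notin> signed_letters n \<Longrightarrow> w u = u"
  using W_B_permutes permutes_not_in by metis

lemma W_B_abs: "w \<in> W_B n \<Longrightarrow> \<bar>w \<bar>u\<bar>\<bar> = \<bar>w u\<bar>"
  by (cases "u \<ge> 0") (auto simp: W_B_odd)

lemma finite_W_B: "finite (W_B n)"
proof -
  have "finite {w. w permutes signed_letters n}"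
    by (rule finite_permutations) (simp add: signed_letters_def)
  then show ?thesis by (rule rev_finite_subset) (auto simp: W_B_def)
qed

lemma letter_abs: "u \<in> signed_letters n \<longleftrightarrow> \<bar>u\<bar> \<in> pos n"
  by (auto simp: signed_letters_def)

lemma letter_uminus: "- u \<in> signed_letters n \<longleftrightarrow> u \<in> signed_letters n"
  by (auto simp: signed_letters_def)

lemma pos_letter: "u \<in> pos n \<Longrightarrow> u \<in> signed_letters n"
  by (auto simp: signed_letters_def)

lemma W_B_cong:
  assumes "v \<in> W_B n" "w \<in> W_B n" "\<And>u. u \<in> pos n \<Longrightarrow> v u = w u"
  shows "v = w"
proof
  fix u
  consider "u \<in> pos n" | "- u \<in> pos n" | "u \<notin> signed_letters n"
    by (cases "u \<in> signed_letters n"; cases "u > 0") (auto simp: signed_letters_def)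
  then show "v u = w u"
  proof cases
    case 2
    then have "v (- u) = w (- u)" by (rule assms(3))
    then show ?thesis using assms(1,2) by (simp add: W_B_odd)
  next
    case 3
    then show ?thesis using W_B_outside[OF assms(1)] W_B_outside[OF assms(2)] by simp
  qed (rule assms(3))
qed

lemma refl_A_apply:
  assumes "\<bar>x\<bar> \<noteq> \<bar>z\<bar>" "x \<noteq> 0" "z \<noteq> 0"
  shows "refl_A x z u = (if u = x then z else if u = z then x else
    if u = - x then - z else if u = - z then - x else u)"
  using assms by (auto simp: refl_A_def transpose_def)

lemma refl_B_apply: "refl_B x u = (if u = x then - x else if u = - x then x else u)"
  by (auto simp: refl_B_def transpose_def)

lemma refl_A_W_B:
  assumes "\<bar>x\<bar> \<noteq> \<bar>z\<bar>" "x \<in> signed_letters n" "z \<in> signed_letters n"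
  shows "refl_A x z \<in> W_B n"
proof (rule W_BI)
  have "x \<noteq> 0" "z \<noteq> 0" using assms by (auto simp: signed_letters_def)
  then show "refl_A x z (- i) = - refl_A x z i" for i
    using assms(1) by (auto simp: refl_A_apply)
  show "refl_A x z permutes signed_letters n" unfolding refl_A_def
    using assms by (intro permutes_compose permutes_swap_id) (auto simp: letter_uminus)
qed

lemma refl_B_W_B:
  assumes "x \<in> signed_letters n"
  shows "refl_B x \<in> W_B n"
proof (rule W_BI)
  show "refl_B x (- i) = - refl_B x i" for i by (auto simp: refl_B_apply)
  show "refl_B x permutes signed_letters n" unfolding refl_B_def
    using assms by (intro permutes_swap_id) (auto simp: letter_uminus)
qed

lemma refl_A_sq: "refl_A x z \<circ> refl_A x z = id" if "\<bar>x\<bar> \<noteq> \<bar>z\<bar>" "x \<noteq> 0" "z \<noteq> 0"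
  using that by (auto simp: fun_eq_iff refl_A_apply)

lemma refl_B_sq: "refl_B x \<circ> refl_B x = id"
  by (auto simp: fun_eq_iff refl_B_apply)

section \<open>The induced permutation of absolute values, its orbits and their signs\<close>

definition aw :: "nat \<Rightarrow> (int \<Rightarrow> int) \<Rightarrow> int \<Rightarrow> int" where
  "aw n w u = (if u \<in> pos n then \<bar>w u\<bar> else u)"

lemma aw_in: "w \<in> W_B n \<Longrightarrow> u \<in> pos n \<Longrightarrow> aw n w u \<in> pos n"
  using W_B_letter[of w n u] pos_letter[of u n] unfolding aw_def letter_abs[of "w u"] by simp

lemma aw_permutes: assumes "w \<in> W_B n" shows "aw n w permutes pos n"
proof (rule bij_imp_permutes)
  have "inj_on (aw n w) (pos n)"
  proof (rule inj_onI)
    fix u v assume uv: "u \<in> pos n" "v \<in> pos n" "aw n w u = aw n w v"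
    then have "w u = w v \<or> w u = w (- v)" using assms by (auto simp: aw_def W_B_odd abs_eq_iff)
    then show "u = v" using uv by (auto simp: W_B_inj[OF assms])
  qed
  moreover have "aw n w ` pos n \<subseteq> pos n" using aw_in[OF assms] by blast
  ultimately show "bij_betw (aw n w) (pos n) (pos n)"
    by (simp add: bij_betw_def endo_inj_surj)
qed (simp only: aw_def if_False)

lemma aw_permutation: "w \<in> W_B n \<Longrightarrow> permutation (aw n w)"
  using aw_permutes by (metis finite_atLeastAtMost_int permutes_imp_permutation)

lemma aw_comp: assumes "v \<in> W_B n" "w \<in> W_B n" shows "aw n (v \<circ> w) = aw n v \<circ> aw n w"
proof
  fix u
  show "aw n (v \<circ> w) u = (aw n v \<circ> aw n w) u"
  proof (cases "u \<in> pos n")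
    case True
    then have "\<bar>w u\<bar> \<in> pos n" using aw_in[OF assms(2) True] by (simp add: aw_def)
    then show ?thesis using True W_B_abs[OF assms(1)] by (simp add: aw_def)
  next
    case False
    then show ?thesis unfolding aw_def comp_def if_not_P[OF False] by simp
  qed
qed

lemma aw_refl_A:
  assumes "\<bar>x\<bar> \<noteq> \<bar>z\<bar>" "x \<in> signed_letters n" "z \<in> signed_letters n"
  shows "aw n (refl_A x z) = transpose \<bar>x\<bar> \<bar>z\<bar>"
proof -
  have "x \<noteq> 0" "z \<noteq> 0" using assms by (auto simp: signed_letters_def)
  note ap = refl_A_apply[OF assms(1) this]
  have xz: "\<bar>x\<bar> \<in> pos n" "\<bar>z\<bar> \<in> pos n" using assms by (simp_all only: letter_abs)
  show ?thesis
  proof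
    fix u
    show "aw n (refl_A x z) u = transpose \<bar>x\<bar> \<bar>z\<bar> u"
    proof (cases "u \<in> pos n")
      case True
      then have "u > 0" by simp
      then have "\<bar>refl_A x z u\<bar> = (if u = \<bar>x\<bar> then \<bar>z\<bar> else if u = \<bar>z\<bar> then \<bar>x\<bar> else u)"
        unfolding ap by (cases "x > 0"; cases "z > 0") auto
      then show ?thesis unfolding aw_def if_P[OF True] by (simp add: transpose_def)
    next
      case False
      then have "u \<noteq> \<bar>x\<bar>" "u \<noteq> \<bar>z\<bar>" using xz by auto
      then show ?thesis unfolding aw_def if_not_P[OF False] by simp
    qed
  qed
qed

lemma aw_refl_B: "x \<in> signed_letters n \<Longrightarrow> aw n (refl_B x) = id"
  by (auto simp: aw_def refl_B_apply fun_eq_iff)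

definition blk :: "nat \<Rightarrow> (int \<Rightarrow> int) \<Rightarrow> int \<Rightarrow> int set" where
  "blk n w u = orbit (aw n w) u"

text \<open>Fixed letters count as blocks of size 1, so the blocks partition all of {1, ..., n} and
  their sizes add up to n.\<close>

definition blocks :: "nat \<Rightarrow> (int \<Rightarrow> int) \<Rightarrow> int set set" where
  "blocks n w = blk n w ` pos n"

lemma blk_self: "w \<in> W_B n \<Longrightarrow> u \<in> blk n w u"
  unfolding blk_def by (intro permutation_self_in_orbit aw_permutation)

lemma blk_subset: "w \<in> W_B n \<Longrightarrow> u \<in> pos n \<Longrightarrow> blk n w u \<subseteq> pos n"
  unfolding blk_def by (intro permutes_orbit_subset aw_permutes)

lemma blk_eq: "w \<in> W_B n \<Longrightarrow> v \<in> blk n w u \<Longrightarrow> blk n w v = blk n w u"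
  unfolding blk_def by (intro orbit_cyclic_eq3[OF cyclic_on_orbit'] aw_permutation)

lemma blk_step: "w \<in> W_B n \<Longrightarrow> u \<in> pos n \<Longrightarrow> \<bar>w u\<bar> \<in> blk n w u"
  unfolding blk_def using orbit.base[of "aw n w" u] by (simp add: aw_def)

lemma finite_blocks: "finite (blocks n w)"
  by (simp add: blocks_def)

lemma block_props:
  assumes "w \<in> W_B n" "b \<in> blocks n w"
  shows "b \<noteq> {}" "b \<subseteq> pos n" "finite b" "\<And>u. u \<in> b \<Longrightarrow> blk n w u = b" "card b \<ge> 1"
proof -
  obtain v where v: "v \<in> pos n" "b = blk n w v" using assms(2) by (auto simp: blocks_def)
  show 1: "b \<noteq> {}" using blk_self[OF assms(1), of v] v by auto
  show 2: "b \<subseteq> pos n" using blk_subset[OF assms(1)] v by auto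
  then show 3: "finite b" using finite_subset by blast
  show "\<And>u. u \<in> b \<Longrightarrow> blk n w u = b" using blk_eq[OF assms(1)] v by simp
  show "card b \<ge> 1" using 1 3 by (simp add: Suc_le_eq card_gt_0_iff)
qed

lemma blk_in_blocks: "u \<in> pos n \<Longrightarrow> blk n w u \<in> blocks n w"
  by (simp add: blocks_def)

lemma blocks_disjoint:
  assumes "w \<in> W_B n" "b \<in> blocks n w" "c \<in> blocks n w" "b \<inter> c \<noteq> {}"
  shows "b = c"
  using assms block_props(4)[OF assms(1)] by blast

lemma Union_blocks: assumes "w \<in> W_B n" shows "\<Union>(blocks n w) = pos n"
  using block_props(2)[OF assms] blk_self[OF assms] blk_in_blocks by blast

text \<open>Lets products over a block be reindexed along w, which is how signs are multiplied up
  around a cycle.\<close>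

lemma block_bij:
  assumes w: "w \<in> W_B n" and b: "b \<in> blocks n w"
  shows "bij_betw (\<lambda>u. \<bar>w u\<bar>) b b"
proof -
  note P = block_props[OF w b]
  have eq: "aw n w u = \<bar>w u\<bar>" if "u \<in> b" for u using that P(2) by (auto simp: aw_def)
  have "\<bar>w u\<bar> \<in> b" if "u \<in> b" for u 
    using blk_step[OF w, of u] that P(2) P(4)[OF that] by auto
  then have "(\<lambda>u. \<bar>w u\<bar>) ` b \<subseteq> b" by auto
  moreover have "inj_on (aw n w) b" using aw_permutes[OF w] permutes_inj_on by blast
  then have "inj_on (\<lambda>u. \<bar>w u\<bar>) b" using eq by (simp add: inj_on_def)
  ultimately show ?thesis using P(3) by (simp add: bij_betw_def endo_inj_surj)
qed

lemma sum_card_blocks: assumes "w \<in> W_B n" shows "(\<Sum>b\<in>blocks n w. card b) = n"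
proof -
  have "card (\<Union>(blocks n w)) = (\<Sum>b\<in>blocks n w. card b)"
    using blocks_disjoint[OF assms] block_props(3)[OF assms] 
    by (intro card_Union_disjoint) (auto simp: pairwise_def disjnt_def)
  then show ?thesis using Union_blocks[OF assms] by simp
qed

text \<open>The bridge between permutations and hypergraphs: blocks are only ever compared through
  their invariant colourings, which behave well under products.\<close>

lemma inv_colour_blocks:
  assumes w: "w \<in> W_B n"
  shows "(\<forall>u\<in>pos n. r \<bar>w u\<bar> = r u) \<longleftrightarrow> (\<forall>b\<in>blocks n w. \<forall>u\<in>b. \<forall>v\<in>b. r u = r v)"
proof
  assume *: "\<forall>u\<in>pos n. r \<bar>w u\<bar> = r u"
  show "\<forall>b\<in>blocks n w. \<forall>u\<in>b. \<forall>v\<in>b. r u = r v"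
  proof (intro ballI)
    fix b u v assume b: "b \<in> blocks n w" "u \<in> b" "v \<in> b"
    note P = block_props[OF w b(1)]
    have "orbit (aw n w) u \<subseteq> {t\<in>pos n. r t = r u}"
    proof (rule orbit_closed_subset)
      show "u \<in> {t\<in>pos n. r t = r u}" using P(2) b(2) by auto
      fix t assume "t \<in> {t\<in>pos n. r t = r u}"
      then show "aw n w t \<in> {t\<in>pos n. r t = r u}" 
        using * aw_in[OF w, of t] by (simp add: aw_def)
    qed
    moreover have "v \<in> orbit (aw n w) u" using b P(4)[OF b(2)] by (simp only: blk_def)
    ultimately show "r u = r v" by auto
  qed
next
  assume *: "\<forall>b\<in>blocks n w. \<forall>u\<in>b. \<forall>v\<in>b. r u = r v"
  show "\<forall>u\<in>pos n. r \<bar>w u\<bar> = r u"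
  proof
    fix u assume u: "u \<in> pos n"
    show "r \<bar>w u\<bar> = r u"
      using * blk_in_blocks[OF u, of w] blk_self[OF w, of u] blk_step[OF w u] by blast
  qed
qed

text \<open>The product of the signs met in one turn around the block. It is -1 exactly if the walk
  that starts at u first returns at the bar of u, i.e. for a type B cycle.\<close>

definition flagged :: "(int \<Rightarrow> int) \<Rightarrow> int set \<Rightarrow> bool" where
  "flagged w b \<longleftrightarrow> (\<Prod>u\<in>b. sgn (w u)) = -1"

definition lab :: "(int \<Rightarrow> int) \<Rightarrow> int set \<Rightarrow> nat \<times> bool" where
  "lab w b = (card b, flagged w b)"

text \<open>The signed cycle type. A fixed letter appears as (1, False), the cycle [i] as (1,
  True).\<close>

definition Lam :: "nat \<Rightarrow> (int \<Rightarrow> int) \<Rightarrow> (nat \<times> bool) multiset" where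
  "Lam n w = image_mset (lab w) (mset_set (blocks n w))"

section \<open>Inserting a fixed letter into a cycle\<close>

lemma blk_refl_A:
  assumes w: "w \<in> W_B n" and x: "x \<in> pos n" "w x = x" and z: "z \<in> signed_letters n" "\<bar>z\<bar> \<noteq> x"
  shows "blk n (refl_A x z \<circ> w) u =
    (if u \<in> insert x (blk n w \<bar>z\<bar>) then insert x (blk n w \<bar>z\<bar>) else blk n w u)"
proof -
  have "\<bar>x\<bar> = x" using x by simp
  moreover have "aw n (refl_A x z \<circ> w) = transpose \<bar>x\<bar> \<bar>z\<bar> \<circ> aw n w"
    using aw_comp[OF refl_A_W_B w] aw_refl_A x z pos_letter by simp
  moreover have "aw n w x = x" using x by (simp add: aw_def)
  ultimately show ?thesis using orbit_transpose_insert[OF aw_permutation[OF w], of x "\<bar>z\<bar>"] z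
    unfolding blk_def by simp
qed

lemma blk_fixed: "w x = x \<Longrightarrow> blk n w x = {x}"
  by (cases "x \<in> pos n") (auto simp: blk_def orbit_eq_singleton_iff aw_def)

text \<open>The fixed letter x is spliced into the signed cycle just before z. The sign of z enters
  twice, at the arrow into x and at the arrow from x to z, so the flag of the enlarged block is the
  old one.\<close>

lemma insertion:
  assumes w: "w \<in> W_B n" and x: "x \<in> pos n" "w x = x" and z: "z \<in> signed_letters n" "\<bar>z\<bar> \<noteq> x"
  defines "w' \<equiv> refl_A x z \<circ> w" and "b \<equiv> blk n w \<bar>z\<bar>"
  shows "w' \<in> W_B n" "{x} \<in> blocks n w" "b \<in> blocks n w" "x \<notin> b"
    "blocks n w' = insert (insert x b) (blocks n w - {{x}, b})"
    "insert x b \<notin> blocks n w - {{x}, b}"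
    "lab w {x} = (1, False)"
    "lab w' (insert x b) = (Suc (card b), flagged w b)"
    "\<And>c. c \<in> blocks n w - {{x}, b} \<Longrightarrow> lab w' c = lab w c"
proof -
  have zp: "\<bar>z\<bar> \<in> pos n" using z by (simp add: letter_abs)
  have x0: "x > 0" "\<bar>x\<bar> = x" using x by auto
  have z0: "z \<noteq> 0" using z by (auto simp: signed_letters_def)
  have ap: "refl_A x z u = (if u = x then z else if u = z then x else
    if u = - x then - z else if u = - z then - x else u)" for u
    using x0 z z0 by (intro refl_A_apply) auto
  show w': "w' \<in> W_B n" unfolding w'_def
    using x z x0 by (intro W_B_comp w refl_A_W_B) (auto simp: pos_letter)
  have bx: "blk n w x = {x}" using x(2) by (rule blk_fixed)
  then show xb: "{x} \<in> blocks n w" using blk_in_blocks[OF x(1), of w] by simp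
  show b: "b \<in> blocks n w" unfolding b_def using zp by (rule blk_in_blocks)
  show xnb: "x \<notin> b"
  proof
    assume "x \<in> b"
    then have "b = {x}" using block_props(4)[OF w b] bx by auto
    then show False using blk_self[OF w, of "\<bar>z\<bar>"] z unfolding b_def by auto
  qed
  have blk': "blk n w' u = (if u \<in> insert x b then insert x b else blk n w u)" for u
    unfolding w'_def b_def by (rule blk_refl_A[OF w x z])
  have bp: "insert x b \<subseteq> pos n" using block_props(2)[OF w b] x by auto
  have in_iff: "u \<in> insert x b \<longleftrightarrow> blk n w u \<in> {{x}, b}" for u
  proof
    assume "blk n w u \<in> {{x}, b}"
    then have "u \<in> {x} \<or> u \<in> b" using blk_self[OF w, of u] by auto
    then show "u \<in> insert x b" by auto
  qed (use bx block_props(4)[OF w b, of u] in auto)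
  show "blocks n w' = insert (insert x b) (blocks n w - {{x}, b})"
  proof
    show "blocks n w' \<subseteq> insert (insert x b) (blocks n w - {{x}, b})"
    proof
      fix c assume "c \<in> blocks n w'"
      then obtain u where u: "u \<in> pos n" "c = blk n w' u" by (auto simp: blocks_def)
      show "c \<in> insert (insert x b) (blocks n w - {{x}, b})"
        using u blk'[of u] in_iff[of u] blk_in_blocks[OF u(1), of w] by (cases "u \<in> insert x b") auto
    qed
    have "insert x b \<in> blocks n w'" using blk'[of x] blk_in_blocks[OF x(1), of w'] by simp
    moreover have "c \<in> blocks n w'" if c: "c \<in> blocks n w" "c \<noteq> {x}" "c \<noteq> b" for c
    proof -
      obtain u where u: "u \<in> pos n" "c = blk n w u" using c unfolding blocks_def by blast
      then have "u \<notin> insert x b" unfolding in_iff using c by auto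
      then have "c = blk n w' u" using u blk'[of u] by simp
      then show ?thesis using u by (simp add: blocks_def)
    qed
    ultimately show "insert (insert x b) (blocks n w - {{x}, b}) \<subseteq> blocks n w'"
      by blast
  qed
  show "insert x b \<notin> blocks n w - {{x}, b}"
  proof
    assume "insert x b \<in> blocks n w - {{x}, b}"
    then show False using blocks_disjoint[OF w _ xb, of "insert x b"] by auto
  qed
  show "lab w {x} = (1, False)" using x x0 by (simp add: lab_def flagged_def)
  have fb: "finite b" using block_props(3)[OF w b] .
  have wu: "w u \<noteq> x" "w u \<noteq> - x" if "u \<in> pos n" "u \<noteq> x" for u
  proof -
    show "w u \<noteq> x" using that W_B_inj[OF w, of u x] x by auto
    show "w u \<noteq> - x" using that W_B_inj[OF w, of u "- x"] x by (auto simp: W_B_odd[OF w])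
  qed
  show "lab w' (insert x b) = (Suc (card b), flagged w b)"
  proof -
    have "sgn (w' u) = sgn (w u) * (if \<bar>w u\<bar> = \<bar>z\<bar> then sgn z else 1)" if "u \<in> b" for u
    proof -
      have "u \<in> pos n" "u \<noteq> x" using that bp xnb by auto
      note W = wu[OF this]
      have "z > 0 \<or> z < 0" using z0 by auto
      then show ?thesis using W x0 unfolding w'_def comp_def ap by auto
    qed
    then have "(\<Prod>u\<in>b. sgn (w' u)) = (\<Prod>u\<in>b. sgn (w u)) * (\<Prod>u\<in>b. if \<bar>w u\<bar> = \<bar>z\<bar> then sgn z else 1)"
      by (simp add: prod.distrib)
    also have "(\<Prod>u\<in>b. if \<bar>w u\<bar> = \<bar>z\<bar> then sgn z else 1) = (\<Prod>v\<in>b. if v = \<bar>z\<bar> then sgn z else 1)"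
      by (rule prod.reindex_bij_betw[OF block_bij[OF w b], of "\<lambda>v. if v = \<bar>z\<bar> then sgn z else 1"])
    also have "\<dots> = sgn z" using fb blk_self[OF w, of "\<bar>z\<bar>"] unfolding b_def[symmetric]
      by (simp add: prod.delta')
    finally have "(\<Prod>u\<in>b. sgn (w' u)) = (\<Prod>u\<in>b. sgn (w u)) * sgn z" .
    moreover have "w' x = z" using x unfolding w'_def by (simp add: ap)
    ultimately have "(\<Prod>u\<in>insert x b. sgn (w' u)) = (\<Prod>u\<in>b. sgn (w u)) * (sgn z * sgn z)"
      using fb xnb by simp
    also have "sgn z * sgn z = 1" using z0 by (auto simp: sgn_if)
    finally show ?thesis using fb xnb by (simp add: lab_def flagged_def)
  qed
  fix c assume c: "c \<in> blocks n w - {{x}, b}"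
  have "w' u = w u" if "u \<in> c" for u
  proof -
    have cb: "c \<in> blocks n w" using c by auto
    have u: "u \<in> pos n" "blk n w u = c"
      using block_props(2)[OF w cb] that block_props(4)[OF w cb that] by auto
    then have ux: "u \<noteq> x" and "u \<notin> b" using c block_props(4)[OF w b, of u] bx by auto
    have "\<bar>w u\<bar> \<noteq> \<bar>z\<bar>"
    proof
      assume "\<bar>w u\<bar> = \<bar>z\<bar>"
      then have "\<bar>z\<bar> \<in> c" using blk_step[OF w u(1)] u by simp
      then have "c = b" using blk_eq[OF w, of "\<bar>z\<bar>" u] u unfolding b_def by simp
      then show False using c by auto
    qed
    then have "w u \<noteq> z" "w u \<noteq> - z" by auto
    then show ?thesis using wu[OF u(1) ux] unfolding w'_def comp_def ap by simp
  qed
  then show "lab w' c = lab w c" by (simp add: lab_def flagged_def)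
qed

lemma insertion_mset:
  assumes "w \<in> W_B n" "x \<in> pos n" "w x = x" "z \<in> signed_letters n" "\<bar>z\<bar> \<noteq> x"
  defines "b \<equiv> blk n w \<bar>z\<bar>"
  shows "\<exists>G. mset_set (blocks n w) = add_mset {x} (add_mset b G) \<and>
     mset_set (blocks n (refl_A x z \<circ> w)) = add_mset (insert x b) G"
    "\<exists>M. Lam n w = add_mset (1, False) (add_mset (lab w b) M) \<and>
     Lam n (refl_A x z \<circ> w) = add_mset (Suc (card b), flagged w b) M"
proof -
  note I = insertion[OF assms(1-5)]
  let ?G = "mset_set (blocks n w - {{x}, b})"
  have bx: "{x} \<noteq> b" using I(4) unfolding b_def by auto
  have 1: "mset_set (blocks n w) = add_mset {x} (add_mset b ?G)"
  proof -
    have "blocks n w = insert {x} (insert b (blocks n w - {{x}, b}))" using I(2,3) unfolding b_def by auto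
    then have "mset_set (blocks n w) = mset_set (insert {x} (insert b (blocks n w - {{x}, b})))" by simp
    also have "\<dots> = add_mset {x} (add_mset b ?G)" using bx finite_blocks[of n w]
      by (subst mset_set.insert | force)+
    finally show ?thesis .
  qed
  have 2: "mset_set (blocks n (refl_A x z \<circ> w)) = add_mset (insert x b) ?G"
    using I(6) finite_blocks[of n w] unfolding I(5) b_def by (subst mset_set.insert) auto
  show "\<exists>G. mset_set (blocks n w) = add_mset {x} (add_mset b G) \<and>
     mset_set (blocks n (refl_A x z \<circ> w)) = add_mset (insert x b) G" using 1 2 by blast
  have "image_mset (lab (refl_A x z \<circ> w)) ?G = image_mset (lab w) ?G"
    using I(9) finite_blocks[of n w] unfolding b_def by (intro image_mset_cong) simp
  then show "\<exists>M. Lam n w = add_mset (1, False) (add_mset (lab w b) M) \<and>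
     Lam n (refl_A x z \<circ> w) = add_mset (Suc (card b), flagged w b) M"
    using I(7,8) unfolding Lam_def 1 2 b_def by (intro exI[of _ "image_mset (lab w) ?G"]) (simp add: b_def)
qed

text \<open>A sign change at a fixed letter leaves the permutation of absolute values alone; all it
  does is to flag the block of x.\<close>

lemma insertion_B:
  assumes w: "w \<in> W_B n" and x: "x \<in> pos n" "w x = x"
  defines "w' \<equiv> refl_B x \<circ> w"
  shows "w' \<in> W_B n" "blocks n w' = blocks n w" "lab w' {x} = (1, True)" "{x} \<in> blocks n w"
    "\<And>c. c \<in> blocks n w - {{x}} \<Longrightarrow> lab w' c = lab w c"
    "\<And>u. blk n w' u = blk n w u"
proof -
  have xl: "x \<in> signed_letters n" using x by (rule_tac pos_letter)
  show "w' \<in> W_B n" unfolding w'_def by (intro W_B_comp w refl_B_W_B xl)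
  have aw': "aw n w' = aw n w" unfolding w'_def
    using aw_comp[OF refl_B_W_B[OF xl] w] aw_refl_B[OF xl] by simp
  then show bl: "blk n w' u = blk n w u" for u by (simp add: blk_def)
  then show "blocks n w' = blocks n w" by (simp add: blocks_def)
  show "lab w' {x} = (1, True)" using x by (simp add: lab_def flagged_def w'_def refl_B_apply)
  have bx: "blk n w x = {x}" using x by (intro blk_fixed)
  then show "{x} \<in> blocks n w" using blk_in_blocks[OF x(1), of w] by simp
  fix c assume c: "c \<in> blocks n w - {{x}}"
  have "w' u = w u" if "u \<in> c" for u
  proof -
    have cb: "c \<in> blocks n w" using c by auto
    have u: "u \<in> pos n" "u \<noteq> x"
      using block_props(2)[OF w cb] that block_props(4)[OF w cb that] bx c by auto
    then have "w u \<noteq> x" "w u \<noteq> - x" using W_B_inj[OF w, of u x] W_B_inj[OF w, of u "- x"] x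
      by (auto simp: W_B_odd[OF w])
    then show ?thesis by (simp add: w'_def refl_B_apply)
  qed
  then show "lab w' c = lab w c" by (simp add: lab_def flagged_def)
qed

section \<open>Signed cycles and types\<close>

definition cyc :: "bool \<times> int list \<Rightarrow> int \<Rightarrow> int" where
  "cyc c = (if fst c then cycle_B (snd c) else cycle_A (snd c))"

text \<open>Distinctness of the letters together with their bars, put on absolute values so that it
  splits along lists; \<open>sdist_iff\<close> links it to the form in
  \<open>has_comb_type\<close>.\<close>

definition sdist :: "int list \<Rightarrow> bool" where
  "sdist xs \<longleftrightarrow> distinct (map abs xs) \<and> 0 \<notin> set xs"

lemma sdist_iff: "distinct (xs @ map uminus xs) \<longleftrightarrow> sdist xs"
proof (induction xs)
  case (Cons x xs)
  have "distinct ((x # xs) @ map uminus (x # xs)) \<longleftrightarrow>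
    distinct (xs @ map uminus xs) \<and> x \<noteq> 0 \<and> x \<notin> set xs \<and> x \<notin> uminus ` set xs"
  proof -
    have "- x \<in> uminus ` set xs \<longleftrightarrow> x \<in> set xs" by auto
    moreover have "- x \<in> set xs \<longleftrightarrow> x \<in> uminus ` set xs" by force
    ultimately show ?thesis by auto
  qed
  moreover have "\<bar>x\<bar> \<in> abs ` set xs \<longleftrightarrow> x \<in> set xs \<or> x \<in> uminus ` set xs"
    by (force simp: image_iff abs_eq_iff)
  ultimately show ?case using Cons by (auto simp: sdist_def)
qed (simp add: sdist_def)

lemma sdist_append:
  "sdist (xs @ ys) \<longleftrightarrow> sdist xs \<and> sdist ys \<and> abs ` set xs \<inter> abs ` set ys = {}"
  by (auto simp: sdist_def)

lemma sdist_Cons: "sdist (x # xs) \<longleftrightarrow> x \<noteq> 0 \<and> \<bar>x\<bar> \<notin> abs ` set xs \<and> sdist xs"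
  by (auto simp: sdist_def)

lemma sdist_perm: "mset xs = mset ys \<Longrightarrow> sdist xs \<longleftrightarrow> sdist ys"
  unfolding sdist_def by (metis mset_map mset_eq_imp_distinct_iff mset_eq_setD)

lemma sdist_concat_perm:
  "mset L = mset L' \<Longrightarrow> sdist (concat (map snd L)) \<longleftrightarrow> sdist (concat (map snd L'))"
proof (rule sdist_perm)
  have *: "mset (concat (map snd M)) = (\<Sum>c\<in>#mset M. mset (snd c))" for M :: "('a \<times> int list) list"
    by (induction M) auto
  assume "mset L = mset L'"
  then show "mset (concat (map snd L)) = mset (concat (map snd L'))" unfolding * by simp
qed

lemma sdist_disjoint: "sdist xs \<Longrightarrow> set xs \<inter> set (map uminus xs) = {}"
  using sdist_iff[of xs] by auto

lemma sdist_distinct: "sdist xs \<Longrightarrow> distinct xs" "sdist xs \<Longrightarrow> distinct (map uminus xs)"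
  using sdist_iff[of xs] by auto

lemma cycle_of_list_commute_transpose:
  assumes "distinct cs" "a \<notin> set cs" "b \<notin> set cs"
  shows "cycle_of_list cs \<circ> transpose a b = transpose a b \<circ> cycle_of_list cs"
proof -
  have "map (transpose a b) cs = cs" using assms(2,3) by (intro map_idI transpose_apply_other) auto
  then have "transpose a b \<circ> cycle_of_list cs \<circ> inv (transpose a b) = cycle_of_list cs"
    using conjugation_of_cycle[OF assms(1), of "transpose a b"] by simp
  then have "transpose a b \<circ> cycle_of_list cs \<circ> transpose a b \<circ> transpose a b =
    cycle_of_list cs \<circ> transpose a b" by simp
  then show ?thesis by (simp add: comp_assoc)
qed

lemma cycle_of_list_append:
  "cycle_of_list (xs @ a # ys) = cycle_of_list (xs @ [a]) \<circ> cycle_of_list (a # ys)"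
proof (induction xs)
  case (Cons x xs)
  show ?case
  proof (cases xs)
    case Nil then show ?thesis by (simp add: comp_assoc)
  next
    case (Cons y zs)
    then show ?thesis using Cons.IH by (simp add: comp_assoc)
  qed
qed simp

lemma cycle_A_singleton: "cycle_A [x] = id"
  by (simp add: cycle_A_def)

lemma cycle_B_singleton: "cycle_B [x] = refl_B x"
  by (simp add: cycle_B_def refl_B_def)

lemma cycle_A_Cons:
  assumes "sdist (x # z # cs)"
  shows "cycle_A (x # z # cs) = refl_A x z \<circ> cycle_A (z # cs)"
proof -
  have "sdist (z # cs)" using assms by (simp add: sdist_Cons)
  then have "distinct (z # cs)" by (rule sdist_distinct)
  moreover have "- x \<notin> set (z # cs)" "- z \<notin> set (z # cs)"
    using sdist_disjoint[OF assms] by auto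
  ultimately have "cycle_of_list (z # cs) \<circ> transpose (- x) (- z) =
    transpose (- x) (- z) \<circ> cycle_of_list (z # cs)"
    by (intro cycle_of_list_commute_transpose)
  then show ?thesis
    by (simp add: cycle_A_def refl_A_def comp_assoc) (simp add: fun_eq_iff)
qed

text \<open>Cut the doubled cycle x, z, cs, -x, -z, -cs at -x. Conjugation by the transposition of
  -x and -z turns the end -x of the first piece into -z; the pieces then recombine to the doubled
  cycle of z, cs, and the transposition left over completes \<open>refl_A x z\<close>.\<close>

lemma cycle_B_Cons:
  assumes "sdist (x # z # cs)"
  shows "cycle_B (x # z # cs) = refl_A x z \<circ> cycle_B (z # cs)"
proof -
  let ?t = "transpose (- x) (- z)" and ?m = "map uminus cs"
  have nx: "- x \<notin> set (z # cs)" "- z \<notin> set (z # cs)" "- x \<noteq> - z"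
    using sdist_disjoint[OF assms] assms by (auto simp: sdist_Cons)
  have d: "distinct (z # cs @ [- z])" using sdist_distinct(1)[OF assms] nx by auto
  have "map ?t (z # cs @ [- z]) = z # cs @ [- x]"
  proof -
    have "map ?t (z # cs) = z # cs" using nx by (intro map_idI transpose_apply_other) auto
    then show ?thesis by simp
  qed
  then have 1: "?t \<circ> cycle_of_list (z # cs @ [- z]) \<circ> ?t = cycle_of_list (z # cs @ [- x])"
    using conjugation_of_cycle[OF d, of ?t] by (simp del: cycle_of_list.simps)
  have "cycle_B (x # z # cs) = transpose x z \<circ> cycle_of_list ((z # cs) @ - x # - z # ?m)"
    by (simp add: cycle_B_def)
  also have "\<dots> = transpose x z \<circ> (cycle_of_list (z # cs @ [- x]) \<circ> (?t \<circ> cycle_of_list (- z # ?m)))"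
    by (subst cycle_of_list_append) simp
  also have "\<dots> = transpose x z \<circ> (?t \<circ> cycle_of_list (z # cs @ [- z]) \<circ> (?t \<circ> ?t) \<circ> cycle_of_list (- z # ?m))"
    by (simp add: 1[symmetric] comp_assoc del: cycle_of_list.simps transpose_comp_involutory)
  also have "\<dots> = refl_A x z \<circ> (cycle_of_list ((z # cs) @ [- z]) \<circ> cycle_of_list (- z # ?m))"
    by (simp add: refl_A_def comp_assoc del: cycle_of_list.simps)
  also have "\<dots> = refl_A x z \<circ> cycle_B (z # cs)"
    unfolding cycle_B_def by (subst cycle_of_list_append[symmetric]) simp
  finally show ?thesis .
qed

lemma cyc_Cons: "sdist (x # z # cs) \<Longrightarrow> cyc (f, x # z # cs) = refl_A x z \<circ> cyc (f, z # cs)"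
  by (simp add: cyc_def cycle_A_Cons cycle_B_Cons)

lemma cycle_A_uminus: assumes "sdist as" shows "cycle_A (map uminus as) = cycle_A as"
proof -
  have "map uminus (map uminus as) = as" by (simp add: comp_def)
  then show ?thesis unfolding cycle_A_def
    using cycles_commute[OF sdist_distinct(1)[OF assms] sdist_distinct(2)[OF assms] sdist_disjoint[OF assms]]
    by simp
qed

text \<open>A window of half the length of the doubled list that starts k places later ends with the
  barred first k letters.\<close>

lemma cycle_B_rotate:
  assumes "sdist as" "k \<le> length as"
  shows "cycle_B as = cycle_B (drop k as @ map uminus (take k as))"
proof -
  have d: "distinct (as @ map uminus as)" using assms(1) by (simp only: sdist_iff)
  have "rotate (length (take k as)) (take k as @ (drop k as @ map uminus as)) =
      (drop k as @ map uminus as) @ take k as" by (rule rotate_append)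
  then have "rotate k (as @ map uminus as) = drop k as @ map uminus as @ take k as"
    using assms(2) by (simp add: min_absorb2 flip: append_assoc)
  moreover have "map uminus as = map uminus (take k as) @ map uminus (drop k as)"
    by (metis append_take_drop_id map_append)
  then have "drop k as @ map uminus as @ take k as = (drop k as @ map uminus (take k as)) @
      map uminus (drop k as @ map uminus (take k as))" by (simp add: comp_def)
  ultimately show ?thesis unfolding cycle_B_def
    using cycle_of_list_rotate_independent[OF d, of k] by metis
qed

lemma cycle_A_rotate:
  assumes "sdist as"
  shows "cycle_A as = cycle_A (rotate k as)"
  unfolding cycle_A_def rotate_map[symmetric]
  by (metis assms cycle_of_list_rotate_independent sdist_distinct)

lemma cyc_uminus: assumes "sdist as" shows "cyc (f, map uminus as) = cyc (f, as)"
  using cycle_B_rotate[OF assms, of "length as"] cycle_A_uminus[OF assms] by (simp add: cyc_def)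

text \<open>Barring all letters and rotating leave a cycle unchanged, so any letter of the support,
  with either sign, can be put first. This prepares the insertion of a letter before z.\<close>

lemma cyc_head:
  assumes as: "sdist as" and z: "\<bar>z\<bar> \<in> abs ` set as"
  shows "\<exists>cs. cyc (f, as) = cyc (f, z # cs) \<and> mset (map abs (z # cs)) = mset (map abs as) \<and> sdist (z # cs)"
proof -
  have main: "\<exists>cs. cyc (f, as) = cyc (f, z # cs) \<and> mset (map abs (z # cs)) = mset (map abs as)"
    if as: "sdist as" and z: "z \<in> set as" for as
  proof -
    obtain ys zs where y: "as = ys @ z # zs" using z by (metis split_list)
    show ?thesis
    proof (cases f)
      case True
      have "cycle_B as = cycle_B (z # zs @ map uminus ys)"
        using cycle_B_rotate[OF as, of "length ys"] by (simp add: y)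
      then show ?thesis using True y by (intro exI[of _ "zs @ map uminus ys"]) (simp add: cyc_def comp_def)
    next
      case False
      have "cycle_A as = cycle_A (z # zs @ ys)"
        using cycle_A_rotate[OF as, of "length ys"] y rotate_append[of ys "z # zs"] by simp
      then show ?thesis using False y by (intro exI[of _ "zs @ ys"]) (simp add: cyc_def)
    qed
  qed
  have um: "sdist (map uminus as)" using as by (auto simp: sdist_def comp_def)
  have "z \<in> set as \<or> z \<in> set (map uminus as)" using z by (auto simp: abs_eq_iff)
  then obtain cs where cs: "cyc (f, as) = cyc (f, z # cs)" "mset (map abs (z # cs)) = mset (map abs as)"
  proof
    assume "z \<in> set (map uminus as)"
    then obtain cs where "cyc (f, map uminus as) = cyc (f, z # cs)"
      "mset (map abs (z # cs)) = mset (map abs (map uminus as))" using main[OF um] by blast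
    then show thesis using that[of cs] cyc_uminus[OF as] by (simp add: comp_def)
  qed (use main[OF as] in blast)
  have e: "mset (map abs (z # cs)) = mset (map abs as)" by (rule cs)
  then have "distinct (map abs (z # cs))" using as mset_eq_imp_distinct_iff unfolding sdist_def by blast
  moreover have "abs ` set (z # cs) = abs ` set as" using mset_eq_setD[OF e] by simp
  then have "0 \<notin> set (z # cs)" using as unfolding sdist_def by (metis abs_eq_0 image_iff)
  ultimately show ?thesis using cs unfolding sdist_def by blast
qed

section \<open>Products of lists and conjugation\<close>

lemma prod_perm_simps: "prod_perm [] = id" "prod_perm (w # ws) = w \<circ> prod_perm ws"
  by (simp_all add: prod_perm_def)

lemma prod_perm_append: "prod_perm (xs @ ys) = prod_perm xs \<circ> prod_perm ys"
  by (induction xs) (simp_all add: prod_perm_simps comp_assoc)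

lemma prod_perm_W_B: "set ws \<subseteq> W_B n \<Longrightarrow> prod_perm ws \<in> W_B n"
  by (induction ws) (auto simp: prod_perm_simps W_B_id intro: W_B_comp)

lemma prod_perm_move:
  "(\<And>c. c \<in> set xs \<Longrightarrow> a \<circ> c = c \<circ> a) \<Longrightarrow> prod_perm (xs @ a # ys) = a \<circ> prod_perm (xs @ ys)"
proof (induction xs)
  case (Cons x xs)
  have "prod_perm ((x # xs) @ a # ys) = x \<circ> (a \<circ> prod_perm (xs @ ys))"
  proof -
    have "prod_perm (xs @ a # ys) = a \<circ> prod_perm (xs @ ys)"
      by (rule Cons.IH) (rule Cons.prems, simp)
    then show ?thesis by (simp only: append_Cons prod_perm_simps)
  qed
  also have "\<dots> = (x \<circ> a) \<circ> prod_perm (xs @ ys)" by (simp add: comp_assoc)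
  also have "x \<circ> a = a \<circ> x" by (rule Cons.prems[symmetric]) simp
  finally show ?case by (simp add: prod_perm_simps comp_assoc)
qed (simp add: prod_perm_simps)

lemma prod_perm_commute:
  assumes "mset xs = mset ys" "\<And>a b. a \<in> set xs \<Longrightarrow> b \<in> set xs \<Longrightarrow> a \<circ> b = b \<circ> a"
  shows "prod_perm xs = prod_perm ys"
  using assms
proof (induction xs arbitrary: ys)
  case (Cons x xs)
  have "x \<in> set ys" using Cons.prems(1) by (metis list.set_intros(1) mset_eq_setD)
  then obtain us vs where y: "ys = us @ x # vs" by (metis split_list)
  have "mset xs = mset (us @ vs)" using Cons.prems(1) y by simp
  then have "prod_perm xs = prod_perm (us @ vs)" using Cons by (intro Cons.IH) auto
  moreover have "set us \<subseteq> set (x # xs)" using mset_eq_setD[OF Cons.prems(1)] y by auto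
  then have "prod_perm ys = x \<circ> prod_perm (us @ vs)"
    unfolding y by (intro prod_perm_move Cons.prems(2)) auto
  ultimately show ?case by (simp add: prod_perm_simps)
qed (simp add: prod_perm_simps)

lemma conj_prod_perm:
  assumes "bij g"
  shows "g \<circ> prod_perm ws \<circ> inv g = prod_perm (map (\<lambda>w. g \<circ> w \<circ> inv g) ws)"
proof (induction ws)
  case Nil
  then show ?case using assms by (simp add: prod_perm_simps bij_is_surj surj_f_inv_f fun_eq_iff)
next
  case (Cons w ws)
  have "g \<circ> prod_perm (w # ws) \<circ> inv g = (g \<circ> w \<circ> inv g) \<circ> (g \<circ> prod_perm ws \<circ> inv g)"
    using assms by (simp add: prod_perm_simps fun_eq_iff bij_is_inj)
  also have "\<dots> = prod_perm (map (\<lambda>w. g \<circ> w \<circ> inv g) (w # ws))"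
    by (simp only: list.map prod_perm_simps Cons.IH)
  finally show ?case .
qed

lemma conj_cyc:
  assumes g: "g \<in> W_B n" and as: "sdist as"
  shows "g \<circ> cyc (f, as) \<circ> inv g = cyc (f, map g as)"
proof -
  have b: "bij g" by (rule W_B_bij[OF g])
  have m: "map g (map uminus as) = map uminus (map g as)" using W_B_odd[OF g] by simp
  have d: "distinct (as @ map uminus as)" using as by (simp only: sdist_iff)
  show ?thesis
  proof (cases f)
    case True
    have "g \<circ> cycle_B as \<circ> inv g = cycle_B (map g as)"
      unfolding cycle_B_def conjugation_of_cycle[OF d b] map_append m ..
    then show ?thesis using True by (simp add: cyc_def)
  next
    case False
    have d': "distinct as" "distinct (map uminus as)" using d by auto
    have "g \<circ> cycle_A as \<circ> inv g = (g \<circ> cycle_of_list as \<circ> inv g) \<circ> (g \<circ> cycle_of_list (map uminus as) \<circ> inv g)"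
      by (simp add: cycle_A_def fun_eq_iff W_B_inv_cancel(3)[OF g])
    also have "\<dots> = cycle_A (map g as)"
      unfolding cycle_A_def conjugation_of_cycle[OF d'(1) b] conjugation_of_cycle[OF d'(2) b] m ..
    finally show ?thesis using False by (simp add: cyc_def)
  qed
qed

lemma sdist_map: assumes "g \<in> W_B n" shows "sdist (map g xs) \<longleftrightarrow> sdist xs"
proof -
  have "g 0 = 0" using W_B_odd[OF assms, of 0] by simp
  then have "0 \<in> g ` set xs \<longleftrightarrow> 0 \<in> set xs" using W_B_inj[OF assms, of 0] by (auto simp: image_iff)
  moreover have "\<bar>g x\<bar> = \<bar>g y\<bar> \<longleftrightarrow> \<bar>x\<bar> = \<bar>y\<bar>" for x y
    using W_B_inj[OF assms, of x y] W_B_inj[OF assms, of x "- y"] by (auto simp: abs_eq_iff W_B_odd[OF assms])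
  then have "distinct (map (\<lambda>x. \<bar>g x\<bar>) xs) \<longleftrightarrow> distinct (map abs xs)"
    by (induction xs) (auto simp: image_iff)
  ultimately show ?thesis by (simp add: sdist_def comp_def)
qed

text \<open>A pair \<open>(x, z)\<close> with \<open>\<bar>x\<bar> = \<bar>z\<bar>\<close> encodes the reflection \<open>[x]\<close>.\<close>

definition reflection :: "int \<times> int \<Rightarrow> int \<Rightarrow> int" where
  "reflection p = (if \<bar>fst p\<bar> = \<bar>snd p\<bar> then refl_B (fst p) else refl_A (fst p) (snd p))"

text \<open>A pair is read as an edge between the absolute values of its entries. A loop joins
  nothing; it only affects flags.\<close>

definition loop :: "int \<times> int \<Rightarrow> bool" where
  "loop p \<longleftrightarrow> \<bar>fst p\<bar> = \<bar>snd p\<bar>"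

definition cycles_of :: "nat \<Rightarrow> (bool \<times> int list) list \<Rightarrow> bool" where
  "cycles_of n L \<longleftrightarrow> (\<forall>c\<in>set L. snd c \<noteq> []) \<and> sdist (concat (map snd L)) \<and>
     set (concat (map snd L)) \<subseteq> signed_letters n"

lemma cycles_of_Cons:
  "cycles_of n ((f, as) # L) \<longleftrightarrow> as \<noteq> [] \<and> sdist as \<and> set as \<subseteq> signed_letters n \<and> cycles_of n L \<and>
     abs ` set as \<inter> abs ` set (concat (map snd L)) = {}"
  by (auto simp: cycles_of_def sdist_append)

lemma cycles_of_length:
  assumes "cycles_of n L" shows "length (concat (map snd L)) \<le> n"
proof -
  let ?xs = "concat (map snd L)"
  have "abs ` set ?xs \<subseteq> pos n" using assms letter_abs unfolding cycles_of_def by blast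
  then have "card (set (map abs ?xs)) \<le> card (pos n)" by (intro card_mono) auto
  moreover have "card (set (map abs ?xs)) = length ?xs"
    using assms unfolding cycles_of_def sdist_def by (metis distinct_card length_map)
  ultimately show ?thesis by simp
qed

section \<open>Invariants of a product of disjoint cycles\<close>

lemma insertion_B_mset:
  assumes "w \<in> W_B n" "x \<in> pos n" "w x = x"
  shows "\<exists>M. Lam n w = add_mset (1, False) M \<and> Lam n (refl_B x \<circ> w) = add_mset (1, True) M"
proof -
  note I = insertion_B[OF assms]
  let ?G = "mset_set (blocks n w - {{x}})"
  have 1: "mset_set (blocks n w) = add_mset {x} ?G"
    using mset_set.remove[OF finite_blocks I(4)] .
  have "image_mset (lab (refl_B x \<circ> w)) ?G = image_mset (lab w) ?G"
    using I(5) finite_blocks[of n w] by (intro image_mset_cong) simp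
  moreover have "lab w {x} = (1, False)" using assms by (simp add: lab_def flagged_def)
  ultimately show ?thesis using I(3) unfolding Lam_def I(2) 1 by simp
qed

text \<open>Bundles everything that has to be carried through the insertion of one more letter:
  blocks and labels, the fixed letters, the cycle type, and a word of reflections with k - 1
  non-loops for a cycle of k letters and one loop for each flagged cycle.\<close>

definition realises :: "nat \<Rightarrow> (bool \<times> int list) list \<Rightarrow> (int \<Rightarrow> int) \<Rightarrow> bool" where
  "realises n L w \<longleftrightarrow> w \<in> W_B n \<and>
    (\<forall>c\<in>set L. abs ` set (snd c) \<in> blocks n w \<and> lab w (abs ` set (snd c)) = (length (snd c), fst c)) \<and>
    (\<forall>u\<in>pos n. u \<notin> abs ` set (concat (map snd L)) \<longrightarrow> w u = u) \<and>
    Lam n w = mset (map (\<lambda>c. (length (snd c), fst c)) L) +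
      replicate_mset (n - length (concat (map snd L))) (1, False) \<and>
    (\<exists>ts. set ts \<subseteq> signed_letters n \<times> signed_letters n \<and> w = prod_perm (map reflection ts) \<and>
      length (filter (\<lambda>p. \<not> loop p) ts) + length L = length (concat (map snd L)) \<and>
      length (filter loop ts) = length (filter fst L))"

lemma realisesD:
  assumes "realises n L w"
  shows "w \<in> W_B n" "\<And>c. c \<in> set L \<Longrightarrow> abs ` set (snd c) \<in> blocks n w"
    "\<And>c. c \<in> set L \<Longrightarrow> lab w (abs ` set (snd c)) = (length (snd c), fst c)"
    "\<And>u. u \<in> pos n \<Longrightarrow> u \<notin> abs ` set (concat (map snd L)) \<Longrightarrow> w u = u"
    "Lam n w = mset (map (\<lambda>c. (length (snd c), fst c)) L) +
      replicate_mset (n - length (concat (map snd L))) (1, False)"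
    "\<exists>ts. set ts \<subseteq> signed_letters n \<times> signed_letters n \<and> w = prod_perm (map reflection ts) \<and>
      length (filter (\<lambda>p. \<not> loop p) ts) + length L = length (concat (map snd L)) \<and>
      length (filter loop ts) = length (filter fst L)"
proof -
  note A = assms[unfolded realises_def]
  show "w \<in> W_B n" by (rule A[THEN conjunct1])
  note A = A[THEN conjunct2]
  have 1: "\<forall>c\<in>set L. abs ` set (snd c) \<in> blocks n w \<and> lab w (abs ` set (snd c)) = (length (snd c), fst c)"
    by (rule A[THEN conjunct1])
  note A = A[THEN conjunct2]
  have 2: "\<forall>u\<in>pos n. u \<notin> abs ` set (concat (map snd L)) \<longrightarrow> w u = u"
    by (rule A[THEN conjunct1])
  note A = A[THEN conjunct2]
  show "Lam n w = mset (map (\<lambda>c. (length (snd c), fst c)) L) +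
      replicate_mset (n - length (concat (map snd L))) (1, False)"
    by (rule A[THEN conjunct1])
  show "\<exists>ts. set ts \<subseteq> signed_letters n \<times> signed_letters n \<and> w = prod_perm (map reflection ts) \<and>
      length (filter (\<lambda>p. \<not> loop p) ts) + length L = length (concat (map snd L)) \<and>
      length (filter loop ts) = length (filter fst L)"
    by (rule A[THEN conjunct2])
  show "\<And>c. c \<in> set L \<Longrightarrow> abs ` set (snd c) \<in> blocks n w"
    "\<And>c. c \<in> set L \<Longrightarrow> lab w (abs ` set (snd c)) = (length (snd c), fst c)"
    using 1 by blast+
  show "\<And>u. u \<in> pos n \<Longrightarrow> u \<notin> abs ` set (concat (map snd L)) \<Longrightarrow> w u = u" using 2 by blast
qed

lemma entry_subset: "c \<in> set L \<Longrightarrow> abs ` set (snd c) \<subseteq> abs ` set (concat (map snd L))"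
  by (rule image_mono) auto

lemma realises_Nil: "realises n [] id"
proof -
  have "blk n id u = {u}" for u by (rule blk_fixed) simp
  then have "blocks n id = (\<lambda>u. {u}) ` pos n" by (auto simp: blocks_def)
  moreover have "mset_set ((\<lambda>u. {u}) ` pos n) = image_mset (\<lambda>u. {u}) (mset_set (pos n))"
    by (rule image_mset_mset_set[symmetric]) (auto simp: inj_on_def)
  moreover have "image_mset (\<lambda>u. lab id {u}) (mset_set (pos n)) =
    image_mset (\<lambda>u. (1, False)) (mset_set (pos n))"
    by (intro image_mset_cong) (auto simp: lab_def flagged_def)
  ultimately have "Lam n id = replicate_mset n (1, False)"
    by (simp add: Lam_def image_mset.compositionality comp_def image_mset_const_eq)
  moreover have "\<exists>ts. set ts \<subseteq> signed_letters n \<times> signed_letters n \<and> id = prod_perm (map reflection ts) \<and>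
      length (filter (\<lambda>p. \<not> loop p) ts) + 0 = 0 \<and> length (filter loop ts) = 0"
    by (rule exI[of _ "[]"]) (simp add: prod_perm_simps)
  ultimately show ?thesis by (simp add: realises_def W_B_id)
qed

lemma replicate_split: "Suc k \<le> n \<Longrightarrow> replicate_mset (n - k) a = add_mset a (replicate_mset (n - Suc k) a)"
proof -
  assume "Suc k \<le> n"
  then have "n - k = Suc (n - Suc k)" by simp
  then show ?thesis by simp
qed

lemma realises_A_singleton:
  assumes r: "realises n L w" and x: "\<bar>x\<bar> \<in> pos n" "\<bar>x\<bar> \<notin> abs ` set (concat (map snd L))"
    and len: "Suc (length (concat (map snd L))) \<le> n"
  shows "realises n ((False, [x]) # L) w"
proof -
  have wx: "w \<bar>x\<bar> = \<bar>x\<bar>" using realisesD(4)[OF r x] .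
  have bx: "{\<bar>x\<bar>} \<in> blocks n w" using blk_fixed[of w "\<bar>x\<bar>" n, OF wx] blk_in_blocks[OF x(1), of w] by simp
  have lx: "lab w {\<bar>x\<bar>} = (1, False)" using wx x by (simp add: lab_def flagged_def)
  let ?L = "(False, [x]) # L"
  show ?thesis unfolding realises_def
  proof (intro conjI ballI impI)
    fix c assume "c \<in> set ?L"
    then show "abs ` set (snd c) \<in> blocks n w" "lab w (abs ` set (snd c)) = (length (snd c), fst c)"
      using bx lx realisesD(2,3)[OF r, of c] by auto
  next
    show "Lam n w = mset (map (\<lambda>c. (length (snd c), fst c)) ?L) +
      replicate_mset (n - length (concat (map snd ?L))) (1, False)"
      unfolding realisesD(5)[OF r] replicate_split[OF len] by simp
  next
    fix u assume "u \<in> pos n" "u \<notin> abs ` set (concat (map snd ?L))"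
    then show "w u = u" by (intro realisesD(4)[OF r]) auto
  next
    show "\<exists>ts. set ts \<subseteq> signed_letters n \<times> signed_letters n \<and> w = prod_perm (map reflection ts) \<and>
      length (filter (\<lambda>p. \<not> loop p) ts) + length ?L = length (concat (map snd ?L)) \<and>
      length (filter loop ts) = length (filter fst ?L)"
      using realisesD(6)[OF r] by simp
  qed (rule realisesD(1)[OF r])
qed

lemma realises_B_singleton:
  assumes r: "realises n L w" and x: "\<bar>x\<bar> \<in> pos n" "\<bar>x\<bar> \<notin> abs ` set (concat (map snd L))"
    and len: "Suc (length (concat (map snd L))) \<le> n"
  shows "realises n ((True, [x]) # L) (refl_B x \<circ> w)"
proof -
  have W: "w \<in> W_B n" using realisesD(1)[OF r] .
  have wx: "w \<bar>x\<bar> = \<bar>x\<bar>" using realisesD(4)[OF r x] .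
  have re: "refl_B x = refl_B \<bar>x\<bar>" by (auto simp: refl_B_def transpose_def fun_eq_iff abs_if)
  note I = insertion_B[OF W x(1) wx]
  obtain M where M: "Lam n w = add_mset (1, False) M" "Lam n (refl_B \<bar>x\<bar> \<circ> w) = add_mset (1, True) M"
    using insertion_B_mset[OF W x(1) wx] by blast
  have "Lam n w = mset (map (\<lambda>c. (length (snd c), fst c)) L) +
      add_mset (1, False) (replicate_mset (n - Suc (length (concat (map snd L)))) (1, False))"
    using realisesD(5)[OF r] unfolding replicate_split[OF len] .
  then have "M = mset (map (\<lambda>c. (length (snd c), fst c)) L) +
    replicate_mset (n - Suc (length (concat (map snd L)))) (1, False)"
    using M(1) by simp
  then have 1: "Lam n (refl_B \<bar>x\<bar> \<circ> w) = mset (map (\<lambda>c. (length (snd c), fst c)) ((True, [x]) # L)) +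
    replicate_mset (n - length (concat (map snd ((True, [x]) # L)))) (1, False)"
    using M(2) by simp
  obtain ts where ts: "set ts \<subseteq> signed_letters n \<times> signed_letters n" "w = prod_perm (map reflection ts)"
      "length (filter (\<lambda>p. \<not> loop p) ts) + length L = length (concat (map snd L))"
      "length (filter loop ts) = length (filter fst L)" using realisesD(6)[OF r] by blast
  have 2: "\<exists>ts. set ts \<subseteq> signed_letters n \<times> signed_letters n \<and>
     refl_B \<bar>x\<bar> \<circ> w = prod_perm (map reflection ts) \<and>
     length (filter (\<lambda>p. \<not> loop p) ts) + length ((True, [x]) # L) = length (concat (map snd ((True, [x]) # L))) \<and>
     length (filter loop ts) = length (filter fst ((True, [x]) # L))"
  proof (intro exI conjI)
    show "refl_B \<bar>x\<bar> \<circ> w = prod_perm (map reflection ((\<bar>x\<bar>, \<bar>x\<bar>) # ts))"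
      unfolding ts(2) by (simp add: reflection_def prod_perm_simps)
  qed (use ts x pos_letter[OF x(1)] in \<open>auto simp: loop_def\<close>)
  have 3: "abs ` set (snd c) \<in> blocks n (refl_B \<bar>x\<bar> \<circ> w) \<and>
      lab (refl_B \<bar>x\<bar> \<circ> w) (abs ` set (snd c)) = (length (snd c), fst c)" if c: "c \<in> set ((True, [x]) # L)" for c
  proof (cases "c = (True, [x])")
    case True
    then show ?thesis using I(2,3,4) by simp
  next
    case False
    then have m: "c \<in> set L" using c by auto
    note realisesD(2,3)[OF r m]
    moreover have "abs ` set (snd c) \<noteq> {\<bar>x\<bar>}"
    proof
      assume "abs ` set (snd c) = {\<bar>x\<bar>}"
      then show False using x(2) entry_subset[OF m] by (metis insertI1 subsetD)
    qed
    ultimately show ?thesis using I(2) I(5)[of "abs ` set (snd c)"] by simp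
  qed
  have 4: "(refl_B \<bar>x\<bar> \<circ> w) u = u" if "u \<in> pos n" "u \<notin> abs ` set (concat (map snd ((True, [x]) # L)))" for u
  proof -
    have "w u = u" using that by (intro realisesD(4)[OF r]) auto
    moreover have "u \<noteq> \<bar>x\<bar>" "u \<noteq> - \<bar>x\<bar>" using that by auto
    ultimately show ?thesis by (simp add: refl_B_apply)
  qed
  show ?thesis unfolding re realises_def by (intro conjI ballI impI I(1) 1 2 4 3[THEN conjunct1] 3[THEN conjunct2])
qed

text \<open>The inductive step for a cycle with at least two letters: by \<open>cyc_Cons\<close> the
  longer cycle arises from the shorter one by inserting the still fixed letter x before z.\<close>

lemma realises_Cons:
  assumes r: "realises n ((f, z # ds) # L) w" and xp: "\<bar>x\<bar> \<in> pos n"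
    and xn: "\<bar>x\<bar> \<notin> abs ` set (concat (map snd ((f, z # ds) # L)))" and zl: "z \<in> signed_letters n"
    and len: "Suc (length (concat (map snd ((f, z # ds) # L)))) \<le> n"
    and disj: "abs ` set (z # ds) \<inter> abs ` set (concat (map snd L)) = {}"
    and nn: "\<forall>c\<in>set L. snd c \<noteq> []"
  shows "realises n ((f, x # z # ds) # L) (refl_A x z \<circ> w)"
proof -
  let ?L1 = "(f, z # ds) # L" and ?L = "(f, x # z # ds) # L"
  have W: "w \<in> W_B n" using realisesD(1)[OF r] .
  have wx: "w \<bar>x\<bar> = \<bar>x\<bar>" using realisesD(4)[OF r xp xn] .
  have xn1: "\<bar>x\<bar> \<notin> abs ` set (z # ds)" and xn2: "\<bar>x\<bar> \<notin> abs ` set (concat (map snd L))"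
    using xn by (simp_all add: image_Un)
  have x0: "x \<noteq> 0" using xp by auto
  \<comment> \<open>\<open>insertion\<close> expects a positive letter. Barring both entries does
    not change \<open>refl_A x z\<close>, so z is barred if x is negative.\<close>
  define y where "y = (if x > 0 then z else - z)"
  have ay: "\<bar>y\<bar> = \<bar>z\<bar>" by (simp add: y_def)
  have yl: "y \<in> signed_letters n" using zl ay letter_abs by metis
  have re: "refl_A x z = refl_A \<bar>x\<bar> y"
  proof (cases "x > 0")
    case False
    have "\<bar>x\<bar> \<noteq> \<bar>z\<bar>" "z \<noteq> 0" "\<bar>- x\<bar> \<noteq> \<bar>- z\<bar>"
      using xn1 zl by (auto simp: signed_letters_def)
    then have "refl_A x z = refl_A (- x) (- z)"
      using x0 by (auto simp: fun_eq_iff refl_A_apply)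
    then show ?thesis using False by (simp add: y_def)
  qed (simp add: y_def)
  have yx: "\<bar>y\<bar> \<noteq> \<bar>x\<bar>" using ay xn by auto
  note I = insertion[OF W xp wx yl yx]
  have IH: "\<And>c. c \<in> set ?L1 \<Longrightarrow> abs ` set (snd c) \<in> blocks n w"
    "\<And>c. c \<in> set ?L1 \<Longrightarrow> lab w (abs ` set (snd c)) = (length (snd c), fst c)"
    by (rule realisesD[OF r], assumption)+
  have b: "blk n w \<bar>y\<bar> = abs ` set (z # ds)"
    using block_props(4)[OF W IH(1)[of "(f, z # ds)"], of "\<bar>y\<bar>"] ay by simp
  have lb: "lab w (blk n w \<bar>y\<bar>) = (length (z # ds), f)" unfolding b
    using IH(2)[of "(f, z # ds)"] by simp
  have cb: "card (blk n w \<bar>y\<bar>) = Suc (length ds)" "flagged w (blk n w \<bar>y\<bar>) = f"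
    using lb by (auto simp: lab_def)
  obtain M where M: "Lam n w = add_mset (1, False) (add_mset (length (z # ds), f) M)"
    "Lam n (refl_A \<bar>x\<bar> y \<circ> w) = add_mset (Suc (Suc (length ds)), f) M"
    using insertion_mset(2)[OF W xp wx yl yx] unfolding lb cb by blast
  have "Lam n w = mset (map (\<lambda>c. (length (snd c), fst c)) ?L1) +
      add_mset (1, False) (replicate_mset (n - Suc (length (concat (map snd ?L1)))) (1, False))"
    using realisesD(5)[OF r] unfolding replicate_split[OF len] .
  then have "M = mset (map (\<lambda>c. (length (snd c), fst c)) L) +
    replicate_mset (n - Suc (length (concat (map snd ?L1)))) (1, False)"
    using M(1) by simp
  then have 1: "Lam n (refl_A \<bar>x\<bar> y \<circ> w) = mset (map (\<lambda>c. (length (snd c), fst c)) ?L) +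
    replicate_mset (n - length (concat (map snd ?L))) (1, False)"
    using M(2) by simp
  obtain ts where ts: "set ts \<subseteq> signed_letters n \<times> signed_letters n" "w = prod_perm (map reflection ts)"
      "length (filter (\<lambda>p. \<not> loop p) ts) + length ?L1 = length (concat (map snd ?L1))"
      "length (filter loop ts) = length (filter fst ?L1)" using realisesD(6)[OF r] by blast
  have 2: "\<exists>ts. set ts \<subseteq> signed_letters n \<times> signed_letters n \<and>
     refl_A \<bar>x\<bar> y \<circ> w = prod_perm (map reflection ts) \<and>
     length (filter (\<lambda>p. \<not> loop p) ts) + length ?L = length (concat (map snd ?L)) \<and>
     length (filter loop ts) = length (filter fst ?L)"
  proof (intro exI conjI)
    show "refl_A \<bar>x\<bar> y \<circ> w = prod_perm (map reflection ((\<bar>x\<bar>, y) # ts))"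
      using yx unfolding ts(2) by (simp add: reflection_def prod_perm_simps)
  qed (use ts pos_letter[OF xp] yl yx in \<open>auto simp: loop_def\<close>)
  have 3: "abs ` set (snd c) \<in> blocks n (refl_A \<bar>x\<bar> y \<circ> w) \<and>
     lab (refl_A \<bar>x\<bar> y \<circ> w) (abs ` set (snd c)) = (length (snd c), fst c)" if c: "c \<in> set ?L" for c
  proof (cases "c = (f, x # z # ds)")
    case True
    then have "abs ` set (snd c) = insert \<bar>x\<bar> (blk n w \<bar>y\<bar>)" unfolding b by simp
    then show ?thesis using I(5,8) cb True by simp
  next
    case False
    then have m: "c \<in> set L" using c by auto
    then have "snd c \<noteq> []" using nn by blast
    then obtain e where e: "e \<in> abs ` set (snd c)" by (cases "snd c") auto
    then have "e \<in> abs ` set (concat (map snd L))" using entry_subset[OF m] by blast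
    then have "e \<noteq> \<bar>x\<bar>" "e \<notin> abs ` set (z # ds)"
      using xn2 disj by (metis, metis disjoint_iff)
    then have "abs ` set (snd c) \<noteq> {\<bar>x\<bar>}" "abs ` set (snd c) \<noteq> abs ` set (z # ds)"
      using e by (metis singletonD, metis)
    then have "abs ` set (snd c) \<in> blocks n w - {{\<bar>x\<bar>}, blk n w \<bar>y\<bar>}"
      using IH(1)[of c] m unfolding b by simp
    then show ?thesis unfolding I(5) using I(9)[of "abs ` set (snd c)"] IH(2)[of c] m by simp
  qed
  have 4: "(refl_A \<bar>x\<bar> y \<circ> w) u = u" if "u \<in> pos n" "u \<notin> abs ` set (concat (map snd ?L))" for u
  proof -
    have "u \<notin> abs ` set (concat (map snd ?L1))" using that by auto
    then have "w u = u" using realisesD(4)[OF r that(1)] by blast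
    moreover have "u \<noteq> \<bar>x\<bar>" "u \<noteq> - \<bar>x\<bar>" "u \<noteq> \<bar>z\<bar>" "u \<noteq> - \<bar>z\<bar>" using that by auto
    moreover from this have "u \<noteq> y" "u \<noteq> - y" unfolding y_def by (auto simp: abs_if split: if_splits)
    moreover have "\<bar>\<bar>x\<bar>\<bar> \<noteq> \<bar>y\<bar>" "\<bar>x\<bar> \<noteq> 0" "y \<noteq> 0" using yx x0 yl by (auto simp: signed_letters_def)
    ultimately show ?thesis by (simp add: refl_A_apply)
  qed
  show ?thesis unfolding re realises_def by (intro conjI ballI impI I(1) 1 2 4 3[THEN conjunct1] 3[THEN conjunct2])
qed

text \<open>Induction on the total number of letters: taking away the first letter of the first
  cycle either removes one reflection or removes a cycle of length 1.\<close>

lemma cycles_of_realises: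
  "cycles_of n L \<Longrightarrow> realises n L (prod_perm (map cyc L))"
proof (induction "length (concat (map snd L))" arbitrary: L rule: less_induct)
  case less
  show ?case
  proof (cases L)
    case Nil
    then show ?thesis using realises_Nil by (simp add: prod_perm_simps)
  next
    case (Cons c L2)
    obtain f as where c: "c = (f, as)" by (cases c)
    note L = Cons[unfolded c]
    have C: "as \<noteq> []" "sdist as" "set as \<subseteq> signed_letters n" "cycles_of n L2"
      "abs ` set as \<inter> abs ` set (concat (map snd L2)) = {}"
      using less.prems unfolding L cycles_of_Cons by auto
    obtain x cs where as: "as = x # cs" using C by (cases as) auto
    have xl: "x \<in> signed_letters n" using C as by auto
    then have xp: "\<bar>x\<bar> \<in> pos n" by (simp only: letter_abs)
    have len: "length (concat (map snd L)) \<le> n" by (rule cycles_of_length[OF less.prems])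
    show ?thesis
    proof (cases cs)
      case Nil
      have r: "realises n L2 (prod_perm (map cyc L2))"
        by (rule less.hyps[OF _ C(4)]) (simp add: L as)
      have xn: "\<bar>x\<bar> \<notin> abs ` set (concat (map snd L2))" using C(5) as by auto
      have len': "Suc (length (concat (map snd L2))) \<le> n" using len L as Nil by simp
      show ?thesis
      proof (cases f)
        case True
        then show ?thesis using realises_B_singleton[OF r xp xn len'] L as Nil
          by (simp add: prod_perm_simps cyc_def cycle_B_singleton)
      next
        case False
        then show ?thesis using realises_A_singleton[OF r xp xn len'] L as Nil
          by (simp add: prod_perm_simps cyc_def cycle_A_singleton)
      qed
    next
      case (Cons z ds)
      let ?L1 = "(f, z # ds) # L2"
      have sd: "sdist (x # z # ds)" using C(2) as Cons by simp
      have "cycles_of n ?L1" using C unfolding cycles_of_Cons as Cons by (auto simp: sdist_Cons)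
      then have r: "realises n ?L1 (prod_perm (map cyc ?L1))"
        by (rule less.hyps[rotated]) (simp add: L as Cons)
      have "realises n ((f, x # z # ds) # L2) (refl_A x z \<circ> prod_perm (map cyc ?L1))"
      proof (rule realises_Cons[OF r xp])
        show "\<bar>x\<bar> \<notin> abs ` set (concat (map snd ?L1))" using C(5) as Cons sd by (auto simp: sdist_Cons)
        show "z \<in> signed_letters n" using C as Cons by auto
        show "Suc (length (concat (map snd ?L1))) \<le> n" using len L as Cons by simp
        show "abs ` set (z # ds) \<inter> abs ` set (concat (map snd L2)) = {}" using C(5) as Cons by auto
        show "\<forall>c\<in>set L2. snd c \<noteq> []" using C(4) by (simp add: cycles_of_def)
      qed
      moreover have "prod_perm (map cyc L) = refl_A x z \<circ> prod_perm (map cyc ?L1)"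
        unfolding L as Cons list.map prod_perm_simps cyc_Cons[OF sd] by (simp only: comp_assoc)
      ultimately show ?thesis using L as Cons by simp
    qed
  qed
qed

section \<open>Existence of the cycle decomposition\<close>

lemma permutes_disjoint_commute:
  assumes "p permutes A" "q permutes B" "A \<inter> B = {}"
  shows "p \<circ> q = q \<circ> p"
proof
  fix u
  consider "u \<in> A" "u \<notin> B" | "u \<notin> A" "u \<in> B" | "u \<notin> A" "u \<notin> B" using assms(3) by blast
  then show "(p \<circ> q) u = (q \<circ> p) u"
  proof cases
    case 1
    then have "p u \<notin> B" using permutes_in_image[OF assms(1), of u] assms(3) by blast
    then show ?thesis using 1 permutes_not_in[OF assms(2)] by simp
  next
    case 2
    then have "q u \<notin> A" using permutes_in_image[OF assms(2), of u] assms(3) by blast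
    then show ?thesis using 2 permutes_not_in[OF assms(1)] by simp
  next
    case 3
    then show ?thesis using permutes_not_in[OF assms(1)] permutes_not_in[OF assms(2)] by simp
  qed
qed

lemma cyc_permutes: "cyc c permutes {u. \<bar>u\<bar> \<in> abs ` set (snd c)}"
proof -
  let ?S = "{u. \<bar>u\<bar> \<in> abs ` set (snd c)}"
  have sub: "set (snd c) \<subseteq> ?S" "set (map uminus (snd c)) \<subseteq> ?S"
    by auto
  have "cycle_of_list (snd c) permutes ?S" "cycle_of_list (map uminus (snd c)) permutes ?S"
    using permutes_subset[OF cycle_permutes sub(1)] permutes_subset[OF cycle_permutes sub(2)] .
  moreover have "set (snd c @ map uminus (snd c)) \<subseteq> ?S" using sub by auto
  then have "cycle_of_list (snd c @ map uminus (snd c)) permutes ?S"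
    by (rule permutes_subset[OF cycle_permutes])
  ultimately show ?thesis by (simp add: cyc_def cycle_A_def cycle_B_def permutes_compose)
qed

lemma cycles_of_perm:
  assumes "mset L = mset L'" "cycles_of n L" shows "cycles_of n L'"
proof -
  have s: "set L = set L'" by (rule mset_eq_setD[OF assms(1)])
  then have "set (concat (map snd L)) = set (concat (map snd L'))" by simp
  then show ?thesis using assms(2) sdist_concat_perm[OF assms(1)] s unfolding cycles_of_def by metis
qed

lemma cycles_of_disjoint:
  assumes "cycles_of n L" "c \<in> set L" "d \<in> set L" "c \<noteq> d"
  shows "abs ` set (snd c) \<inter> abs ` set (snd d) = {}"
proof -
  obtain A B where L: "L = A @ c # B" using assms(2) by (metis split_list)
  have "cycles_of n (c # A @ B)" by (rule cycles_of_perm[OF _ assms(1)]) (simp add: L)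
  then have "abs ` set (snd c) \<inter> abs ` set (concat (map snd (A @ B))) = {}"
    using cycles_of_Cons[of n "fst c" "snd c" "A @ B"] by simp
  moreover have "d \<in> set (A @ B)" using assms L by auto
  ultimately show ?thesis using entry_subset[of d "A @ B"] by blast
qed

lemma cyc_commute:
  assumes "cycles_of n L" "c \<in> set L" "d \<in> set L"
  shows "cyc c \<circ> cyc d = cyc d \<circ> cyc c"
proof (cases "c = d")
  case False
  then show ?thesis using cycles_of_disjoint[OF assms False]
    by (intro permutes_disjoint_commute[OF cyc_permutes cyc_permutes]) blast
qed simp

lemma prod_cyc_perm:
  assumes "mset L = mset L'" "cycles_of n L"
  shows "prod_perm (map cyc L) = prod_perm (map cyc L')"
proof (rule prod_perm_commute)
  show "mset (map cyc L) = mset (map cyc L')" using assms(1) by simp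
  fix a b assume "a \<in> set (map cyc L)" "b \<in> set (map cyc L)"
  then show "a \<circ> b = b \<circ> a" using cyc_commute[OF assms(2)] by auto
qed

definition nontrivial :: "(bool \<times> int list) list \<Rightarrow> bool" where
  "nontrivial L \<longleftrightarrow> (\<forall>c\<in>set L. fst c \<or> length (snd c) \<ge> 2)"

text \<open>The block of a fixed letter is an unflagged singleton, so a listed cycle through it
  would be trivial.\<close>

lemma fixed_not_in_cycles:
  assumes "cycles_of n L" "nontrivial L" "prod_perm (map cyc L) u = u"
  shows "u \<notin> abs ` set (concat (map snd L))"
proof
  let ?w = "prod_perm (map cyc L)"
  have r: "realises n L ?w" by (rule cycles_of_realises[OF assms(1)])
  assume "u \<in> abs ` set (concat (map snd L))"
  then obtain c where c: "c \<in> set L" "u \<in> abs ` set (snd c)" by auto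
  have "abs ` set (snd c) = blk n ?w u"
    using block_props(4)[OF realisesD(1)[OF r] realisesD(2)[OF r c(1)] c(2)] by simp
  also have "\<dots> = {u}" using assms(3) by (rule blk_fixed)
  finally have "lab ?w {u} = (length (snd c), fst c)" using realisesD(3)[OF r c(1)] by simp
  moreover have "u \<in> pos n"
    using c(2) block_props(2)[OF realisesD(1)[OF r] realisesD(2)[OF r c(1)]] by blast
  then have "u > 0" by simp
  ultimately have "length (snd c) = 1" "\<not> fst c" using assms(3) by (auto simp: lab_def flagged_def)
  then show False using assms(2) c unfolding nontrivial_def by auto
qed

text \<open>Induction on the number of moved letters. Multiplication by a reflection makes x fixed;
  in a decomposition of the result x is then put back as [x] if w x = -x, and otherwise just before
  z = w x, either in front of the cycle that contains z up to sign or in a new cycle ((x,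
  z)).\<close>

lemma exists_cycles:
  "w \<in> W_B n \<Longrightarrow> \<exists>L. cycles_of n L \<and> nontrivial L \<and> w = prod_perm (map cyc L)"
proof (induction "card {u\<in>pos n. w u \<noteq> u}" arbitrary: w rule: less_induct)
  case less
  note W = less.prems
  show ?case
  proof (cases "\<exists>x\<in>pos n. w x \<noteq> x")
    case False
    then have "w = id" by (intro W_B_cong[OF W W_B_id]) auto
    then show ?thesis
      by (intro exI[of _ "[]"]) (auto simp: cycles_of_def nontrivial_def sdist_def prod_perm_simps)
  next
    case True
    then obtain x where x: "x \<in> pos n" "w x \<noteq> x" by blast
    have xl: "x \<in> signed_letters n" and x0: "x > 0" using pos_letter[OF x(1)] x by auto
    have zl: "w x \<in> signed_letters n" using W_B_letter[OF W] xl by simp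
    then have z0: "w x \<noteq> 0" by (auto simp: signed_letters_def)
    have smaller: "\<exists>L. cycles_of n L \<and> nontrivial L \<and> w1 = prod_perm (map cyc L)"
      if w1: "w1 \<in> W_B n" "w1 x = x" "\<And>u. u \<in> pos n \<Longrightarrow> w u = u \<Longrightarrow> w1 u = u" for w1
    proof (rule less.hyps[OF _ w1(1)])
      have "{u\<in>pos n. w1 u \<noteq> u} \<subset> {u\<in>pos n. w u \<noteq> u}" using w1 x by blast
      then show "card {u\<in>pos n. w1 u \<noteq> u} < card {u\<in>pos n. w u \<noteq> u}"
        by (rule psubset_card_mono[rotated]) (rule finite_subset[of _ "pos n"], auto)
    qed
    show ?thesis
    proof (cases "w x = - x")
      case True
      let ?w1 = "refl_B x \<circ> w"
      have "\<exists>L. cycles_of n L \<and> nontrivial L \<and> ?w1 = prod_perm (map cyc L)"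
      proof (rule smaller)
        show "?w1 \<in> W_B n" by (intro W_B_comp refl_B_W_B xl W)
        show "?w1 x = x" using True by (simp add: refl_B_apply)
        fix u assume "u \<in> pos n" "w u = u"
        then show "?w1 u = u" using x by (auto simp: refl_B_apply)
      qed
      then obtain L where L: "cycles_of n L" "nontrivial L" "?w1 = prod_perm (map cyc L)" by blast
      have "prod_perm (map cyc L) x = x" unfolding L(3)[symmetric] using True by (simp add: refl_B_apply)
      then have xn: "x \<notin> abs ` set (concat (map snd L))" by (rule fixed_not_in_cycles[OF L(1,2)])
      have "w = refl_B x \<circ> ?w1" unfolding comp_assoc[symmetric] refl_B_sq by simp
      then have "w = prod_perm (map cyc ((True, [x]) # L))"
        by (simp add: L(3) prod_perm_simps cyc_def cycle_B_singleton)
      moreover have "cycles_of n ((True, [x]) # L)" unfolding cycles_of_Cons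
        using L(1) xn x0 xl by (auto simp: sdist_def)
      moreover have "nontrivial ((True, [x]) # L)" using L(2) by (simp add: nontrivial_def)
      ultimately show ?thesis by blast
    next
      case False
      let ?z = "w x" and ?w1 = "refl_A x (w x) \<circ> w"
      have zx: "\<bar>x\<bar> \<noteq> \<bar>?z\<bar>" using False x by auto
      have ap: "refl_A x ?z u = (if u = x then ?z else if u = ?z then x else
        if u = - x then - ?z else if u = - ?z then - x else u)" for u
        using zx x0 z0 by (intro refl_A_apply) auto
      have w1x: "?w1 x = x" using x by (simp add: ap)
      have "\<exists>L. cycles_of n L \<and> nontrivial L \<and> ?w1 = prod_perm (map cyc L)"
      proof (rule smaller)
        show "?w1 x = x" by (rule w1x)
        show "?w1 \<in> W_B n" by (intro W_B_comp refl_A_W_B xl W zl zx)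
        fix u assume u: "u \<in> pos n" "w u = u"
        have "u \<noteq> x" using u x by auto
        moreover have "u \<noteq> ?z" using u x W_B_inj[OF W, of u x] by auto
        moreover have "u \<noteq> - ?z"
        proof
          assume "u = - ?z"
          then have "w u = w (- x)" using u by (simp add: W_B_odd[OF W])
          then show False using u x by (auto simp: W_B_inj[OF W])
        qed
        ultimately show "?w1 u = u" using u x0 by (simp add: ap)
      qed
      then obtain L where L: "cycles_of n L" "nontrivial L" "?w1 = prod_perm (map cyc L)" by blast
      have "prod_perm (map cyc L) x = x" unfolding L(3)[symmetric] by (rule w1x)
      then have xn: "x \<notin> abs ` set (concat (map snd L))" by (rule fixed_not_in_cycles[OF L(1,2)])
      have ww: "w = refl_A x ?z \<circ> ?w1"
        unfolding comp_assoc[symmetric] using refl_A_sq[OF zx] x0 z0 by simp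
      show ?thesis
      proof (cases "\<bar>?z\<bar> \<in> abs ` set (concat (map snd L))")
        case False
        have sd: "sdist [x, ?z]" using zx x0 z0 by (simp add: sdist_def)
        have "w = prod_perm (map cyc ((False, [x, ?z]) # L))"
          using ww cycle_A_Cons[OF sd] unfolding L(3)
          by (simp add: prod_perm_simps cyc_def cycle_A_singleton)
        moreover have "cycles_of n ((False, [x, ?z]) # L)" unfolding cycles_of_Cons
          using L(1) xn False xl zl sd x0 by auto
        moreover have "nontrivial ((False, [x, ?z]) # L)" using L(2) by (simp add: nontrivial_def)
        ultimately show ?thesis by blast
      next
        case True
        then obtain c where c: "c \<in> set L" "\<bar>?z\<bar> \<in> abs ` set (snd c)" by auto
        obtain A B where AB: "L = A @ c # B" using c(1) by (metis split_list)
        have m: "mset L = mset (c # A @ B)" by (simp add: AB)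
        have C: "cycles_of n (c # A @ B)" by (rule cycles_of_perm[OF m L(1)])
        then have C': "sdist (snd c)" "set (snd c) \<subseteq> signed_letters n" "cycles_of n (A @ B)"
          "abs ` set (snd c) \<inter> abs ` set (concat (map snd (A @ B))) = {}"
          using cycles_of_Cons[of n "fst c" "snd c" "A @ B"] by auto
        obtain cs where cs: "cyc (fst c, snd c) = cyc (fst c, ?z # cs)"
          "mset (map abs (?z # cs)) = mset (map abs (snd c))" "sdist (?z # cs)"
          using cyc_head[OF C'(1) c(2), of "fst c"] by blast
        have as: "abs ` set (?z # cs) = abs ` set (snd c)" using mset_eq_setD[OF cs(2)] by simp
        have xnc: "x \<notin> abs ` set (?z # cs)" unfolding as using xn entry_subset[OF c(1)] by blast
        have sd: "sdist (x # ?z # cs)" using cs(3) xnc x0 sdist_Cons[of x "?z # cs"] by simp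
        have xr: "x \<notin> abs ` set (concat (map snd (A @ B)))" using xn by (auto simp: AB)
        let ?L = "(fst c, x # ?z # cs) # A @ B"
        have "?w1 = cyc (fst c, ?z # cs) \<circ> prod_perm (map cyc (A @ B))"
          unfolding L(3) prod_cyc_perm[OF m L(1)] using cs(1) by (simp add: prod_perm_simps)
        then have "w = refl_A x ?z \<circ> (cyc (fst c, ?z # cs) \<circ> prod_perm (map cyc (A @ B)))"
          using ww by simp
        then have "w = prod_perm (map cyc ?L)"
          unfolding list.map prod_perm_simps cyc_Cons[OF sd] comp_assoc .
        moreover have "cycles_of n ?L"
        proof -
          have "set (?z # cs) \<subseteq> signed_letters n"
          proof
            fix v assume "v \<in> set (?z # cs)"
            then have "\<bar>v\<bar> \<in> abs ` set (snd c)" using as by blast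
            then obtain v' where v': "v' \<in> set (snd c)" "\<bar>v\<bar> = \<bar>v'\<bar>" by blast
            then have "v' \<in> signed_letters n" using C'(2) by blast
            then show "v \<in> signed_letters n" unfolding letter_abs v'(2) .
          qed
          moreover have "abs ` set (x # ?z # cs) = insert x (abs ` set (snd c))" using as x0 by simp
          ultimately show ?thesis unfolding cycles_of_Cons using sd xl xr C'(3,4) by auto
        qed
        moreover have "nontrivial ?L" using L(2) by (simp add: nontrivial_def AB)
        ultimately show ?thesis by blast
      qed
    qed
  qed
qed

section \<open>Combinatorial type and cycle type\<close>

definition ctype :: "(nat \<times> bool) multiset \<Rightarrow> refl_type" where
  "ctype M = image_mset (\<lambda>l. if snd l then Type_B (fst l) else Type_A (fst l - 1))
     (filter_mset (\<lambda>l. l \<noteq> (1, False)) M)"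

lemma ctype_Lam:
  assumes "realises n L w" "nontrivial L"
  shows "ctype (Lam n w) = mset (map (\<lambda>c. if fst c then Type_B (length (snd c)) else Type_A (length (snd c) - 1)) L)"
proof -
  have "filter_mset (\<lambda>l. l \<noteq> (1, False)) (Lam n w) = mset (map (\<lambda>c. (length (snd c), fst c)) L)"
  proof -
    have "filter_mset (\<lambda>l. l \<noteq> (1, False)) (mset (map (\<lambda>c. (length (snd c), fst c)) L)) =
      mset (map (\<lambda>c. (length (snd c), fst c)) L)"
      unfolding mset_filter[symmetric] using assms(2) by (subst filter_True) (auto simp: nontrivial_def)
    moreover have "filter_mset (\<lambda>l. l \<noteq> (1, False)) (replicate_mset k (1, False)) = {#}" for k :: nat
      by (induction k) auto
    ultimately show ?thesis unfolding realisesD(5)[OF assms(1)] by simp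
  qed
  then have "ctype (Lam n w) = image_mset (\<lambda>l. if snd l then Type_B (fst l) else Type_A (fst l - 1))
      (image_mset (\<lambda>c. (length (snd c), fst c)) (mset L))" unfolding ctype_def by (simp only: mset_map)
  also have "\<dots> = image_mset (\<lambda>c. if fst c then Type_B (length (snd c)) else Type_A (length (snd c) - 1)) (mset L)"
    unfolding image_mset.compositionality by (intro image_mset_cong) simp
  finally show ?thesis by simp
qed

text \<open>In particular the combinatorial type does not depend on the chosen cycle decomposition,
  since \<open>Lam\<close> is defined from w alone.\<close>

lemma has_comb_type_iff:
  assumes W: "w \<in> W_B n"
  shows "has_comb_type w T \<longleftrightarrow> T = ctype (Lam n w)"
proof
  assume "has_comb_type w T"
  then obtain As Bs where AB: "\<forall>as\<in>set As. length as \<ge> 2" "\<forall>bs\<in>set Bs. length bs \<ge> 1"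
    "distinct (concat (As @ Bs) @ map uminus (concat (As @ Bs)))"
    "w = prod_perm (map cycle_A As @ map cycle_B Bs)"
    "T = mset (map (\<lambda>as. Type_A (length as - 1)) As @ map (\<lambda>bs. Type_B (length bs)) Bs)"
    unfolding has_comb_type_def by blast
  define L where "L = map (Pair False) As @ map (Pair True) Bs"
  have w: "w = prod_perm (map cyc L)" unfolding AB(4) L_def by (simp add: cyc_def comp_def)
  have snd: "map snd L = As @ Bs" by (simp add: L_def comp_def)
  have nt: "nontrivial L" using AB(1) by (auto simp: nontrivial_def L_def)
  have ne: "\<forall>c\<in>set L. snd c \<noteq> []" using AB(1,2) by (auto simp: L_def)
  have sd: "sdist (concat (map snd L))" unfolding snd using AB(3) by (simp only: sdist_iff)
  \<comment> \<open>The lists in \<open>has_comb_type\<close> are not confined to the letters of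
    W(B_n). They are first placed in a larger group W(B_N); a letter beyond n among them would be
    fixed by w, which \<open>fixed_not_in_cycles\<close> excludes.\<close>
  define N where "N = n + nat (\<Sum>u\<leftarrow>concat (map snd L). \<bar>u\<bar>)"
  have "\<bar>u\<bar> \<le> int N" if "u \<in> set (concat (map snd L))" for u
  proof -
    have "\<bar>u\<bar> \<le> (\<Sum>u\<leftarrow>concat (map snd L). \<bar>u\<bar>)"
      using that by (intro member_le_sum_list) auto
    then show ?thesis unfolding N_def by linarith
  qed
  moreover have "u \<noteq> 0" if "u \<in> set (concat (map snd L))" for u using sd that unfolding sdist_def by metis
  ultimately have "set (concat (map snd L)) \<subseteq> signed_letters N"
    by (fastforce simp: signed_letters_def)
  then have CN: "cycles_of N L" using ne sd by (simp add: cycles_of_def)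
  have "set (concat (map snd L)) \<subseteq> signed_letters n"
  proof
    fix u assume u: "u \<in> set (concat (map snd L))"
    show "u \<in> signed_letters n"
    proof (rule ccontr)
      assume "u \<notin> signed_letters n"
      then have "\<bar>u\<bar> \<notin> signed_letters n" using letter_abs by (metis abs_abs)
      then have "w \<bar>u\<bar> = \<bar>u\<bar>" by (rule W_B_outside[OF W])
      then show False using fixed_not_in_cycles[OF CN nt] u w by blast
    qed
  qed
  then have "cycles_of n L" using ne sd by (simp add: cycles_of_def)
  then have "realises n L w" unfolding w by (rule cycles_of_realises)
  then show "T = ctype (Lam n w)" using ctype_Lam[OF _ nt] AB(5) by (simp add: L_def comp_def)
next
  assume T: "T = ctype (Lam n w)"
  obtain L where L: "cycles_of n L" "nontrivial L" "w = prod_perm (map cyc L)"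
    using exists_cycles[OF W] by blast
  define As where "As = map snd (filter (\<lambda>c. \<not> fst c) L)"
  define Bs where "Bs = map snd (filter fst L)"
  define L' where "L' = map (Pair False) As @ map (Pair True) Bs"
  have "mset (map (Pair False) (map snd (filter (\<lambda>c. \<not> fst c) L)) @ map (Pair True) (map snd (filter fst L))) = mset L"
    by (induction L) auto
  then have m: "mset L = mset L'" by (simp add: L'_def As_def Bs_def)
  have C: "cycles_of n L'" by (rule cycles_of_perm[OF m L(1)])
  have w: "w = prod_perm (map cyc L')" unfolding L(3) by (rule prod_cyc_perm[OF m L(1)])
  have nt: "nontrivial L'" using L(2) mset_eq_setD[OF m] by (simp add: nontrivial_def)
  have snd: "map snd L' = As @ Bs" by (simp add: L'_def comp_def)
  have "realises n L' w" unfolding w by (rule cycles_of_realises[OF C])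
  then have T': "T = mset (map (\<lambda>c. if fst c then Type_B (length (snd c)) else Type_A (length (snd c) - 1)) L')"
    unfolding T by (rule ctype_Lam[OF _ nt])
  show "has_comb_type w T" unfolding has_comb_type_def
  proof (rule exI[of _ As], rule exI[of _ Bs], intro conjI)
    show "\<forall>as\<in>set As. 2 \<le> length as" using L(2) by (auto simp: As_def nontrivial_def)
    show "\<forall>bs\<in>set Bs. 1 \<le> length bs" using L(1) by (auto simp: Bs_def cycles_of_def Suc_le_eq)
    show "distinct (concat (As @ Bs) @ map uminus (concat (As @ Bs)))"
    proof -
      have "sdist (concat (map snd L'))" using C by (simp only: cycles_of_def)
      then show ?thesis by (simp only: sdist_iff snd)
    qed
    show "w = prod_perm (map cycle_A As @ map cycle_B Bs)"
      unfolding w L'_def by (simp add: cyc_def comp_def)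
    show "T = mset (map (\<lambda>as. Type_A (length as - 1)) As @ map (\<lambda>bs. Type_B (length bs)) Bs)"
      unfolding T' L'_def by (simp add: comp_def)
  qed
qed

section \<open>Conjugation of cycle decompositions\<close>

lemma sdist_concatD: "sdist (concat xss) \<Longrightarrow> xs \<in> set xss \<Longrightarrow> sdist xs"
  by (induction xss) (auto simp: sdist_append)

definition conj_cycles :: "(int \<Rightarrow> int) \<Rightarrow> (bool \<times> int list) list \<Rightarrow> (bool \<times> int list) list" where
  "conj_cycles g L = map (\<lambda>c. (fst c, map g (snd c))) L"

lemma conj_cycles:
  assumes g: "g \<in> W_B n" and L: "cycles_of n L"
  shows "cycles_of n (conj_cycles g L)"
    "g \<circ> prod_perm (map cyc L) \<circ> inv g = prod_perm (map cyc (conj_cycles g L))"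
proof -
  have c: "concat (map snd (conj_cycles g L)) = map g (concat (map snd L))"
    by (simp add: conj_cycles_def map_concat comp_def)
  show "cycles_of n (conj_cycles g L)"
    unfolding cycles_of_def c sdist_map[OF g]
    using L by (auto simp: cycles_of_def conj_cycles_def W_B_letter[OF g])
  have conj: "g \<circ> cyc d \<circ> inv g = cyc (fst d, map g (snd d))" if d: "d \<in> set L" for d
  proof -
    have "sdist (concat (map snd L))" using L by (simp only: cycles_of_def)
    then have "sdist (snd d)" by (rule sdist_concatD) (use d in simp)
    from conj_cyc[OF g this, of "fst d"] show ?thesis by simp
  qed
  have "map (\<lambda>w. g \<circ> w \<circ> inv g) (map cyc L) = map (\<lambda>c. g \<circ> cyc c \<circ> inv g) L"
    by simp
  also have "\<dots> = map (\<lambda>c. cyc (fst c, map g (snd c))) L"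
    by (rule map_cong[OF refl conj])
  also have "\<dots> = map cyc (conj_cycles g L)" by (simp add: conj_cycles_def)
  finally show "g \<circ> prod_perm (map cyc L) \<circ> inv g = prod_perm (map cyc (conj_cycles g L))"
    unfolding conj_prod_perm[OF W_B_bij[OF g]] by (rule arg_cong)
qed

lemma Lam_conj:
  assumes g: "g \<in> W_B n" and W: "w \<in> W_B n"
  shows "Lam n (g \<circ> w \<circ> inv g) = Lam n w"
proof -
  obtain L where L: "cycles_of n L" "w = prod_perm (map cyc L)" using exists_cycles[OF W] by blast
  have "map (\<lambda>c. (length (snd c), fst c)) (conj_cycles g L) = map (\<lambda>c. (length (snd c), fst c)) L"
    by (simp add: conj_cycles_def comp_def)
  moreover have "length (concat (map snd (conj_cycles g L))) = length (concat (map snd L))"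
    by (simp add: conj_cycles_def length_concat comp_def)
  ultimately show ?thesis unfolding L(2) conj_cycles(2)[OF g L(1)]
    realisesD(5)[OF cycles_of_realises[OF L(1)]] realisesD(5)[OF cycles_of_realises[OF conj_cycles(1)[OF g L(1)]]]
    by simp
qed

text \<open>The remaining positive letters complete xs to the one-line notation of a signed
  permutation. This is the source of the conjugating elements used for reflections, for c and for
  parabolic subgroups.\<close>

lemma exists_W_B_extending:
  assumes "sdist xs" "set xs \<subseteq> signed_letters n"
  shows "\<exists>g\<in>W_B n. \<forall>i<length xs. g (int i + 1) = xs ! i"
proof -
  define ys where "ys = xs @ sorted_list_of_set (pos n - abs ` set xs)"
  have ax: "abs ` set xs \<subseteq> pos n" using assms(2) letter_abs by blast
  have pn: "abs v = v" if "v \<in> pos n" for v using that by simp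
  have mp: "map abs (sorted_list_of_set (pos n - abs ` set xs)) = sorted_list_of_set (pos n - abs ` set xs)"
    by (intro map_idI) (simp add: pn)
  have d: "distinct (map abs ys)" using assms(1) unfolding ys_def map_append mp
    by (auto simp: sdist_def)
  have s: "set (map abs ys) = pos n" unfolding ys_def map_append mp using ax by auto
  then have len: "length ys = n" using distinct_card[OF d] by simp
  have abs_eq: "\<bar>ys ! i\<bar> = \<bar>ys ! j\<bar> \<longleftrightarrow> i = j" if "i < n" "j < n" for i j
    using nth_eq_iff_index_eq[OF d, of i j] that len by simp
  have abs_in: "\<bar>ys ! i\<bar> \<in> pos n" if "i < n" for i
    using s that len by (metis length_map nth_map nth_mem)
  define g where "g u = (if u \<in> pos n then ys ! (nat u - 1) else if - u \<in> pos n then - ys ! (nat (- u) - 1) else u)" for u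
  have gp: "g u = ys ! (nat u - 1)" if "u \<in> pos n" for u using that by (simp add: g_def)
  have odd: "g (- u) = - g u" for u
    by (cases "u > 0"; cases "u = 0") (auto simp: g_def)
  have gabs: "\<bar>g u\<bar> = \<bar>ys ! (nat \<bar>u\<bar> - 1)\<bar>" if "u \<in> signed_letters n" for u
    using that odd[of "\<bar>u\<bar>"] gp[of "\<bar>u\<bar>"] letter_abs[of u n] by (cases "u > 0") auto
  have nat_lt: "nat \<bar>u\<bar> - 1 < n" if "u \<in> signed_letters n" for u
    using that by (auto simp: signed_letters_def)
  have "inj_on g (signed_letters n)"
  proof (rule inj_onI)
    fix u v assume uv: "u \<in> signed_letters n" "v \<in> signed_letters n" "g u = g v"
    then have "nat \<bar>u\<bar> - 1 = nat \<bar>v\<bar> - 1"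
      using gabs[of u] gabs[of v] abs_eq[OF nat_lt[of u] nat_lt[of v]] by simp
    then have "\<bar>u\<bar> = \<bar>v\<bar>" using uv by (auto simp: signed_letters_def)
    moreover have "g u \<noteq> 0" using gabs[OF uv(1)] abs_in[OF nat_lt[OF uv(1)]] by auto
    ultimately show "u = v" using uv(3) odd[of v] by (auto simp: abs_eq_iff)
  qed
  moreover have "g ` signed_letters n \<subseteq> signed_letters n"
  proof
    fix v assume "v \<in> g ` signed_letters n"
    then obtain u where u: "u \<in> signed_letters n" "v = g u" by blast
    then show "v \<in> signed_letters n" using gabs[OF u(1)] abs_in[OF nat_lt[OF u(1)]] letter_abs by metis
  qed
  ultimately have "bij_betw g (signed_letters n) (signed_letters n)"
    by (simp add: bij_betw_def endo_inj_surj signed_letters_def)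
  then have "g permutes signed_letters n"
    by (rule bij_imp_permutes) (auto simp: g_def signed_letters_def)
  then have "g \<in> W_B n" using odd by (intro W_BI)
  moreover have "g (int i + 1) = xs ! i" if "i < length xs" for i
  proof -
    have "i < n" using that len unfolding ys_def by simp
    then show ?thesis using that by (simp add: gp ys_def nth_append nat_add_distrib)
  qed
  ultimately show ?thesis by blast
qed

section \<open>Absolute length\<close>

lemma cycle_A_pair: "cycle_A [x, z] = refl_A x z"
  by (simp add: cycle_A_def refl_A_def)

lemma reflection_W_B: "p \<in> signed_letters n \<times> signed_letters n \<Longrightarrow> reflection p \<in> W_B n"
  by (auto simp: reflection_def intro: refl_A_W_B refl_B_W_B)

text \<open>A signed permutation can send 1, or the pair 1, 2, to any letters with distinct absolute
  values, so [1] and ((1, 2)) already have all these conjugates.\<close>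

lemma reflections_eq: "reflections n = reflection ` (signed_letters n \<times> signed_letters n)"
proof
  show "reflections n \<subseteq> reflection ` (signed_letters n \<times> signed_letters n)"
  proof
    fix t assume "t \<in> reflections n"
    then obtain w s where ws: "w \<in> W_B n" "s \<in> simple_reflections n" "t = w \<circ> s \<circ> inv w"
      unfolding reflections_def by blast
    have n: "n \<noteq> 0" using ws(2) by (simp add: simple_reflections_def split: if_splits)
    then consider "s = cycle_B [1]" | i where "s = cycle_A [i, i + 1]" "i \<in> {1..<int n}"
      using ws(2) by (auto simp: simple_reflections_def)
    then show "t \<in> reflection ` (signed_letters n \<times> signed_letters n)"
    proof cases
      case 1
      have "t = cyc (True, map w [1])"
        using conj_cyc[OF ws(1), of "[1]" True] 1 ws(3) by (simp add: cyc_def sdist_def)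
      then have "t = reflection (w 1, w 1)" by (simp add: cyc_def cycle_B_singleton reflection_def)
      moreover have "1 \<in> signed_letters n" using n by (auto simp: signed_letters_def)
      then have "w 1 \<in> signed_letters n" using W_B_letter[OF ws(1)] by simp
      ultimately show ?thesis by blast
    next
      case 2
      have "t = cyc (False, map w [i, i + 1])"
        using conj_cyc[OF ws(1), of "[i, i + 1]" False] 2 ws(3) by (simp add: cyc_def sdist_def)
      moreover have "sdist [i, i + 1]" using 2 by (simp add: sdist_def)
      then have "sdist (map w [i, i + 1])" unfolding sdist_map[OF ws(1)] .
      ultimately have "t = reflection (w i, w (i + 1))"
        by (simp add: cyc_def cycle_A_pair reflection_def sdist_def)
      moreover have "i \<in> signed_letters n" "i + 1 \<in> signed_letters n"
        using 2 by (auto simp: signed_letters_def)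
      then have "w i \<in> signed_letters n" "w (i + 1) \<in> signed_letters n"
        using W_B_letter[OF ws(1)] by simp_all
      ultimately show ?thesis by blast
    qed
  qed
  show "reflection ` (signed_letters n \<times> signed_letters n) \<subseteq> reflections n"
  proof
    fix t assume "t \<in> reflection ` (signed_letters n \<times> signed_letters n)"
    then obtain x z where t: "t = reflection (x, z)" and x: "x \<in> signed_letters n" and z: "z \<in> signed_letters n"
      by blast
    have x0: "x \<noteq> 0" "z \<noteq> 0" "n \<noteq> 0" using x z by (auto simp: signed_letters_def)
    show "t \<in> reflections n"
    proof (cases "\<bar>x\<bar> = \<bar>z\<bar>")
      case True
      have "sdist [x]" using x0 by (simp add: sdist_def)
      then obtain g where g: "g \<in> W_B n" "g 1 = x" using exists_W_B_extending[of "[x]" n] x by auto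
      have "g \<circ> cycle_B [1] \<circ> inv g = refl_B x"
        using conj_cyc[OF g(1), of "[1]" True] g(2) by (simp add: cyc_def sdist_def cycle_B_singleton)
      then have "t = g \<circ> cycle_B [1] \<circ> inv g" using True by (simp add: t reflection_def)
      moreover have "cycle_B [1] \<in> simple_reflections n" using x0 by (simp add: simple_reflections_def)
      ultimately show ?thesis using g(1) unfolding reflections_def by blast
    next
      case False
      have "sdist [x, z]" using x0 False by (simp add: sdist_def)
      then obtain g where g: "g \<in> W_B n" "\<forall>i<length [x, z]. g (int i + 1) = [x, z] ! i"
        using exists_W_B_extending[of "[x, z]" n] x z by auto
      have g1: "g 1 = x" using g(2)[rule_format, of 0] by simp
      have g2: "g 2 = z" using g(2)[rule_format, of 1] by simp
      have "g \<circ> cycle_A [1, 2] \<circ> inv g = refl_A x z"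
        using conj_cyc[OF g(1), of "[1, 2]" False] g1 g2 by (simp add: cyc_def sdist_def cycle_A_pair)
      then have "t = g \<circ> cycle_A [1, 1 + 1] \<circ> inv g" using False by (simp add: t reflection_def)
      moreover have "n \<ge> 2"
      proof (rule ccontr)
        assume "\<not> n \<ge> 2"
        then show False using x z False x0 by (auto simp: signed_letters_def)
      qed
      then have "1 \<in> {1..<int n}" by simp
      then have "cycle_A [1, 1 + 1] \<in> (\<lambda>i. cycle_A [i, i + 1]) ` {1..<int n}" by (rule imageI)
      then have "cycle_A [1, 1 + 1] \<in> simple_reflections n" using x0 by (simp add: simple_reflections_def)
      ultimately show ?thesis using g(1) unfolding reflections_def by blast
    qed
  qed
qed

text \<open>Adding a reflection merges two values of \<open>\<bar>r\<bar>\<close> or makes one of them \<open>0\<close>.\<close>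

lemma odd_colouring_exists:
  assumes "set ts \<subseteq> signed_letters n \<times> signed_letters n"
  shows "\<exists>r::int \<Rightarrow> int. (\<forall>u. r (- u) = - r u) \<and> (\<forall>p\<in>set ts. \<forall>u. r (reflection p u) = r u) \<and>
    n \<le> length ts + card ((\<lambda>u. \<bar>r u\<bar>) ` pos n - {0})"
  using assms
proof (induction ts)
  case Nil
  have "(\<lambda>u. \<bar>u\<bar>) ` pos n - {0} = pos n" by force
  then show ?case by (intro exI[of _ "\<lambda>u. u"]) simp
next
  case (Cons p ts)
  have "set ts \<subseteq> signed_letters n \<times> signed_letters n" using Cons.prems by simp
  then obtain r :: "int \<Rightarrow> int" where r: "\<And>u. r (- u) = - r u"
    "\<And>p u. p \<in> set ts \<Longrightarrow> r (reflection p u) = r u"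
    "n \<le> length ts + card ((\<lambda>u. \<bar>r u\<bar>) ` pos n - {0})" using Cons.IH by blast
  obtain x z where p: "p = (x, z)" by (cases p)
  have x0: "x \<noteq> 0" "z \<noteq> 0" using Cons.prems p by (auto simp: signed_letters_def)
  \<comment> \<open>h acts on colours. If the colours of x and z differ in absolute value and that
    of z is nonzero, the colour of z is replaced by that of x, and likewise for the bars; in all
    other cases, in particular for loops, the colour of x is sent to 0. Either way only colours of
    one absolute value e change, so at most one nonzero absolute value is lost.\<close>
  have "\<exists>h :: int \<Rightarrow> int. (\<forall>a. h (- a) = - h a) \<and> (if \<bar>x\<bar> = \<bar>z\<bar> then h (r x) = 0 else h (r x) = h (r z)) \<and>
    (\<exists>e. \<forall>a. \<bar>a\<bar> \<noteq> e \<longrightarrow> h a = a)"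
  proof (cases "\<bar>x\<bar> \<noteq> \<bar>z\<bar> \<and> \<bar>r x\<bar> \<noteq> \<bar>r z\<bar> \<and> r z \<noteq> 0")
    case True
    then show ?thesis
      by (intro exI[of _ "\<lambda>a. if a = r z then r x else if a = - r z then - r x else a"] conjI exI[of _ "\<bar>r z\<bar>"]) auto
  next
    case False
    have "\<bar>r x\<bar> = \<bar>r z\<bar>" if "\<bar>x\<bar> = \<bar>z\<bar>" using that r(1)[of z] by (auto simp: abs_eq_iff)
    then show ?thesis using False
      by (intro exI[of _ "\<lambda>a. if \<bar>a\<bar> = \<bar>r x\<bar> then 0 else a"] conjI exI[of _ "\<bar>r x\<bar>"]) auto
  qed
  then obtain h e where h: "\<And>a. h (- a) = - h a" "if \<bar>x\<bar> = \<bar>z\<bar> then h (r x) = 0 else h (r x) = h (r z)"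
    "\<And>a. \<bar>a\<bar> \<noteq> e \<Longrightarrow> h a = a" by blast
  have new: "h (r (reflection p u)) = h (r u)" for u
  proof (cases "\<bar>x\<bar> = \<bar>z\<bar>")
    case True
    then show ?thesis using h(1,2) r(1) unfolding p reflection_def by (auto simp: refl_B_apply)
  next
    case False
    then show ?thesis using h(1,2) r(1) unfolding p reflection_def
      by (auto simp: refl_A_apply[OF False x0])
  qed
  let ?A = "(\<lambda>u. \<bar>r u\<bar>) ` pos n - {0}" and ?B = "(\<lambda>u. \<bar>h (r u)\<bar>) ` pos n - {0}"
  have "?A - {e} \<subseteq> ?B"
  proof
    fix a assume "a \<in> ?A - {e}"
    then obtain u where "u \<in> pos n" "a = \<bar>r u\<bar>" "a \<noteq> 0" "a \<noteq> e" by blast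
    then show "a \<in> ?B" using h(3)[of "r u"] by (intro DiffI image_eqI[of _ _ u]) auto
  qed
  then have "card (?A - {e}) \<le> card ?B" by (intro card_mono) auto
  moreover have "card ?A \<le> card (insert e (?A - {e}))" by (intro card_mono) auto
  then have "card ?A \<le> Suc (card (?A - {e}))"
    using card_insert_le_m1[of "Suc (card (?A - {e}))" "?A - {e}" e] by simp
  ultimately have "n \<le> length (p # ts) + card ?B" using r(3) by simp
  then show ?case using h(1) r(1,2) new by (intro exI[of _ "\<lambda>u. h (r u)"]) auto
qed

text \<open>For the cycle type of w this is the dimension of the fixed space in the reflection
  representation: every unflagged block, fixed letters included, carries a line of fixed vectors, a
  flagged block none.\<close>

definition num_A :: "(nat \<times> bool) multiset \<Rightarrow> nat" where
  "num_A M = size (filter_mset (\<lambda>l. \<not> snd l) M)"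

definition num_B :: "(nat \<times> bool) multiset \<Rightarrow> nat" where
  "num_B M = size (filter_mset snd M)"

lemma num_A_B: "num_A M + num_B M = size M"
  unfolding num_A_def num_B_def by (induction M) auto

lemma num_A_Lam: "num_A (Lam n w) = card {b\<in>blocks n w. \<not> flagged w b}"
proof -
  have "filter_mset (\<lambda>l. \<not> snd l) (Lam n w) =
    image_mset (lab w) (filter_mset (\<lambda>b. \<not> flagged w b) (mset_set (blocks n w)))"
    by (simp add: Lam_def filter_mset_image_mset lab_def)
  then show ?thesis by (simp add: num_A_def finite_blocks)
qed

text \<open>An odd invariant colouring is constant up to sign on each block and vanishes on the
  flagged ones, so only the unflagged blocks can supply nonzero absolute values.\<close>

lemma odd_colouring_bound:
  assumes W: "w \<in> W_B n" and odd: "\<And>u. r (- u) = - r u" and inv: "\<And>u. r (w u) = r u"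
  shows "card ((\<lambda>u. \<bar>r u\<bar>) ` pos n - {0 :: int}) \<le> num_A (Lam n w)"
proof -
  let ?F = "{b\<in>blocks n w. \<not> flagged w b}"
  have ra: "r \<bar>v\<bar> = sgn v * r v" for v using odd[of v] odd[of 0] by (cases "v \<ge> 0"; cases "v = 0") auto
  have "\<forall>u\<in>pos n. \<bar>r \<bar>w u\<bar>\<bar> = \<bar>r u\<bar>"
  proof
    fix u
    have "\<bar>r \<bar>w u\<bar>\<bar> = \<bar>r (w u)\<bar>" using odd[of "w u"] by (cases "w u \<ge> 0") auto
    then show "\<bar>r \<bar>w u\<bar>\<bar> = \<bar>r u\<bar>" by (simp add: inv)
  qed
  then have const: "\<forall>b\<in>blocks n w. \<forall>u\<in>b. \<forall>v\<in>b. \<bar>r u\<bar> = \<bar>r v\<bar>"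
    using inv_colour_blocks[OF W, of "\<lambda>u. \<bar>r u\<bar>"] by blast
  \<comment> \<open>Reindexing the product of r over b along w multiplies it by the sign product of
    b, which is -1. So the product is 0, and then so is every value on b, since all agree up to
    sign.\<close>
  have zero: "r u = 0" if b: "b \<in> blocks n w" "flagged w b" "u \<in> b" for b u
  proof -
    have "(\<Prod>u\<in>b. r u) = (\<Prod>u\<in>b. r \<bar>w u\<bar>)"
      by (rule prod.reindex_bij_betw[OF block_bij[OF W b(1)], of r, symmetric])
    also have "\<dots> = (\<Prod>u\<in>b. sgn (w u)) * (\<Prod>u\<in>b. r u)" by (simp add: ra inv prod.distrib)
    also have "\<dots> = - (\<Prod>u\<in>b. r u)" using b(2) by (simp add: flagged_def)
    finally have "(\<Prod>u\<in>b. r u) = 0" by simp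
    then obtain v where "v \<in> b" "r v = 0" using block_props(3)[OF W b(1)] by auto
    then have "\<bar>r u\<bar> = \<bar>0\<bar>" using const b by metis
    then show ?thesis by simp
  qed
  define val where "val b = \<bar>r (SOME u. u \<in> b)\<bar>" for b
  have "(\<lambda>u. \<bar>r u\<bar>) ` pos n - {0} \<subseteq> val ` ?F"
  proof
    fix a assume "a \<in> (\<lambda>u. \<bar>r u\<bar>) ` pos n - {0}"
    then obtain u where u: "u \<in> pos n" "a = \<bar>r u\<bar>" "r u \<noteq> 0" by auto
    have b: "blk n w u \<in> blocks n w" "u \<in> blk n w u"
      using blk_in_blocks[OF u(1)] blk_self[OF W] by auto
    then have "\<not> flagged w (blk n w u)" using zero u(3) by blast
    moreover have "(SOME v. v \<in> blk n w u) \<in> blk n w u" using b(2) by (rule someI)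
    then have "val (blk n w u) = a" using const b u(2) unfolding val_def by metis
    ultimately show "a \<in> val ` ?F" using b(1) by blast
  qed
  then have "card ((\<lambda>u. \<bar>r u\<bar>) ` pos n - {0}) \<le> card (val ` ?F)"
    using finite_blocks[of n w] by (intro card_mono) auto
  also have "\<dots> \<le> card ?F" using finite_blocks[of n w] by (intro card_image_le) auto
  finally show ?thesis by (simp add: num_A_Lam)
qed

text \<open>In total these are n - \<open>num_A\<close> reflections, the upper bound for the
  absolute length. Loops are counted apart because only the other reflections are edges.\<close>

lemma exists_reflections:
  assumes "w \<in> W_B n"
  shows "\<exists>ts. set ts \<subseteq> signed_letters n \<times> signed_letters n \<and> w = prod_perm (map reflection ts) \<and>
    length (filter (\<lambda>p. \<not> loop p) ts) + size (Lam n w) = n \<and> length (filter loop ts) = num_B (Lam n w)"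
proof -
  obtain L where L: "cycles_of n L" "w = prod_perm (map cyc L)" using exists_cycles[OF assms] by blast
  have r: "realises n L w" unfolding L(2) by (rule cycles_of_realises[OF L(1)])
  obtain ts where ts: "set ts \<subseteq> signed_letters n \<times> signed_letters n" "w = prod_perm (map reflection ts)"
    "length (filter (\<lambda>p. \<not> loop p) ts) + length L = length (concat (map snd L))"
    "length (filter loop ts) = length (filter fst L)" using realisesD(6)[OF r] by blast
  have "size (Lam n w) = length L + (n - length (concat (map snd L)))"
    unfolding realisesD(5)[OF r] by simp
  then have "length (filter (\<lambda>p. \<not> loop p) ts) + size (Lam n w) = n"
    using ts(3) cycles_of_length[OF L(1)] by linarith
  moreover have "num_B (mset (map (\<lambda>c. (length (snd c), fst c)) L)) = length (filter fst L)"
    unfolding num_B_def by (induction L) auto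
  then have "num_B (Lam n w) = length (filter fst L)" unfolding realisesD(5)[OF r] by (simp add: num_B_def)
  ultimately show ?thesis using ts by auto
qed

lemma size_Lam_le: "w \<in> W_B n \<Longrightarrow> size (Lam n w) \<le> n"
  using exists_reflections[of w n] by auto

lemma reflection_word:
  "set ts \<subseteq> reflections n \<longleftrightarrow> (\<exists>ps. set ps \<subseteq> signed_letters n \<times> signed_letters n \<and> ts = map reflection ps)"
proof
  assume "set ts \<subseteq> reflections n"
  then show "\<exists>ps. set ps \<subseteq> signed_letters n \<times> signed_letters n \<and> ts = map reflection ps"
  proof (induction ts)
    case (Cons t ts)
    then obtain ps where "set ps \<subseteq> signed_letters n \<times> signed_letters n" "ts = map reflection ps" by auto
    moreover obtain p where "p \<in> signed_letters n \<times> signed_letters n" "t = reflection p"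
      using Cons.prems unfolding reflections_eq by auto
    ultimately show ?case by (intro exI[of _ "p # ps"]) auto
  qed simp
next
  assume "\<exists>ps. set ps \<subseteq> signed_letters n \<times> signed_letters n \<and> ts = map reflection ps"
  then obtain ps where "set ps \<subseteq> signed_letters n \<times> signed_letters n" "ts = map reflection ps" by blast
  then show "set ts \<subseteq> reflections n" by (simp add: reflections_eq image_mono)
qed

lemma colour_prod:
  "(\<And>p u. p \<in> set ps \<Longrightarrow> r (f p u) = r u) \<Longrightarrow> r (prod_perm (map f ps) u) = r u"
  by (induction ps arbitrary: u) (auto simp: prod_perm_simps)

text \<open>The codimension formula. For the lower bound, a word of k reflections admits an odd
  invariant colouring with at least n - k nonzero absolute values, and
  \<open>odd_colouring_bound\<close> limits these by the unflagged blocks.\<close>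

lemma abs_length_eq:
  assumes W: "w \<in> W_B n"
  shows "abs_length n w = n - num_A (Lam n w)"
  unfolding abs_length_def
proof (rule Least_equality)
  obtain ps where ps: "set ps \<subseteq> signed_letters n \<times> signed_letters n" "w = prod_perm (map reflection ps)"
    "length (filter (\<lambda>p. \<not> loop p) ps) + size (Lam n w) = n" "length (filter loop ps) = num_B (Lam n w)"
    using exists_reflections[OF W] by blast
  have "length ps = length (filter loop ps) + length (filter (\<lambda>p. \<not> loop p) ps)"
    by (simp add: sum_length_filter_compl)
  then have "length ps = n - num_A (Lam n w)" using ps(3,4) num_A_B[of "Lam n w"] by linarith
  then show "\<exists>ts. length ts = n - num_A (Lam n w) \<and> set ts \<subseteq> reflections n \<and> prod_perm ts = w"
    using ps(1,2) by (intro exI[of _ "map reflection ps"]) (simp add: reflections_eq image_mono)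
next
  fix k assume "\<exists>ts. length ts = k \<and> set ts \<subseteq> reflections n \<and> prod_perm ts = w"
  then obtain ps where ps: "length ps = k" "set ps \<subseteq> signed_letters n \<times> signed_letters n"
    "w = prod_perm (map reflection ps)" unfolding reflection_word by auto
  obtain r :: "int \<Rightarrow> int" where r: "\<And>u. r (- u) = - r u" "\<And>p u. p \<in> set ps \<Longrightarrow> r (reflection p u) = r u"
    "n \<le> length ps + card ((\<lambda>u. \<bar>r u\<bar>) ` pos n - {0})" using odd_colouring_exists[OF ps(2)] by blast
  have inv: "r (w u) = r u" for u unfolding ps(3) by (rule colour_prod) (rule r(2))
  have "card ((\<lambda>u. \<bar>r u\<bar>) ` pos n - {0}) \<le> num_A (Lam n w)"
    by (rule odd_colouring_bound[of w n r, OF W r(1) inv])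
  then show "n - num_A (Lam n w) \<le> k" using r(3) ps(1) by linarith
qed

lemma abs_length_0:
  assumes W: "w \<in> W_B n" and "abs_length n w = 0"
  shows "w = id"
proof -
  obtain ps where ps: "set ps \<subseteq> signed_letters n \<times> signed_letters n" "w = prod_perm (map reflection ps)"
    "length (filter (\<lambda>p. \<not> loop p) ps) + size (Lam n w) = n" "length (filter loop ps) = num_B (Lam n w)"
    using exists_reflections[OF W] by blast
  have "length ps = length (filter loop ps) + length (filter (\<lambda>p. \<not> loop p) ps)"
    by (simp add: sum_length_filter_compl)
  then have "length ps = 0" using ps(3,4) num_A_B[of "Lam n w"] assms(2) unfolding abs_length_eq[OF W] by linarith
  then show ?thesis using ps(2) by (simp add: prod_perm_simps)
qed

lemma abs_length_id: "abs_length n id = 0"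
  unfolding abs_length_def by (rule Least_eq_0) (simp add: prod_perm_simps)

section \<open>Products of signed permutations\<close>

definition hyp :: "nat \<Rightarrow> (int \<Rightarrow> int) list \<Rightarrow> int set multiset" where
  "hyp n cs = (\<Sum>c\<in>#mset cs. mset_set (blocks n c))"

text \<open>Depends on the supports of the cycles only, neither on signs nor on the order of the
  factors; this is what makes moving a single letter tractable.\<close>

definition conn :: "nat \<Rightarrow> (int \<Rightarrow> int) list \<Rightarrow> bool" where
  "conn n cs \<longleftrightarrow> hconn (hyp n cs) (pos n)"

lemma hyp_simps: "hyp n [] = {#}" "hyp n (c # cs) = mset_set (blocks n c) + hyp n cs"
  by (simp_all add: hyp_def)

lemma set_hyp: "S \<in># hyp n cs \<longleftrightarrow> (\<exists>c\<in>set cs. S \<in> blocks n c)"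
  by (induction cs) (auto simp: hyp_simps finite_blocks)

lemma compatible_hyp:
  assumes "set cs \<subseteq> W_B n"
  shows "compatible (hyp n cs) r \<longleftrightarrow> (\<forall>c\<in>set cs. \<forall>u\<in>pos n. r \<bar>c u\<bar> = r u)"
proof -
  have "compatible (hyp n cs) r \<longleftrightarrow> (\<forall>c\<in>set cs. \<forall>b\<in>blocks n c. \<forall>u\<in>b. \<forall>v\<in>b. r u = r v)"
    unfolding compatible_def using set_hyp[of _ n cs] by blast
  also have "\<dots> \<longleftrightarrow> (\<forall>c\<in>set cs. \<forall>u\<in>pos n. r \<bar>c u\<bar> = r u)"
  proof (rule ball_cong[OF HOL.refl])
    fix c assume "c \<in> set cs"
    then have "c \<in> W_B n" using assms by blast
    from inv_colour_blocks[OF this, of r]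
    show "(\<forall>b\<in>blocks n c. \<forall>u\<in>b. \<forall>v\<in>b. r u = r v) = (\<forall>u\<in>pos n. r \<bar>c u\<bar> = r u)" by blast
  qed
  finally show ?thesis .
qed

lemma size_Lam: "size (Lam n w) = card (blocks n w)"
  by (simp add: Lam_def)

lemma sum_hyp:
  assumes "set cs \<subseteq> W_B n"
  shows "(\<Sum>S\<in>#hyp n cs. card S - 1) = (\<Sum>c\<leftarrow>cs. n - size (Lam n c))"
  using assms
proof (induction cs)
  case (Cons c cs)
  then have W: "c \<in> W_B n" by simp
  have "(\<Sum>b\<in>blocks n c. card b) = (\<Sum>b\<in>blocks n c. (card b - 1) + 1)"
  proof (rule sum.cong[OF HOL.refl])
    fix b assume "b \<in> blocks n c"
    from block_props(5)[OF W this] show "card b = (card b - 1) + 1" by simp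
  qed
  also have "\<dots> = (\<Sum>b\<in>blocks n c. card b - 1) + card (blocks n c)"
    by (simp only: sum.distrib) simp
  finally have "(\<Sum>b\<in>blocks n c. card b - 1) = n - size (Lam n c)"
    unfolding sum_card_blocks[OF W] size_Lam by simp
  then show ?case using Cons by (simp add: hyp_simps flip: sum_unfold_sum_mset)
qed (simp add: hyp_simps)

lemma hyp_blocks:
  assumes "set cs \<subseteq> W_B n"
  shows "\<forall>S\<in>#hyp n cs. S \<noteq> {} \<and> S \<subseteq> pos n"
proof
  fix S assume "S \<in># hyp n cs"
  then obtain c where "c \<in> set cs" "S \<in> blocks n c" unfolding set_hyp by blast
  then show "S \<noteq> {} \<and> S \<subseteq> pos n" using assms block_props(1,2)[of c n S] by blast
qed

lemma conn_bound:
  assumes "set cs \<subseteq> W_B n" "conn n cs"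
  shows "n \<le> 1 + (\<Sum>c\<leftarrow>cs. n - size (Lam n c))"
  using hconn_card_bound[OF _ hyp_blocks[OF assms(1)]] assms(2)
  unfolding conn_def sum_hyp[OF assms(1)] by simp

text \<open>The type B cycles of length n. For n \<ge> 1 they include c, and
  \<open>full_B_conj\<close> shows that all of them are conjugate to c.\<close>

definition full_B :: "nat \<Rightarrow> (int \<Rightarrow> int) set" where
  "full_B n = {w \<in> W_B n. Lam n w = {#(n, True)#}}"

lemma full_B_blocks:
  assumes "w \<in> full_B n" shows "blocks n w = {pos n}"
proof -
  have W: "w \<in> W_B n" and L: "Lam n w = {#(n, True)#}" using assms by (auto simp: full_B_def)
  have "card (blocks n w) = 1" using L by (simp flip: size_Lam)
  then obtain b where b: "blocks n w = {b}" by (rule card_1_singletonE)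
  then have "b = pos n" using Union_blocks[OF W] by simp
  then show ?thesis using b by simp
qed

lemma abs_prod_colour:
  assumes "set cs \<subseteq> W_B n" "\<And>c u. c \<in> set cs \<Longrightarrow> u \<in> pos n \<Longrightarrow> r \<bar>c u\<bar> = r u" "u \<in> pos n"
  shows "r \<bar>prod_perm cs u\<bar> = r u"
  using assms
proof (induction cs)
  case (Cons c cs)
  have W: "c \<in> W_B n" "prod_perm cs \<in> W_B n" using Cons.prems(1) by (auto intro: prod_perm_W_B)
  have "\<bar>prod_perm cs u\<bar> \<in> pos n"
    using W_B_letter[OF W(2)] pos_letter[OF Cons.prems(3)] by (simp only: letter_abs[symmetric])
  then have "r \<bar>c \<bar>prod_perm cs u\<bar>\<bar> = r \<bar>prod_perm cs u\<bar>" using Cons.prems(2) by simp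
  also have "\<dots> = r u" using Cons by simp
  finally show ?case by (simp add: prod_perm_simps W_B_abs[OF W(1)])
qed (simp add: prod_perm_simps)

text \<open>A colouring constant on the blocks of all factors is invariant under each of them, hence
  under the product, whose only block is {1, ..., n}.\<close>

lemma full_B_conn:
  assumes "set cs \<subseteq> W_B n" "prod_perm cs \<in> full_B n"
  shows "conn n cs"
  unfolding conn_def hconn_def
proof (intro allI impI)
  fix r assume "compatible (hyp n cs) r"
  then have *: "r \<bar>c u\<bar> = r u" if "c \<in> set cs" "u \<in> pos n" for c u
    using that unfolding compatible_hyp[OF assms(1)] by blast
  have "\<forall>u\<in>pos n. r \<bar>prod_perm cs u\<bar> = r u"
    by (intro ballI abs_prod_colour[OF assms(1)] *)
  then have "\<forall>b\<in>blocks n (prod_perm cs). \<forall>u\<in>b. \<forall>v\<in>b. r u = r v"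
    using inv_colour_blocks[OF prod_perm_W_B[OF assms(1)]] by blast
  then show "\<forall>u\<in>pos n. \<forall>v\<in>pos n. r u = r v" unfolding full_B_blocks[OF assms(2)] by blast
qed

text \<open>On absolute values a non-loop acts as a transposition and a loop as the identity. So a
  word of reflections becomes a graph whose edges are the non-loops.\<close>

lemma reflection_colour:
  assumes "p \<in> signed_letters n \<times> signed_letters n"
  shows "(\<forall>u\<in>pos n. r \<bar>reflection p u\<bar> = r u) \<longleftrightarrow> loop p \<or> r \<bar>fst p\<bar> = r \<bar>snd p\<bar>"
proof (cases "loop p")
  case True
  then show ?thesis by (auto simp: loop_def reflection_def refl_B_apply)
next
  case False
  obtain x z where p: "p = (x, z)" by (cases p)
  have xz: "\<bar>x\<bar> \<noteq> \<bar>z\<bar>" "x \<in> signed_letters n" "z \<in> signed_letters n" "\<bar>x\<bar> \<in> pos n"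
    using False assms letter_abs[of x n] by (auto simp: p loop_def)
  have "\<bar>reflection p u\<bar> = transpose \<bar>x\<bar> \<bar>z\<bar> u" if "u \<in> pos n" for u
  proof -
    have "\<bar>reflection p u\<bar> = aw n (refl_A x z) u" using that False by (simp add: p loop_def reflection_def aw_def)
    then show ?thesis using aw_refl_A[OF xz(1-3)] by simp
  qed
  then have "(\<forall>u\<in>pos n. r \<bar>reflection p u\<bar> = r u) \<longleftrightarrow> (\<forall>u\<in>pos n. r (transpose \<bar>x\<bar> \<bar>z\<bar> u) = r u)"
    by simp
  also have "\<dots> \<longleftrightarrow> r \<bar>x\<bar> = r \<bar>z\<bar>"
  proof
    assume "\<forall>u\<in>pos n. r (transpose \<bar>x\<bar> \<bar>z\<bar> u) = r u"
    from bspec[OF this xz(4)] show "r \<bar>x\<bar> = r \<bar>z\<bar>" by simp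
  qed (simp add: transpose_def)
  finally show ?thesis using False by (simp add: p)
qed

text \<open>If the reflections of a word are the edges of a forest on \<open>pos n\<close>, then every factor joins
  two different blocks of the product of the factors after it.\<close>

lemma forest_invariant:
  assumes "set ps \<subseteq> signed_letters n \<times> signed_letters n"
    and "\<And>r :: int \<Rightarrow> int. (\<And>p u. p \<in> set ps \<Longrightarrow> u \<in> pos n \<Longrightarrow> r \<bar>reflection p u\<bar> = r u) \<Longrightarrow>
      card (r ` pos n) + length (filter (\<lambda>p. \<not> loop p) ps) \<le> n"
    and "\<And>u. u \<in> pos n \<Longrightarrow> s \<bar>prod_perm (map reflection ps) u\<bar> = (s u :: int)"
    and "p \<in> set ps" "u \<in> pos n"
  shows "s \<bar>reflection p u\<bar> = s u"
  using assms
proof (induction ps arbitrary: p u)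
  case (Cons q ps)
  let ?w = "prod_perm (map reflection ps)"
  have qs: "q \<in> signed_letters n \<times> signed_letters n" "set ps \<subseteq> signed_letters n \<times> signed_letters n"
    using Cons.prems(1) by auto
  have rW: "set (map reflection ps) \<subseteq> W_B n"
    using qs(2) reflection_W_B by (force simp only: set_map)
  then have W: "?w \<in> W_B n" by (rule prod_perm_W_B)
  have "\<exists>r. compatible H r \<and> card (pos n) \<le> card (r ` pos n) + (\<Sum>S\<in>#H. card S - 1)"
    if "\<forall>S\<in>#H. S \<noteq> {} \<and> S \<subseteq> pos n" for H
    using compatible_colouring_exists[OF _ that] by simp
  show ?case
  proof (cases "loop q")
    case True
    have f: "card (r ` pos n) + length (filter (\<lambda>p. \<not> loop p) ps) \<le> n"
      if "\<And>p u. p \<in> set ps \<Longrightarrow> u \<in> pos n \<Longrightarrow> r \<bar>reflection p u\<bar> = r u" for r :: "int \<Rightarrow> int"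
    proof -
      have "\<forall>u\<in>pos n. r \<bar>reflection q u\<bar> = r u" using reflection_colour[OF qs(1)] True by blast
      then have "card (r ` pos n) + length (filter (\<lambda>p. \<not> loop p) (q # ps)) \<le> n"
        using that by (intro Cons.prems(2)) auto
      then show ?thesis using True by simp
    qed
    have eq: "\<bar>reflection q v\<bar> = \<bar>v\<bar>" for v using True by (auto simp: loop_def reflection_def refl_B_apply)
    have "s \<bar>?w v\<bar> = s v" if "v \<in> pos n" for v
      using Cons.prems(3)[OF that] by (simp add: prod_perm_simps eq)
    then have IH: "s \<bar>reflection p v\<bar> = s v" if "p \<in> set ps" "v \<in> pos n" for p v
      using Cons.IH[OF qs(2) f _ that] by blast
    show ?thesis
    proof (cases "p = q")
      case True
      then show ?thesis using Cons.prems(5) by (simp add: eq)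
    qed (use IH Cons.prems(4,5) in auto)
  next
    case False
    define x z where "x = \<bar>fst q\<bar>" and "z = \<bar>snd q\<bar>"
    have l: "fst q \<in> signed_letters n" "snd q \<in> signed_letters n" using qs(1) by auto
    have xz: "x \<in> pos n" "z \<in> pos n" "x \<noteq> z" using l[unfolded letter_abs] False
      by (simp_all add: x_def z_def loop_def)
    have rc: "(\<forall>u\<in>pos n. r \<bar>reflection q u\<bar> = r u) \<longleftrightarrow> r x = r z" for r :: "int \<Rightarrow> int"
      using reflection_colour[OF qs(1), of r] False by (simp add: x_def z_def)
    \<comment> \<open>Without the edge q the rest is still a forest: merging the colours of x and z
      makes a colouring invariant under q as well and costs at most one colour, which pays for the
      missing edge.\<close>
    have f: "card (r ` pos n) + length (filter (\<lambda>p. \<not> loop p) ps) \<le> n"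
      if r: "\<And>p u. p \<in> set ps \<Longrightarrow> u \<in> pos n \<Longrightarrow> r \<bar>reflection p u\<bar> = r u" for r :: "int \<Rightarrow> int"
    proof -
      define r' where "r' = (\<lambda>u. if r u = r z then r x else r u)"
      have "r' \<bar>reflection p u\<bar> = r' u" if "p \<in> set ps" "u \<in> pos n" for p u
        using r[OF that] by (simp add: r'_def)
      moreover have "r' x = r' z" by (simp add: r'_def)
      ultimately have "r' \<bar>reflection p u\<bar> = r' u" if "p \<in> set (q # ps)" "u \<in> pos n" for p u
        using that rc[of r'] by (cases "p = q") auto
      then have "card (r' ` pos n) + length (filter (\<lambda>p. \<not> loop p) (q # ps)) \<le> n"
        by (rule Cons.prems(2))
      moreover have "r ` pos n \<subseteq> insert (r z) (r' ` pos n)"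
      proof
        fix a assume "a \<in> r ` pos n"
        then obtain u where "u \<in> pos n" "a = r u" by blast
        then show "a \<in> insert (r z) (r' ` pos n)" by (cases "a = r z") (auto simp: r'_def)
      qed
      then have "card (r ` pos n) \<le> card (insert (r z) (r' ` pos n))" by (intro card_mono) auto
      then have "card (r ` pos n) \<le> Suc (card (r' ` pos n))"
        using card_insert_le_m1[of "Suc (card (r' ` pos n))" "r' ` pos n" "r z"] by simp
      ultimately show ?thesis using False by simp
    qed
    \<comment> \<open>Take a colouring compatible with the edges of ps that keeps at least n minus
      their number of colours. The forest condition for the whole word forces it to separate x from
      z; being constant on the blocks of the product of ps, it shows that these lie in different
      blocks.\<close>
    have "z \<notin> orbit (aw n ?w) x"
    proof
      assume zo: "z \<in> orbit (aw n ?w) x"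
      define H where "H = image_mset (\<lambda>p. {\<bar>fst p\<bar>, \<bar>snd p\<bar>}) (mset (filter (\<lambda>p. \<not> loop p) ps))"
      have "\<forall>S\<in>#H. S \<noteq> {} \<and> S \<subseteq> pos n"
      proof
        fix S assume "S \<in># H"
        then obtain p where p: "p \<in> set ps" "S = {\<bar>fst p\<bar>, \<bar>snd p\<bar>}" by (auto simp: H_def)
        then have "fst p \<in> signed_letters n" "snd p \<in> signed_letters n" using qs(2) by auto
        then show "S \<noteq> {} \<and> S \<subseteq> pos n" unfolding p(2) letter_abs by blast
      qed
      then obtain r where r: "compatible H r" "card (pos n) \<le> card (r ` pos n) + (\<Sum>S\<in>#H. card S - 1)"
        using compatible_colouring_exists[of "pos n" H] by auto
      have "(\<Sum>S\<in>#H. card S - 1) = length (filter (\<lambda>p. \<not> loop p) ps)"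
        unfolding H_def by (induction ps) (auto simp: loop_def)
      then have c: "n \<le> card (r ` pos n) + length (filter (\<lambda>p. \<not> loop p) ps)" using r(2) by simp
      have rp: "r \<bar>reflection p u\<bar> = r u" if "p \<in> set ps" "u \<in> pos n" for p u
      proof -
        have pl: "p \<in> signed_letters n \<times> signed_letters n" using that qs(2) by auto
        have "loop p \<or> r \<bar>fst p\<bar> = r \<bar>snd p\<bar>"
        proof (cases "loop p")
          case False
          then have "{\<bar>fst p\<bar>, \<bar>snd p\<bar>} \<in># H" using that by (auto simp: H_def)
          then have "r \<bar>fst p\<bar> = r \<bar>snd p\<bar>"
            using r(1)[unfolded compatible_def, rule_format, of _ "\<bar>fst p\<bar>" "\<bar>snd p\<bar>"] by simp
          then show ?thesis by simp
        qed simp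
        then show ?thesis using reflection_colour[OF pl, of r] that by blast
      qed
      have "r x \<noteq> r z"
      proof
        assume "r x = r z"
        then have "r \<bar>reflection p u\<bar> = r u" if "p \<in> set (q # ps)" "u \<in> pos n" for p u
          using that rc[of r] rp by (cases "p = q") auto
        then have "card (r ` pos n) + length (filter (\<lambda>p. \<not> loop p) (q # ps)) \<le> n"
          by (rule Cons.prems(2))
        then show False using c False by simp
      qed
      moreover have "\<forall>u\<in>pos n. r \<bar>?w u\<bar> = r u"
      proof
        fix u assume "u \<in> pos n"
        then show "r \<bar>?w u\<bar> = r u" using rp by (intro abs_prod_colour[OF rW]) auto
      qed
      then have "\<forall>b\<in>blocks n ?w. \<forall>u\<in>b. \<forall>v\<in>b. r u = r v" using inv_colour_blocks[OF W] by blast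
      then have "r x = r z" using blk_in_blocks[OF xz(1), of ?w] blk_self[OF W, of x] zo
        unfolding blk_def by blast
      ultimately show False by simp
    qed
    note merge = invariant_transpose_merge[OF aw_permutation[OF W] this, of "pos n" s]
    have st: "s (transpose x z (aw n ?w v)) = s v" if v: "v \<in> pos n" for v
    proof -
      have "reflection q = refl_A (fst q) (snd q)" using False by (simp add: loop_def reflection_def)
      then have "prod_perm (map reflection (q # ps)) = refl_A (fst q) (snd q) \<circ> ?w"
        by (simp add: prod_perm_simps)
      moreover have "aw n (refl_A (fst q) (snd q) \<circ> ?w) = transpose x z \<circ> aw n ?w"
        using aw_comp[OF refl_A_W_B W, of "fst q" "snd q"] aw_refl_A[of "fst q" "snd q" n] l False
        by (simp add: loop_def x_def z_def)
      ultimately have "\<bar>prod_perm (map reflection (q # ps)) v\<bar> = transpose x z (aw n ?w v)"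
        using v by (metis aw_def comp_apply)
      then show ?thesis using Cons.prems(3)[OF v] by simp
    qed
    have sx: "s x = s z" using merge(1) aw_in[OF W] xz st by blast
    have "s (aw n ?w v) = s v" if "v \<in> pos n" for v using merge(2) aw_in[OF W] xz st that by blast
    then have "s \<bar>?w v\<bar> = s v" if "v \<in> pos n" for v using that by (metis aw_def)
    then have IH: "s \<bar>reflection p v\<bar> = s v" if "p \<in> set ps" "v \<in> pos n" for p v
      using Cons.IH[OF qs(2) f _ that] by blast
    show ?thesis
    proof (cases "p = q")
      case True
      then show ?thesis using rc[of s] sx Cons.prems(5) by blast
    qed (use IH Cons.prems(4,5) in auto)
  qed
qed simp

section \<open>Parity of the number of type B cycles\<close>

definition sg :: "nat \<Rightarrow> (int \<Rightarrow> int) \<Rightarrow> int" where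
  "sg n w = (\<Prod>u\<in>pos n. sgn (w u))"

text \<open>\<open>sg\<close> is the linear character of W(B_n) with kernel W(D_n). It gives the
  parity of the number of type B cycles of a product from those of the factors.\<close>

lemma sg_comp:
  assumes "v \<in> W_B n" "w \<in> W_B n"
  shows "sg n (v \<circ> w) = sg n v * sg n w"
proof -
  have "sgn (v (w u)) = sgn (w u) * sgn (v \<bar>w u\<bar>)" if "u \<in> pos n" for u
  proof -
    have "w u \<noteq> 0" using W_B_letter[OF assms(2)] pos_letter[OF that] by (auto simp: signed_letters_def)
    then show ?thesis using W_B_odd[OF assms(1), of "w u"] by (cases "w u > 0") auto
  qed
  then have "sg n (v \<circ> w) = sg n w * (\<Prod>u\<in>pos n. sgn (v \<bar>w u\<bar>))"
    by (simp add: sg_def prod.distrib)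
  also have "(\<Prod>u\<in>pos n. sgn (v \<bar>w u\<bar>)) = (\<Prod>u\<in>pos n. sgn (v (aw n w u)))"
    by (intro prod.cong) (simp_all add: aw_def)
  also have "\<dots> = (\<Prod>u\<in>pos n. sgn (v u))"
    by (rule prod.reindex_bij_betw[OF permutes_imp_bij[OF aw_permutes[OF assms(2)]], of "\<lambda>u. sgn (v u)"])
  finally show ?thesis by (simp only: sg_def[of n v] mult.commute)
qed

lemma sg_num_B:
  assumes W: "w \<in> W_B n" shows "sg n w = (- 1) ^ num_B (Lam n w)"
proof -
  have pm: "(\<Prod>u\<in>b. sgn (w u)) = (if flagged w b then - 1 else 1)" if b: "b \<in> blocks n w" for b
  proof -
    have "sgn (w u) \<in> {1, - 1}" if "u \<in> b" for u
    proof -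
      have "u \<in> signed_letters n" using that block_props(2)[OF W b] pos_letter by blast
      then have "w u \<noteq> 0" using W_B_letter[OF W] by (auto simp: signed_letters_def)
      then show ?thesis by (auto simp: sgn_if)
    qed
    moreover have "finite B \<Longrightarrow> (\<forall>u\<in>B. sgn (w u) \<in> {1, - 1}) \<Longrightarrow> (\<Prod>u\<in>B. sgn (w u)) \<in> {1, - 1}" for B
      by (induction B rule: finite_induct) auto
    ultimately have "(\<Prod>u\<in>b. sgn (w u)) \<in> {1, - 1}" using block_props(3)[OF W b] by blast
    then show ?thesis by (auto simp: flagged_def)
  qed
  have "sg n w = (\<Prod>u\<in>\<Union>(blocks n w). sgn (w u))" by (simp add: sg_def Union_blocks[OF W])
  also have "\<dots> = (\<Prod>b\<in>blocks n w. \<Prod>u\<in>b. sgn (w u))"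
    using blocks_disjoint[OF W] block_props(3)[OF W] by (subst prod.Union_disjoint) auto
  also have "\<dots> = (\<Prod>b\<in>blocks n w. if flagged w b then - 1 else 1)" using pm by (intro prod.cong) auto
  also have "\<dots> = (- 1) ^ card {b\<in>blocks n w. flagged w b}"
    unfolding prod.inter_filter[OF finite_blocks, symmetric] by simp
  also have "card {b\<in>blocks n w. flagged w b} = num_B (Lam n w)"
  proof -
    have "filter_mset snd (Lam n w) = image_mset (lab w) (filter_mset (flagged w) (mset_set (blocks n w)))"
      by (simp add: Lam_def filter_mset_image_mset lab_def)
    then show ?thesis by (simp add: num_B_def finite_blocks)
  qed
  finally show ?thesis .
qed

lemma sg_prod_perm:
  assumes "set cs \<subseteq> W_B n"
  shows "sg n (prod_perm cs) = (- 1) ^ (\<Sum>c\<leftarrow>cs. num_B (Lam n c))"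
  using assms
proof (induction cs)
  case Nil
  then show ?case by (simp add: prod_perm_simps sg_def)
next
  case (Cons c cs)
  then have W: "c \<in> W_B n" "prod_perm cs \<in> W_B n" by (auto intro: prod_perm_W_B)
  have "sg n (prod_perm cs) = (- 1) ^ (\<Sum>c\<leftarrow>cs. num_B (Lam n c))" using Cons by simp
  then show ?case unfolding prod_perm_simps sg_comp[OF W] sg_num_B[OF W(1)] by (simp add: power_add)
qed

text \<open>Each factor is replaced by a word of reflections. The last clause says that the edges of
  the long word connect at least as much as the blocks of the factors.\<close>

lemma exists_reflections_list:
  assumes "set cs \<subseteq> W_B n"
  shows "\<exists>ps. set ps \<subseteq> signed_letters n \<times> signed_letters n \<and> prod_perm cs = prod_perm (map reflection ps) \<and>
    length (filter (\<lambda>p. \<not> loop p) ps) = (\<Sum>c\<leftarrow>cs. n - size (Lam n c)) \<and>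
    (\<forall>r :: int \<Rightarrow> int. (\<forall>p\<in>set ps. \<forall>u\<in>pos n. r \<bar>reflection p u\<bar> = r u) \<longrightarrow>
       (\<forall>c\<in>set cs. \<forall>u\<in>pos n. r \<bar>c u\<bar> = r u))"
  using assms
proof (induction cs)
  case Nil
  then show ?case by (intro exI[of _ "[]"]) (simp add: prod_perm_simps)
next
  case (Cons c cs)
  then obtain ps where ps: "set ps \<subseteq> signed_letters n \<times> signed_letters n"
    "prod_perm cs = prod_perm (map reflection ps)"
    "length (filter (\<lambda>p. \<not> loop p) ps) = (\<Sum>c\<leftarrow>cs. n - size (Lam n c))"
    "\<And>r :: int \<Rightarrow> int. (\<forall>p\<in>set ps. \<forall>u\<in>pos n. r \<bar>reflection p u\<bar> = r u) \<Longrightarrow>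
       (\<forall>c\<in>set cs. \<forall>u\<in>pos n. r \<bar>c u\<bar> = r u)" by auto
  have "c \<in> W_B n" using Cons.prems by simp
  then obtain qs where qs: "set qs \<subseteq> signed_letters n \<times> signed_letters n" "c = prod_perm (map reflection qs)"
    "length (filter (\<lambda>p. \<not> loop p) qs) + size (Lam n c) = n" using exists_reflections by blast
  have rW: "set (map reflection qs) \<subseteq> W_B n"
    using qs(1) reflection_W_B by (force simp only: set_map)
  show ?case
  proof (intro exI[of _ "qs @ ps"] conjI allI impI ballI)
    show "set (qs @ ps) \<subseteq> signed_letters n \<times> signed_letters n" using ps(1) qs(1) by simp
    show "prod_perm (c # cs) = prod_perm (map reflection (qs @ ps))"
      by (simp add: prod_perm_simps prod_perm_append ps(2) flip: qs(2))
    show "length (filter (\<lambda>p. \<not> loop p) (qs @ ps)) = (\<Sum>c\<leftarrow>c # cs. n - size (Lam n c))"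
      using ps(3) qs(3) by simp
    fix r :: "int \<Rightarrow> int" and d u
    assume r: "\<forall>p\<in>set (qs @ ps). \<forall>u\<in>pos n. r \<bar>reflection p u\<bar> = r u" and d: "d \<in> set (c # cs)" and u: "u \<in> pos n"
    show "r \<bar>d u\<bar> = r u"
    proof (cases "d = c")
      case True
      have "r \<bar>prod_perm (map reflection qs) u\<bar> = r u"
        using r by (intro abs_prod_colour[OF rW _ u]) auto
      then show ?thesis using True qs(2) by simp
    next
      case False
      have "\<forall>p\<in>set ps. \<forall>u\<in>pos n. r \<bar>reflection p u\<bar> = r u" using r by (metis Un_iff set_append)
      from ps(4)[OF this] show ?thesis using False d u by auto
    qed
  qed
qed

text \<open>The converse of \<open>full_B_conn\<close> for trees. The word of reflections has n - 1
  edges and connects everything, so by \<open>forest_invariant\<close> a colouring invariant under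
  the product is invariant under every reflection, hence constant; thus the product has one block.
  Its flag is decided by the parity.\<close>

lemma conn_full_B:
  assumes n: "n \<ge> 1" and W: "set cs \<subseteq> W_B n" and conn: "conn n cs"
    and tree: "(\<Sum>c\<leftarrow>cs. n - size (Lam n c)) + 1 = n" and odd: "odd (\<Sum>c\<leftarrow>cs. num_B (Lam n c))"
  shows "prod_perm cs \<in> full_B n"
proof -
  let ?w = "prod_perm cs"
  have wW: "?w \<in> W_B n" by (rule prod_perm_W_B[OF W])
  obtain ps where ps: "set ps \<subseteq> signed_letters n \<times> signed_letters n"
    "prod_perm cs = prod_perm (map reflection ps)"
    "length (filter (\<lambda>p. \<not> loop p) ps) = (\<Sum>c\<leftarrow>cs. n - size (Lam n c))"
    "\<And>r :: int \<Rightarrow> int. (\<forall>p\<in>set ps. \<forall>u\<in>pos n. r \<bar>reflection p u\<bar> = r u) \<Longrightarrow>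
       (\<forall>c\<in>set cs. \<forall>u\<in>pos n. r \<bar>c u\<bar> = r u)" using exists_reflections_list[OF W] by blast
  have const: "\<forall>u\<in>pos n. \<forall>v\<in>pos n. r u = r v"
    if r: "\<forall>p\<in>set ps. \<forall>u\<in>pos n. r \<bar>reflection p u\<bar> = r u" for r :: "int \<Rightarrow> int"
    using conn ps(4)[OF r] unfolding conn_def hconn_def compatible_hyp[OF W] by blast
  have one: "1 \<in> pos n" using n by simp
  have forest: "card (r ` pos n) + length (filter (\<lambda>p. \<not> loop p) ps) \<le> n"
    if r: "\<And>p u. p \<in> set ps \<Longrightarrow> u \<in> pos n \<Longrightarrow> r \<bar>reflection p u\<bar> = r u" for r :: "int \<Rightarrow> int"
  proof -
    have "\<forall>u\<in>pos n. r u = r 1" using const[of r] r one by blast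
    then have "r ` pos n \<subseteq> {r 1}" by blast
    then have "card (r ` pos n) \<le> card {r 1}" by (intro card_mono) auto
    then show ?thesis using ps(3) tree by simp
  qed
  \<comment> \<open>The indicator function of the block of 1 is invariant under the product, so it
    must be constant.\<close>
  define s where "s = (\<lambda>u. if u \<in> blk n ?w 1 then 1 else 0 :: int)"
  have b1: "blk n ?w 1 \<in> blocks n ?w" by (rule blk_in_blocks[OF one])
  have "\<forall>b\<in>blocks n ?w. \<forall>u\<in>b. \<forall>v\<in>b. s u = s v"
    unfolding s_def using blocks_disjoint[OF wW _ b1] by (smt (verit) disjoint_iff)
  then have sw: "\<forall>u\<in>pos n. s \<bar>?w u\<bar> = s u" unfolding inv_colour_blocks[OF wW] .
  have "s \<bar>reflection p u\<bar> = s u" if "p \<in> set ps" "u \<in> pos n" for p u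
  proof (rule forest_invariant[OF ps(1) forest _ that])
    show "\<And>u. u \<in> pos n \<Longrightarrow> s \<bar>prod_perm (map reflection ps) u\<bar> = s u"
      using sw unfolding ps(2) by blast
  qed
  then have "\<forall>u\<in>pos n. s u = s 1" using const[of s] one by blast
  moreover have "s 1 = 1" using blk_self[OF wW, of 1] by (simp add: s_def)
  ultimately have "pos n \<subseteq> blk n ?w 1" by (auto simp: s_def split: if_splits)
  then have pb: "blk n ?w 1 = pos n" using blk_subset[OF wW one] by blast
  have bl: "blocks n ?w = {pos n}"
  proof
    show "{pos n} \<subseteq> blocks n ?w" using b1 pb by simp
    show "blocks n ?w \<subseteq> {pos n}"
    proof
      fix b assume b: "b \<in> blocks n ?w"
      have "b \<inter> pos n \<noteq> {}" using block_props(1,2)[OF wW b] by blast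
      then show "b \<in> {pos n}" using blocks_disjoint[OF wW b b1[unfolded pb]] by simp
    qed
  qed
  have "sg n ?w = - 1" using sg_prod_perm[OF W] odd by simp
  then have "flagged ?w (pos n)" by (simp add: flagged_def sg_def)
  then have "Lam n ?w = {#(n, True)#}" by (simp add: Lam_def bl lab_def)
  then show ?thesis using wW by (simp add: full_B_def)
qed

lemma num_B_full_B: "w \<in> full_B n \<Longrightarrow> num_B (Lam n w) = 1 \<and> num_A (Lam n w) = 0"
  by (simp add: full_B_def num_B_def num_A_def)

text \<open>The total rank n counts the edges and the type B cycles together. Connectedness takes at
  least n - 1 edges, so at most one type B cycle remains, and the parity excludes none.\<close>

lemma full_B_sum_num_B:
  assumes W: "set cs \<subseteq> W_B n" and full: "prod_perm cs \<in> full_B n"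
    and rank: "(\<Sum>c\<leftarrow>cs. n - num_A (Lam n c)) = n"
  shows "(\<Sum>c\<leftarrow>cs. num_B (Lam n c)) = 1"
proof -
  have "(\<Sum>c\<leftarrow>cs. n - num_A (Lam n c)) = (\<Sum>c\<leftarrow>cs. (n - size (Lam n c)) + num_B (Lam n c))"
  proof (intro arg_cong[of _ _ sum_list] map_cong[OF HOL.refl])
    fix c assume "c \<in> set cs"
    then have "size (Lam n c) \<le> n" using W size_Lam_le by blast
    then show "n - num_A (Lam n c) = (n - size (Lam n c)) + num_B (Lam n c)"
      using num_A_B[of "Lam n c"] by linarith
  qed
  then have "(\<Sum>c\<leftarrow>cs. n - size (Lam n c)) + (\<Sum>c\<leftarrow>cs. num_B (Lam n c)) = n"
    using rank by (simp add: sum_list_addf)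
  then have le: "(\<Sum>c\<leftarrow>cs. num_B (Lam n c)) \<le> 1"
    using conn_bound[OF W full_B_conn[OF W full]] by linarith
  have "prod_perm cs \<in> W_B n" by (rule prod_perm_W_B[OF W])
  then have "sg n (prod_perm cs) = - 1" using sg_num_B num_B_full_B[OF full] by simp
  then have "odd (\<Sum>c\<leftarrow>cs. num_B (Lam n c))" using sg_prod_perm[OF W] by (metis neg_one_even_power one_neq_neg_one)
  moreover have "odd k \<Longrightarrow> k \<le> 1 \<Longrightarrow> k = 1" for k :: nat by presburger
  ultimately show ?thesis using le by blast
qed

lemma cox_full_B: assumes "n \<ge> 1" shows "cox n \<in> full_B n"
proof -
  let ?L = "[(True, [1..int n])]"
  have d: "map abs [1..int n] = [1..int n]" by (intro map_idI) auto
  have c: "cycles_of n ?L" using assms by (auto simp: cycles_of_def sdist_def d signed_letters_def)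
  have "cox n = prod_perm (map cyc ?L)" by (simp add: cox_def prod_perm_simps cyc_def)
  then have "realises n ?L (cox n)" using cycles_of_realises[OF c] by simp
  from realisesD(1,5)[OF this] show ?thesis by (simp add: full_B_def)
qed

lemma full_B_conj:
  assumes "w \<in> full_B n"
  shows "\<exists>g\<in>W_B n. w = g \<circ> cox n \<circ> inv g"
proof -
  have W: "w \<in> W_B n" and Lw: "Lam n w = {#(n, True)#}" using assms by (auto simp: full_B_def)
  obtain L where L: "cycles_of n L" "w = prod_perm (map cyc L)" using exists_cycles[OF W] by blast
  have r: "realises n L w" unfolding L(2) by (rule cycles_of_realises[OF L(1)])
  have e: "mset (map (\<lambda>c. (length (snd c), fst c)) L) +
      replicate_mset (n - length (concat (map snd L))) (1, False) = {#(n, True)#}"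
    using realisesD(5)[OF r] Lw by simp
  then have "size (mset (map (\<lambda>c. (length (snd c), fst c)) L) +
      replicate_mset (n - length (concat (map snd L))) (1, False)) = 1" by (simp only: size_single)
  then have s: "length L + (n - length (concat (map snd L))) = 1" by simp
  have "L \<noteq> []"
  proof
    assume "L = []"
    then have "n = 1" using s by simp
    then show False using e \<open>L = []\<close> by simp
  qed
  then obtain f bs where Lf: "L = [(f, bs)]" using s by (cases L) auto
  then have fb: "f" "length bs = n" using e s by auto
  have "sdist bs" "set bs \<subseteq> signed_letters n" using L(1) Lf by (auto simp: cycles_of_def)
  then obtain g where g: "g \<in> W_B n" "\<forall>i<length bs. g (int i + 1) = bs ! i"
    using exists_W_B_extending by blast
  have "map g [1..int n] = bs" using g(2) fb(2) by (intro nth_equalityI) (auto simp: add.commute)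
  moreover have "sdist [1..int n]"
  proof -
    have "map abs [1..int n] = [1..int n]" by (intro map_idI) auto
    then show ?thesis by (simp add: sdist_def)
  qed
  ultimately have "g \<circ> cox n \<circ> inv g = w"
    using conj_cyc[OF g(1), of "[1..int n]" True] L(2) Lf fb(1)
    by (simp add: cox_def cyc_def prod_perm_simps)
  then show ?thesis using g(1) by blast
qed

section \<open>Switching\<close>

definition ins :: "(int \<Rightarrow> int) list \<Rightarrow> nat \<Rightarrow> int \<Rightarrow> int \<Rightarrow> (int \<Rightarrow> int) list" where
  "ins cs i x y = cs[i := refl_A x y \<circ> cs ! i]"

text \<open>By \<open>tuples_full_B\<close>, for tree types with an odd number of type B cycles
  these are the tuples whose product is a type B cycle of length n.\<close>

definition tuples :: "nat \<Rightarrow> (nat \<times> bool) multiset list \<Rightarrow> (int \<Rightarrow> int) list set" where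
  "tuples n P = {cs. set cs \<subseteq> W_B n \<and> map (Lam n) cs = P \<and> conn n cs}"

text \<open>A factor with s blocks contributes n - s to the tree sum; the equation says that the
  total is n - 1, in a form without subtraction.\<close>

definition tree_type :: "nat \<Rightarrow> (nat \<times> bool) multiset list \<Rightarrow> bool" where
  "tree_type n P \<longleftrightarrow> (\<Sum>M\<leftarrow>P. size M) + n = n * length P + 1"

lemma finite_tuples: "finite (tuples n P)"
proof -
  have "tuples n P \<subseteq> {cs. set cs \<subseteq> W_B n \<and> length cs = length P}"
    by (auto simp: tuples_def)
  then show ?thesis using finite_lists_length_eq[OF finite_W_B] finite_subset by blast
qed

lemma tuples_tree:
  assumes "tree_type n P" "map (Lam n) cs = P" "set cs \<subseteq> W_B n"
  shows "(\<Sum>c\<leftarrow>cs. n - size (Lam n c)) + 1 = n"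
proof -
  have "(\<Sum>c\<leftarrow>cs. n - size (Lam n c)) + (\<Sum>c\<leftarrow>cs. size (Lam n c)) = (\<Sum>c\<leftarrow>cs. n)"
    using assms(3)
  proof (induction cs)
    case (Cons c cs)
    then have "size (Lam n c) \<le> n" using size_Lam_le[of c n] by simp
    then show ?case using Cons by simp
  qed simp
  also have "\<dots> = n * length P" using assms(2) by (auto simp: sum_list_triv)
  finally have "(\<Sum>c\<leftarrow>cs. n - size (Lam n c)) + (\<Sum>M\<leftarrow>P. size M) = n * length P"
    using assms(2) by (auto simp: comp_def)
  then show ?thesis using assms(1) by (simp add: tree_type_def)
qed

text \<open>The inverse of \<open>insertion\<close>. The place from which x is taken is forced,
  since y must be c x; so taking letters out contributes only the choice of x, while putting them in
  also contributes a choice of place.\<close>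

lemma removal:
  assumes c: "c \<in> W_B n" and x: "x \<in> pos n" and card: "card (blk n c x) \<ge> 2"
  defines "y \<equiv> c x" and "c1 \<equiv> refl_A x (c x) \<circ> c"
  shows "y \<in> signed_letters n" "\<bar>y\<bar> \<noteq> x" "c1 \<in> W_B n" "c1 x = x" "refl_A x y \<circ> c1 = c"
    "blk n c1 \<bar>y\<bar> = blk n c x - {x}"
proof -
  have x0: "x > 0" using x by simp
  show y: "y \<in> signed_letters n" using W_B_letter[OF c] pos_letter[OF x] by (simp add: y_def)
  then have y0: "y \<noteq> 0" by (auto simp: signed_letters_def)
  show yx: "\<bar>y\<bar> \<noteq> x"
  proof
    assume "\<bar>y\<bar> = x"
    then have "aw n c x = x" using x by (simp add: aw_def y_def)
    then have "blk n c x = {x}" by (simp add: blk_def orbit_eq_singleton_iff)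
    then show False using card by simp
  qed
  have axy: "\<bar>x\<bar> \<noteq> \<bar>y\<bar>" using yx x0 by simp
  show c1: "c1 \<in> W_B n" unfolding c1_def y_def[symmetric]
    by (intro W_B_comp refl_A_W_B axy pos_letter[OF x] y c)
  show c1x: "c1 x = x" using refl_A_apply[OF axy] x0 y0 by (simp add: c1_def y_def)
  show e: "refl_A x y \<circ> c1 = c"
    using refl_A_sq[OF axy] x0 y0 unfolding c1_def y_def[symmetric] comp_assoc[symmetric] by simp
  note I = insertion[OF c1 x c1x y yx]
  have "blk n c x = insert x (blk n c1 \<bar>y\<bar>)"
    using blk_refl_A[OF c1 x c1x y yx, of x] unfolding e by simp
  then show "blk n c1 \<bar>y\<bar> = blk n c x - {x}" using I(4) by simp
qed

lemma hyp_update: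
  assumes "i < length cs"
  shows "hyp n (cs[i := c]) + mset_set (blocks n (cs ! i)) = hyp n cs + mset_set (blocks n c)"
  using assms
proof (induction cs arbitrary: i)
  case (Cons d cs)
  then show ?case by (cases i) (auto simp: hyp_simps ac_simps)
qed simp

lemma hyp_ins:
  assumes i: "i < length cs" and W: "cs ! i \<in> W_B n" and x: "x \<in> pos n" "(cs ! i) x = x"
    and y: "y \<in> signed_letters n" "\<bar>y\<bar> \<noteq> x"
  defines "b \<equiv> blk n (cs ! i) \<bar>y\<bar>"
  shows "add_mset {x} (add_mset b (hyp n (ins cs i x y))) = add_mset (insert x b) (hyp n cs)"
proof -
  obtain G where G: "mset_set (blocks n (cs ! i)) = add_mset {x} (add_mset b G)"
    "mset_set (blocks n (refl_A x y \<circ> cs ! i)) = add_mset (insert x b) G"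
    using insertion_mset(1)[OF W x y] unfolding b_def by blast
  show ?thesis using hyp_update[OF i, of n "refl_A x y \<circ> cs ! i"] unfolding ins_def G
    by (simp add: union_mset_add_mset_right add_mset_commute)
qed

lemma hyp_sum: "hyp n cs = (\<Sum>k<length cs. mset_set (blocks n (cs ! k)))"
  by (induction cs) (simp_all add: hyp_simps sum.lessThan_Suc_shift del: sum.lessThan_Suc)

lemma hyp_two:
  assumes i: "i < length cs" and j: "j < length cs"
    and a: "a \<in> blocks n (cs ! i)" and b: "b \<in> blocks n (cs ! j)" and ab: "i = j \<Longrightarrow> a \<noteq> b"
  shows "\<exists>G. hyp n cs = add_mset a (add_mset b G)"
proof -
  let ?M = "\<lambda>k. mset_set (blocks n (cs ! k))"
  have "hyp n cs = ?M i + sum ?M ({..<length cs} - {i})"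
    unfolding hyp_sum using i by (intro sum.remove) auto
  moreover have Ma: "?M i = add_mset a (mset_set (blocks n (cs ! i) - {a}))"
    by (rule mset_set.remove[OF finite_blocks a])
  moreover have "\<exists>R. mset_set (blocks n (cs ! i) - {a}) + sum ?M ({..<length cs} - {i}) = add_mset b R"
  proof (cases "i = j")
    case True
    then have "b \<in> blocks n (cs ! i) - {a}" using b ab by auto
    then have "mset_set (blocks n (cs ! i) - {a}) = add_mset b (mset_set (blocks n (cs ! i) - {a} - {b}))"
      by (intro mset_set.remove) (auto simp: finite_blocks)
    then show ?thesis by auto
  next
    case False
    have "sum ?M ({..<length cs} - {i}) = ?M j + sum ?M ({..<length cs} - {i} - {j})"
      using j False by (intro sum.remove) auto
    moreover have "?M j = add_mset b (mset_set (blocks n (cs ! j) - {b}))"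
      by (rule mset_set.remove[OF finite_blocks b])
    ultimately show ?thesis by (auto simp: ac_simps)
  qed
  ultimately show ?thesis by (metis union_mset_add_mset_left)
qed

text \<open>cs1 is the intermediate tuple in which x is fixed by both factors. Both insertions are
  compared with its hypergraph, where x is the singleton edge, and the remaining edges G
  cancel.\<close>

lemma hyp_move:
  assumes i: "i < length cs1" and j: "j < length cs1" and W: "set cs1 \<subseteq> W_B n"
    and x: "x \<in> pos n" "(cs1 ! i) x = x" "(cs1 ! j) x = x"
    and y: "y \<in> signed_letters n" "\<bar>y\<bar> \<noteq> x" and z: "z \<in> signed_letters n" "\<bar>z\<bar> \<noteq> x"
    and H: "hyp n (ins cs1 i x y) = add_mset (insert x (blk n (cs1 ! i) \<bar>y\<bar>)) (add_mset (blk n (cs1 ! j) \<bar>z\<bar>) G)"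
  shows "hyp n (ins cs1 j x z) = add_mset (blk n (cs1 ! i) \<bar>y\<bar>) (add_mset (insert x (blk n (cs1 ! j) \<bar>z\<bar>)) G)"
proof -
  let ?a = "blk n (cs1 ! i) \<bar>y\<bar>" and ?b = "blk n (cs1 ! j) \<bar>z\<bar>"
  have Wi: "cs1 ! i \<in> W_B n" "cs1 ! j \<in> W_B n" using W i j nth_mem by blast+
  have 1: "add_mset {x} (add_mset ?a (hyp n (ins cs1 i x y))) = add_mset (insert x ?a) (hyp n cs1)"
    by (rule hyp_ins[OF i Wi(1) x(1,2) y])
  have 2: "add_mset {x} (add_mset ?b (hyp n (ins cs1 j x z))) = add_mset (insert x ?b) (hyp n cs1)"
    by (rule hyp_ins[OF j Wi(2) x(1,3) z])
  have 3: "hyp n cs1 = add_mset {x} (add_mset ?a (add_mset ?b G))"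
    using 1 unfolding H by (simp add: add_mset_commute)
  show ?thesis using 2 unfolding 3 by (simp add: add_mset_commute)
qed

text \<open>If x already lay in b, the move would not enlarge b, and the tree sum would fall below
  the bound.\<close>

lemma not_movable:
  assumes "finite U" and sub: "\<forall>S\<in>#add_mset a (add_mset b G). S \<noteq> {} \<and> S \<subseteq> U"
    and tree: "(\<Sum>S\<in>#add_mset a (add_mset b G). card S - 1) + 1 = card U"
    and "card a \<ge> 2" and x: "x \<in> a" "x \<in> b"
  shows "\<not> hconn (add_mset (a - {x}) (add_mset (insert x b) G)) U"
proof
  assume h: "hconn (add_mset (a - {x}) (add_mset (insert x b) G)) U"
  have b: "insert x b = b" using x by blast
  have fa: "finite a" using sub assms(1) finite_subset[of a U] by auto
  have "a - {x} \<noteq> {}"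
  proof
    assume "a - {x} = {}"
    then have "a = {x}" using x by auto
    then show False using \<open>card a \<ge> 2\<close> by simp
  qed
  then have "card U \<le> 1 + (\<Sum>S\<in>#add_mset (a - {x}) (add_mset (insert x b) G). card S - 1)"
    using sub unfolding b by (intro hconn_card_bound[OF assms(1) _ h[unfolded b]]) auto
  then show False using tree x(1) fa \<open>card a \<ge> 2\<close> unfolding b by simp
qed

definition hub :: "nat \<Rightarrow> nat \<times> bool \<Rightarrow> (nat \<times> bool) multiset" where
  "hub k l = add_mset l (replicate_mset k (1, False))"

text \<open>When the two colours differ, both must be hubs, so that the moved element is fixed by the
  other one.\<close>

definition transfer :: "(nat \<times> bool) multiset list \<Rightarrow> (nat \<times> bool) multiset list \<Rightarrow>
    nat \<Rightarrow> nat \<Rightarrow> nat \<Rightarrow> bool \<Rightarrow> nat \<Rightarrow> bool \<Rightarrow> bool" where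
  "transfer P P' i j a f b g \<longleftrightarrow> i < length P \<and> j < length P \<and> a \<ge> 1 \<and> b \<ge> 1 \<and>
    (if i = j then \<exists>M. P ! i = add_mset (Suc a, f) (add_mset (b, g) M) \<and>
        P' = P[i := add_mset (a, f) (add_mset (Suc b, g) M)]
     else \<exists>k m. P ! i = hub k (Suc a, f) \<and> P ! j = hub (Suc m) (b, g) \<and>
        P' = P[i := hub (Suc k) (a, f), j := hub m (Suc b, g)])"

lemma transfer_sym: assumes "transfer P P' i j a f b g" shows "transfer P' P j i b g a f"
proof (cases "i = j")
  case True
  then obtain M where M: "P ! i = add_mset (Suc a, f) (add_mset (b, g) M)"
    "P' = P[i := add_mset (a, f) (add_mset (Suc b, g) M)]" using assms unfolding transfer_def by auto
  have "P = P'[i := P ! i]" unfolding M(2) by simp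
  then have "P = P'[j := add_mset (b, g) (add_mset (Suc a, f) M)]"
    using True unfolding M(1) by (simp add: add_mset_commute)
  moreover have "P' ! j = add_mset (Suc b, g) (add_mset (a, f) M)" "length P' = length P"
    using assms True unfolding M(2) transfer_def by (auto simp: add_mset_commute)
  ultimately show ?thesis using assms True unfolding transfer_def by auto
next
  case False
  then obtain k m where M: "P ! i = hub k (Suc a, f)" "P ! j = hub (Suc m) (b, g)"
    "P' = P[i := hub (Suc k) (a, f), j := hub m (Suc b, g)]" using assms unfolding transfer_def by auto
  have "P = P'[j := P ! j, i := P ! i]" unfolding M(3) using False
    by (simp add: list_update_swap[of i j] )
  then have "P = P'[j := hub (Suc m) (b, g), i := hub k (Suc a, f)]" using M(1,2) by simp
  moreover have "P' ! j = hub m (Suc b, g)" "P' ! i = hub (Suc k) (a, f)" "length P' = length P"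
    using assms False unfolding M(3) transfer_def by auto
  ultimately show ?thesis using assms False unfolding transfer_def by auto
qed

lemma transfer_tree:
  assumes "transfer P P' i j a f b g" "tree_type n P" shows "tree_type n P'"
proof -
  have upd: "(\<Sum>M\<leftarrow>P[i := M]. size M) + size (P ! i) = (\<Sum>M\<leftarrow>P. size M) + size M"
    if "i < length P" for P :: "(nat \<times> bool) multiset list" and i M
    using that by (induction P arbitrary: i) (auto simp: nth_Cons' split: nat.split)
  show ?thesis
  proof (cases "i = j")
    case True
    then obtain M where M: "P ! i = add_mset (Suc a, f) (add_mset (b, g) M)"
      "P' = P[i := add_mset (a, f) (add_mset (Suc b, g) M)]" "i < length P"
      using assms(1) unfolding transfer_def by auto
    then show ?thesis using upd[OF M(3), of "add_mset (a, f) (add_mset (Suc b, g) M)"] assms(2)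
      unfolding tree_type_def by simp
  next
    case False
    then obtain k m where M: "P ! i = hub k (Suc a, f)" "P ! j = hub (Suc m) (b, g)"
      "P' = P[i := hub (Suc k) (a, f), j := hub m (Suc b, g)]" "i < length P" "j < length P"
      using assms(1) unfolding transfer_def by auto
    let ?Q = "P[i := hub (Suc k) (a, f)]"
    have "(\<Sum>M\<leftarrow>?Q. size M) + size (P ! i) = (\<Sum>M\<leftarrow>P. size M) + size (hub (Suc k) (a, f))"
      by (rule upd[OF M(4)])
    moreover have "(\<Sum>M\<leftarrow>P'. size M) + size (?Q ! j) = (\<Sum>M\<leftarrow>?Q. size M) + size (hub m (Suc b, g))"
      unfolding M(3) using M(5) by (intro upd) simp
    moreover have "?Q ! j = P ! j" using False by simp
    ultimately have "(\<Sum>M\<leftarrow>P'. size M) = (\<Sum>M\<leftarrow>P. size M)" unfolding M(1,2) by (simp add: hub_def)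
    then show ?thesis using assms(2) M(3) by (simp add: tree_type_def)
  qed
qed

text \<open>The set counted in two ways: an intermediate tuple in which the factors i and j fix x,
  with a place y in factor i and a place z in factor j such that the two insertions give connected
  tuples of types P and P'. Exchanging y and z exchanges the roles.\<close>

definition tri :: "nat \<Rightarrow> (nat \<times> bool) multiset list \<Rightarrow> (nat \<times> bool) multiset list \<Rightarrow>
    nat \<Rightarrow> nat \<Rightarrow> nat \<times> bool \<Rightarrow> nat \<times> bool \<Rightarrow> ((int \<Rightarrow> int) list \<times> int \<times> int \<times> int) set" where
  "tri n P P' i j l k = {(cs, x, y, z). set cs \<subseteq> W_B n \<and> length cs = length P \<and> x \<in> pos n \<and>
     (cs ! i) x = x \<and> (cs ! j) x = x \<and>
     y \<in> signed_letters n \<and> \<bar>y\<bar> \<noteq> x \<and> z \<in> signed_letters n \<and> \<bar>z\<bar> \<noteq> x \<and>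
     lab (cs ! i) (blk n (cs ! i) \<bar>y\<bar>) = l \<and> lab (cs ! j) (blk n (cs ! j) \<bar>z\<bar>) = k \<and>
     (i = j \<longrightarrow> blk n (cs ! i) \<bar>y\<bar> \<noteq> blk n (cs ! j) \<bar>z\<bar>) \<and>
     ins cs i x y \<in> tuples n P \<and> ins cs j x z \<in> tuples n P'}"

lemma card_tri_sym:
  assumes "length P = length P'"
  shows "card (tri n P P' i j l k) = card (tri n P' P j i k l)"
proof (rule bij_betw_same_card[of "\<lambda>(cs, x, y, z). (cs, x, z, y)"],
    rule bij_betw_byWitness[where f' = "\<lambda>(cs, x, y, z). (cs, x, z, y)"])
qed (use assms in \<open>auto simp: tri_def\<close>)

section \<open>Counting the moves out of a tuple\<close>

definition block_pairs :: "nat \<Rightarrow> (int \<Rightarrow> int) list \<Rightarrow> nat \<Rightarrow> nat \<Rightarrow> nat \<times> bool \<Rightarrow> nat \<times> bool \<Rightarrow>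
    (int set \<times> int set) set" where
  "block_pairs n cs i j l k = {(a, b). a \<in> blocks n (cs ! i) \<and> b \<in> blocks n (cs ! j) \<and>
     lab (cs ! i) a = l \<and> lab (cs ! j) b = k \<and> (i = j \<longrightarrow> a \<noteq> b)}"

lemma hub_fixed:
  assumes W: "e \<in> W_B n" and L: "Lam n e = hub m l" and b: "b \<in> blocks n e" "lab e b = l"
    and x: "x \<in> pos n" "x \<notin> b"
  shows "e x = x"
proof -
  have "mset_set (blocks n e) = add_mset b (mset_set (blocks n e - {b}))"
    by (rule mset_set.remove[OF finite_blocks b(1)])
  then have "image_mset (lab e) (mset_set (blocks n e - {b})) = replicate_mset m (1, False)"
    using L b(2) by (simp add: Lam_def hub_def)
  moreover have "blk n e x \<in> blocks n e - {b}" using blk_in_blocks[OF x(1), of e] blk_self[OF W, of x] x(2) by auto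
  then have "lab e (blk n e x) \<in># image_mset (lab e) (mset_set (blocks n e - {b}))"
    using finite_blocks[of n e] by auto
  ultimately have l: "lab e (blk n e x) = (1, False)" by (metis in_replicate_mset)
  then have "card (blk n e x) = 1" by (simp add: lab_def)
  then obtain v where "blk n e x = {v}" by (rule card_1_singletonE)
  then have bx: "blk n e x = {x}" using blk_self[OF W, of x] by simp
  then have "\<bar>e x\<bar> = x" using blk_step[OF W x(1)] by simp
  moreover have "sgn (e x) \<noteq> - 1" using l bx by (simp add: lab_def flagged_def)
  ultimately show ?thesis using x(1) by (cases "e x > 0") auto
qed

lemma card_signed: assumes "b \<subseteq> pos n" shows "card {z \<in> signed_letters n. \<bar>z\<bar> \<in> b} = 2 * card b"
proof -
  have fb: "finite b" using assms finite_subset by blast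
  have "{z \<in> signed_letters n. \<bar>z\<bar> \<in> b} = b \<union> uminus ` b"
  proof
    show "b \<union> uminus ` b \<subseteq> {z \<in> signed_letters n. \<bar>z\<bar> \<in> b}"
      using assms by (auto simp: signed_letters_def)
    show "{z \<in> signed_letters n. \<bar>z\<bar> \<in> b} \<subseteq> b \<union> uminus ` b"
    proof
      fix z assume "z \<in> {z \<in> signed_letters n. \<bar>z\<bar> \<in> b}"
      then have "\<bar>z\<bar> \<in> b" by simp
      moreover have "z = \<bar>z\<bar> \<or> z = - \<bar>z\<bar>" by auto
      ultimately show "z \<in> b \<union> uminus ` b" by (metis UnI1 UnI2 imageI)
    qed
  qed
  moreover have "b \<inter> uminus ` b = {}"
  proof -
    have p: "u > 0" if "u \<in> b" for u using that assms by auto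
    have "u \<notin> uminus ` b" if "u \<in> b" for u
    proof
      assume "u \<in> uminus ` b"
      then obtain v where "v \<in> b" "u = - v" by blast
      then show False using p[of u] p[of v] that by simp
    qed
    then show ?thesis by blast
  qed
  moreover have "card (uminus ` b) = card b" by (intro card_image) (auto simp: inj_on_def)
  ultimately show ?thesis using fb by (simp add: card_Un_disjoint)
qed

lemma transfer_length: "transfer P P' i j a f b g \<Longrightarrow> length P' = length P"
  by (auto simp: transfer_def split: if_splits)

lemma map_ins:
  "map (Lam n) (ins cs i x y) = (map (Lam n) cs)[i := Lam n (refl_A x y \<circ> cs ! i)]"
  by (simp add: ins_def map_update)

text \<open>An element over cs amounts to a pair of blocks with the given labels, one of the a
  movable letters x of the first block (\<open>card_movable\<close>), and one of the 2 b signed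
  letters z over the second; y is forced by \<open>removal\<close>.\<close>

lemma card_fibre:
  assumes tr: "transfer P P' i j a f b g" and tree: "tree_type n P" and cs: "cs \<in> tuples n P"
  shows "card {t \<in> tri n P P' i j (a, f) (b, g). case t of (cs1, x, y, z) \<Rightarrow> ins cs1 i x y = cs} =
    card (block_pairs n cs i j (Suc a, f) (b, g)) * (a * (2 * b))"
proof -
  let ?l = "(Suc a, f)" and ?k = "(b, g)"
  let ?c = "cs ! i"
  have csW: "set cs \<subseteq> W_B n" and Lcs: "map (Lam n) cs = P" and cc: "conn n cs"
    using cs by (auto simp: tuples_def)
  have len: "length cs = length P" using Lcs by auto
  have i: "i < length cs" and j: "j < length cs" and ab: "a \<ge> 1" "b \<ge> 1"
    using tr len by (auto simp: transfer_def)
  have W: "?c \<in> W_B n" "cs ! j \<in> W_B n" using csW i j nth_mem by blast+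
  have treeH: "(\<Sum>S\<in>#hyp n cs. card S - 1) + 1 = card (pos n)"
    unfolding sum_hyp[OF csW] using tuples_tree[OF tree Lcs csW] by simp
  have sub: "\<forall>S\<in>#hyp n cs. S \<noteq> {} \<and> S \<subseteq> pos n" by (rule hyp_blocks[OF csW])
  define Pr where "Pr = block_pairs n cs i j ?l ?k"
  have Pr: "A \<in> blocks n ?c" "B \<in> blocks n (cs ! j)" "lab ?c A = ?l" "lab (cs ! j) B = ?k" "i = j \<Longrightarrow> A \<noteq> B"
    if "(A, B) \<in> Pr" for A B using that by (auto simp: Pr_def block_pairs_def)
  \<comment> \<open>The edges besides A and B; they are determined by the pair, and a name is fixed
    so that movability can be stated for each pair.\<close>
  define G where "G A B = (SOME G. hyp n cs = add_mset A (add_mset B G))" for A B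
  have G: "hyp n cs = add_mset A (add_mset B (G A B))" if "(A, B) \<in> Pr" for A B
    unfolding G_def by (rule someI_ex, rule hyp_two[OF i j Pr(1,2)[OF that]], rule Pr(5)[OF that])
  define good where "good A B = {x\<in>A. hconn (add_mset (A - {x}) (add_mset (insert x B) (G A B))) (pos n)}" for A B
  have cardA: "card A = Suc a" "card B = b" if "(A, B) \<in> Pr" for A B
    using Pr(3,4)[OF that] by (auto simp: lab_def)
  have card_good: "card (good A B) = a" if "(A, B) \<in> Pr" for A B
    using card_movable[of "pos n" A B "G A B"] sub cc treeH cardA[OF that] ab
    unfolding good_def conn_def G[OF that] by simp
  \<comment> \<open>For different factors this is what ensures that the hub at j fixes x.\<close>
  have good_notin: "x \<notin> B" if "(A, B) \<in> Pr" "x \<in> good A B" for A B x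
    using not_movable[of "pos n" A B "G A B" x] sub treeH cardA[OF that(1)] ab that(2)
    unfolding good_def G[OF that(1)] by auto
  have sub_pos: "A \<subseteq> pos n" "B \<subseteq> pos n" if "(A, B) \<in> Pr" for A B
    using block_props(2)[OF W(1) Pr(1)[OF that]] block_props(2)[OF W(2) Pr(2)[OF that]] .
  define S where "S = (\<Union>p\<in>Pr. good (fst p) (snd p) \<times> {z \<in> signed_letters n. \<bar>z\<bar> \<in> snd p})"
  have finPr: "finite Pr"
    by (rule finite_subset[of _ "blocks n ?c \<times> blocks n (cs ! j)"]) (auto simp: Pr_def block_pairs_def finite_blocks)
  have fin: "finite (good A B)" "finite {z \<in> signed_letters n. \<bar>z\<bar> \<in> B}" if "(A, B) \<in> Pr" for A B
  proof -
    have "finite A" using sub_pos(1)[OF that] finite_subset by blast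
    then show "finite (good A B)" by (simp add: good_def)
    have "finite (signed_letters n)" by (simp add: signed_letters_def)
    then show "finite {z \<in> signed_letters n. \<bar>z\<bar> \<in> B}" by (rule rev_finite_subset) blast
  qed
  have "card S = (\<Sum>p\<in>Pr. card (good (fst p) (snd p) \<times> {z \<in> signed_letters n. \<bar>z\<bar> \<in> snd p}))"
    unfolding S_def
  proof (rule card_UN_disjoint[OF finPr])
    show "\<forall>p\<in>Pr. finite (good (fst p) (snd p) \<times> {z \<in> signed_letters n. \<bar>z\<bar> \<in> snd p})"
      using fin by (metis finite_cartesian_product prod.collapse)
    show "\<forall>p\<in>Pr. \<forall>q\<in>Pr. p \<noteq> q \<longrightarrow> (good (fst p) (snd p) \<times> {z \<in> signed_letters n. \<bar>z\<bar> \<in> snd p}) \<inter>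
        (good (fst q) (snd q) \<times> {z \<in> signed_letters n. \<bar>z\<bar> \<in> snd q}) = {}"
    proof (intro ballI impI, rule ccontr)
      fix p q assume p: "p \<in> Pr" and q: "q \<in> Pr" and "p \<noteq> q"
        and "(good (fst p) (snd p) \<times> {z \<in> signed_letters n. \<bar>z\<bar> \<in> snd p}) \<inter>
        (good (fst q) (snd q) \<times> {z \<in> signed_letters n. \<bar>z\<bar> \<in> snd q}) \<noteq> {}"
      then obtain x z where "x \<in> fst p" "x \<in> fst q" "\<bar>z\<bar> \<in> snd p" "\<bar>z\<bar> \<in> snd q"
        by (auto simp: good_def)
      then have "fst p = fst q" "snd p = snd q"
        using blocks_disjoint[OF W(1), of "fst p" "fst q"] blocks_disjoint[OF W(2), of "snd p" "snd q"]
          Pr(1,2)[of "fst p" "snd p"] Pr(1,2)[of "fst q" "snd q"] p q by auto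
      then show False using \<open>p \<noteq> q\<close> by (simp add: prod_eq_iff)
    qed
  qed
  also have "\<dots> = (\<Sum>p\<in>Pr. a * (2 * b))"
  proof (rule sum.cong[OF HOL.refl])
    fix p assume "p \<in> Pr"
    then have p: "(fst p, snd p) \<in> Pr" by simp
    show "card (good (fst p) (snd p) \<times> {z \<in> signed_letters n. \<bar>z\<bar> \<in> snd p}) = a * (2 * b)"
      unfolding card_cartesian_product card_good[OF p] card_signed[OF sub_pos(2)[OF p]] cardA[OF p] ..
  qed
  finally have cardS: "card S = card Pr * (a * (2 * b))" by simp
  \<comment> \<open>The intermediate tuple is recovered by cutting x out of factor i.\<close>
  define \<phi> where "\<phi> p = (cs[i := refl_A (fst p) (?c (fst p)) \<circ> ?c], fst p, ?c (fst p), snd p)" for p :: "int \<times> int"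
  let ?F = "{t \<in> tri n P P' i j (a, f) (b, g). case t of (cs1, x, y, z) \<Rightarrow> ins cs1 i x y = cs}"
  have "\<phi> ` S = ?F"
  proof
    show "\<phi> ` S \<subseteq> ?F"
    proof
      fix t assume "t \<in> \<phi> ` S"
      then obtain A B x z where AB: "(A, B) \<in> Pr" "x \<in> good A B" "z \<in> signed_letters n" "\<bar>z\<bar> \<in> B" "t = \<phi> (x, z)"
        unfolding S_def by force
      define y where "y = ?c x"
      define c1 where "c1 = refl_A x y \<circ> ?c"
      define cs1 where "cs1 = cs[i := c1]"
      define e where "e = cs1 ! j"
      note p = Pr[OF AB(1)]
      have xA: "x \<in> A" using AB(2) by (simp add: good_def)
      have xB: "x \<notin> B" by (rule good_notin[OF AB(1,2)])
      have xp: "x \<in> pos n" using xA sub_pos(1)[OF AB(1)] by blast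
      have bA: "blk n ?c x = A" by (rule block_props(4)[OF W(1) p(1) xA])
      have "card (blk n ?c x) \<ge> 2" using cardA(1)[OF AB(1)] ab by (simp add: bA)
      note R = removal[OF W(1) xp this, folded y_def, folded c1_def]
      have cs1i: "cs1 ! i = c1" using i by (simp add: cs1_def)
      have cs1W: "set cs1 \<subseteq> W_B n" unfolding cs1_def by (rule set_update_subsetI[OF csW R(3)])
      have len1: "length cs1 = length P" using len by (simp add: cs1_def)
      note I1 = insertion[OF R(3) xp R(4,1,2), unfolded R(5,6) bA]
      have insA: "insert x (A - {x}) = A" using xA by blast
      have lab1: "lab c1 (A - {x}) = (a, f)"
      proof -
        have "lab ?c A = (Suc (card (A - {x})), flagged c1 (A - {x}))" using I1(8) unfolding insA .
        then show ?thesis using p(3) by (simp add: lab_def)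
      qed
      \<comment> \<open>For i = j, B is a block of the same permutation and survives the removal of
        x from A; for i \<noteq> j, factor j is a hub with block B and fixes every letter outside
        it.\<close>
      have e: "e \<in> W_B n" "e x = x" "B \<in> blocks n e" "lab e B = ?k"
      proof -
        have "e x = x \<and> B \<in> blocks n e \<and> lab e B = ?k"
        proof (cases "i = j")
          case True
          then have ec: "e = c1" using cs1i by (simp add: e_def)
          have "B \<in> blocks n c1 - {{x}, A - {x}}"
            using p(2,5) True I1(5) xB \<open>\<bar>z\<bar> \<in> B\<close> unfolding insA by auto
          then show ?thesis using I1(9) R(4) p(4) True unfolding ec by auto
        next
          case False
          then have ec: "e = cs ! j" by (simp add: e_def cs1_def)
          obtain m where "P ! j = hub (Suc m) ?k" using tr False unfolding transfer_def by auto
          then have "Lam n e = hub (Suc m) ?k" using Lcs j unfolding ec by (metis nth_map)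
          then have "e x = x" using hub_fixed[OF W(2), of "Suc m" ?k B x] p(2,4) xp xB unfolding ec by blast
          then show ?thesis using p(2,4) unfolding ec by blast
        qed
        then show "e x = x" "B \<in> blocks n e" "lab e B = ?k" by blast+
        show "e \<in> W_B n" unfolding e_def using cs1W len1 j len nth_mem by (metis subsetD)
      qed
      have bB: "blk n e \<bar>z\<bar> = B" by (rule block_props(4)[OF e(1,3) AB(4)])
      have zx: "\<bar>z\<bar> \<noteq> x" using AB(4) xB by auto
      have restore: "ins cs1 i x y = cs" unfolding ins_def cs1i R(5) by (simp add: cs1_def)
      obtain M where M: "Lam n c1 = add_mset (1, False) (add_mset (a, f) M)"
        "Lam n ?c = add_mset (Suc (card (A - {x})), flagged c1 (A - {x})) M"
        using insertion_mset(2)[OF R(3) xp R(4,1,2), unfolded R(5,6) bA lab1] by blast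
      have M': "Lam n ?c = add_mset (Suc a, f) M" using M(2) lab1 by (simp add: lab_def)
      obtain M2 where M2: "Lam n e = add_mset (1, False) (add_mset (b, g) M2)"
        "Lam n (refl_A x z \<circ> e) = add_mset (Suc b, g) M2"
        using insertion_mset(2)[OF e(1) xp e(2) AB(3) zx, unfolded bB e(4)] e(4) by (auto simp: lab_def)
      have Pi: "P ! i = Lam n ?c" using Lcs i by (metis nth_map)
      have "map (Lam n) (ins cs1 j x z) = P'"
      proof (cases "i = j")
        case True
        then obtain MM where MM: "P ! i = add_mset (Suc a, f) (add_mset (b, g) MM)"
          "P' = P[i := add_mset (a, f) (add_mset (Suc b, g) MM)]" using tr unfolding transfer_def by auto
        have "M = add_mset (b, g) MM" using MM(1) M' Pi by simp
        then have "add_mset (b, g) M2 = add_mset (b, g) (add_mset (a, f) MM)"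
          using M(1) M2(1) True cs1i unfolding e_def by (simp add: add_mset_commute)
        then have "M2 = add_mset (a, f) MM" by simp
        then have "Lam n (refl_A x z \<circ> cs1 ! j) = add_mset (a, f) (add_mset (Suc b, g) MM)"
          using M2(2) unfolding e_def by (simp add: add_mset_commute)
        then show ?thesis unfolding map_ins cs1_def[THEN arg_cong[where f = "map (Lam n)"]]
          using True by (simp add: map_update Lcs MM(2))
      next
        case False
        then obtain k m where KM: "P ! i = hub k (Suc a, f)" "P ! j = hub (Suc m) (b, g)"
          "P' = P[i := hub (Suc k) (a, f), j := hub m (Suc b, g)]" using tr unfolding transfer_def by auto
        have "M = replicate_mset k (1, False)" using KM(1) M' Pi by (simp add: hub_def)
        then have 1: "Lam n c1 = hub (Suc k) (a, f)" using M(1) by (simp add: hub_def add_mset_commute)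
        have "Lam n e = P ! j" using Lcs j False by (simp add: e_def cs1_def nth_map[symmetric])
        then have "M2 = replicate_mset m (1, False)" using M2(1) KM(2) by (simp add: hub_def add_mset_commute)
        then have 2: "Lam n (refl_A x z \<circ> cs1 ! j) = hub m (Suc b, g)" using M2(2) by (simp add: hub_def e_def)
        show ?thesis unfolding map_ins 2 unfolding cs1_def map_update Lcs 1 KM(3) ..
      qed
      moreover have "conn n (ins cs1 j x z)"
      proof -
        have "hyp n (ins cs1 i x y) = add_mset (insert x (blk n (cs1 ! i) \<bar>y\<bar>)) (add_mset (blk n (cs1 ! j) \<bar>z\<bar>) (G A B))"
          unfolding restore cs1i R(6) bA insA bB[unfolded e_def] by (rule G[OF AB(1)])
        from hyp_move[OF _ _ cs1W xp _ _ R(1,2) AB(3) zx this]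
        have "hyp n (ins cs1 j x z) = add_mset (A - {x}) (add_mset (insert x B) (G A B))"
          using len1 len i j R(4) e(2) unfolding cs1i R(6) bA bB[unfolded e_def] e_def by simp
        then show ?thesis using AB(2) by (simp add: conn_def good_def)
      qed
      moreover have "set (ins cs1 j x z) \<subseteq> W_B n"
      proof -
        have "refl_A x z \<circ> cs1 ! j \<in> W_B n" using insertion(1)[OF e(1) xp e(2) AB(3) zx] by (simp add: e_def)
        then show ?thesis unfolding ins_def by (rule set_update_subsetI[OF cs1W])
      qed
      ultimately have "ins cs1 j x z \<in> tuples n P'" by (simp add: tuples_def)
      moreover have "t = (cs1, x, y, z)" using AB(5) by (simp add: \<phi>_def cs1_def c1_def y_def)
      moreover have "blk n (cs1 ! j) \<bar>y\<bar> \<noteq> B" if "i = j"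
      proof -
        have "A - {x} \<noteq> B"
          using p(1,2) p(5)[OF that] blocks_disjoint[OF W(1) p(1), of B] that AB(4) by blast
        then show ?thesis using that cs1i R(6) bA by simp
      qed
      ultimately show "t \<in> ?F"
        using cs1W len1 xp R(1,2,4,6) e AB(3) zx lab1 cs restore bB unfolding tri_def bA
        by (simp add: cs1i e_def bA)
    qed
    show "?F \<subseteq> \<phi> ` S"
    proof
      fix t assume t: "t \<in> ?F"
      obtain cs1 x y z where T: "t = (cs1, x, y, z)" by (metis prod_cases4)
      have h: "set cs1 \<subseteq> W_B n" "length cs1 = length P" "x \<in> pos n"
         "(cs1 ! i) x = x" "(cs1 ! j) x = x"
         "y \<in> signed_letters n" "\<bar>y\<bar> \<noteq> x" "z \<in> signed_letters n" "\<bar>z\<bar> \<noteq> x"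
         "lab (cs1 ! i) (blk n (cs1 ! i) \<bar>y\<bar>) = (a, f)" "lab (cs1 ! j) (blk n (cs1 ! j) \<bar>z\<bar>) = (b, g)"
         "i = j \<Longrightarrow> blk n (cs1 ! i) \<bar>y\<bar> \<noteq> blk n (cs1 ! j) \<bar>z\<bar>"
         "ins cs1 j x z \<in> tuples n P'" "ins cs1 i x y = cs"
        using t unfolding T tri_def by auto
      have i1: "i < length cs1" and j1: "j < length cs1" using i j len h(2) by auto
      have W1: "cs1 ! i \<in> W_B n" "cs1 ! j \<in> W_B n" using h(1) i1 j1 nth_mem by blast+
      note I = insertion[OF W1(1) h(3,4,6,7)]
      define A where "A = insert x (blk n (cs1 ! i) \<bar>y\<bar>)"
      define B where "B = blk n (cs1 ! j) \<bar>z\<bar>"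
      have ci: "?c = refl_A x y \<circ> cs1 ! i" unfolding h(14)[symmetric] ins_def using i1 by simp
      have Ab: "A \<in> blocks n ?c" unfolding ci I(5) A_def by blast
      have cx: "?c x = y" using h(3,4,6,7) unfolding ci by (subst comp_apply) (auto simp: refl_A_def transpose_def signed_letters_def)
      have Al: "lab ?c A = ?l" using I(8) h(10) unfolding ci A_def by (simp add: lab_def)
      have Bb: "B \<in> blocks n (cs1 ! j)" unfolding B_def using h(8) by (intro blk_in_blocks) (simp only: letter_abs)
      have xB: "x \<notin> B"
      proof
        assume "x \<in> B"
        then have "B = {x}" using block_props(4)[OF W1(2) Bb] blk_fixed[of "cs1 ! j" x n, OF h(5)] by auto
        then show False using h(9) blk_self[OF W1(2), of "\<bar>z\<bar>"] by (auto simp: B_def)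
      qed
      have zB: "\<bar>z\<bar> \<in> B" unfolding B_def by (rule blk_self[OF W1(2)])
      have B: "B \<in> blocks n (cs ! j) \<and> lab (cs ! j) B = ?k"
      proof (cases "i = j")
        case True
        then have "B \<in> blocks n (cs1 ! i) - {{x}, blk n (cs1 ! i) \<bar>y\<bar>}" using Bb xB h(12) by (auto simp: B_def)
        then have "B \<in> blocks n ?c" "lab ?c B = lab (cs1 ! i) B" unfolding ci I(5) using I(9) by auto
        then show ?thesis using True h(11) by (simp add: B_def)
      next
        case False
        then have "cs ! j = cs1 ! j" unfolding h(14)[symmetric] ins_def by simp
        then show ?thesis using Bb h(11) by (simp add: B_def)
      qed
      have AB: "(A, B) \<in> Pr" unfolding Pr_def block_pairs_def using Ab B Al xB by (auto simp: A_def)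
      have "hyp n (ins cs1 i x y) = add_mset A (add_mset B (G A B))" unfolding h(14) by (rule G[OF AB])
      then have H2: "hyp n (ins cs1 j x z) = add_mset (blk n (cs1 ! i) \<bar>y\<bar>) (add_mset (insert x B) (G A B))"
        unfolding A_def B_def by (rule hyp_move[OF i1 j1 h(1,3,4,5,6,7,8,9)])
      have bA: "blk n (cs1 ! i) \<bar>y\<bar> = A - {x}" using I(4) by (simp add: A_def)
      have "conn n (ins cs1 j x z)" using h(13) by (simp add: tuples_def)
      then have "hconn (add_mset (A - {x}) (add_mset (insert x B) (G A B))) (pos n)"
        unfolding conn_def H2 bA .
      moreover have "x \<in> A" unfolding A_def by blast
      ultimately have "x \<in> good A B" unfolding good_def by blast
      then have "(x, z) \<in> good (fst (A, B)) (snd (A, B)) \<times> {z \<in> signed_letters n. \<bar>z\<bar> \<in> snd (A, B)}"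
        using h(8) zB by simp
      then have "(x, z) \<in> S" unfolding S_def using AB by blast
      moreover have "cs1 = cs[i := refl_A x y \<circ> ?c]"
      proof -
        have "\<bar>x\<bar> \<noteq> \<bar>y\<bar>" "x \<noteq> 0" "y \<noteq> 0" using h(3,6,7) by (auto simp: signed_letters_def)
        then have "refl_A x y \<circ> ?c = cs1 ! i" unfolding ci comp_assoc[symmetric] by (simp add: refl_A_sq)
        then show ?thesis unfolding h(14)[symmetric] ins_def using i1 by simp
      qed
      then have "\<phi> (x, z) = t" unfolding \<phi>_def T using cx by simp
      ultimately show "t \<in> \<phi> ` S" by blast
    qed
  qed
  moreover have "inj_on \<phi> S" by (auto simp: inj_on_def \<phi>_def)
  ultimately have "card ?F = card S" using card_image by metis
  then show ?thesis unfolding cardS Pr_def .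
qed

lemma card_tri:
  assumes tr: "transfer P P' i j a f b g" and tree: "tree_type n P"
    and K: "\<And>cs. cs \<in> tuples n P \<Longrightarrow> card (block_pairs n cs i j (Suc a, f) (b, g)) = K"
  shows "card (tri n P P' i j (a, f) (b, g)) = card (tuples n P) * K * (a * (2 * b))"
proof -
  let ?T = "tri n P P' i j (a, f) (b, g)"
  define h where "h t = (case t of (cs1, x, y, z) \<Rightarrow> ins cs1 i x y)" for t :: "(int \<Rightarrow> int) list \<times> int \<times> int \<times> int"
  have fin: "finite ?T"
  proof (rule finite_subset)
    show "?T \<subseteq> {cs. set cs \<subseteq> W_B n \<and> length cs = length P} \<times> pos n \<times> signed_letters n \<times> signed_letters n"
      by (auto simp: tri_def)
    show "finite ({cs. set cs \<subseteq> W_B n \<and> length cs = length P} \<times> pos n \<times> signed_letters n \<times> signed_letters n)"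
      using finite_lists_length_eq[OF finite_W_B, of n "length P"] by (intro finite_cartesian_product) (auto simp: signed_letters_def)
  qed
  have "h ` ?T \<subseteq> tuples n P" by (auto simp: h_def tri_def)
  then have "card ?T = (\<Sum>cs\<in>tuples n P. card {t\<in>?T. h t = cs})"
    using sum.group[OF fin finite_tuples, of h n P "\<lambda>_. 1 :: nat"] by simp
  also have "\<dots> = (\<Sum>cs\<in>tuples n P. K * (a * (2 * b)))"
  proof (rule sum.cong[OF HOL.refl])
    fix cs assume cs: "cs \<in> tuples n P"
    have "{t\<in>?T. h t = cs} = {t \<in> ?T. case t of (cs1, x, y, z) \<Rightarrow> ins cs1 i x y = cs}"
      by (auto simp: h_def)
    then show "card {t\<in>?T. h t = cs} = K * (a * (2 * b))"
      using card_fibre[OF tr tree cs] K[OF cs] by simp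
  qed
  finally show ?thesis by simp
qed

text \<open>The two counts of \<open>tri\<close> carry the factors a times 2 b and b times 2 a,
  which cancel; what is left compares the numbers of tuples by numbers of block pairs.\<close>

lemma switching:
  assumes tr: "transfer P P' i j a f b g" and tree: "tree_type n P"
    and K: "\<And>cs. cs \<in> tuples n P \<Longrightarrow> card (block_pairs n cs i j (Suc a, f) (b, g)) = K"
    and K': "\<And>cs. cs \<in> tuples n P' \<Longrightarrow> card (block_pairs n cs j i (Suc b, g) (a, f)) = K'"
  shows "card (tuples n P) * K = card (tuples n P') * K'"
proof -
  have 1: "card (tri n P P' i j (a, f) (b, g)) = card (tuples n P) * K * (a * (2 * b))"
    by (rule card_tri[OF tr tree K])
  have 2: "card (tri n P' P j i (b, g) (a, f)) = card (tuples n P') * K' * (b * (2 * a))"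
    by (rule card_tri[OF transfer_sym[OF tr] transfer_tree[OF tr tree] K'])
  have 3: "card (tri n P P' i j (a, f) (b, g)) = card (tri n P' P j i (b, g) (a, f))"
    by (rule card_tri_sym) (simp add: transfer_length[OF tr])
  have "card (tuples n P) * K * (a * (2 * b)) = card (tuples n P') * K' * (b * (2 * a))"
    using 1[symmetric] unfolding 3 2 .
  then have "card (tuples n P) * K * (2 * a * b) = card (tuples n P') * K' * (2 * a * b)"
    by (simp only: mult.assoc mult.commute mult.left_commute)
  moreover have "2 * a * b \<noteq> 0" using tr by (simp add: transfer_def)
  ultimately show ?thesis using mult_right_cancel by blast
qed

section \<open>Counting tuples of given types\<close>

text \<open>For the types in the theorem this becomes the denominator of the multinomial
  coefficient, with the fixed letters supplying the factorial of m_0; see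
  \<open>one_B_weight\<close>.\<close>

definition weight :: "'a multiset \<Rightarrow> nat" where
  "weight M = (\<Prod>x\<in>set_mset M. fact (count M x))"

lemma weight_add: "weight (add_mset l M) = Suc (count M l) * weight M"
proof -
  have w: "weight N = (\<Prod>x\<in>S. fact (count N x))" if "finite S" "set_mset N \<subseteq> S" for N :: "'a multiset" and S
    unfolding weight_def using that
    by (intro prod.mono_neutral_left) (auto simp: not_in_iff)
  let ?S = "insert l (set_mset M)"
  have "weight (add_mset l M) = (\<Prod>x\<in>?S. fact (count (add_mset l M) x))" by (rule w) auto
  also have "\<dots> = fact (count (add_mset l M) l) * (\<Prod>x\<in>?S - {l}. fact (count (add_mset l M) x))"
    by (rule prod.remove) auto
  also have "(\<Prod>x\<in>?S - {l}. fact (count (add_mset l M) x)) = (\<Prod>x\<in>?S - {l}. fact (count M x))"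
    by (rule prod.cong) auto
  finally have 1: "weight (add_mset l M) = Suc (count M l) * (fact (count M l) * (\<Prod>x\<in>?S - {l}. fact (count M x)))"
    by (simp add: algebra_simps)
  have "weight M = (\<Prod>x\<in>?S. fact (count M x))" by (rule w) auto
  also have "\<dots> = fact (count M l) * (\<Prod>x\<in>?S - {l}. fact (count M x))"
    by (rule prod.remove) auto
  finally show ?thesis unfolding 1 by (rule arg_cong[where f = "(*) (Suc (count M l))", symmetric])
qed

lemma count_image_mset_set:
  "finite B \<Longrightarrow> count (image_mset L (mset_set B)) l = card {b\<in>B. L b = l}"
proof (induction B rule: finite_induct)
  case (insert b B)
  have "{c \<in> insert b B. L c = l} = (if L b = l then insert b {c\<in>B. L c = l} else {c\<in>B. L c = l})" by auto
  then show ?case using insert by auto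
qed simp

text \<open>The formula covers equal and different labels at once: the inner
  \<open>add_mset k M\<close> adds one to the first count exactly if k = l.\<close>

lemma card_label_pairs:
  assumes "finite B" "image_mset L (mset_set B) = add_mset l (add_mset k M)"
  shows "card {(a, b). a \<in> B \<and> b \<in> B \<and> L a = l \<and> L b = k \<and> a \<noteq> b} =
    Suc (count (add_mset k M) l) * Suc (count M k)"
proof -
  have "{(a, b). a \<in> B \<and> b \<in> B \<and> L a = l \<and> L b = k \<and> a \<noteq> b} =
    (SIGMA a:{a\<in>B. L a = l}. {b\<in>B - {a}. L b = k})" by auto
  also have "card \<dots> = (\<Sum>a\<in>{a\<in>B. L a = l}. card {b\<in>B - {a}. L b = k})"
    using assms(1) by (intro card_SigmaI) auto
  also have "\<dots> = (\<Sum>a\<in>{a\<in>B. L a = l}. Suc (count M k))"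
  proof (rule sum.cong[OF HOL.refl])
    fix a assume a: "a \<in> {a\<in>B. L a = l}"
    have "mset_set B = add_mset a (mset_set (B - {a}))" using assms(1) a by (intro mset_set.remove) auto
    then have "image_mset L (mset_set (B - {a})) = add_mset k M" using assms(2) a by simp
    then show "card {b\<in>B - {a}. L b = k} = Suc (count M k)"
      using count_image_mset_set[of "B - {a}" L k] assms(1) by simp
  qed
  also have "\<dots> = card {a\<in>B. L a = l} * Suc (count M k)" by simp
  also have "card {a\<in>B. L a = l} = Suc (count (add_mset k M) l)"
    using count_image_mset_set[OF assms(1), of L l] assms(2) by simp
  finally show ?thesis .
qed

text \<open>So the number of pairs is a quotient of two weights and the same for all tuples of the
  type, as \<open>switching\<close> requires.\<close>

lemma card_block_pairs_same:
  assumes cs: "cs \<in> tuples n P" and i: "i < length P" and P: "P ! i = add_mset l (add_mset k M)"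
  shows "card (block_pairs n cs i i l k) * weight M = weight (P ! i)"
proof -
  have "map (Lam n) cs = P" using cs by (simp add: tuples_def)
  then have "Lam n (cs ! i) = P ! i" using i by auto
  then have "image_mset (lab (cs ! i)) (mset_set (blocks n (cs ! i))) = add_mset l (add_mset k M)"
    using P by (simp add: Lam_def)
  from card_label_pairs[OF finite_blocks this]
  have "card (block_pairs n cs i i l k) = Suc (count (add_mset k M) l) * Suc (count M k)"
    unfolding block_pairs_def by (auto elim!: back_subst[of "\<lambda>S. card S = _"])
  then show ?thesis unfolding P weight_add by (simp add: algebra_simps)
qed

lemma card_block_pairs_diff:
  assumes cs: "cs \<in> tuples n P" and ij: "i < length P" "j < length P" "i \<noteq> j"
  shows "card (block_pairs n cs i j l k) = count (P ! i) l * count (P ! j) k"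
proof -
  have "map (Lam n) cs = P" using cs by (simp add: tuples_def)
  then have L: "Lam n (cs ! i) = P ! i" "Lam n (cs ! j) = P ! j" using ij by auto
  have "block_pairs n cs i j l k = {a\<in>blocks n (cs ! i). lab (cs ! i) a = l} \<times> {b\<in>blocks n (cs ! j). lab (cs ! j) b = k}"
    using ij by (auto simp: block_pairs_def)
  then show ?thesis unfolding L[symmetric] Lam_def
    by (simp add: card_cartesian_product count_image_mset_set finite_blocks)
qed

lemma weight_pos: "weight M > 0"
  by (simp add: weight_def prod_pos)

text \<open>A letter moves between two blocks of one factor. Both numbers of block pairs have the
  same denominator \<open>weight M\<close>, which cancels.\<close>

lemma switch_same_colour:
  assumes i: "i < length P" and P: "P ! i = add_mset (Suc a, f) (add_mset (b, g) M)" and ab: "a \<ge> 1" "b \<ge> 1"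
    and tree: "tree_type n P"
  defines "X \<equiv> add_mset (a, f) (add_mset (Suc b, g) M)"
  shows "card (tuples n P) * weight (P ! i) = card (tuples n (P[i := X])) * weight X"
proof -
  let ?P' = "P[i := X]"
  have tr: "transfer P ?P' i i a f b g" unfolding transfer_def using i P ab by (auto simp: X_def)
  define K where "K = weight (P ! i) div weight M"
  define K' where "K' = weight X div weight M"
  have X: "?P' ! i = X" using i by simp
  have k: "card (block_pairs n cs i i (Suc a, f) (b, g)) = K" if "cs \<in> tuples n P" for cs
    using card_block_pairs_same[OF that i P] weight_pos[of M] unfolding K_def by (metis nonzero_mult_div_cancel_right less_not_refl)
  have k': "card (block_pairs n cs i i (Suc b, g) (a, f)) = K'" if "cs \<in> tuples n ?P'" for cs
    using card_block_pairs_same[OF that, of i "(Suc b, g)" "(a, f)" M] weight_pos[of M] i unfolding K'_def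
    by (simp add: X_def add_mset_commute) (metis nonzero_mult_div_cancel_right less_not_refl)
  have "card (tuples n P) * K = card (tuples n ?P') * K'" by (rule switching[OF tr tree k k'])
  moreover have "weight M dvd weight (P ! i)" "weight M dvd weight X"
    unfolding P X_def weight_add by (intro dvd_mult dvd_refl)+
  then have "K * weight M = weight (P ! i)" "K' * weight M = weight X"
    unfolding K_def K'_def by (simp_all add: dvd_div_mult_self)
  ultimately show ?thesis by (metis mult.assoc)
qed

text \<open>The distinguished block swallows the other blocks of its factor letter by letter until
  only single fixed letters are left. Induction on the number of letters still to be moved.\<close>

lemma switch_to_hub:
  assumes "i < length P" "P ! i = add_mset (q, g) M" "q \<ge> 1" "\<forall>l\<in>#M. \<not> snd l \<and> fst l \<ge> 1" "tree_type n P"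
  defines "X \<equiv> hub (size M) (q + (\<Sum>l\<in>#M. fst l - 1), g)"
  shows "card (tuples n P) * weight (P ! i) = card (tuples n (P[i := X])) * weight X"
  using assms(1-5) unfolding X_def
proof (induction "\<Sum>l\<in>#M. fst l - 1" arbitrary: M q P)
  case 0
  then have "\<forall>l\<in>#M. l = (1, False)" by (force simp: prod_eq_iff)
  then have M: "M = replicate_mset (size M) (1, False)" by (intro set_mset_subset_singletonD) auto
  have "P[i := hub (size M) (q + (\<Sum>l\<in>#M. fst l - 1), g)] = P"
    using 0 M by (metis add.right_neutral hub_def list_update_id)
  moreover have "hub (size M) (q + (\<Sum>l\<in>#M. fst l - 1), g) = P ! i"
    using 0 M by (metis add.right_neutral hub_def)
  ultimately show ?case by simp
next
  case (Suc t)
  have "\<exists>l\<in>#M. fst l - 1 \<noteq> 0"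
  proof (rule ccontr)
    assume "\<not> (\<exists>l\<in>#M. fst l - 1 \<noteq> 0)"
    then have "(\<Sum>l\<in>#M. fst l - 1) = 0" by simp
    then show False using Suc.hyps(2) by linarith
  qed
  then obtain l where l: "l \<in># M" "fst l - 1 \<noteq> 0" by blast
  define a where "a = fst l - 1"
  have la: "l = (Suc a, False)" "a \<ge> 1" using l Suc.prems(4) by (auto simp: a_def prod_eq_iff)
  obtain M1 where M: "M = add_mset l M1" using l by (meson multi_member_split)
  let ?X = "add_mset (a, False) (add_mset (Suc q, g) M1)"
  have P: "P ! i = add_mset (Suc a, False) (add_mset (q, g) M1)" using Suc.prems(2) M la by (simp add: add_mset_commute)
  have 1: "card (tuples n P) * weight (P ! i) = card (tuples n (P[i := ?X])) * weight ?X"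
    by (rule switch_same_colour[OF Suc.prems(1) P la(2) Suc.prems(3,5)])
  have tr: "transfer P (P[i := ?X]) i i a False q g" unfolding transfer_def using P Suc.prems la by auto
  let ?P = "P[i := ?X]" and ?M = "add_mset (a, False) M1"
  have 2: "card (tuples n ?P) * weight (?P ! i) =
    card (tuples n (?P[i := hub (size ?M) (Suc q + (\<Sum>l\<in>#?M. fst l - 1), g)])) *
      weight (hub (size ?M) (Suc q + (\<Sum>l\<in>#?M. fst l - 1), g))"
  proof (rule Suc.hyps(1))
    show "t = (\<Sum>l\<in>#?M. fst l - 1)" using Suc.hyps(2) la unfolding M by simp
    show "?P ! i = add_mset (Suc q, g) ?M" using Suc.prems(1) by (simp add: add_mset_commute)
    show "\<forall>l\<in>#?M. \<not> snd l \<and> 1 \<le> fst l" using Suc.prems(4) la unfolding M by auto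
    show "tree_type n ?P" by (rule transfer_tree[OF tr Suc.prems(5)])
  qed (use Suc.prems in auto)
  have e: "Suc q + (\<Sum>l\<in>#?M. fst l - 1) = q + (\<Sum>l\<in>#M. fst l - 1)" "size ?M = size M"
    using la unfolding M by auto
  show ?case using 1 2[unfolded e] Suc.prems(1) by simp
qed

lemma weight_hub: "weight (hub k l) = (if l = (1, False) then fact (Suc k) else fact k)"
proof -
  have r: "weight (replicate_mset k (1, False)) = fact k" for k :: nat
    by (induction k) (auto simp: weight_add simp: weight_def[of "{#}"])
  show ?thesis unfolding hub_def weight_add r by (auto simp: algebra_simps)
qed

lemma Lam_trivial:
  assumes "w \<in> W_B n" "Lam n w = replicate_mset n (1, False)"
  shows "w = id"
proof -
  have "filter_mset (\<lambda>l. \<not> snd l) (replicate_mset n (1 :: nat, False)) = replicate_mset n (1, False)"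
    by (induction n) auto
  then have "num_A (Lam n w) = n" using assms(2) by (simp add: num_A_def)
  then show ?thesis using abs_length_0[OF assms(1)] abs_length_eq[OF assms(1)] by simp
qed

lemma Lam_id: "Lam n id = replicate_mset n (1, False)"
  using realisesD(5)[OF realises_Nil, of n] by simp

section \<open>Tuples of hubs\<close>

definition hubs :: "nat \<Rightarrow> nat \<Rightarrow> nat \<Rightarrow> (nat \<Rightarrow> nat) \<Rightarrow> (nat \<times> bool) multiset list" where
  "hubs n d j h = map (\<lambda>i. hub (n - h i) (h i, i = j)) [0..<d]"

text \<open>All factors other than j are forced to be the identity, and every type B cycle of length
  n is admissible as factor j.\<close>

lemma card_hubs_base:
  assumes "j < d" "n \<ge> 1"
  shows "card (tuples n (hubs n d j (\<lambda>i. if i = j then n else 1))) = card (full_B n)"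
proof -
  let ?P = "hubs n d j (\<lambda>i. if i = j then n else 1)"
  define emb where "emb w = (map (\<lambda>i. id) [0..<d])[j := w]" for w :: "int \<Rightarrow> int"
  have l: "length (emb w) = d" for w by (simp add: emb_def)
  have nth: "emb w ! i = (if i = j then w else id)" if "i < d" for i w using that assms by (simp add: emb_def nth_list_update)
  have Pn: "?P ! i = (if i = j then {#(n, True)#} else replicate_mset n (1, False))" if "i < d" for i
    using that assms by (cases n) (auto simp: hubs_def hub_def)
  have lP: "length ?P = d" by (simp add: hubs_def)
  have "prod_perm (emb w) = w" for w
  proof -
    have p: "prod_perm (map (\<lambda>i. id) xs) = id" for xs :: "nat list" by (induction xs) (simp_all add: prod_perm_simps)
    have "emb w = map (\<lambda>i. id) [0..<j] @ w # map (\<lambda>i. id) [Suc j..<d]"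
      using assms unfolding emb_def by (intro nth_equalityI) (auto simp: nth_list_update nth_append nth_Cons')
    then show ?thesis by (simp only: prod_perm_append prod_perm_simps p id_comp comp_id)
  qed
  note pe = this
  have "bij_betw emb (full_B n) (tuples n ?P)"
    unfolding bij_betw_def
  proof
    show "inj_on emb (full_B n)" using pe by (metis inj_onI)
    show "emb ` full_B n = tuples n ?P"
    proof
      show "emb ` full_B n \<subseteq> tuples n ?P"
      proof
        fix cs assume "cs \<in> emb ` full_B n"
        then obtain w where w: "w \<in> full_B n" "cs = emb w" by blast
        have W: "set cs \<subseteq> W_B n"
        proof
          fix c assume "c \<in> set cs"
          then obtain i where "i < d" "c = emb w ! i" using w l by (metis in_set_conv_nth)
          then show "c \<in> W_B n" using w nth by (auto simp: full_B_def W_B_id)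
        qed
        moreover have "map (Lam n) cs = ?P"
        proof (rule nth_equalityI)
          show "length (map (Lam n) cs) = length ?P" using w l lP by simp
          fix i assume "i < length (map (Lam n) cs)"
          then have "i < d" using w l by simp
          then show "map (Lam n) cs ! i = ?P ! i" using w l nth[of i w] Pn[of i]
            by (simp add: full_B_def Lam_id)
        qed
        moreover have "conn n cs" using full_B_conn[OF W] w pe by simp
        ultimately show "cs \<in> tuples n ?P" by (simp add: tuples_def)
      qed
      show "tuples n ?P \<subseteq> emb ` full_B n"
      proof
        fix cs assume "cs \<in> tuples n ?P"
        then have cs: "set cs \<subseteq> W_B n" "map (Lam n) cs = ?P" by (auto simp: tuples_def)
        have len: "length cs = d" using cs(2) lP by (metis length_map)
        have cn: "cs ! i \<in> W_B n" "Lam n (cs ! i) = ?P ! i" if "i < d" for i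
          using that cs len by (auto simp flip: cs(2))
        have "cs ! j \<in> full_B n" using cn[OF assms(1)] Pn[OF assms(1)] by (simp add: full_B_def)
        moreover have "cs = emb (cs ! j)"
        proof (rule nth_equalityI)
          show "length cs = length (emb (cs ! j))" by (simp add: len l)
          fix i assume i: "i < length cs"
          then have "cs ! i = id" if "i \<noteq> j" using cn[of i] Pn[of i] len that by (intro Lam_trivial) auto
          then show "cs ! i = emb (cs ! j) ! i" using nth[of i "cs ! j"] i len by simp
        qed
        ultimately show "cs \<in> emb ` full_B n" by blast
      qed
    qed
  qed
  then show ?thesis by (metis bij_betw_same_card)
qed

lemma sum_hubs:
  assumes "\<And>i. i < d \<Longrightarrow> 1 \<le> h i \<and> h i \<le> n"
  shows "(\<Sum>M\<leftarrow>hubs n d j h. size M) + (\<Sum>i<d. h i - 1) = n * d"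
proof -
  have "(\<Sum>M\<leftarrow>hubs n d j h. size M) = (\<Sum>i<d. n - h i + 1)"
    by (simp add: hubs_def hub_def comp_def interv_sum_list_conv_sum_set_nat atLeast0LessThan)
  moreover have "(\<Sum>i<d. n - h i + 1) + (\<Sum>i<d. h i - 1) = (\<Sum>i<d. n)"
    unfolding sum.distrib[symmetric] using assms by (intro sum.cong) fastforce+
  ultimately show ?thesis by simp
qed

text \<open>The other hubs give their letters to the flagged hub one by one. The step that reduces a
  hub to size 1 gives a factor n, since its block becomes one of n equal singletons. The product on
  the left belongs to the hubs of size 1 that are present at the start and never give this
  factor.\<close>

lemma card_hubs:
  assumes "j < d" "n \<ge> 1" "\<And>i. i < d \<Longrightarrow> 1 \<le> h i \<and> h i \<le> n" "(\<Sum>i<d. h i - 1) + 1 = n"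
  shows "card (tuples n (hubs n d j h)) * (\<Prod>i\<in>{..<d} - {j}. if h i = 1 then n else 1) =
    n ^ (d - 1) * card (full_B n)"
  using assms(3,4)
proof (induction "\<Sum>i\<in>{..<d} - {j}. h i - 1" arbitrary: h)
  case 0
  have h1: "h i = 1" if "i < d" "i \<noteq> j" for i
  proof -
    have "h i - 1 = 0" using 0(1) that by simp
    then show ?thesis using 0(2)[OF that(1)] by simp
  qed
  have "(\<Sum>i<d. h i - 1) = (h j - 1) + (\<Sum>i\<in>{..<d} - {j}. h i - 1)"
    using assms(1) by (intro sum.remove) auto
  then have "h j = n" using 0 0(2)[OF assms(1)] by linarith
  then have "hubs n d j h = hubs n d j (\<lambda>i. if i = j then n else 1)"
    using h1 unfolding hubs_def by (intro map_cong) auto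
  moreover have "(\<Prod>i\<in>{..<d} - {j}. if h i = 1 then n else 1) = (\<Prod>i\<in>{..<d} - {j}. n)"
    using h1 by (intro prod.cong) auto
  ultimately show ?case using card_hubs_base[OF assms(1,2)] assms(1) by simp
next
  case (Suc t)
  have "\<exists>i\<in>{..<d} - {j}. h i - 1 \<noteq> 0"
  proof (rule ccontr)
    assume "\<not> (\<exists>i\<in>{..<d} - {j}. h i - 1 \<noteq> 0)"
    then have "(\<Sum>i\<in>{..<d} - {j}. h i - 1) = 0" by simp
    then show False using Suc.hyps(2) by simp
  qed
  then obtain i where i: "i < d" "i \<noteq> j" "h i - 1 \<noteq> 0" by blast
  define a where "a = h i - 1"
  have ha: "h i = Suc a" "a \<ge> 1" using i by (auto simp: a_def)
  have sj: "(\<Sum>i<d. h i - 1) = (h j - 1) + (\<Sum>i\<in>{..<d} - {j}. h i - 1)"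
    using assms(1) by (intro sum.remove) auto
  have hj: "1 \<le> h j" "h j < n" using Suc.prems(1)[OF assms(1)] Suc.prems(2) Suc.hyps(2) sj by auto
  define h' where "h' = h(i := a, j := Suc (h j))"
  let ?P = "hubs n d j h" and ?P' = "hubs n d j h'"
  have tree: "tree_type n ?P" unfolding tree_type_def using sum_hubs[of d h n j, OF Suc.prems(1)] Suc.prems(2)
    by (simp add: hubs_def)
  have Pi: "?P ! i = hub (n - h i) (Suc a, False)" "?P ! j = hub (n - h j) (h j, True)"
    "?P' ! i = hub (n - a) (a, False)" "?P' ! j = hub (n - Suc (h j)) (Suc (h j), True)"
    using i assms(1) ha by (auto simp: hubs_def h'_def)
  have "Suc (n - h i) = n - a" using ha Suc.prems(1)[OF i(1)] by linarith
  moreover have "n - h j = Suc (n - Suc (h j))" using hj by linarith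
  moreover have "?P' = ?P[i := ?P' ! i, j := ?P' ! j]"
    using i assms(1) by (intro nth_equalityI) (auto simp: hubs_def h'_def nth_list_update)
  ultimately have "?P ! i = hub (n - h i) (Suc a, False) \<and> ?P ! j = hub (Suc (n - Suc (h j))) (h j, True) \<and>
     ?P' = ?P[i := hub (Suc (n - h i)) (a, False), j := hub (n - Suc (h j)) (Suc (h j), True)]"
    using Pi by simp
  then have ex: "\<exists>k m. ?P ! i = hub k (Suc a, False) \<and> ?P ! j = hub (Suc m) (h j, True) \<and>
     ?P' = ?P[i := hub (Suc k) (a, False), j := hub m (Suc (h j), True)]" by blast
  have "length ?P = d" by (simp add: hubs_def)
  then have tr: "transfer ?P ?P' i j a False (h j) True"
    unfolding transfer_def if_not_P[OF i(2)] using i(1) assms(1) ha(2) hj(1) ex by (intro conjI) simp_all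
  have lens: "i < length ?P" "j < length ?P" "i < length ?P'" "j < length ?P'"
    using i assms(1) by (simp_all add: hubs_def)
  have "count (?P ! i) (Suc a, False) = 1" using ha unfolding Pi hub_def by simp
  moreover have "count (?P ! j) (h j, True) = 1" unfolding Pi hub_def by simp
  ultimately have K: "card (block_pairs n cs i j (Suc a, False) (h j, True)) = 1" if "cs \<in> tuples n ?P" for cs
    using card_block_pairs_diff[OF that lens(1,2) i(2)] by simp
  have an: "a \<le> n" using ha Suc.prems(1)[OF i(1)] by simp
  \<comment> \<open>A hub of size 1 consists of n labels (1, False); otherwise only its large block
    has the label.\<close>
  have "count (?P' ! i) (a, False) = (if a = 1 then n else 1)" using assms(2) unfolding Pi hub_def by auto
  moreover have "count (?P' ! j) (Suc (h j), True) = 1" unfolding Pi hub_def by simp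
  ultimately have K': "card (block_pairs n cs j i (Suc (h j), True) (a, False)) = (if a = 1 then n else 1)"
    if "cs \<in> tuples n ?P'" for cs
    using card_block_pairs_diff[OF that lens(4,3)] i(2) by simp
  have sw: "card (tuples n ?P) * 1 = card (tuples n ?P') * (if a = 1 then n else 1)"
    by (rule switching[OF tr tree K K'])
  have si: "(\<Sum>i\<in>{..<d} - {j}. g i - 1) = (g i - 1) + (\<Sum>i\<in>{..<d} - {j} - {i}. g i - 1)" for g :: "nat \<Rightarrow> nat"
    using i by (intro sum.remove) auto
  have rest: "(\<Sum>k\<in>{..<d} - {j} - {i}. h' k - 1) = (\<Sum>k\<in>{..<d} - {j} - {i}. h k - 1)"
    by (intro sum.cong) (auto simp: h'_def)
  have t: "t = (\<Sum>i\<in>{..<d} - {j}. h' i - 1)"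
    using Suc.hyps(2) ha i unfolding si[of h'] si[of h] rest by (simp add: h'_def)
  have "(\<Sum>i<d. h' i - 1) = (h' j - 1) + (\<Sum>i\<in>{..<d} - {j}. h' i - 1)"
    using assms(1) by (intro sum.remove) auto
  then have "(\<Sum>i<d. h' i - 1) + 1 = n" unfolding t[symmetric] using Suc.prems(2) Suc.hyps(2) hj unfolding sj
    by (simp add: h'_def)
  moreover have "1 \<le> h' k \<and> h' k \<le> n" if "k < d" for k
    using Suc.prems(1)[OF that] ha an hj by (auto simp: h'_def)
  ultimately have IH: "card (tuples n ?P') * (\<Prod>i\<in>{..<d} - {j}. if h' i = 1 then n else 1) = n ^ (d - 1) * card (full_B n)"
    using Suc.hyps(1)[OF t] by blast
  have pi: "(\<Prod>k\<in>{..<d} - {j}. if g k = 1 then n else 1) =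
      (if g i = 1 then n else 1) * (\<Prod>k\<in>{..<d} - {j} - {i}. if g k = 1 then n else 1)" for g :: "nat \<Rightarrow> nat"
    using i by (intro prod.remove) auto
  have "(\<Prod>k\<in>{..<d} - {j} - {i}. if h' k = 1 then n else 1) = (\<Prod>k\<in>{..<d} - {j} - {i}. if h k = 1 then n else 1)"
    by (intro prod.cong) (auto simp: h'_def)
  then show ?case using IH sw ha i unfolding pi[of h'] pi[of h] by (simp add: h'_def algebra_simps)
qed

lemma filter_mset_eq_empty: "filter_mset Q M = {#} \<longleftrightarrow> (\<forall>x\<in>#M. \<not> Q x)"
  by (induction M) auto

text \<open>Contract every factor to a hub at the price of weights, then apply
  \<open>card_hubs\<close>. In the end only the numbers of blocks survive on the right.\<close>

lemma card_tuples:
  assumes n: "n \<ge> 1" and j: "j < length P" and tree: "tree_type n P"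
    and sums: "\<And>i. i < length P \<Longrightarrow> (\<Sum>l\<in>#P ! i. fst l) = n"
    and pos: "\<And>i l. i < length P \<Longrightarrow> l \<in># P ! i \<Longrightarrow> fst l \<ge> 1"
    and Pj: "num_B (P ! j) = 1" and Pi: "\<And>i. i < length P \<Longrightarrow> i \<noteq> j \<Longrightarrow> num_B (P ! i) = 0"
  shows "card (tuples n P) * (\<Prod>i<length P. weight (P ! i)) =
    n ^ (length P - 1) * card (full_B n) * (fact (size (P ! j) - 1) * (\<Prod>i\<in>{..<length P} - {j}. fact (size (P ! i) - 1)))"
proof -
  let ?d = "length P"
  \<comment> \<open>The size of the hub that has as many blocks as factor i: one block of size h i
    and n - h i single letters.\<close>
  define h where "h i = n + 1 - size (P ! i)" for i
  have ex: "\<exists>q M. P ! i = add_mset (q, i = j) M \<and> (\<forall>l\<in>#M. \<not> snd l)" if i: "i < ?d" for i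
  proof (cases "i = j")
    case True
    have "filter_mset snd (P ! i) \<noteq> {#}"
    proof
      assume "filter_mset snd (P ! i) = {#}"
      then have "num_B (P ! i) = 0" by (simp add: num_B_def)
      then show False using Pj True by simp
    qed
    then obtain l where "l \<in># filter_mset snd (P ! i)" by (meson multiset_nonemptyE)
    then have l: "l \<in># P ! i" "snd l" by auto
    then obtain M where M: "P ! i = add_mset l M" by (meson multi_member_split)
    then have "filter_mset snd M = {#}" using Pj True l by (simp add: num_B_def)
    then have "\<forall>l\<in>#M. \<not> snd l" by (simp only: filter_mset_eq_empty)
    then show ?thesis using M l True by (intro exI[of _ "fst l"] exI[of _ M]) (cases l, auto)
  next
    case False
    have "P ! i \<noteq> {#}" using sums[OF i] n by auto
    then obtain l where l: "l \<in># P ! i" by (meson multiset_nonemptyE)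
    have "filter_mset snd (P ! i) = {#}" using Pi[OF i False] by (simp add: num_B_def)
    then have u: "\<forall>l\<in>#P ! i. \<not> snd l" by (simp only: filter_mset_eq_empty)
    obtain M where M: "P ! i = add_mset l M" using l by (meson multi_member_split)
    then show ?thesis using u False by (intro exI[of _ "fst l"] exI[of _ M]) (cases l, auto)
  qed
  define H where "H i = hub (n - h i) (h i, i = j)" for i
  \<comment> \<open>The intermediate stages, with the first k factors already contracted.\<close>
  define Q where "Q k = map (\<lambda>i. if i < k then H i else P ! i) [0..<?d]" for k
  have sizes: "1 \<le> size (P ! i) \<and> size (P ! i) \<le> n" if i: "i < ?d" for i
  proof -
    obtain q M where "P ! i = add_mset (q, i = j) M" using ex[OF i] by blast
    then have "1 \<le> size (P ! i)" by simp
    moreover have "size (P ! i) \<le> (\<Sum>l\<in>#P ! i. fst l)"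
    proof -
      have "size N \<le> (\<Sum>l\<in>#N. fst l)" if "\<And>l. l \<in># N \<Longrightarrow> fst l \<ge> 1" for N :: "(nat \<times> bool) multiset"
        using that
      proof (induction N)
        case (add x N)
        then have "size N \<le> (\<Sum>l\<in>#N. fst l)" "fst x \<ge> 1" by auto
        then show ?case by simp
      qed simp
      then show ?thesis using pos[OF i] by blast
    qed
    ultimately show ?thesis using sums[OF i] by simp
  qed
  have sH: "size (H i) = size (P ! i)" if "i < ?d" for i using sizes[OF that] by (simp add: H_def hub_def h_def)
  have treeQ: "tree_type n (Q k)" for k
  proof -
    have "map size (Q k) = map size P" unfolding Q_def using sH by (intro nth_equalityI) auto
    moreover have "length (Q k) = length P" by (simp add: Q_def)
    ultimately show ?thesis using tree by (simp add: tree_type_def)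
  qed
  have step: "card (tuples n P) * (\<Prod>i<k. weight (P ! i)) = card (tuples n (Q k)) * (\<Prod>i<k. weight (H i))"
    if "k \<le> ?d" for k using that
  proof (induction k)
    case 0
    have "Q 0 = P" by (simp add: Q_def map_nth)
    then show ?case by simp
  next
    case (Suc k)
    then have k: "k < ?d" by simp
    obtain q M where M: "P ! k = add_mset (q, k = j) M" "\<forall>l\<in>#M. \<not> snd l" using ex[OF k] by blast
    have q1: "q \<ge> 1" using pos[OF k, of "(q, k = j)"] M(1) by simp
    have Qk: "Q k ! k = P ! k" "k < length (Q k)" using k by (simp_all add: Q_def)
    have "size M + (\<Sum>l\<in>#M. fst l - 1) = (\<Sum>l\<in>#M. fst l)"
    proof -
      have "\<And>l. l \<in># M \<Longrightarrow> fst l \<ge> 1" using pos[OF k] M by simp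
      then show ?thesis
      proof (induction M)
        case (add x M)
        then have "size M + (\<Sum>l\<in>#M. fst l - 1) = (\<Sum>l\<in>#M. fst l)" "fst x \<ge> 1" by auto
        then show ?case by simp
      qed simp
    qed
    then have hk: "q + (\<Sum>l\<in>#M. fst l - 1) = h k" "size M = n - h k"
      using sums[OF k] sizes[OF k] M(1) pos[OF k, of "(q, k = j)"] by (auto simp: h_def)
    have "card (tuples n (Q k)) * weight (Q k ! k) = card (tuples n ((Q k)[k := H k])) * weight (H k)"
      using switch_to_hub[OF Qk(2), of q "k = j" M n] M pos[OF k] treeQ Qk(1) q1
      unfolding hk(1) unfolding hk(2) H_def[symmetric] by auto
    moreover have "(Q k)[k := H k] = Q (Suc k)"
      using k by (intro nth_equalityI) (auto simp: Q_def nth_list_update)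
    ultimately have s: "card (tuples n (Q k)) * weight (P ! k) = card (tuples n (Q (Suc k))) * weight (H k)"
      using Qk(1) by simp
    have "card (tuples n P) * (\<Prod>i<Suc k. weight (P ! i)) = (card (tuples n P) * (\<Prod>i<k. weight (P ! i))) * weight (P ! k)"
      by simp
    also have "\<dots> = (card (tuples n (Q k)) * weight (P ! k)) * (\<Prod>i<k. weight (H i))"
      using Suc by simp
    also have "\<dots> = card (tuples n (Q (Suc k))) * (\<Prod>i<Suc k. weight (H i))" unfolding s by simp
    finally show ?case .
  qed
  have Qd: "Q ?d = hubs n ?d j h" by (simp add: Q_def hubs_def H_def)
  have hb: "1 \<le> h i \<and> h i \<le> n" if "i < ?d" for i using sizes[OF that] by (auto simp: h_def)
  have "(\<Sum>M\<leftarrow>hubs n ?d j h. size M) + n = n * ?d + 1"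
    using treeQ[of ?d] unfolding Qd tree_type_def by (simp add: hubs_def)
  then have "(\<Sum>i<?d. h i - 1) + 1 = n" using sum_hubs[of ?d h n j, OF hb] by linarith
  then have main: "card (tuples n (hubs n ?d j h)) * (\<Prod>i\<in>{..<?d} - {j}. if h i = 1 then n else 1) =
    n ^ (?d - 1) * card (full_B n)" by (intro card_hubs[OF j n] hb)
  \<comment> \<open>A hub of size 1 is indistinguishable from its n - 1 singletons, so its weight is
    n! instead of (n - 1)!. The extra n is the factor that \<open>card_hubs\<close> attaches to such
    hubs.\<close>
  have wi: "weight (H i) = (if h i = 1 then n else 1) * fact (size (P ! i) - 1)" if "i \<in> {..<?d} - {j}" for i
  proof -
    have i: "i < ?d" "(i = j) = False" using that by auto
    have d: "n - h i = size (P ! i) - 1" using sizes[OF i(1)] by (simp add: h_def)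
    have H: "H i = hub (n - h i) (h i, False)" unfolding H_def i(2) ..
    show ?thesis
    proof (cases "h i = 1")
      case True
      then have "size (P ! i) = n" using sizes[OF i(1)] by (simp add: h_def)
      moreover have "weight (H i) = fact (Suc (n - 1))" unfolding H weight_hub True by simp
      then have "weight (H i) = n * fact (n - 1)" using n by (simp add: fact_reduce)
      ultimately show ?thesis using True by simp
    next
      case False
      then show ?thesis unfolding H weight_hub d by simp
    qed
  qed
  have wj: "weight (H j) = fact (size (P ! j) - 1)"
  proof -
    have "n - h j = size (P ! j) - 1" using sizes[OF j] by (auto simp: h_def)
    then show ?thesis unfolding H_def weight_hub by simp
  qed
  have "(\<Prod>i<?d. weight (H i)) = weight (H j) * (\<Prod>i\<in>{..<?d} - {j}. weight (H i))"
    using j by (intro prod.remove) auto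
  also have "(\<Prod>i\<in>{..<?d} - {j}. weight (H i)) =
    (\<Prod>i\<in>{..<?d} - {j}. (if h i = 1 then n else 1) * fact (size (P ! i) - 1))"
    using wi by (intro prod.cong) auto
  finally have W: "(\<Prod>i<?d. weight (H i)) = fact (size (P ! j) - 1) *
     ((\<Prod>i\<in>{..<?d} - {j}. if h i = 1 then n else 1) * (\<Prod>i\<in>{..<?d} - {j}. fact (size (P ! i) - 1)))"
    by (simp only: wj prod.distrib)
  have "card (tuples n P) * (\<Prod>i<?d. weight (P ! i)) = card (tuples n (hubs n ?d j h)) * (\<Prod>i<?d. weight (H i))"
    using step[of ?d] unfolding Qd by simp
  also have "\<dots> = (card (tuples n (hubs n ?d j h)) * (\<Prod>i\<in>{..<?d} - {j}. if h i = 1 then n else 1)) *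
     (fact (size (P ! j) - 1) * (\<Prod>i\<in>{..<?d} - {j}. fact (size (P ! i) - 1)))"
    unfolding W by (simp only: ac_simps)
  finally show ?thesis unfolding main .
qed

section \<open>Combinatorial decomposition numbers\<close>

definition dec :: "nat \<Rightarrow> (nat \<times> bool) multiset list \<Rightarrow> (int \<Rightarrow> int) list set" where
  "dec n P = {cs. set cs \<subseteq> W_B n \<and> map (Lam n) cs = P \<and> prod_perm cs = cox n}"

lemma tuples_full_B:
  assumes n: "n \<ge> 1" and tree: "tree_type n P" and odd: "odd (\<Sum>M\<leftarrow>P. num_B M)"
  shows "tuples n P = {cs. set cs \<subseteq> W_B n \<and> map (Lam n) cs = P \<and> prod_perm cs \<in> full_B n}"
proof -
  have "conn n cs \<longleftrightarrow> prod_perm cs \<in> full_B n" if W: "set cs \<subseteq> W_B n" and L: "map (Lam n) cs = P" for cs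
  proof
    assume c: "conn n cs"
    have "odd (\<Sum>c\<leftarrow>cs. num_B (Lam n c))" using odd unfolding L[symmetric] by (simp add: comp_def)
    then show "prod_perm cs \<in> full_B n"
      by (rule conn_full_B[OF n W c tuples_tree[OF tree L W]])
  qed (rule full_B_conn[OF W])
  then show ?thesis unfolding tuples_def by blast
qed

lemma prod_perm_conj_list:
  assumes "g \<in> W_B n" "set cs \<subseteq> W_B n"
  shows "set (map (\<lambda>c. g \<circ> c \<circ> inv g) cs) \<subseteq> W_B n" "map (Lam n) (map (\<lambda>c. g \<circ> c \<circ> inv g) cs) = map (Lam n) cs"
    "prod_perm (map (\<lambda>c. g \<circ> c \<circ> inv g) cs) = g \<circ> prod_perm cs \<circ> inv g"
proof -
  show "set (map (\<lambda>c. g \<circ> c \<circ> inv g) cs) \<subseteq> W_B n"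
  proof
    fix x assume "x \<in> set (map (\<lambda>c. g \<circ> c \<circ> inv g) cs)"
    then obtain c where "c \<in> set cs" "x = g \<circ> c \<circ> inv g" unfolding set_map by blast
    then show "x \<in> W_B n" using assms by (auto intro!: W_B_comp W_B_inv)
  qed
  show "map (Lam n) (map (\<lambda>c. g \<circ> c \<circ> inv g) cs) = map (Lam n) cs"
  proof -
    have "Lam n (g \<circ> c \<circ> inv g) = Lam n c" if "c \<in> set cs" for c
      using Lam_conj[OF assms(1)] assms(2) that by blast
    then show ?thesis unfolding map_map by (intro map_cong HOL.refl) (simp only: comp_apply)
  qed
  show "prod_perm (map (\<lambda>c. g \<circ> c \<circ> inv g) cs) = g \<circ> prod_perm cs \<circ> inv g"
    by (rule conj_prod_perm[OF W_B_bij[OF assms(1)], symmetric])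
qed

text \<open>Simultaneous conjugation preserves the cycle types of all factors, so the product map
  from tuples to the class of c has fibres of equal size.\<close>

lemma card_tuples_dec:
  assumes n: "n \<ge> 1" and tree: "tree_type n P" and odd: "odd (\<Sum>M\<leftarrow>P. num_B M)"
  shows "card (tuples n P) = card (full_B n) * card (dec n P)"
proof -
  define fib where "fib w = {cs. set cs \<subseteq> W_B n \<and> map (Lam n) cs = P \<and> prod_perm cs = w}" for w
  have T: "tuples n P = (\<Union>w\<in>full_B n. fib w)"
    unfolding tuples_full_B[OF assms] fib_def by blast
  have fin: "finite (fib w)" if "w \<in> full_B n" for w
    by (rule finite_subset[OF _ finite_tuples[of n P]]) (use that T in blast)
  have finB: "finite (full_B n)" using finite_W_B[of n] by (rule rev_finite_subset) (auto simp: full_B_def)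
  have "card (fib w) = card (dec n P)" if w: "w \<in> full_B n" for w
  proof -
    obtain g where g: "g \<in> W_B n" "w = g \<circ> cox n \<circ> inv g" using full_B_conj[OF w] by blast
    have gi: "inv g \<in> W_B n" "inv (inv g) = g" using W_B_inv[OF g(1)] W_B_inv_cancel(5)[OF g(1)] .
    have c1: "g \<circ> (inv g \<circ> c \<circ> g) \<circ> inv g = c" "inv g \<circ> (g \<circ> c \<circ> inv g) \<circ> g = c" for c
      by (simp_all add: fun_eq_iff W_B_inv_cancel(3,4)[OF g(1)])
    have "bij_betw (map (\<lambda>c. g \<circ> c \<circ> inv g)) (dec n P) (fib w)"
    proof (rule bij_betw_byWitness[where f' = "map (\<lambda>c. inv g \<circ> c \<circ> g)"])
      show "\<forall>a\<in>dec n P. map (\<lambda>c. inv g \<circ> c \<circ> g) (map (\<lambda>c. g \<circ> c \<circ> inv g) a) = a"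
        unfolding map_map by (intro ballI map_idI) (simp only: comp_apply[of "\<lambda>c. inv g \<circ> c \<circ> g"] c1)
      show "\<forall>a\<in>fib w. map (\<lambda>c. g \<circ> c \<circ> inv g) (map (\<lambda>c. inv g \<circ> c \<circ> g) a) = a"
        unfolding map_map by (intro ballI map_idI) (simp only: comp_apply[of "\<lambda>c. g \<circ> c \<circ> inv g"] c1)
      show "map (\<lambda>c. g \<circ> c \<circ> inv g) ` dec n P \<subseteq> fib w"
      proof
        fix cs assume "cs \<in> map (\<lambda>c. g \<circ> c \<circ> inv g) ` dec n P"
        then obtain ds where ds: "set ds \<subseteq> W_B n" "map (Lam n) ds = P" "prod_perm ds = cox n"
          "cs = map (\<lambda>c. g \<circ> c \<circ> inv g) ds" unfolding dec_def by blast
        show "cs \<in> fib w" unfolding fib_def mem_Collect_eq ds(4)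
          by (simp only: prod_perm_conj_list[OF g(1) ds(1)] ds(2,3) g(2) simp_thms)
      qed
      show "map (\<lambda>c. inv g \<circ> c \<circ> g) ` fib w \<subseteq> dec n P"
      proof
        fix cs assume "cs \<in> map (\<lambda>c. inv g \<circ> c \<circ> g) ` fib w"
        then obtain ds where ds: "set ds \<subseteq> W_B n" "map (Lam n) ds = P" "prod_perm ds = w"
          "cs = map (\<lambda>c. inv g \<circ> c \<circ> g) ds" unfolding fib_def by blast
        show "cs \<in> dec n P" unfolding dec_def mem_Collect_eq ds(4)
          using prod_perm_conj_list[OF gi(1) ds(1), unfolded gi(2)]
          by (simp only: ds(2,3) g(2) c1 simp_thms)
      qed
    qed
    then show ?thesis by (metis bij_betw_same_card)
  qed
  moreover have "card (tuples n P) = (\<Sum>w\<in>full_B n. card (fib w))"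
    unfolding T using fin finB by (intro card_UN_disjoint) (auto simp: fib_def)
  ultimately show ?thesis by simp
qed

section \<open>Rank, absolute length and cycle type\<close>

lemma sum_fst_Lam: assumes "w \<in> W_B n" shows "(\<Sum>l\<in>#Lam n w. fst l) = n"
proof -
  have "image_mset fst (Lam n w) = image_mset card (mset_set (blocks n w))"
    unfolding Lam_def image_mset.compositionality by (intro image_mset_cong) (simp add: lab_def)
  then show ?thesis using sum_card_blocks[OF assms] by (simp only: sum_unfold_sum_mset)
qed

lemma Lam_pos: assumes "w \<in> W_B n" "l \<in># Lam n w" shows "fst l \<ge> 1"
proof -
  obtain b where "b \<in> blocks n w" "l = lab w b" using assms(2) by (auto simp: Lam_def finite_blocks)
  then show ?thesis using block_props(5)[OF assms(1), of b] by (simp add: lab_def)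
qed

lemma rk_ctype:
  assumes "\<And>l. l \<in># M \<Longrightarrow> fst l \<ge> 1"
  shows "rk (ctype M) + num_A M = (\<Sum>l\<in>#M. fst l)"
  using assms
proof (induction M)
  case empty
  then show ?case by (simp add: ctype_def rk_def num_A_def)
next
  case (add l M)
  then have IH: "rk (ctype M) + num_A M = (\<Sum>l\<in>#M. fst l)" and "fst l \<ge> 1" by auto
  then show ?case by (cases "l = (1, False)"; cases "snd l") (auto simp: ctype_def rk_def num_A_def)
qed

lemma rk_ctype_Lam:
  assumes "w \<in> W_B n" shows "rk (ctype (Lam n w)) = abs_length n w"
proof -
  have "rk (ctype (Lam n w)) + num_A (Lam n w) = (\<Sum>l\<in>#Lam n w. fst l)"
    by (rule rk_ctype) (rule Lam_pos[OF assms])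
  then have "rk (ctype (Lam n w)) + num_A (Lam n w) = n" unfolding sum_fst_Lam[OF assms] .
  then show ?thesis unfolding abs_length_eq[OF assms] by linarith
qed

lemma abs_length_reflection_word_inv:
  assumes "w \<in> W_B n" "v \<in> W_B n" "abs_length n (inv w \<circ> v) = 0"
  shows "w = v"
proof -
  have "inv w \<circ> v = id" by (rule abs_length_0[OF W_B_comp[OF W_B_inv[OF assms(1)] assms(2)] assms(3)])
  then have "w \<circ> (inv w \<circ> v) = w" by simp
  then show ?thesis by (simp add: W_B_inv_cancel(2)[OF assms(1)] flip: comp_assoc)
qed

text \<open>An element below c whose absolute length is already n, that of c, differs from c by an
  element of length 0.\<close>

lemma decomposition_iff:
  assumes n: "n \<ge> 1" and W: "set cs \<subseteq> W_B n" and rank: "(\<Sum>c\<leftarrow>cs. abs_length n c) = n"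
  shows "abs_le n (prod_perm cs) (cox n) \<and> (\<Sum>c\<leftarrow>cs. abs_length n c) = abs_length n (prod_perm cs) \<longleftrightarrow>
    prod_perm cs = cox n"
proof -
  have c: "cox n \<in> full_B n" by (rule cox_full_B[OF n])
  then have cW: "cox n \<in> W_B n" by (simp add: full_B_def)
  have cl: "abs_length n (cox n) = n" using abs_length_eq[OF cW] num_B_full_B[OF c] by simp
  have pW: "prod_perm cs \<in> W_B n" by (rule prod_perm_W_B[OF W])
  show ?thesis
  proof
    assume "abs_le n (prod_perm cs) (cox n) \<and> (\<Sum>c\<leftarrow>cs. abs_length n c) = abs_length n (prod_perm cs)"
    then have "abs_length n (inv (prod_perm cs) \<circ> cox n) = 0" using rank cl by (simp add: abs_le_def)
    then show "prod_perm cs = cox n" by (rule abs_length_reflection_word_inv[OF pW cW])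
  next
    assume p: "prod_perm cs = cox n"
    show "abs_le n (prod_perm cs) (cox n) \<and> (\<Sum>c\<leftarrow>cs. abs_length n c) = abs_length n (prod_perm cs)"
      unfolding abs_le_def p W_B_inv_cancel(1)[OF cW] abs_length_id using rank cl by simp
  qed
qed

section \<open>Cycle types belonging to given types\<close>

fun lam_irr :: "irr_type \<Rightarrow> nat \<times> bool" where
  "lam_irr (Type_A k) = (Suc k, False)"
| "lam_irr (Type_B k) = (k, True)"
| "lam_irr _ = (0, False)"

text \<open>Completes the cycles of T by fixed letters. If T takes more than n letters, the
  truncated difference is 0 and the sizes exceed n, so that no element of W(B_n) has this cycle
  type.\<close>

definition lamT :: "nat \<Rightarrow> refl_type \<Rightarrow> (nat \<times> bool) multiset" where
  "lamT n T = image_mset lam_irr T + replicate_mset (n - (\<Sum>X\<in>#T. fst (lam_irr X))) (1, False)"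

lemma lamT_ctype:
  assumes "\<And>l. l \<in># M \<Longrightarrow> fst l \<ge> 1"
  shows "lamT (\<Sum>l\<in>#M. fst l) (ctype M) = M"
proof -
  have "\<exists>k. M = image_mset lam_irr (ctype M) + replicate_mset k (1, False)"
    using assms
  proof (induction M)
    case (add l M)
    then obtain k where k: "M = image_mset lam_irr (ctype M) + replicate_mset k (1, False)" by auto
    have "fst l \<ge> 1" using add.prems by simp
    then show ?case
    proof (cases "l = (1, False)")
      case True
      then have "ctype (add_mset l M) = ctype M" by (simp add: ctype_def)
      then show ?thesis using k True by (intro exI[of _ "Suc k"]) simp
    next
      case False
      then have "image_mset lam_irr (ctype (add_mset l M)) = add_mset l (image_mset lam_irr (ctype M))"
        using \<open>fst l \<ge> 1\<close> by (cases l) (auto simp: ctype_def)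
      then show ?thesis using k by (intro exI[of _ k]) simp
    qed
  qed (auto simp: ctype_def)
  then obtain k where k: "M = image_mset lam_irr (ctype M) + replicate_mset k (1, False)" by blast
  have "(\<Sum>l\<in>#M. fst l) = (\<Sum>X\<in>#ctype M. fst (lam_irr X)) + k"
    by (subst k) (simp add: image_mset.compositionality comp_def)
  then show ?thesis unfolding lamT_def using k by simp
qed

lemma ctype_lamT:
  assumes "is_comb_type T" shows "ctype (lamT n T) = T"
proof -
  have r: "ctype (M + replicate_mset k (1, False)) = ctype M" for M k by (induction k) (auto simp: ctype_def)
  have "ctype (image_mset lam_irr T) = T"
    using assms unfolding is_comb_type_def
  proof (induction T)
    case (add X T)
    then obtain k where "k \<ge> 1" "X = Type_A k \<or> X = Type_B k" by auto
    then show ?case using add by (auto simp: ctype_def)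
  qed (simp add: ctype_def)
  then show ?thesis by (simp only: lamT_def r)
qed

lemma has_comb_type_lamT:
  assumes W: "w \<in> W_B n" and T: "is_comb_type T"
  shows "has_comb_type w T \<longleftrightarrow> Lam n w = lamT n T"
proof
  assume "has_comb_type w T"
  then have "T = ctype (Lam n w)" by (simp add: has_comb_type_iff[OF W])
  then show "Lam n w = lamT n T" using lamT_ctype[of "Lam n w"] Lam_pos[OF W] sum_fst_Lam[OF W] by simp
next
  assume "Lam n w = lamT n T"
  then show "has_comb_type w T" using has_comb_type_iff[OF W] ctype_lamT[OF T] by simp
qed

lemma comb_decompositions:
  assumes n: "n \<ge> 1" and Ts: "\<forall>T\<in>set Ts. is_comb_type T" and rank: "(\<Sum>T\<leftarrow>Ts. rk T) = n"
  shows "decompositions n has_comb_type Ts = dec n (map (lamT n) Ts)"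
proof -
  have "cs \<in> decompositions n has_comb_type Ts \<longleftrightarrow> cs \<in> dec n (map (lamT n) Ts)" for cs
  proof (cases "length cs = length Ts \<and> set cs \<subseteq> W_B n")
    case True
    then have W: "set cs \<subseteq> W_B n" and len: "length cs = length Ts" by auto
    have cW: "cs ! i \<in> W_B n" "is_comb_type (Ts ! i)" if "i < length Ts" for i
      using that W len Ts by (auto simp: nth_mem subset_iff)
    have t: "(\<forall>i<length Ts. has_comb_type (cs ! i) (Ts ! i)) \<longleftrightarrow> map (Lam n) cs = map (lamT n) Ts"
      using has_comb_type_lamT[OF cW] len by (auto simp: list_eq_iff_nth_eq)
    have r: "(\<Sum>c\<leftarrow>cs. abs_length n c) = n" if ht: "\<forall>i<length Ts. has_comb_type (cs ! i) (Ts ! i)"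
    proof -
      have "abs_length n (cs ! i) = rk (Ts ! i)" if i: "i < length Ts" for i
      proof -
        have "Ts ! i = ctype (Lam n (cs ! i))"
          using ht i has_comb_type_iff[OF cW(1)[OF i], of "Ts ! i"] by blast
        then show ?thesis using rk_ctype_Lam[OF cW(1)[OF i]] by simp
      qed
      then have "map (abs_length n) cs = map rk Ts"
        using len by (intro nth_equalityI) auto
      then show ?thesis using rank by metis
    qed
    show ?thesis unfolding decompositions_def dec_def mem_Collect_eq
      using True t decomposition_iff[OF n W] r by blast
  next
    case False
    then show ?thesis unfolding decompositions_def dec_def by (auto dest: map_eq_imp_length_eq)
  qed
  then show ?thesis by blast
qed

lemma num_B_lamT: "num_B (lamT n T) = size (filter_mset (\<lambda>X. snd (lam_irr X)) T)"
proof -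
  have "filter_mset snd (replicate_mset k (1 :: nat, False)) = {#}" for k by (induction k) auto
  then show ?thesis by (simp add: num_B_def lamT_def filter_mset_image_mset)
qed

lemma dec_num_B:
  assumes n: "n \<ge> 1" and cs: "set cs \<subseteq> W_B n" "prod_perm cs = cox n" and rank: "(\<Sum>c\<leftarrow>cs. abs_length n c) = n"
  shows "(\<Sum>c\<leftarrow>cs. num_B (Lam n c)) = 1"
proof (rule full_B_sum_num_B[OF cs(1)])
  show "prod_perm cs \<in> full_B n" using cox_full_B[OF n] cs(2) by simp
  have "(\<Sum>c\<leftarrow>cs. n - num_A (Lam n c)) = (\<Sum>c\<leftarrow>cs. abs_length n c)"
    using cs(1) abs_length_eq by (intro arg_cong[of _ _ sum_list] map_cong) auto
  then show "(\<Sum>c\<leftarrow>cs. n - num_A (Lam n c)) = n" using rank by simp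
qed

section \<open>The cycle types that occur in the formulas\<close>

lemma weight_disjoint:
  "set_mset M \<inter> set_mset N = {} \<Longrightarrow> weight (M + N) = weight M * weight N"
proof (induction N)
  case empty
  then show ?case by (simp add: weight_def)
next
  case (add l N)
  then have "count M l = 0" by (auto simp: not_in_iff[symmetric])
  then show ?case using add by (simp add: weight_add algebra_simps)
qed

lemma weight_replicate: "weight (replicate_mset k l) = fact k"
  by (induction k) (simp_all add: weight_add weight_def[of "{#}"])

lemma A_type_0: "A_type 0 m = {#}"
  by (simp add: A_type_def)

lemma A_type_Suc: "A_type (Suc r) m = A_type r m + replicate_mset (m (Suc r)) (Type_A (Suc r))"
  by (simp add: A_type_def)

lemma set_A_type: "X \<in># A_type r m \<Longrightarrow> \<exists>s\<in>{1..r}. X = Type_A s"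
proof (induction r)
  case (Suc r)
  then consider "X \<in># A_type r m" | "X = Type_A (Suc r)" by (auto simp: A_type_Suc split: if_splits)
  then show ?case
  proof cases
    case 1
    from Suc.IH[OF this] show ?thesis by auto
  qed auto
qed (simp add: A_type_0)

lemma size_A_type: "size (A_type r m) = (\<Sum>s=1..r. m s)"
  by (induction r) (simp_all add: A_type_0 A_type_Suc)

lemma sum_lam_A_type: "(\<Sum>X\<in>#A_type r m. fst (lam_irr X)) = rk (A_type r m) + (\<Sum>s=1..r. m s)"
  by (induction r) (simp_all add: A_type_0 A_type_Suc rk_def algebra_simps)

lemma lam_A_type_disjoint:
  assumes "\<not> (2 \<le> t \<and> t \<le> Suc r)"
  shows "set_mset (image_mset lam_irr (A_type r m)) \<inter> set_mset (replicate_mset k (t, False)) = {}"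
proof (rule ccontr)
  assume "set_mset (image_mset lam_irr (A_type r m)) \<inter> set_mset (replicate_mset k (t, False)) \<noteq> {}"
  then obtain l where l: "l \<in># image_mset lam_irr (A_type r m)" "l \<in># replicate_mset k (t, False)" by blast
  then obtain X where "X \<in># A_type r m" "l = lam_irr X" by auto
  then obtain s where "s \<in> {1..r}" "l = (Suc s, False)" using set_A_type[of X r m] by auto
  moreover have "l = (t, False)" using l(2) by (simp add: in_replicate_mset split: if_splits)
  ultimately show False using assms by auto
qed

lemma weight_A_type: "weight (image_mset lam_irr (A_type r m)) = (\<Prod>s=1..r. fact (m s))"
proof (induction r)
  case 0
  then show ?case by (simp add: A_type_0 weight_def)
next
  case (Suc r)
  have "set_mset (image_mset lam_irr (A_type r m)) \<inter> set_mset (replicate_mset (m (Suc r)) (Suc (Suc r), False)) = {}"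
    by (rule lam_A_type_disjoint) simp
  then show ?case using Suc by (simp add: A_type_Suc weight_disjoint weight_replicate)
qed

lemma rk_add: "rk (M + N) = rk M + rk N"
  by (simp add: rk_def)

context
  fixes n \<alpha> :: nat and b :: bool and m :: "nat \<Rightarrow> nat" and T :: refl_type
  assumes T: "T = (if b then {#Type_B \<alpha>#} else {#}) + A_type n m" and \<alpha>: "\<alpha> \<ge> 1"
begin

lemma one_B_is_comb_type: "is_comb_type T"
  using T \<alpha> set_A_type[of _ n m] unfolding is_comb_type_def by (fastforce split: if_splits)

lemma one_B_sum: "(\<Sum>X\<in>#T. fst (lam_irr X)) = rk T + (\<Sum>s=1..n. m s)"
  unfolding T rk_add by (simp add: sum_lam_A_type rk_def[of "{#Type_B \<alpha>#}"] rk_def[of "{#}"])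

lemma one_B_lamT:
  "lamT n T = (if b then {#(\<alpha>, True)#} else {#}) + (image_mset lam_irr (A_type n m) +
     replicate_mset (n - (rk T + (\<Sum>s=1..n. m s))) (1, False))"
  unfolding lamT_def one_B_sum by (simp add: T)

lemma one_B_num_B: "num_B (lamT n T) = (if b then 1 else 0)"
proof -
  have "filter_mset (\<lambda>X. snd (lam_irr X)) (A_type n m) = {#}"
    unfolding filter_mset_eq_empty using set_A_type[of _ n m] by fastforce
  then show ?thesis unfolding num_B_lamT T by simp
qed

lemma one_B_pos: "l \<in># lamT n T \<Longrightarrow> fst l \<ge> 1"
  unfolding one_B_lamT using \<alpha> set_A_type[of _ n m] by (fastforce split: if_splits simp: in_replicate_mset)

text \<open>The maximum comes from the truncated subtraction in \<open>lamT\<close>; it equals n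
  exactly if T fits into n letters.\<close>

lemma sum_fst_lamT: "(\<Sum>l\<in>#lamT n T. fst l) = max n (rk T + (\<Sum>s=1..n. m s))"
  by (simp add: lamT_def image_mset.compositionality comp_def one_B_sum)

lemma one_B_size:
  "rk T + (\<Sum>s=1..n. m s) \<le> n \<Longrightarrow> size (lamT n T) = (if b then 1 else 0) + (n - rk T)"
  by (auto simp: one_B_lamT size_A_type)

lemma one_B_weight:
  "weight (lamT n T) = (\<Prod>s=1..n. fact (m s)) * fact (n - (rk T + (\<Sum>s=1..n. m s)))"
proof -
  have 1: "set_mset (image_mset lam_irr (A_type n m)) \<inter> set_mset (replicate_mset k (1, False)) = {}" for k
    by (rule lam_A_type_disjoint) simp
  have "count (image_mset lam_irr (A_type n m) + replicate_mset k (1, False)) (\<alpha>, True) = 0" for k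
  proof (rule ccontr, simp only: count_eq_zero_iff not_not)
    assume "(\<alpha>, True) \<in># image_mset lam_irr (A_type n m) + replicate_mset k (1, False)"
    then obtain X where "X \<in># A_type n m" "lam_irr X = (\<alpha>, True)" by (auto split: if_splits)
    then show False using set_A_type[of X n m] by auto
  qed
  moreover have "weight (image_mset lam_irr (A_type n m) + replicate_mset k (1, False)) = (\<Prod>s=1..n. fact (m s)) * fact k" for k
    by (simp only: weight_disjoint[OF 1] weight_replicate weight_A_type)
  ultimately show ?thesis unfolding one_B_lamT
    by (auto simp: weight_add simp del: One_nat_def)
qed

text \<open>The default value 0 of \<open>recip_fact\<close> takes effect exactly when T does not
  fit into n letters, which is also when no element has type T.\<close>

lemma one_B_multinomial:
  assumes "rk T \<le> n"
  shows "multinomial (n - rk T) n m = (if rk T + (\<Sum>s=1..n. m s) \<le> n then fact (n - rk T) / real (weight (lamT n T)) else 0)"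
proof (cases "rk T + (\<Sum>s=1..n. m s) \<le> n")
  case True
  have e: "int (n - rk T) - int (\<Sum>s=1..n. m s) = int (n - (rk T + (\<Sum>s=1..n. m s)))"
    using True by linarith
  show ?thesis unfolding multinomial_def one_B_weight e if_P[OF True] recip_fact_def nat_int by simp
next
  case False
  then have "int (n - rk T) - int (\<Sum>s=1..n. m s) < 0" using assms by linarith
  then show ?thesis using False by (simp add: multinomial_def recip_fact_def)
qed

end

section \<open>The formula for exactly one type B factor\<close>

lemma finite_full_B: "finite (full_B n)"
  using finite_W_B[of n] by (rule rev_finite_subset) (auto simp: full_B_def)

text \<open>If every type fits into n letters, \<open>card_tuples\<close> and
  \<open>card_tuples_dec\<close> apply and the size of the class of c cancels; otherwise both sides
  are 0.\<close>

lemma card_dec_one_B: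
  assumes n: "n \<ge> 1" and ty: "types_one_B n j \<alpha> m Ts" and \<alpha>: "\<alpha> \<ge> 1" and rank: "(\<Sum>i<length Ts. rk (Ts ! i)) = n"
  shows "real (card (dec n (map (lamT n) Ts))) =
    real n ^ (length Ts - 1) * multinomial (n - rk (Ts ! j)) n (m j) *
       (\<Prod>i\<in>{..<length Ts} - {j}. 1 / (real n - real (rk (Ts ! i))) * multinomial (n - rk (Ts ! i)) n (m i))"
proof -
  let ?d = "length Ts" and ?P = "map (lamT n) Ts"
  have j: "j < ?d" and T: "\<And>i. i < ?d \<Longrightarrow> Ts ! i = (if i = j then {#Type_B \<alpha>#} else {#}) + A_type n (m i)"
    using ty by (auto simp: types_one_B_def)
  note sumf = sum_fst_lamT[OF T \<alpha>] and sizef = one_B_size[OF T \<alpha>] and mult = one_B_multinomial[OF T \<alpha>]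
  \<comment> \<open>The type B factor takes at least one unit of rank, so every other rank is below
    n and no denominator vanishes.\<close>
  have rkj: "rk (Ts ! j) \<ge> 1" using T[OF j] \<alpha> by (simp add: rk_def)
  have sj: "n = rk (Ts ! j) + (\<Sum>i\<in>{..<?d} - {j}. rk (Ts ! i))"
    unfolding rank[symmetric] using j by (intro sum.remove) auto
  have rki: "rk (Ts ! i) < n" if "i < ?d" "i \<noteq> j" for i
  proof -
    have "rk (Ts ! i) \<le> (\<Sum>i\<in>{..<?d} - {j}. rk (Ts ! i))" using that by (intro member_le_sum) auto
    then show ?thesis using sj rkj by linarith
  qed
  have rkle: "rk (Ts ! i) \<le> n" if "i < ?d" for i using rki[OF that] sj by (cases "i = j") auto
  show ?thesis
  proof (cases "\<forall>i<?d. rk (Ts ! i) + (\<Sum>s=1..n. m i s) \<le> n")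
    case True
    \<comment> \<open>The number of blocks: n - rk T unflagged ones, and the flagged one for i =
      j.\<close>
    have sz: "size (?P ! i) = (if i = j then 1 else 0) + (n - rk (Ts ! i))" if "i < ?d" for i
      using sizef[OF that] True that rkle[OF that] by (auto simp: Suc_diff_le)
    have nB: "num_B (?P ! i) = (if i = j then 1 else 0)" if "i < ?d" for i
      using one_B_num_B[OF T[OF that] \<alpha>] that by simp
    have tree: "tree_type n ?P"
    proof -
      have "(\<Sum>M\<leftarrow>?P. size M) = (\<Sum>i<?d. size (?P ! i))"
        by (simp add: sum_list_sum_nth atLeast0LessThan)
      also have "\<dots> = (\<Sum>i<?d. (if i = j then 1 else 0) + (n - rk (Ts ! i)))" using sz by (intro sum.cong) auto
      also have "\<dots> = 1 + (\<Sum>i<?d. n - rk (Ts ! i))" using j by (simp add: sum.distrib)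
      finally have "(\<Sum>M\<leftarrow>?P. size M) + n = 1 + ((\<Sum>i<?d. n - rk (Ts ! i)) + (\<Sum>i<?d. rk (Ts ! i)))"
        using rank by simp
      also have "(\<Sum>i<?d. n - rk (Ts ! i)) + (\<Sum>i<?d. rk (Ts ! i)) = (\<Sum>i<?d. n)"
        unfolding sum.distrib[symmetric] using rkle by (intro sum.cong) auto
      finally show ?thesis by (simp add: tree_type_def)
    qed
    have "(\<Sum>M\<leftarrow>?P. num_B M) = (\<Sum>i<?d. num_B (?P ! i))"
      by (simp add: sum_list_sum_nth atLeast0LessThan)
    also have "\<dots> = (\<Sum>i<?d. if i = j then 1 else 0)" using nB by (intro sum.cong) auto
    also have "\<dots> = 1" using j by simp
    finally have odd: "odd (\<Sum>M\<leftarrow>?P. num_B M)" by simp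
    let ?X = "fact (n - rk (Ts ! j)) * (\<Prod>i\<in>{..<?d} - {j}. fact (n - rk (Ts ! i) - 1)) :: nat"
    have "card (tuples n ?P) * (\<Prod>i<length ?P. weight (?P ! i)) =
      n ^ (length ?P - 1) * card (full_B n) * (fact (size (?P ! j) - 1) * (\<Prod>i\<in>{..<length ?P} - {j}. fact (size (?P ! i) - 1)))"
    proof (rule card_tuples[OF n _ tree])
      show "(\<Sum>l\<in>#?P ! i. fst l) = n" if "i < length ?P" for i
        using sumf[of i] True that by simp
      show "1 \<le> fst l" if "i < length ?P" "l \<in># ?P ! i" for i l
        using one_B_pos[OF T \<alpha>, of i l] that by simp
    qed (use j nB in auto)
    also have "fact (size (?P ! j) - 1) = (fact (n - rk (Ts ! j)) :: nat)" using sz[OF j] by simp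
    also have "(\<Prod>i\<in>{..<length ?P} - {j}. fact (size (?P ! i) - 1)) = (\<Prod>i\<in>{..<?d} - {j}. fact (n - rk (Ts ! i) - 1) :: nat)"
      using sz by (intro prod.cong) auto
    finally have "card (full_B n) * (card (dec n ?P) * (\<Prod>i<?d. weight (?P ! i))) = card (full_B n) * (n ^ (?d - 1) * ?X)"
      unfolding card_tuples_dec[OF n tree odd] by (simp add: algebra_simps)
    moreover have "card (full_B n) > 0" using cox_full_B[OF n] finite_full_B by (auto simp: card_gt_0_iff)
    ultimately have "card (dec n ?P) * (\<Prod>i<?d. weight (?P ! i)) = n ^ (?d - 1) * ?X" by simp
    then have "real (card (dec n ?P)) * (\<Prod>i<?d. real (weight (?P ! i))) = real (n ^ (?d - 1) * ?X)"
      by (metis of_nat_mult of_nat_prod)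
    moreover have "(\<Prod>i<?d. real (weight (?P ! i))) \<noteq> 0" by (simp add: prod_zero_iff weight_pos[THEN less_imp_neq, symmetric])
    ultimately have "real (card (dec n ?P)) = real (n ^ (?d - 1) * ?X) / (\<Prod>i<?d. real (weight (?P ! i)))"
      by (subst nonzero_eq_divide_eq) auto
    also have "(\<Prod>i<?d. real (weight (?P ! i))) = real (weight (?P ! j)) * (\<Prod>i\<in>{..<?d} - {j}. real (weight (?P ! i)))"
      using j by (intro prod.remove) auto
    also have "real (n ^ (?d - 1) * ?X) / \<dots> = real n ^ (?d - 1) * (fact (n - rk (Ts ! j)) / real (weight (?P ! j))) *
        (\<Prod>i\<in>{..<?d} - {j}. fact (n - rk (Ts ! i) - 1) / real (weight (?P ! i)))"
      by (simp add: prod_dividef)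
    also have "fact (n - rk (Ts ! j)) / real (weight (?P ! j)) = multinomial (n - rk (Ts ! j)) n (m j)"
      using mult[OF j rkle[OF j]] True j by simp
    also have "(\<Prod>i\<in>{..<?d} - {j}. fact (n - rk (Ts ! i) - 1) / real (weight (?P ! i))) =
        (\<Prod>i\<in>{..<?d} - {j}. 1 / (real n - real (rk (Ts ! i))) * multinomial (n - rk (Ts ! i)) n (m i))"
    proof (rule prod.cong[OF HOL.refl])
      fix i assume i: "i \<in> {..<?d} - {j}"
      then have l: "rk (Ts ! i) < n" using rki by simp
      \<comment> \<open>The origin of the factors 1 / (n - rk T_i): an unflagged factor with n - rk
        T_i blocks contributes (n - rk T_i - 1)!, the flagged one the full factorial.\<close>
      have "(fact (n - rk (Ts ! i)) :: real) = real (n - rk (Ts ! i)) * fact (n - rk (Ts ! i) - 1)"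
        using l by (simp add: fact_reduce)
      moreover have "real (n - rk (Ts ! i)) = real n - real (rk (Ts ! i))" using l by simp
      moreover have "real n - real (rk (Ts ! i)) \<noteq> 0" using l by simp
      moreover have "multinomial (n - rk (Ts ! i)) n (m i) = fact (n - rk (Ts ! i)) / real (weight (?P ! i))"
        using mult[of i] rkle[of i] True i by simp
      ultimately show "fact (n - rk (Ts ! i) - 1) / real (weight (?P ! i)) =
        1 / (real n - real (rk (Ts ! i))) * multinomial (n - rk (Ts ! i)) n (m i)" by simp
    qed
    finally show ?thesis .
  next
    case False
    then obtain i where i: "i < ?d" "\<not> rk (Ts ! i) + (\<Sum>s=1..n. m i s) \<le> n" by blast
    have "dec n ?P = {}"
    proof (rule ccontr)
      assume "dec n ?P \<noteq> {}"
      then obtain cs where cs: "set cs \<subseteq> W_B n" "map (Lam n) cs = ?P" unfolding dec_def by blast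
      then have len: "length cs = ?d" by (metis length_map)
      then have "cs ! i \<in> W_B n" using cs i by (auto simp: subset_iff)
      moreover have "Lam n (cs ! i) = lamT n (Ts ! i)" using cs(2) i(1) len by (metis nth_map)
      ultimately have "(\<Sum>l\<in>#lamT n (Ts ! i). fst l) = n" using sum_fst_Lam by metis
      then show False using sumf[OF i(1)] i(2) by simp
    qed
    moreover have mz: "multinomial (n - rk (Ts ! i)) n (m i) = 0" using mult[OF i(1) rkle[OF i(1)]] i(2) by simp
    have "multinomial (n - rk (Ts ! j)) n (m j) *
       (\<Prod>i\<in>{..<length Ts} - {j}. 1 / (real n - real (rk (Ts ! i))) * multinomial (n - rk (Ts ! i)) n (m i)) = 0"
    proof (cases "i = j")
      case True
      then show ?thesis using mz by simp
    next
      case False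
      then have "(\<Prod>i\<in>{..<length Ts} - {j}. 1 / (real n - real (rk (Ts ! i))) * multinomial (n - rk (Ts ! i)) n (m i)) = 0"
        using i mz by (intro prod_zero) auto
      then show ?thesis by simp
    qed
    ultimately show ?thesis by simp
  qed
qed

lemma sum_list_rk: "(\<Sum>T\<leftarrow>Ts. rk T) = (\<Sum>i<length Ts. rk (Ts ! i))"
  by (simp add: sum_list_sum_nth atLeast0LessThan)

lemma types_one_B_comb:
  assumes "types_one_B n j \<alpha> m Ts" "\<alpha> \<ge> 1"
  shows "\<forall>T\<in>set Ts. is_comb_type T"
proof
  fix T assume "T \<in> set Ts"
  then obtain i where "i < length Ts" "T = Ts ! i" by (metis in_set_conv_nth)
  then show "is_comb_type T" using assms one_B_is_comb_type unfolding types_one_B_def by blast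
qed

lemma N_B_comb_one_B:
  assumes "n \<ge> 1" "types_one_B n j \<alpha> m Ts" "\<alpha> \<ge> 1" "(\<Sum>i<length Ts. rk (Ts ! i)) = n"
  shows "real (N_B_comb n Ts) =
    real n ^ (length Ts - 1) * multinomial (n - rk (Ts ! j)) n (m j) *
       (\<Prod>i\<in>{..<length Ts} - {j}. 1 / (real n - real (rk (Ts ! i))) * multinomial (n - rk (Ts ! i)) n (m i))"
  using card_dec_one_B[OF assms] comb_decompositions[OF assms(1) types_one_B_comb[OF assms(2,3)]] assms(4)
  by (simp add: N_B_comb_def sum_list_rk)

section \<open>Which combinatorial types admit decompositions\<close>

definition nB :: "refl_type \<Rightarrow> nat" where
  "nB T = size (filter_mset (\<lambda>X. snd (lam_irr X)) T)"

lemma A_type_exists: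
  assumes "\<forall>X\<in>#T. \<exists>k\<ge>1. X = Type_A k" "rk T \<le> n"
  shows "\<exists>m. T = A_type n m"
proof
  define m where "m s = count T (Type_A s)" for s
  have c: "count (A_type r m) X = (\<Sum>s=1..r. if X = Type_A s then m s else 0)" for r X
    by (induction r) (auto simp: A_type_0 A_type_Suc)
  have irr: "irr_rank X \<le> rk T" if "X \<in># T" for X
    using that by (auto simp: rk_def dest!: multi_member_split)
  show "T = A_type n m"
  proof (rule multiset_eqI)
    fix X
    show "count T X = count (A_type n m) X"
    proof (cases "X \<in># T")
      case True
      then obtain k where k: "k \<ge> 1" "X = Type_A k" using assms(1) by blast
      then have "k \<in> {1..n}" using irr[OF True] assms(2) by simp
      then show ?thesis using k unfolding c by (simp add: m_def)
    next
      case False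
      then have "count T X = 0" by (simp add: not_in_iff)
      then show ?thesis unfolding c by (auto simp: m_def)
    qed
  qed
qed

text \<open>A single type B label in the whole list is precisely the form in (i). The subscripts of
  the type A labels stay within n because no rank exceeds the total rank.\<close>

lemma comb_type_one_B:
  assumes comb: "\<forall>T\<in>set Ts. is_comb_type T" and rank: "(\<Sum>i<length Ts. rk (Ts ! i)) = n"
    and one: "(\<Sum>T\<leftarrow>Ts. nB T) = 1"
  shows "\<exists>j \<alpha> m. \<alpha> \<ge> 1 \<and> types_one_B n j \<alpha> m Ts"
proof -
  let ?d = "length Ts"
  have s: "(\<Sum>i<?d. nB (Ts ! i)) = 1" using one by (simp add: sum_list_sum_nth atLeast0LessThan)
  then have "\<exists>j<?d. nB (Ts ! j) \<noteq> 0" by (metis lessThan_iff sum.neutral zero_neq_one)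
  then obtain j where j: "j < ?d" "nB (Ts ! j) \<noteq> 0" by blast
  have "(\<Sum>i<?d. nB (Ts ! i)) = nB (Ts ! j) + (\<Sum>i\<in>{..<?d} - {j}. nB (Ts ! i))"
    using j by (intro sum.remove) auto
  then have nj: "nB (Ts ! j) = 1" and "(\<Sum>i\<in>{..<?d} - {j}. nB (Ts ! i)) = 0" using s j by linarith+
  then have ni: "nB (Ts ! i) = 0" if "i < ?d" "i \<noteq> j" for i using that by simp
  have rkle: "rk (Ts ! i) \<le> n" if "i < ?d" for i
    unfolding rank[symmetric] using that by (intro member_le_sum) auto
  have comb': "is_comb_type (Ts ! i)" if "i < ?d" for i using comb that by simp
  have onlyA: "\<forall>X\<in>#M. \<exists>k\<ge>1. X = Type_A k" if "is_comb_type M" "nB M = 0" for M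
  proof
    fix X assume X: "X \<in># M"
    have "filter_mset (\<lambda>X. snd (lam_irr X)) M = {#}" using that(2) by (simp add: nB_def)
    then have "\<forall>X\<in>#M. \<not> snd (lam_irr X)" by (simp only: filter_mset_eq_empty)
    then have "\<not> snd (lam_irr X)" using X by blast
    moreover have "\<exists>k\<ge>1. X = Type_A k \<or> X = Type_B k" using that(1) X unfolding is_comb_type_def by (rule bspec)
    ultimately show "\<exists>k\<ge>1. X = Type_A k" by auto
  qed
  have "filter_mset (\<lambda>X. snd (lam_irr X)) (Ts ! j) \<noteq> {#}"
  proof
    assume "filter_mset (\<lambda>X. snd (lam_irr X)) (Ts ! j) = {#}"
    then have "nB (Ts ! j) = 0" by (simp add: nB_def)
    then show False using nj by simp
  qed
  then obtain X where "X \<in># filter_mset (\<lambda>X. snd (lam_irr X)) (Ts ! j)" by (meson multiset_nonemptyE)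
  then have X: "X \<in># Ts ! j" "snd (lam_irr X)" by auto
  moreover have "\<exists>k\<ge>1. X = Type_A k \<or> X = Type_B k"
    using comb'[OF j(1)] X(1) unfolding is_comb_type_def by (rule bspec)
  ultimately obtain \<alpha> where \<alpha>: "\<alpha> \<ge> 1" "X = Type_B \<alpha>" by auto
  obtain M where M: "Ts ! j = add_mset (Type_B \<alpha>) M" using X(1) \<alpha>(2) by (meson multi_member_split)
  have "nB M = 0" using nj by (simp add: nB_def M)
  moreover have "is_comb_type M" using comb'[OF j(1)] by (simp add: is_comb_type_def M)
  ultimately have "\<exists>m. M = A_type n m"
    using rkle[OF j(1)] by (intro A_type_exists onlyA) (simp_all add: M rk_def)
  then obtain mj where mj: "M = A_type n mj" by blast
  have "\<exists>m. Ts ! i = A_type n m" if "i < ?d" "i \<noteq> j" for i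
    by (intro A_type_exists onlyA comb' rkle ni that)
  then obtain mi where mi: "\<And>i. i < ?d \<Longrightarrow> i \<noteq> j \<Longrightarrow> Ts ! i = A_type n (mi i)" by metis
  have "types_one_B n j \<alpha> (mi(j := mj)) Ts" unfolding types_one_B_def using j(1) M mj mi by auto
  then show ?thesis using \<alpha>(1) by blast
qed

text \<open>With combined rank n the product is c itself, and \<open>full_B_sum_num_B\<close> leaves
  exactly one type B cycle. This is the reason for the vanishing in (iii).\<close>

lemma comb_decomposition_one_B:
  assumes n: "n \<ge> 1" and cs: "cs \<in> decompositions n has_comb_type Ts" and rank: "(\<Sum>i<length Ts. rk (Ts ! i)) = n"
  shows "(\<Sum>T\<leftarrow>Ts. nB T) = 1" "prod_perm cs = cox n"
proof -
  have W: "set cs \<subseteq> W_B n" and len: "length cs = length Ts"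
    and ht: "\<And>i. i < length Ts \<Longrightarrow> has_comb_type (cs ! i) (Ts ! i)"
    and le: "abs_le n (prod_perm cs) (cox n) \<and> (\<Sum>c\<leftarrow>cs. abs_length n c) = abs_length n (prod_perm cs)"
    using cs unfolding decompositions_def by auto
  have cW: "cs ! i \<in> W_B n" if "i < length Ts" for i using that W len by (auto simp: subset_iff)
  have ct: "Ts ! i = ctype (Lam n (cs ! i))" if "i < length Ts" for i
    using ht[OF that] has_comb_type_iff[OF cW[OF that]] by simp
  have "abs_length n (cs ! i) = rk (Ts ! i)" if "i < length Ts" for i
    using rk_ctype_Lam[OF cW[OF that]] ct[OF that] by simp
  then have "map (abs_length n) cs = map rk Ts" using len by (intro nth_equalityI) auto
  then have r: "(\<Sum>c\<leftarrow>cs. abs_length n c) = n" using rank by (simp add: sum_list_rk)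
  then show p: "prod_perm cs = cox n" using decomposition_iff[OF n W r] le by blast
  have "nB (Ts ! i) = num_B (Lam n (cs ! i))" if i: "i < length Ts" for i
  proof -
    have "Lam n (cs ! i) = lamT n (Ts ! i)"
      unfolding ct[OF i] using lamT_ctype[of "Lam n (cs ! i)"] Lam_pos[OF cW[OF i]] sum_fst_Lam[OF cW[OF i]] by simp
    then show ?thesis by (simp add: num_B_lamT nB_def)
  qed
  then have "map nB Ts = map (\<lambda>c. num_B (Lam n c)) cs" using len by (intro nth_equalityI) auto
  then show "(\<Sum>T\<leftarrow>Ts. nB T) = 1" using dec_num_B[OF n W p r] by simp
qed

section \<open>Coxeter elements of parabolic subgroups\<close>

text \<open>The node p of the diagram as a pair for \<open>reflection\<close>: node 0 is the loop
  [1], node p > 0 the edge ((p, p + 1)).\<close>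

definition spair :: "nat \<Rightarrow> int \<times> int" where
  "spair p = (if p = 0 then (1, 1) else (int p, int p + 1))"

lemma spair_letters: "p < n \<Longrightarrow> spair p \<in> signed_letters n \<times> signed_letters n"
  by (auto simp: spair_def signed_letters_def)

lemma loop_spair: "loop (spair p) \<longleftrightarrow> p = 0"
  by (auto simp: spair_def loop_def)

lemma reflection_spair:
  "reflection (spair p) u = (if p = 0 then if u = 1 then - 1 else if u = - 1 then 1 else u
     else if u = int p then int p + 1 else if u = int p + 1 then int p
     else if u = - int p then - int p - 1 else if u = - int p - 1 then - int p else u)"
  by (auto simp: spair_def reflection_def refl_B_apply refl_A_apply)

lemma simple_reflections_spair: "simple_reflections n = (\<lambda>p. reflection (spair p)) ` {..<n}"
proof (cases "n = 0")
  case False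
  have "cycle_B [1] = reflection (spair 0)" by (simp add: cycle_B_singleton spair_def reflection_def)
  moreover have "cycle_A [int p, int p + 1] = reflection (spair p)" if "p \<in> {1..<n}" for p
    using that by (simp add: cycle_A_pair spair_def reflection_def)
  then have "(\<lambda>i. cycle_A [i, i + 1]) ` int ` {1..<n} = (\<lambda>p. reflection (spair p)) ` {1..<n}"
    unfolding image_image by (rule image_cong[OF HOL.refl])
  moreover have "int ` {1..<n} = {1..<int n}" by (simp add: image_int_atLeastLessThan)
  moreover have "{..<n} = insert 0 {1..<n}" using False by auto
  ultimately show ?thesis using False by (simp add: simple_reflections_def)
qed (simp add: simple_reflections_def)

lemma conj_reflection:
  assumes g: "g \<in> W_B n" and p: "p \<in> signed_letters n \<times> signed_letters n"
  shows "g \<circ> reflection p \<circ> inv g = reflection (map_prod g g p)"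
proof -
  obtain x z where xz: "p = (x, z)" by (cases p)
  have x: "x \<noteq> 0" "z \<noteq> 0" using p by (auto simp: xz signed_letters_def)
  have e: "\<bar>g x\<bar> = \<bar>g z\<bar> \<longleftrightarrow> \<bar>x\<bar> = \<bar>z\<bar>"
    using W_B_inj[OF g, of x z] W_B_inj[OF g, of x "- z"] by (auto simp: abs_eq_iff W_B_odd[OF g])
  show ?thesis
  proof (cases "\<bar>x\<bar> = \<bar>z\<bar>")
    case True
    then show ?thesis using conj_cyc[OF g, of "[x]" True] x e
      by (simp add: xz reflection_def cyc_def sdist_def cycle_B_singleton)
  next
    case False
    then show ?thesis using conj_cyc[OF g, of "[x, z]" False] x e
      by (simp add: xz reflection_def cyc_def sdist_def cycle_A_pair)
  qed
qed

subsection \<open>Orders of products of two simple reflections\<close>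

lemma perm_order_eqI:
  assumes "k > 0" "w ^^ k = id" "\<And>j. 0 < j \<Longrightarrow> j < k \<Longrightarrow> w ^^ j \<noteq> id"
  shows "perm_order w = k"
  unfolding perm_order_def using assms by (intro Least_equality) (auto simp: not_less[symmetric])

lemma perm_order_conj:
  assumes "bij g" shows "perm_order (g \<circ> w \<circ> inv g) = perm_order w"
proof -
  have i: "inv g (g x) = x" "g (inv g x) = x" for x
    using assms by (simp_all add: bij_is_inj bij_is_surj surj_f_inv_f)
  have p: "(g \<circ> w \<circ> inv g) ^^ k = g \<circ> w ^^ k \<circ> inv g" for k
    by (induction k) (simp_all add: fun_eq_iff i)
  have "g \<circ> v \<circ> inv g = id \<longleftrightarrow> v = id" for v
  proof
    assume "g \<circ> v \<circ> inv g = id"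
    then have "g (v (inv g (g x))) = g x" for x by (metis comp_apply id_apply)
    then show "v = id" using i(1) by (metis eq_id_iff)
  qed (simp add: fun_eq_iff i)
  then show ?thesis by (simp only: perm_order_def p)
qed

lemma perm_order_comp_commute:
  assumes "a \<circ> a = id" shows "perm_order (a \<circ> b) = perm_order (b \<circ> a)"
proof -
  have "inv a = a" using assms by (metis inv_unique_comp)
  moreover have "bij a" using assms by (metis o_bij)
  ultimately have "perm_order (a \<circ> (b \<circ> a) \<circ> a) = perm_order (b \<circ> a)" using perm_order_conj by metis
  moreover have "a \<circ> (b \<circ> a) \<circ> a = a \<circ> b" using assms by (simp add: comp_assoc)
  ultimately show ?thesis by simp
qed

lemma reflection_spair_sq: "reflection (spair p) \<circ> reflection (spair p) = id"
  by (auto simp: fun_eq_iff reflection_spair)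

text \<open>\<open>cox_bond\<close> ignores the rank, so \<open>Type_B 0\<close> gives the diagram of \<open>W(B\<^sub>n)\<close> for all \<open>n\<close>.\<close>

abbreviation cm :: "nat \<Rightarrow> nat \<Rightarrow> nat" where
  "cm \<equiv> cox_matrix (Type_B 0)"

lemma cm_eq: "cm p q = (if p = q then 1 else if q = Suc p \<or> p = Suc q then if p = 0 \<or> q = 0 then 4 else 3 else 2)"
  by (auto simp: cox_matrix_def min_def max_def)

text \<open>Non-adjacent nodes move disjoint sets of letters and commute; [1] and ((1, 2)) multiply
  to a type B cycle of length 2, of order 4; two consecutive nonzero nodes give a type A cycle of
  length 3.\<close>

lemma perm_order_spair_less:
  assumes "p < q" shows "perm_order (reflection (spair p) \<circ> reflection (spair q)) = cm p q"
proof -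
  define w where "w = reflection (spair p) \<circ> reflection (spair q)"
  let ?x = "int p"
  have q: "q \<noteq> 0" using assms by simp
  consider "q \<noteq> Suc p" | "p = 0" "q = 1" | "p \<noteq> 0" "q = Suc p" using assms by linarith
  then have "perm_order w = cm p q"
  proof cases
    case 1
    have "reflection (spair r) permutes {u. \<bar>u\<bar> \<in> abs ` set (if r = 0 then [1] else [int r, int r + 1])}" for r
    proof -
      have "reflection (spair r) = cyc (r = 0, if r = 0 then [1] else [int r, int r + 1])"
        by (simp add: cyc_def cycle_B_singleton cycle_A_pair spair_def reflection_def)
      then show ?thesis using cyc_permutes[of "(r = 0, if r = 0 then [1] else [int r, int r + 1])"] by simp
    qed
    then have "reflection (spair p) \<circ> reflection (spair q) = reflection (spair q) \<circ> reflection (spair p)"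
    proof (intro permutes_disjoint_commute)
      show "{u. \<bar>u\<bar> \<in> abs ` set (if p = 0 then [1] else [int p, int p + 1])} \<inter>
          {u. \<bar>u\<bar> \<in> abs ` set (if q = 0 then [1] else [int q, int q + 1])} = {}"
        using 1 assms by (cases "p = 0") auto
    qed
    then have "reflection (spair p) (reflection (spair q) u) = reflection (spair q) (reflection (spair p) u)" for u
      by (simp add: fun_eq_iff)
    then have "(w ^^ 2) u = u" for u
      unfolding w_def using reflection_spair_sq[of p] reflection_spair_sq[of q] by (simp add: numeral_2_eq_2 fun_eq_iff)
    moreover have "w (int q) \<noteq> int q" using 1 assms by (auto simp: w_def reflection_spair)
    then have "w ^^ j \<noteq> id" if "0 < j" "j < 2" for j
    proof -
      have "j = 1" using that by simp
      then have "(w ^^ j) (int q) \<noteq> int q" using \<open>w (int q) \<noteq> int q\<close> by simp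
      then show ?thesis by (metis id_apply)
    qed
    ultimately have "perm_order w = 2" by (intro perm_order_eqI) (auto simp: fun_eq_iff)
    then show ?thesis using 1 assms by (simp add: cm_eq)
  next
    case 2
    have w: "w u = (if u = 1 then 2 else if u = 2 then - 1 else if u = - 1 then - 2 else if u = - 2 then 1 else u)" for u
      using 2 by (auto simp: w_def reflection_spair)
    have "(w ^^ 4) u = u" for u by (auto simp: eval_nat_numeral w)
    moreover have "w ^^ j \<noteq> id" if "0 < j" "j < 4" for j
    proof -
      have "j = 1 \<or> j = 2 \<or> j = 3" using that by linarith
      moreover have "(w ^^ 1) 1 \<noteq> 1" "(w ^^ 2) 1 \<noteq> 1" "(w ^^ 3) 1 \<noteq> 1"
        using 2 by (simp_all add: eval_nat_numeral w)
      ultimately show ?thesis by (metis id_apply)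
    qed
    ultimately have "perm_order w = 4" by (intro perm_order_eqI) (auto simp: fun_eq_iff)
    then show ?thesis using 2 by (simp add: cm_eq)
  next
    case 3
    have w: "w u = (if u = ?x then ?x + 1 else if u = ?x + 1 then ?x + 2 else if u = ?x + 2 then ?x
        else if u = - ?x then - ?x - 1 else if u = - ?x - 1 then - ?x - 2 else if u = - ?x - 2 then - ?x else u)" for u
      using 3 by (auto simp: w_def reflection_spair)
    have "(w ^^ 3) u = u" for u
      using 3 by (auto simp: eval_nat_numeral w)
    moreover have "w ^^ j \<noteq> id" if "0 < j" "j < 3" for j
    proof -
      have "j = 1 \<or> j = 2" using that by linarith
      moreover have "(w ^^ 1) ?x \<noteq> ?x" "(w ^^ 2) ?x \<noteq> ?x"
        using 3 by (simp_all add: eval_nat_numeral w)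
      ultimately show ?thesis by (metis id_apply)
    qed
    ultimately have "perm_order w = 3" by (intro perm_order_eqI) (auto simp: fun_eq_iff)
    then show ?thesis using 3 by (simp add: cm_eq)
  qed
  then show ?thesis by (simp only: w_def)
qed

lemma perm_order_id: "perm_order id = 1"
  by (rule perm_order_eqI) auto

lemma cm_commute: "cm p q = cm q p"
  by (auto simp: cm_eq)

lemma perm_order_spair: "perm_order (reflection (spair p) \<circ> reflection (spair q)) = cm p q"
proof (cases p q rule: linorder_cases)
  case less
  then show ?thesis by (rule perm_order_spair_less)
next
  case equal
  then show ?thesis by (simp add: reflection_spair_sq perm_order_id cm_eq)
next
  case greater
  then show ?thesis using perm_order_comp_commute[OF reflection_spair_sq[of p]] perm_order_spair_less[OF greater]
    by (simp only: cm_commute)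
qed

section \<open>Simple systems as conjugated sets of nodes\<close>

definition crefl :: "(int \<Rightarrow> int) \<Rightarrow> nat \<Rightarrow> int \<Rightarrow> int" where
  "crefl w p = w \<circ> reflection (spair p) \<circ> inv w"

lemma perm_order_crefl:
  assumes w: "w \<in> W_B n" shows "perm_order (crefl w p \<circ> crefl w q) = cm p q"
proof -
  have "crefl w p \<circ> crefl w q = w \<circ> (reflection (spair p) \<circ> reflection (spair q)) \<circ> inv w"
    by (simp add: crefl_def fun_eq_iff W_B_inv_cancel[OF w])
  then show ?thesis by (simp only: perm_order_conj[OF W_B_bij[OF w]] perm_order_spair)
qed

text \<open>Equal conjugates would give a product of order 1, and cm p q = 1 happens only for p =
  q.\<close>

lemma crefl_inj:
  assumes w: "w \<in> W_B n" shows "inj (crefl w)"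
proof (rule injI)
  fix p q assume "crefl w p = crefl w q"
  then have "cm p q = cm p p" using perm_order_crefl[OF w] by metis
  then show "p = q" by (auto simp: cm_eq split: if_splits)
qed

lemma parabolic_systems_eq: "parabolic_systems n = {crefl w ` J | w J. w \<in> W_B n \<and> J \<subseteq> {..<n}}"
proof -
  have "(\<lambda>s. w \<circ> s \<circ> inv w) ` (\<lambda>p. reflection (spair p)) ` J = crefl w ` J" for w J
    by (simp add: image_image crefl_def)
  then show ?thesis unfolding parabolic_systems_def simple_reflections_spair
    by (auto simp: subset_image_iff) metis+
qed

lemma crefl_list:
  assumes w: "w \<in> W_B n" and ss: "distinct ss" "set ss = crefl w ` J"
  shows "\<exists>js. distinct js \<and> set js = J \<and> ss = map (crefl w) js"
proof -
  have "ss \<in> lists (range (crefl w))" using ss(2) by auto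
  then obtain js where js: "ss = map (crefl w) js" by (auto simp: lists_image)
  then have "distinct js" using ss(1) by (simp add: distinct_map)
  moreover have "set js = J" using ss(2) inj_image_eq_iff[OF crefl_inj[OF w]] unfolding js by simp
  ultimately show ?thesis using js by blast
qed

lemma crefl_reflection:
  assumes w: "w \<in> W_B n" and p: "p < n"
  shows "crefl w p = reflection (map_prod w w (spair p))" "map_prod w w (spair p) \<in> signed_letters n \<times> signed_letters n"
    "loop (map_prod w w (spair p)) \<longleftrightarrow> p = 0" "crefl w p \<in> W_B n"
proof -
  have sp: "spair p \<in> signed_letters n \<times> signed_letters n" by (rule spair_letters[OF p])
  show 1: "crefl w p = reflection (map_prod w w (spair p))" unfolding crefl_def by (rule conj_reflection[OF w sp])
  show 2: "map_prod w w (spair p) \<in> signed_letters n \<times> signed_letters n"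
    using sp W_B_letter[OF w] by (cases "spair p") simp
  show "crefl w p \<in> W_B n" unfolding 1 by (rule reflection_W_B[OF 2])
  have "\<bar>w x\<bar> = \<bar>w z\<bar> \<longleftrightarrow> \<bar>x\<bar> = \<bar>z\<bar>" for x z
    using W_B_inj[OF w, of x z] W_B_inj[OF w, of x "- z"] by (auto simp: abs_eq_iff W_B_odd[OF w])
  then show "loop (map_prod w w (spair p)) \<longleftrightarrow> p = 0"
    using loop_spair[of p] by (cases "spair p") (simp add: loop_def)
qed

text \<open>The letters that do not follow a letter of \<open>J\<close> represent all colours.\<close>

lemma path_colours:
  fixes q :: "int \<Rightarrow> int"
  assumes "J \<subseteq> {..<n}" "\<And>p. p \<in> J \<Longrightarrow> p \<noteq> 0 \<Longrightarrow> q (int p) = q (int p + 1)"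
  shows "card (q ` pos n) + card (J - {0}) \<le> n"
proof -
  let ?K = "(\<lambda>p. int p + 1) ` (J - {0})"
  have "l \<ge> 1 \<Longrightarrow> l \<le> n \<Longrightarrow> q (int l) \<in> q ` (pos n - ?K)" for l :: nat
  proof (induction l)
    case (Suc l)
    show ?case
    proof (cases "int (Suc l) \<in> ?K")
      case True
      then have l: "l \<in> J" "l \<noteq> 0" by auto
      then have "q (int (Suc l)) = q (int l)" using assms(2)[of l] by (simp add: add.commute)
      then show ?thesis using Suc.IH Suc.prems l by simp
    qed (use Suc.prems in auto)
  qed simp
  then have "q ` pos n \<subseteq> q ` (pos n - ?K)"
  proof (intro subsetI, elim imageE)
    fix y x assume l: "\<And>l :: nat. l \<ge> 1 \<Longrightarrow> l \<le> n \<Longrightarrow> q (int l) \<in> q ` (pos n - ?K)" and x: "y = q x" "x \<in> pos n"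
    then have "nat x \<ge> 1" "nat x \<le> n" "int (nat x) = x" by auto
    then show "y \<in> q ` (pos n - ?K)" using l[of "nat x"] x(1) by metis
  qed
  then have "card (q ` pos n) \<le> card (q ` (pos n - ?K))" by (intro card_mono) auto
  also have "\<dots> \<le> card (pos n - ?K)" by (intro card_image_le) auto
  also have "\<dots> = n - card (J - {0})"
  proof -
    have "?K \<subseteq> pos n" using assms(1) by auto
    moreover have "card ?K = card (J - {0})" by (intro card_image) (simp add: inj_on_def)
    moreover have "finite ?K" using finite_subset[OF assms(1)] by simp
    ultimately show ?thesis by (simp add: card_Diff_subset)
  qed
  finally have "card (q ` pos n) \<le> n - card (J - {0})" .
  moreover have "card (J - {0}) \<le> n" using card_mono[of "{..<n}" "J - {0}"] assms(1) by auto
  ultimately show ?thesis by linarith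
qed

context
  fixes n :: nat and w :: "int \<Rightarrow> int" and js :: "nat list"
  assumes w: "w \<in> W_B n" and js: "distinct js" "set js \<subseteq> {..<n}"
begin

text \<open>The non-loops of a simple system form part of a path, carried along by w, hence a
  forest. By \<open>forest_invariant\<close> the product, in whatever order, has the same invariant
  colourings as its factors.\<close>

lemma crefl_prod_invariant:
  fixes r :: "int \<Rightarrow> int"
  assumes r: "\<forall>u\<in>pos n. r \<bar>prod_perm (map (crefl w) js) u\<bar> = r u" and p: "p \<in> set js" and u: "u \<in> pos n"
  shows "r \<bar>crefl w p u\<bar> = r u"
proof -
  define ps where "ps = map (\<lambda>p. map_prod w w (spair p)) js"
  have lt: "p < n" if "p \<in> set js" for p using js(2) that by auto
  have psl: "set ps \<subseteq> signed_letters n \<times> signed_letters n"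
    unfolding ps_def using crefl_reflection(2)[OF w lt] by (force simp only: set_map)
  have mp: "map (crefl w) js = map reflection ps"
    unfolding ps_def using crefl_reflection(1)[OF w lt] by simp
  have "length (filter (\<lambda>p. \<not> loop p) ps) = length (filter (\<lambda>p. p \<noteq> 0) js)"
    unfolding ps_def filter_map length_map comp_def using crefl_reflection(3)[OF w lt]
    by (intro arg_cong[of _ _ length] filter_cong) auto
  also have "\<dots> = card (set js - {0})"
    using distinct_card[OF distinct_filter[OF js(1)], of "\<lambda>p. p \<noteq> 0"] by (simp add: set_diff_eq)
  finally have len: "length (filter (\<lambda>p. \<not> loop p) ps) = card (set js - {0})" .
  have "r \<bar>reflection (map_prod w w (spair p)) u\<bar> = r u"
  proof (rule forest_invariant[OF psl])
    fix s :: "int \<Rightarrow> int" assume s: "\<And>p u. p \<in> set ps \<Longrightarrow> u \<in> pos n \<Longrightarrow> s \<bar>reflection p u\<bar> = s u"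
    \<comment> \<open>Pulled back along w, s colours the path 1, ..., n, and each nonzero node p in
      js identifies the colours of p and p + 1.\<close>
    have "card ((\<lambda>l. s \<bar>w l\<bar>) ` pos n) + card (set js - {0}) \<le> n"
    proof (rule path_colours[OF js(2)])
      fix p assume p: "p \<in> set js" "p \<noteq> 0"
      have "\<forall>u\<in>pos n. s \<bar>reflection (map_prod w w (spair p)) u\<bar> = s u" using s p(1) by (simp add: ps_def)
      then have "s \<bar>fst (map_prod w w (spair p))\<bar> = s \<bar>snd (map_prod w w (spair p))\<bar>"
        using reflection_colour[OF crefl_reflection(2)[OF w lt[OF p(1)]], of s] crefl_reflection(3)[OF w lt[OF p(1)]] p(2) by blast
      then show "s \<bar>w (int p)\<bar> = s \<bar>w (int p + 1)\<bar>" using p(2) by (simp add: spair_def)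
    qed
    moreover have "(\<lambda>l. s \<bar>w l\<bar>) ` pos n = s ` pos n"
    proof -
      have "(\<lambda>l. s \<bar>w l\<bar>) ` pos n = s ` (aw n w ` pos n)" by (auto simp: aw_def image_image)
      then show ?thesis by (simp only: permutes_image[OF aw_permutes[OF w]])
    qed
    ultimately show "card (s ` pos n) + length (filter (\<lambda>p. \<not> loop p) ps) \<le> n" unfolding len by simp
  qed (use r mp p u in \<open>auto simp: ps_def\<close>)
  then show ?thesis using crefl_reflection(1)[OF w lt[OF p]] by simp
qed

lemma crefl_set_W_B: "crefl w ` set js \<subseteq> W_B n"
  using crefl_reflection(4)[OF w] js(2) by auto

text \<open>The right side mentions the generated subgroup only, so all its Coxeter elements have
  the same blocks.\<close>

lemma parabolic_invariant:
  fixes r :: "int \<Rightarrow> int"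
  shows "(\<forall>u\<in>pos n. r \<bar>prod_perm (map (crefl w) js) u\<bar> = r u) \<longleftrightarrow>
    (\<forall>v\<in>gen_by (crefl w ` set js). \<forall>u\<in>pos n. r \<bar>v u\<bar> = r u)" (is "?L \<longleftrightarrow> ?R")
proof
  assume L: ?L
  show ?R
  proof (intro ballI)
    fix v u assume v: "v \<in> gen_by (crefl w ` set js)" and u: "u \<in> pos n"
    from v obtain ts where ts: "v = prod_perm ts" "set ts \<subseteq> crefl w ` set js" unfolding gen_by_def by blast
    have tW: "set ts \<subseteq> W_B n" using ts(2) crefl_set_W_B by blast
    show "r \<bar>v u\<bar> = r u" unfolding ts(1)
      by (rule abs_prod_colour[OF tW _ u]) (use ts(2) crefl_prod_invariant[OF L] in blast)
  qed
next
  assume R: ?R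
  have "prod_perm (map (crefl w) js) \<in> gen_by (crefl w ` set js)"
    unfolding gen_by_def mem_Collect_eq by (rule exI[of _ "map (crefl w) js"]) simp
  then show ?L using R by blast
qed

end

text \<open>The indicator function of a block of w is invariant under w, hence under v, so a block
  of v cannot leave it.\<close>

lemma blocks_subI:
  assumes v: "v \<in> W_B n" and w: "w \<in> W_B n" and x: "x \<in> pos n"
    and r: "\<And>r :: int \<Rightarrow> int. (\<forall>u\<in>pos n. r \<bar>w u\<bar> = r u) \<Longrightarrow> (\<forall>u\<in>pos n. r \<bar>v u\<bar> = r u)"
  shows "blk n v x \<subseteq> blk n w x"
proof -
  define s :: "int \<Rightarrow> int" where "s u = (if u \<in> blk n w x then 1 else 0)" for u
  have "\<forall>b\<in>blocks n w. \<forall>u\<in>b. \<forall>z\<in>b. s u = s z"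
  proof (intro ballI)
    fix b u z assume b: "b \<in> blocks n w" "u \<in> b" "z \<in> b"
    then have "u \<in> blk n w x \<longleftrightarrow> z \<in> blk n w x"
      using blocks_disjoint[OF w b(1) blk_in_blocks[OF x, of w]] by blast
    then show "s u = s z" by (simp add: s_def)
  qed
  then have "\<forall>u\<in>pos n. s \<bar>w u\<bar> = s u" using inv_colour_blocks[OF w] by blast
  then have "\<forall>u\<in>pos n. s \<bar>v u\<bar> = s u" by (rule r)
  then have c: "\<forall>b\<in>blocks n v. \<forall>u\<in>b. \<forall>z\<in>b. s u = s z" using inv_colour_blocks[OF v] by blast
  show ?thesis
  proof
    fix y assume "y \<in> blk n v x"
    then have "s y = s x" using c blk_in_blocks[OF x, of v] blk_self[OF v, of x] by blast
    moreover have "s x = 1" using blk_self[OF w, of x] by (simp add: s_def)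
    ultimately show "y \<in> blk n w x" by (simp add: s_def split: if_splits)
  qed
qed

lemma blocks_eqI:
  assumes "v \<in> W_B n" "w \<in> W_B n"
    and "\<And>r :: int \<Rightarrow> int. (\<forall>u\<in>pos n. r \<bar>v u\<bar> = r u) \<longleftrightarrow> (\<forall>u\<in>pos n. r \<bar>w u\<bar> = r u)"
  shows "blocks n v = blocks n w"
proof -
  have "blk n v x = blk n w x" if "x \<in> pos n" for x
    using blocks_subI[OF assms(1,2) that] blocks_subI[OF assms(2,1) that] assms(3) by blast
  then show ?thesis unfolding blocks_def by (intro image_cong) auto
qed

section \<open>Flags of Coxeter elements\<close>

definition sgb :: "int set \<Rightarrow> (int \<Rightarrow> int) \<Rightarrow> int" where
  "sgb b w = (\<Prod>u\<in>b. sgn (w u))"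

lemma flagged_sgb: "flagged w b \<longleftrightarrow> sgb b w = - 1"
  by (simp add: flagged_def sgb_def)

definition keeps :: "int set \<Rightarrow> (int \<Rightarrow> int) \<Rightarrow> bool" where
  "keeps b w \<longleftrightarrow> (\<forall>u\<in>b. \<bar>w u\<bar> \<in> b)"

context
  fixes n :: nat and b :: "int set"
  assumes b: "b \<subseteq> pos n"
begin

text \<open>The local version of \<open>sg_comp\<close>: on signed permutations that keep b, the
  sign product over b is multiplicative.\<close>

lemma keeps_sgb_comp:
  assumes v: "v \<in> W_B n" and w: "w \<in> W_B n" and kv: "keeps b v" and kw: "keeps b w"
  shows "keeps b (v \<circ> w)" "sgb b (v \<circ> w) = sgb b v * sgb b w"
proof -
  have fb: "finite b" using b by (rule finite_subset) simp
  show "keeps b (v \<circ> w)" unfolding keeps_def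
  proof
    fix u assume "u \<in> b"
    then have "\<bar>v \<bar>w u\<bar>\<bar> \<in> b" using kv kw by (auto simp: keeps_def)
    then show "\<bar>(v \<circ> w) u\<bar> \<in> b" by (simp add: W_B_abs[OF v])
  qed
  have "sgn (v (w u)) = sgn (w u) * sgn (v \<bar>w u\<bar>)" if "u \<in> b" for u
  proof -
    have "u \<in> pos n" using that b by blast
    then have "w u \<in> signed_letters n" using W_B_letter[OF w, of u] pos_letter[of u n] by simp
    then have "w u \<noteq> 0" by (simp add: signed_letters_def)
    then show ?thesis using W_B_odd[OF v, of "w u"] by (cases "w u > 0") auto
  qed
  then have "sgb b (v \<circ> w) = sgb b w * (\<Prod>u\<in>b. sgn (v \<bar>w u\<bar>))"
    by (simp add: sgb_def prod.distrib)
  also have "(\<Prod>u\<in>b. sgn (v \<bar>w u\<bar>)) = (\<Prod>u\<in>b. sgn (v u))"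
  proof (rule prod.reindex_bij_betw[of "\<lambda>u. \<bar>w u\<bar>" b b "\<lambda>u. sgn (v u)"])
    have "inj_on (\<lambda>u. \<bar>w u\<bar>) b"
    proof (rule inj_onI)
      fix x y assume xy: "x \<in> b" "y \<in> b" "\<bar>w x\<bar> = \<bar>w y\<bar>"
      then have "w x = w y \<or> w x = w (- y)" by (auto simp: abs_eq_iff W_B_odd[OF w])
      then have "x = y \<or> x = - y" by (simp add: W_B_inj[OF w])
      moreover have "x \<ge> 1" "y \<ge> 1" using xy b by auto
      ultimately show "x = y" by linarith
    qed
    moreover have "(\<lambda>u. \<bar>w u\<bar>) ` b \<subseteq> b" using kw by (auto simp: keeps_def)
    ultimately show "bij_betw (\<lambda>u. \<bar>w u\<bar>) b b" using endo_inj_surj[OF fb] by (simp add: bij_betw_def)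
  qed
  finally show "sgb b (v \<circ> w) = sgb b v * sgb b w" by (simp only: sgb_def[of b v] mult.commute)
qed

lemma sgb_prod_perm:
  assumes "set ts \<subseteq> W_B n" "\<forall>t\<in>set ts. keeps b t"
  shows "keeps b (prod_perm ts) \<and> sgb b (prod_perm ts) = (\<Prod>t\<leftarrow>ts. sgb b t)"
  using assms
proof (induction ts)
  case Nil
  have "sgn u = 1" "\<bar>u\<bar> = u" if "u \<in> b" for u using that b by auto
  then show ?case by (simp add: prod_perm_simps keeps_def sgb_def)
next
  case (Cons t ts)
  have W: "t \<in> W_B n" "prod_perm ts \<in> W_B n" using Cons.prems(1) by (auto intro: prod_perm_W_B)
  have IH: "keeps b (prod_perm ts)" "sgb b (prod_perm ts) = (\<Prod>t\<leftarrow>ts. sgb b t)"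
    using Cons by auto
  have "keeps b t" using Cons.prems(2) by simp
  note c = keeps_sgb_comp[OF W this IH(1)]
  show ?case unfolding prod_perm_simps list.map prod_list.Cons
    by (rule conjI[OF c(1)]) (simp only: c(2) IH(2))
qed

text \<open>A non-loop that keeps b has both absolute values in b or neither; in the first case its
  two signs are equal and cancel.\<close>

lemma sgb_reflection:
  assumes p: "p \<in> signed_letters n \<times> signed_letters n" and l: "\<not> loop p" and k: "keeps b (reflection p)"
  shows "sgb b (reflection p) = 1"
proof -
  have fb: "finite b" using b by (rule finite_subset) simp
  obtain x z where xz: "p = (x, z)" by (cases p)
  have x: "x \<noteq> 0" "z \<noteq> 0" "\<bar>x\<bar> \<noteq> \<bar>z\<bar>" using p l by (auto simp: xz signed_letters_def loop_def)
  have ap: "reflection p u = (if u = x then z else if u = z then x else if u = - x then - z else if u = - z then - x else u)" for u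
    using x by (simp add: xz reflection_def refl_A_apply)
  have bp: "u \<ge> 1" if "u \<in> b" for u using that b by auto
  have kx: "\<bar>x\<bar> \<in> b \<longleftrightarrow> \<bar>z\<bar> \<in> b"
  proof
    have "\<bar>reflection p \<bar>x\<bar>\<bar> = \<bar>z\<bar>" using x by (auto simp: ap abs_if)
    then show "\<bar>x\<bar> \<in> b \<Longrightarrow> \<bar>z\<bar> \<in> b" using k unfolding keeps_def by metis
    have "\<bar>reflection p \<bar>z\<bar>\<bar> = \<bar>x\<bar>" using x by (auto simp: ap abs_if)
    then show "\<bar>z\<bar> \<in> b \<Longrightarrow> \<bar>x\<bar> \<in> b" using k unfolding keeps_def by metis
  qed
  have o: "sgn (reflection p u) = 1" if "u \<in> b" "u \<noteq> \<bar>x\<bar>" "u \<noteq> \<bar>z\<bar>" for u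
  proof -
    have "reflection p u = u" using that bp[OF that(1)] by (auto simp: ap abs_if split: if_splits)
    then show ?thesis using bp[OF that(1)] by simp
  qed
  show ?thesis
  proof (cases "\<bar>x\<bar> \<in> b")
    case True
    have "sgb b (reflection p) = sgn (reflection p \<bar>x\<bar>) * (\<Prod>u\<in>b - {\<bar>x\<bar>}. sgn (reflection p u))"
      unfolding sgb_def by (rule prod.remove[OF fb True])
    also have "(\<Prod>u\<in>b - {\<bar>x\<bar>}. sgn (reflection p u)) =
      sgn (reflection p \<bar>z\<bar>) * (\<Prod>u\<in>b - {\<bar>x\<bar>} - {\<bar>z\<bar>}. sgn (reflection p u))"
      using True kx x(3) fb by (intro prod.remove) auto
    also have "(\<Prod>u\<in>b - {\<bar>x\<bar>} - {\<bar>z\<bar>}. sgn (reflection p u)) = 1"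
      by (intro prod.neutral) (use o in auto)
    also have "sgn (reflection p \<bar>x\<bar>) * (sgn (reflection p \<bar>z\<bar>) * 1) = 1"
      using x by (auto simp: ap abs_if)
    finally show ?thesis .
  next
    case False
    then show ?thesis unfolding sgb_def using kx o by (intro prod.neutral) auto
  qed
qed

end

text \<open>On the subgroup \<open>sgb b\<close> is multiplicative, with value 1 on all simple
  reflections except possibly node 0. That node occurs at most once in a Coxeter element, so b is
  flagged exactly if \<open>sgb b\<close> is nontrivial on the subgroup, a condition free of the
  chosen simple system.\<close>

lemma sgb_parabolic:
  assumes w: "w \<in> W_B n" and js: "distinct js" "set js \<subseteq> {..<n}" and b: "b \<in> blocks n (prod_perm (map (crefl w) js))"
  shows "sgb b (prod_perm (map (crefl w) js)) = - 1 \<longleftrightarrow> (\<exists>v\<in>gen_by (crefl w ` set js). sgb b v \<noteq> 1)"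
proof -
  let ?u = "prod_perm (map (crefl w) js)"
  have W: "set (map (crefl w) js) \<subseteq> W_B n" using crefl_set_W_B[OF w js] by simp
  have uW: "?u \<in> W_B n" by (rule prod_perm_W_B[OF W])
  have bp: "b \<subseteq> pos n" by (rule block_props(2)[OF uW b])
  define s :: "int \<Rightarrow> int" where "s u = (if u \<in> b then 1 else 0)" for u
  have "\<forall>c\<in>blocks n ?u. \<forall>u\<in>c. \<forall>z\<in>c. s u = s z"
  proof (intro ballI)
    fix c u z assume c: "c \<in> blocks n ?u" "u \<in> c" "z \<in> c"
    then have "u \<in> b \<longleftrightarrow> z \<in> b" using blocks_disjoint[OF uW c(1) b] by blast
    then show "s u = s z" by (simp add: s_def)
  qed
  then have sinv: "\<forall>u\<in>pos n. s \<bar>?u u\<bar> = s u" using inv_colour_blocks[OF uW] by blast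
  have keeps: "keeps b (crefl w p)" if p: "p \<in> set js" for p unfolding keeps_def
  proof
    fix u assume u: "u \<in> b"
    then have "s \<bar>crefl w p u\<bar> = s u" using crefl_prod_invariant[OF w js sinv p] bp by blast
    then show "\<bar>crefl w p u\<bar> \<in> b" using u by (simp add: s_def split: if_splits)
  qed
  have one: "sgb b (crefl w p) = 1" if p: "p \<in> set js" "p \<noteq> 0" for p
  proof -
    have pn: "p < n" using js(2) p(1) by auto
    show ?thesis unfolding crefl_reflection(1)[OF w pn]
    proof (rule sgb_reflection[OF bp crefl_reflection(2)[OF w pn]])
      show "\<not> loop (map_prod w w (spair p))" using crefl_reflection(3)[OF w pn] p(2) by simp
      show "keeps b (reflection (map_prod w w (spair p)))"
        using keeps[OF p(1)] by (simp only: crefl_reflection(1)[OF w pn])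
    qed
  qed
  show ?thesis
  proof
    assume "sgb b ?u = - 1"
    moreover have "?u \<in> gen_by (crefl w ` set js)"
      unfolding gen_by_def mem_Collect_eq by (rule exI[of _ "map (crefl w) js"]) simp
    ultimately show "\<exists>v\<in>gen_by (crefl w ` set js). sgb b v \<noteq> 1" by force
  next
    assume "\<exists>v\<in>gen_by (crefl w ` set js). sgb b v \<noteq> 1"
    then obtain ts where ts: "set ts \<subseteq> crefl w ` set js" "sgb b (prod_perm ts) \<noteq> 1" unfolding gen_by_def by blast
    have tsp: "set ts \<subseteq> W_B n" "\<forall>t\<in>set ts. keeps b t" using ts(1) keeps crefl_set_W_B[OF w js] by auto
    have "(\<Prod>t\<leftarrow>ts. sgb b t) \<noteq> 1" using sgb_prod_perm[OF bp tsp] ts(2) by simp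
    then have "\<exists>t\<in>set ts. sgb b t \<noteq> 1" by (induction ts) auto
    then obtain p where p: "p \<in> set js" "sgb b (crefl w p) \<noteq> 1" using ts(1) by blast
    then have p0: "p = 0" using one by blast
    \<comment> \<open>The node 0 occurs exactly once in js; the factors before and after it
      contribute 1.\<close>
    obtain A B where AB: "js = A @ 0 # B" using p(1) p0 by (metis split_list)
    have "0 \<notin> set A" "0 \<notin> set B" using js(1) AB by auto
    then have AB1: "sgb b (crefl w q) = 1" if "q \<in> set A \<union> set B" for q 
    proof -
      show ?thesis
      proof (rule one)
      show "q \<in> set js" using that AB by auto
      show "q \<noteq> 0" using that \<open>0 \<notin> set A\<close> \<open>0 \<notin> set B\<close> by (metis Un_iff)
      qed
    qed
    have pl: "(\<Prod>t\<leftarrow>map (crefl w) C. sgb b t) = 1" if "\<forall>q\<in>set C. sgb b (crefl w q) = 1" for C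
      using that by (induction C) auto
    have "(\<Prod>t\<leftarrow>map (crefl w) A. sgb b t) = 1" "(\<Prod>t\<leftarrow>map (crefl w) B. sgb b t) = 1"
      by (rule pl, rule ballI, rule AB1, simp)+
    moreover have "sgb b ?u = (\<Prod>t\<leftarrow>map (crefl w) js. sgb b t)"
      using sgb_prod_perm[OF bp W] keeps by simp
    ultimately have u0: "sgb b ?u = sgb b (crefl w 0)" unfolding AB by simp
    have pm: "prod f c \<in> {1, - 1}" if "finite c" "\<forall>x\<in>c. f x \<in> {1, - 1}" for f :: "int \<Rightarrow> int" and c
      using that by (induction c rule: finite_induct) auto
    have "sgb b ?u \<in> {1, - 1}" unfolding sgb_def
    proof (rule pm)
      show "finite b" using bp by (rule finite_subset) simp
      show "\<forall>x\<in>b. sgn (?u x) \<in> {1, - 1}"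
      proof
        fix x assume "x \<in> b"
        then have "?u x \<in> signed_letters n" using W_B_letter[OF uW, of x] pos_letter[of x n] bp by blast
        then have "?u x \<noteq> 0" by (auto simp: signed_letters_def)
        then show "sgn (?u x) \<in> {1, - 1}" by (auto simp: sgn_if)
      qed
    qed
    then show "sgb b ?u = - 1" using p(2) p0 u0 by auto
  qed
qed

text \<open>Blocks and flags have both been described through the generated subgroup. Thus the cycle
  type depends neither on the simple system nor on the order of its reflections.\<close>

lemma Lam_coxeter_element:
  assumes v: "v \<in> W_B n" "distinct is" "set is \<subseteq> {..<n}" and w: "w \<in> W_B n" "distinct js" "set js \<subseteq> {..<n}"
    and eq: "gen_by (crefl v ` set is) = gen_by (crefl w ` set js)"
  shows "Lam n (prod_perm (map (crefl v) is)) = Lam n (prod_perm (map (crefl w) js))"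
proof -
  let ?u = "prod_perm (map (crefl v) is)" and ?u' = "prod_perm (map (crefl w) js)"
  have W: "?u \<in> W_B n" "?u' \<in> W_B n"
    using crefl_set_W_B[OF v] crefl_set_W_B[OF w] by (auto intro!: prod_perm_W_B)
  have bl: "blocks n ?u = blocks n ?u'"
    by (rule blocks_eqI[OF W]) (simp only: parabolic_invariant[OF v] parabolic_invariant[OF w] eq)
  have "lab ?u b = lab ?u' b" if b: "b \<in> blocks n ?u" for b
    using sgb_parabolic[OF v b] sgb_parabolic[OF w b[unfolded bl]] by (simp add: lab_def flagged_sgb eq)
  then show ?thesis unfolding Lam_def bl[symmetric] by (intro image_mset_cong) (simp add: finite_blocks)
qed

subsection \<open>Intervals in the diagram\<close>

text \<open>The pair \<open>(l, k)\<close> stands for the nodes \<open>l, ..., l + k - 1\<close> of the diagram of \<open>W(B\<^sub>n)\<close>; the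
  node \<open>0\<close> is the reflection \<open>[1]\<close>, the node \<open>p\<close> the reflection \<open>((p, p + 1))\<close>.\<close>

definition ivl :: "nat \<times> nat \<Rightarrow> nat list" where
  "ivl I = [fst I..<fst I + snd I]"

text \<open>The product of the nodes of an interval in increasing order is one cycle: [1, ..., k]
  for the nodes 0, ..., k - 1, and ((l, ..., l + k)) for l \<ge> 1. The maximum with 1 is there
  because node 0 uses the letter 1 only.\<close>

definition icyc :: "nat \<times> nat \<Rightarrow> bool \<times> int list" where
  "icyc I = (fst I = 0, map int [max 1 (fst I)..<Suc (fst I + snd I)])"

text \<open>The single node 0 is A_1, since B_1 is not a group-theoretic label.\<close>

definition ityp :: "nat \<times> nat \<Rightarrow> irr_type" where
  "ityp I = (if fst I = 0 \<and> snd I \<ge> 2 then Type_B (snd I) else Type_A (snd I))"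

lemma sdist_map_int: "distinct ks \<Longrightarrow> 0 \<notin> set ks \<Longrightarrow> sdist (map int ks)"
  by (auto simp: sdist_def distinct_map inj_on_def)

text \<open>Letters are peeled off by \<open>cyc_Cons\<close>; the cycle that remains has one letter
  and is the identity in type A, a sign change in type B.\<close>

lemma cyc_chain:
  "l \<ge> 1 \<Longrightarrow> cyc (f, map int [l..<Suc (l + m)]) =
     prod_perm (map (\<lambda>p. reflection (spair p)) [l..<l + m]) \<circ> cyc (f, [int (l + m)])"
proof (induction m arbitrary: l)
  case (Suc m)
  have u: "[l..<l + Suc m] = l # [Suc l..<Suc l + m]" "[l..<Suc (l + Suc m)] = l # Suc l # [Suc (Suc l)..<Suc (Suc l + m)]"
    "[Suc l..<Suc (Suc l + m)] = Suc l # [Suc (Suc l)..<Suc (Suc l + m)]"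
    by (simp_all add: upt_conv_Cons)
  have sd: "sdist (map int [l..<Suc (l + Suc m)])" using Suc.prems by (intro sdist_map_int) auto
  have "cyc (f, map int [l..<Suc (l + Suc m)]) = refl_A (int l) (int (Suc l)) \<circ> cyc (f, map int [Suc l..<Suc (Suc l + m)])"
    using sd unfolding u(2,3) list.map by (rule cyc_Cons)
  also have "refl_A (int l) (int (Suc l)) = reflection (spair l)"
    using Suc.prems by (simp add: spair_def reflection_def add.commute)
  also have "cyc (f, map int [Suc l..<Suc (Suc l + m)]) =
      prod_perm (map (\<lambda>p. reflection (spair p)) [Suc l..<Suc l + m]) \<circ> cyc (f, [int (Suc l + m)])"
    by (rule Suc.IH) simp
  finally show ?case unfolding u(1) list.map prod_perm_simps by (simp add: comp_assoc)
qed (simp add: prod_perm_simps)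

lemma chain_last: "prod_perm (map (\<lambda>p. reflection (spair p)) [1..<Suc k]) (int k + 1) = 1"
proof (induction k)
  case (Suc k)
  let ?f = "\<lambda>p. reflection (spair p)"
  have u: "[1..<Suc (Suc k)] = [1..<Suc k] @ [Suc k]" by simp
  have "prod_perm (map ?f [1..<Suc (Suc k)]) = prod_perm (map ?f [1..<Suc k]) \<circ> ?f (Suc k)"
    unfolding u map_append prod_perm_append list.map prod_perm_simps by simp
  moreover have "?f (Suc k) (int (Suc k) + 1) = int k + 1" by (simp add: reflection_spair)
  ultimately show ?case using Suc by simp
qed (simp add: prod_perm_simps)

text \<open>For an interval from 0 the chain gives g followed on the right by the sign change [k],
  where g is the product of the nodes 1, ..., k - 1. As g sends k to 1, conjugation by g turns [k]
  into [1], which can thus be put in front.\<close>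

lemma cyc_icyc:
  assumes "snd I \<ge> 1"
  shows "cyc (icyc I) = prod_perm (map (\<lambda>p. reflection (spair p)) (ivl I))"
proof -
  obtain l k where I: "I = (l, k)" by (cases I)
  show ?thesis
  proof (cases "l = 0")
    case False
    then have "cyc (False, map int [l..<Suc (l + k)]) = prod_perm (map (\<lambda>p. reflection (spair p)) [l..<l + k]) \<circ> cyc (False, [int (l + k)])"
      by (intro cyc_chain) simp
    moreover have "max 1 l = l" using False by simp
    ultimately show ?thesis using False by (simp add: I icyc_def ivl_def cyc_def cycle_A_singleton)
  next
    case True
    obtain m where m: "k = Suc m" using assms I by (cases k) auto
    define g where "g = prod_perm (map (\<lambda>p. reflection (spair p)) [1..<k])"
    have rW: "reflection (spair p) \<in> W_B k" if "p < k" for p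
      by (rule reflection_W_B[OF spair_letters[OF that]])
    have gW: "g \<in> W_B k" unfolding g_def by (rule prod_perm_W_B) (use rW in auto)
    have gk: "g (int k) = 1" using chain_last[of m] unfolding m g_def by (simp add: add.commute)
    have kl: "(int k, int k) \<in> signed_letters k \<times> signed_letters k" using m by (simp add: signed_letters_def)
    have rk: "reflection (int k, int k) = refl_B (int k)" by (simp add: reflection_def)
    have "g \<circ> refl_B (int k) \<circ> inv g = reflection (spair 0)"
      using conj_reflection[OF gW kl] unfolding rk by (simp add: gk spair_def)
    then have "g \<circ> refl_B (int k) \<circ> inv g \<circ> g = reflection (spair 0) \<circ> g" by simp
    then have c: "g \<circ> refl_B (int k) = reflection (spair 0) \<circ> g"
      by (simp add: comp_assoc W_B_inv_cancel(1)[OF gW])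
    have km: "1 + m = k" using m by simp
    have "cyc (True, map int [1..<Suc k]) = g \<circ> cyc (True, [int k])"
      unfolding g_def by (rule cyc_chain[of 1 True m, unfolded km]) simp
    also have "cyc (True, [int k]) = refl_B (int k)" by (simp add: cyc_def cycle_B_singleton)
    also note c
    finally have "cyc (True, map int [1..<Suc k]) = reflection (spair 0) \<circ> g" .
    moreover have "[0..<k] = 0 # [1..<k]" using m by (simp add: upt_conv_Cons)
    moreover have "prod_perm (map (\<lambda>p. reflection (spair p)) (0 # [1..<k])) = reflection (spair 0) \<circ> g"
      unfolding list.map prod_perm_simps g_def ..
    ultimately show ?thesis using True by (simp add: I icyc_def ivl_def)
  qed
qed

lemma prod_perm_concat: "prod_perm (concat xss) = prod_perm (map prod_perm xss)"
  by (induction xss) (simp_all add: prod_perm_simps prod_perm_append)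

lemma distinct_concat_nth:
  "distinct (concat xss) \<longleftrightarrow> (\<forall>xs\<in>set xss. distinct xs) \<and>
     (\<forall>j<length xss. \<forall>i<j. set (xss ! i) \<inter> set (xss ! j) = {})"
proof (induction xss)
  case (Cons xs xss)
  have h: "set xs \<inter> set (concat xss) = {} \<longleftrightarrow> (\<forall>j<length xss. set xs \<inter> set (xss ! j) = {})"
    by (simp add: all_set_conv_all_nth[symmetric, of xss "\<lambda>ys. set xs \<inter> set ys = {}"]) blast
  have e: "(\<forall>j<length (xs # xss). \<forall>i<j. set ((xs # xss) ! i) \<inter> set ((xs # xss) ! j) = {}) \<longleftrightarrow>
     (\<forall>j<length xss. set xs \<inter> set (xss ! j) = {}) \<and> (\<forall>j<length xss. \<forall>i<j. set (xss ! i) \<inter> set (xss ! j) = {})"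
    by (simp add: All_less_Suc2 imp_conjR all_conj_distrib)
  show ?case unfolding e concat.simps distinct_append list.set ball_simps Cons.IH h by blast
qed simp

definition interval_system :: "nat \<Rightarrow> (nat \<times> nat) list \<Rightarrow> bool" where
  "interval_system n Is \<longleftrightarrow> (\<forall>I\<in>set Is. snd I \<ge> 1) \<and> cycles_of n (map icyc Is)"

definition conv :: "refl_type \<Rightarrow> refl_type" where
  "conv T = image_mset (\<lambda>X. if X = Type_B 1 then Type_A 1 else X) T"

lemma set_icyc: "set (snd (icyc I)) = int ` {max 1 (fst I)..fst I + snd I}"
  by (auto simp: icyc_def)

text \<open>Node x > 0 uses the letters x and x + 1, node 0 the letter 1. So two nodes share a
  letter exactly if they are equal or adjacent, and disjoint cycles correspond to intervals that
  neither meet nor touch.\<close>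

lemma icyc_meet:
  assumes "snd I \<ge> 1" "snd J \<ge> 1"
  shows "set (snd (icyc I)) \<inter> set (snd (icyc J)) = {} \<longleftrightarrow> (\<forall>x\<in>set (ivl I). \<forall>y\<in>set (ivl J). cm x y = 2)"
proof
  assume d: "set (snd (icyc I)) \<inter> set (snd (icyc J)) = {}"
  show "\<forall>x\<in>set (ivl I). \<forall>y\<in>set (ivl J). cm x y = 2"
  proof (intro ballI, rule ccontr)
    fix x y assume xy: "x \<in> set (ivl I)" "y \<in> set (ivl J)" "cm x y \<noteq> 2"
    then have "x = y \<or> y = Suc x \<or> x = Suc y" by (auto simp: cm_eq split: if_splits)
    moreover have "int (Suc x) \<in> set (snd (icyc I))" "x \<noteq> 0 \<Longrightarrow> int x \<in> set (snd (icyc I))"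
      "int (Suc y) \<in> set (snd (icyc J))" "y \<noteq> 0 \<Longrightarrow> int y \<in> set (snd (icyc J))"
      using xy unfolding set_icyc by (auto simp: ivl_def simp del: of_nat_Suc)
    ultimately show False using d by auto
  qed
next
  assume c: "\<forall>x\<in>set (ivl I). \<forall>y\<in>set (ivl J). cm x y = 2"
  show "set (snd (icyc I)) \<inter> set (snd (icyc J)) = {}"
  proof (rule ccontr)
    assume "set (snd (icyc I)) \<inter> set (snd (icyc J)) \<noteq> {}"
    then obtain v where "v \<in> set (snd (icyc I))" "v \<in> set (snd (icyc J))" by blast
    then obtain m where m: "m \<in> {max 1 (fst I)..fst I + snd I}" "m \<in> {max 1 (fst J)..fst J + snd J}"
      unfolding set_icyc by auto
    have "m \<in> set (ivl I) \<or> m - 1 \<in> set (ivl I)" "m \<in> set (ivl J) \<or> m - 1 \<in> set (ivl J)"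
      using m assms by (auto simp: ivl_def)
    moreover have "cm m m \<noteq> 2" "cm (m - 1) m \<noteq> 2" "cm m (m - 1) \<noteq> 2" "cm (m - 1) (m - 1) \<noteq> 2"
      by (cases m; simp add: cm_eq)+
    ultimately show False using c by blast
  qed
qed

lemma interval_systemI:
  assumes pos: "\<forall>I\<in>set Is. snd I \<ge> 1" and bd: "\<forall>I\<in>set Is. fst I + snd I \<le> n"
    and sep: "\<And>i j x y. i < length Is \<Longrightarrow> j < length Is \<Longrightarrow> i \<noteq> j \<Longrightarrow> x \<in> set (ivl (Is ! i)) \<Longrightarrow> y \<in> set (ivl (Is ! j)) \<Longrightarrow> cm x y = 2"
  shows "interval_system n Is"
proof -
  have p: "v \<ge> 1 \<and> v \<le> int n" if v: "v \<in> set (concat (map snd (map icyc Is)))" for v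
  proof -
    obtain I where "I \<in> set Is" "v \<in> set (snd (icyc I))" using v by auto
    then show ?thesis using bd by (fastforce simp: set_icyc)
  qed
  have "distinct (concat (map snd (map icyc Is)))" unfolding distinct_concat_nth
  proof (intro conjI ballI allI impI)
    fix xs assume "xs \<in> set (map snd (map icyc Is))"
    then show "distinct xs" by (auto simp: icyc_def distinct_map inj_on_def)
  next
    fix j i assume "j < length (map snd (map icyc Is))" "i < j"
    then have ij: "i < length Is" "j < length Is" "i \<noteq> j" by auto
    have "set (snd (icyc (Is ! i))) \<inter> set (snd (icyc (Is ! j))) = {}"
    proof (rule icyc_meet[THEN iffD2])
      show "\<forall>x\<in>set (ivl (Is ! i)). \<forall>y\<in>set (ivl (Is ! j)). cm x y = 2" using sep[OF ij] by blast
    qed (use pos ij in auto)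
    then show "set (map snd (map icyc Is) ! i) \<inter> set (map snd (map icyc Is) ! j) = {}" using ij by simp
  qed
  moreover have "map abs (concat (map snd (map icyc Is))) = concat (map snd (map icyc Is))"
    by (rule map_idI) (use p in force)
  ultimately have "sdist (concat (map snd (map icyc Is)))" unfolding sdist_def using p by force
  moreover have "set (concat (map snd (map icyc Is))) \<subseteq> signed_letters n"
  proof
    fix v assume "v \<in> set (concat (map snd (map icyc Is)))"
    from p[OF this] show "v \<in> signed_letters n" by (simp add: signed_letters_def)
  qed
  moreover have "\<forall>c\<in>set (map icyc Is). snd c \<noteq> []" using pos by (auto simp: icyc_def)
  ultimately show ?thesis unfolding interval_system_def cycles_of_def using pos by blast
qed

context
  fixes n :: nat and Is :: "(nat \<times> nat) list"
  assumes sys: "interval_system n Is"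
begin

lemma interval_pos: "I \<in> set Is \<Longrightarrow> snd I \<ge> 1"
  using sys by (simp add: interval_system_def)

lemma interval_cycles: "cycles_of n (map icyc Is)"
  using sys by (simp add: interval_system_def)

lemma interval_separated:
  assumes "i < length Is" "j < length Is" "i \<noteq> j" "x \<in> set (ivl (Is ! i))" "y \<in> set (ivl (Is ! j))"
  shows "cm x y = 2"
proof -
  have "sdist (concat (map snd (map icyc Is)))" using interval_cycles unfolding cycles_of_def by blast
  then have "distinct (concat (map snd (map icyc Is)))" by (rule sdist_distinct)
  then have *: "set (snd (icyc (Is ! i))) \<inter> set (snd (icyc (Is ! j))) = {}" if "i < j" "j < length Is" for i j
    using that unfolding distinct_concat_nth by simp
  have "set (snd (icyc (Is ! i))) \<inter> set (snd (icyc (Is ! j))) = {}"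
    using *[of i j] *[of j i] assms(1-3) by (cases i j rule: linorder_cases) blast+
  moreover have "snd (Is ! i) \<ge> 1" "snd (Is ! j) \<ge> 1" using interval_pos assms(1,2) by simp_all
  ultimately show ?thesis using icyc_meet assms(4,5) by blast
qed

lemma interval_list: "distinct (concat (map ivl Is))" "set (concat (map ivl Is)) \<subseteq> {..<n}"
proof -
  show "distinct (concat (map ivl Is))" unfolding distinct_concat_nth
  proof (intro conjI ballI allI impI)
    fix xs assume "xs \<in> set (map ivl Is)"
    then show "distinct xs" by (auto simp: ivl_def)
  next
    fix j i assume "j < length (map ivl Is)" "i < j"
    then have ij: "i < length Is" "j < length Is" "i \<noteq> j" by auto
    have "cm x x \<noteq> 2" for x by (simp add: cm_eq)
    then have "set (ivl (Is ! i)) \<inter> set (ivl (Is ! j)) = {}" using interval_separated[OF ij] by blast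
    then show "set (map ivl Is ! i) \<inter> set (map ivl Is ! j) = {}" using ij by simp
  qed
  show "set (concat (map ivl Is)) \<subseteq> {..<n}"
  proof
    fix x assume "x \<in> set (concat (map ivl Is))"
    then obtain I where I: "I \<in> set Is" "x \<in> set (ivl I)" by auto
    then have "int (Suc x) \<in> set (snd (icyc I))" unfolding set_icyc by (auto simp: ivl_def simp del: of_nat_Suc)
    then have "int (Suc x) \<in> signed_letters n" using interval_cycles I(1) unfolding cycles_of_def by auto
    then show "x \<in> {..<n}" by (simp add: signed_letters_def)
  qed
qed

lemma interval_prod:
  "prod_perm (map cyc (map icyc Is)) = prod_perm (map (\<lambda>p. reflection (spair p)) (concat (map ivl Is)))"
proof -
  have "map cyc (map icyc Is) = map prod_perm (map (map (\<lambda>p. reflection (spair p))) (map ivl Is))"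
    using cyc_icyc[OF interval_pos] by simp
  then show ?thesis unfolding map_concat prod_perm_concat by (rule arg_cong)
qed

lemma interval_nontrivial: "nontrivial (map icyc Is)"
  unfolding nontrivial_def
proof
  fix c assume "c \<in> set (map icyc Is)"
  then obtain I where "I \<in> set Is" "c = icyc I" by auto
  then show "fst c \<or> 2 \<le> length (snd c)" using interval_pos[of I] by (auto simp: icyc_def max_def)
qed

lemma interval_type: "conv (ctype (Lam n (prod_perm (map cyc (map icyc Is))))) = mset (map ityp Is)"
proof -
  have "conv (mset (map (\<lambda>c. if fst c then Type_B (length (snd c)) else Type_A (length (snd c) - 1)) (map icyc Is))) =
    mset (map (\<lambda>I. if (if fst (icyc I) then Type_B (length (snd (icyc I))) else Type_A (length (snd (icyc I)) - 1)) = Type_B 1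
       then Type_A 1 else (if fst (icyc I) then Type_B (length (snd (icyc I))) else Type_A (length (snd (icyc I)) - 1))) Is)"
    by (simp add: conv_def comp_def image_mset.compositionality flip: mset_map)
  also have "\<dots> = mset (map ityp Is)"
  proof (intro arg_cong[of _ _ mset] map_cong HOL.refl)
    fix I assume "I \<in> set Is"
    then have "snd I \<ge> 1" by (rule interval_pos)
    then show "(if (if fst (icyc I) then Type_B (length (snd (icyc I))) else Type_A (length (snd (icyc I)) - 1)) = Type_B 1
       then Type_A 1 else (if fst (icyc I) then Type_B (length (snd (icyc I))) else Type_A (length (snd (icyc I)) - 1))) = ityp I"
      by (auto simp: icyc_def ityp_def max_def)
  qed
  finally show ?thesis unfolding ctype_Lam[OF cycles_of_realises[OF interval_cycles] interval_nontrivial] .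
qed

text \<open>A type B cycle comes from an interval containing the node 0, and separated intervals
  contain it at most once.\<close>

lemma interval_num_B: "num_B (Lam n (prod_perm (map cyc (map icyc Is)))) \<le> 1"
proof -
  have "num_B (Lam n (prod_perm (map cyc (map icyc Is)))) = length (filter (\<lambda>I. fst I = 0) Is)"
    unfolding realisesD(5)[OF cycles_of_realises[OF interval_cycles]] num_B_def
    by (simp add: icyc_def comp_def filter_mset_image_mset flip: mset_map mset_filter)
  also have "\<dots> = card {i. i < length Is \<and> fst (Is ! i) = 0}" by (rule length_filter_conv_card)
  also have "\<dots> \<le> 1"
  proof -
    have "i = j" if "i < length Is" "fst (Is ! i) = 0" "j < length Is" "fst (Is ! j) = 0" for i j
    proof (rule ccontr)
      assume "i \<noteq> j"
      moreover have "snd (Is ! i) \<ge> 1" "snd (Is ! j) \<ge> 1" using interval_pos that by simp_all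
      then have "0 \<in> set (ivl (Is ! i))" "0 \<in> set (ivl (Is ! j))" using that by (auto simp: ivl_def)
      ultimately have "cm 0 0 = 2" using interval_separated[of i j] that by blast
      then show False by (simp add: cm_eq)
    qed
    then show ?thesis by (auto simp: card_le_Suc0_iff_eq)
  qed
  finally show ?thesis .
qed

end

subsection \<open>Group-theoretic types and cycle types\<close>

text \<open>An injective walk on the integers with steps of size 1 cannot turn back, so it is
  monotone.\<close>

lemma path_interval:
  fixes q :: "nat \<Rightarrow> nat"
  assumes "k \<ge> 1" "inj_on q {..<k}" "\<And>a. Suc a < k \<Longrightarrow> q (Suc a) = Suc (q a) \<or> q a = Suc (q (Suc a))"
  shows "\<exists>l. q ` {..<k} = {l..<l + k}"
proof -
  have "(\<forall>a<k. q a = q 0 + a) \<or> (\<forall>a<k. q a + a = q 0)"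
    using assms(2,3)
  proof (induction k)
    case (Suc k)
    have "inj_on q {..<k}" using Suc.prems(1) by (rule inj_on_subset) auto
    then have IH: "(\<forall>a<k. q a = q 0 + a) \<or> (\<forall>a<k. q a + a = q 0)"
      using Suc.prems(2) by (intro Suc.IH) auto
    consider "k = 0" | "k = 1" | m where "k = Suc (Suc m)"
      using not0_implies_Suc[of k] not0_implies_Suc[of "k - 1"] by (cases k) auto
    then show ?case
    proof cases
      case 2
      then have "q 1 = Suc (q 0) \<or> q 0 = Suc (q 1)" using Suc.prems(2)[of 0] by simp
      then show ?thesis using 2 by (auto simp: less_Suc_eq)
    next
      case 3
      have st: "q k = Suc (q (Suc m)) \<or> q (Suc m) = Suc (q k)" using Suc.prems(2)[of "Suc m"] 3 by simp
      have ne: "q k \<noteq> q m" using inj_onD[OF Suc.prems(1), of k m] 3 by auto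
      from IH show ?thesis
      proof
        assume h: "\<forall>a<k. q a = q 0 + a"
        have "q (Suc m) = q 0 + Suc m" "q m = q 0 + m" using h[rule_format, of "Suc m"] h[rule_format, of m] 3 by simp_all
        then have qk: "q k = q 0 + k" using st ne 3 by linarith
        have "q a = q 0 + a" if "a < Suc k" for a
          using qk h[rule_format, of a] that by (cases "a = k") simp_all
        then show ?thesis by blast
      next
        assume h: "\<forall>a<k. q a + a = q 0"
        have "q (Suc m) + Suc m = q 0" "q m + m = q 0" using h[rule_format, of "Suc m"] h[rule_format, of m] 3 by simp_all
        then have qk: "q k + k = q 0" using st ne 3 by linarith
        have "q a + a = q 0" if "a < Suc k" for a
          using qk h[rule_format, of a] that by (cases "a = k") simp_all
        then show ?thesis by blast
      qed
    qed simp
  qed simp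
  then show ?thesis
  proof
    assume h: "\<forall>a<k. q a = q 0 + a"
    have "q ` {..<k} = (\<lambda>a. q 0 + a) ` {..<k}" by (rule image_cong[OF HOL.refl]) (use h in blast)
    also have "\<dots> = {q 0..<q 0 + k}"
      using image_add_atLeastLessThan[of "q 0" 0 k] by (simp add: atLeast0LessThan add.commute)
    finally show ?thesis by blast
  next
    assume h: "\<forall>a<k. q a + a = q 0"
    have "q ` {..<k} = {q (k - 1)..<q (k - 1) + k}"
    proof (rule card_subset_eq)
      show "q ` {..<k} \<subseteq> {q (k - 1)..<q (k - 1) + k}"
      proof
        fix y assume "y \<in> q ` {..<k}"
        then obtain a where a: "a < k" "y = q a" by auto
        have "q (k - 1) + (k - 1) = q 0" using h[rule_format, of "k - 1"] assms(1) by linarith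
        moreover have "q a + a = q 0" using h a(1) by blast
        ultimately have "q (k - 1) \<le> y \<and> y < q (k - 1) + k" using a by linarith
        then show "y \<in> {q (k - 1)..<q (k - 1) + k}" by simp
      qed
      show "card (q ` {..<k}) = card {q (k - 1)..<q (k - 1) + k}" using card_image[OF assms(2)] by simp
    qed simp
    then show ?thesis by blast
  qed
qed

lemma cm_3: "cm p q = 3 \<Longrightarrow> q = Suc p \<or> p = Suc q"
  by (auto simp: cm_eq split: if_splits)

text \<open>In the path every node has at most two neighbours, which excludes the branch nodes of D
  and E. Bonds above 4 do not occur, which excludes H and I. The only bond 4 involves node 0, which
  has no bond 3, whereas F_4 has a bond 3 on both sides of its bond 4.\<close>

lemma subdiagram_interval:
  assumes irr: "is_group_irr X" and inj: "inj_on q {..<irr_rank X}"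
    and cm: "\<And>a b. a < irr_rank X \<Longrightarrow> b < irr_rank X \<Longrightarrow> cm (q a) (q b) = cox_matrix X a b"
  shows "\<exists>I. snd I \<ge> 1 \<and> q ` {..<irr_rank X} = set (ivl I) \<and> X = ityp I"
proof -
  have three: False if "a < irr_rank X" "b < irr_rank X" "c < irr_rank X" "e < irr_rank X"
      "a \<noteq> b" "b \<noteq> c" "a \<noteq> c" "cox_matrix X a e = 3" "cox_matrix X b e = 3" "cox_matrix X c e = 3" for a b c e
  proof -
    have "q a \<noteq> q b" "q b \<noteq> q c" "q a \<noteq> q c" using inj_onD[OF inj] that(1-7) by (metis lessThan_iff)+
    moreover have "cm (q a) (q e) = 3" "cm (q b) (q e) = 3" "cm (q c) (q e) = 3" using cm that by simp_all
    ultimately show False using cm_3[of "q a" "q e"] cm_3[of "q b" "q e"] cm_3[of "q c" "q e"] by arith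
  qed
  have cm4: "cm x y \<le> 4" for x y by (simp add: cm_eq)
  show ?thesis
  proof (cases X)
    case (Type_A k)
    then have k: "k \<ge> 1" "irr_rank X = k" using irr by simp_all
    have "\<exists>l. q ` {..<k} = {l..<l + k}"
    proof (rule path_interval[OF k(1) inj[unfolded k(2)]])
      fix a assume a: "Suc a < k"
      then have "cm (q a) (q (Suc a)) = 3" using cm[of a "Suc a"] by (simp add: Type_A cox_matrix_def)
      then show "q (Suc a) = Suc (q a) \<or> q a = Suc (q (Suc a))" by (rule cm_3)
    qed
    then obtain l where l: "q ` {..<k} = {l..<l + k}" by blast
    \<comment> \<open>An interval with the nodes 0 and 1 contains a bond 4, which type A has
      not.\<close>
    have "\<not> (l = 0 \<and> k \<ge> 2)"
    proof
      assume "l = 0 \<and> k \<ge> 2"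
      then have "0 \<in> q ` {..<k}" "1 \<in> q ` {..<k}" using l by auto
      then obtain a b where ab: "a < k" "b < k" "q a = 0" "q b = 1" by (metis imageE lessThan_iff)
      then have "cox_matrix X a b = 4" using cm[of a b] k(2) by (simp add: cm_eq)
      then show False by (auto simp: Type_A cox_matrix_def split: if_splits)
    qed
    then have "X = ityp (l, k)" by (auto simp: Type_A ityp_def)
    then show ?thesis using k l by (intro exI[of _ "(l, k)"]) (auto simp: ivl_def)
  next
    case (Type_B k)
    then have k: "k \<ge> 2" "irr_rank X = k" using irr by simp_all
    have "\<exists>l. q ` {..<k} = {l..<l + k}"
    proof (rule path_interval[OF _ inj[unfolded k(2)]])
      fix a assume a: "Suc a < k"
      then have "cm (q a) (q (Suc a)) = 3 \<or> cm (q a) (q (Suc a)) = 4"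
        using cm[of a "Suc a"] by (simp add: Type_B cox_matrix_def)
      then show "q (Suc a) = Suc (q a) \<or> q a = Suc (q (Suc a))" by (auto simp: cm_eq split: if_splits)
    qed (use k in simp)
    then obtain l where l: "q ` {..<k} = {l..<l + k}" by blast
    \<comment> \<open>A bond 4 involves node 0, so the interval starts there.\<close>
    have "cm (q 0) (q 1) = 4" using cm[of 0 1] k by (simp add: Type_B cox_matrix_def)
    then have "q 0 = 0 \<or> q 1 = 0" by (auto simp: cm_eq split: if_splits)
    then have "0 \<in> q ` {..<k}" using k by (metis One_nat_def imageI lessThan_iff less_le_trans numeral_2_eq_2 lessI zero_less_Suc)
    then have "l = 0" using l by simp
    then show ?thesis using k l by (intro exI[of _ "(0, k)"]) (auto simp: ivl_def ityp_def Type_B)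
  next
    case (Type_D k)
    then have "k \<ge> 4" using irr by simp
    then show ?thesis using three[of 0 1 3 2] by (simp add: Type_D cox_matrix_def)
  next
    case (Type_E k)
    then have "k \<ge> 6" using irr by auto
    then show ?thesis using three[of 0 2 4 3] by (simp add: Type_E cox_matrix_def)
  next
    case Type_F4
    have "cm (q 0) (q 1) = 3" "cm (q 1) (q 2) = 4" "cm (q 2) (q 3) = 3"
      using cm[of 0 1] cm[of 1 2] cm[of 2 3] by (simp_all add: Type_F4 cox_matrix_def)
    then have False by (auto simp: cm_eq split: if_splits)
    then show ?thesis ..
  next
    case (Type_H k)
    then have "k \<ge> 3" using irr by auto
    then have "cm (q 0) (q 1) = 5" using cm[of 0 1] by (simp add: Type_H cox_matrix_def)
    then show ?thesis using cm4[of "q 0" "q 1"] by simp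
  next
    case (Type_I m)
    then have "m \<ge> 5" using irr by simp
    moreover have "cm (q 0) (q 1) = m" using cm[of 0 1] by (simp add: Type_I cox_matrix_def)
    ultimately show ?thesis using cm4[of "q 0" "q 1"] by simp
  qed
qed

text \<open>Each irreducible component occupies an interval of nodes, and nodes of different
  components commute, so the intervals are separated.\<close>

lemma diagram_interval_system:
  assumes w: "w \<in> W_B n" and J: "J \<subseteq> {..<n}" and dia: "has_diagram (crefl w ` J) T" and T: "is_group_type T"
  shows "\<exists>Is. interval_system n Is \<and> set (concat (map ivl Is)) = J \<and> T = mset (map ityp Is)"
proof -
  obtain Xs f where Xs: "mset Xs = T" and bij: "bij_betw f (diagram_nodes Xs) (crefl w ` J)"
    and ord: "\<And>i a j b. (i, a) \<in> diagram_nodes Xs \<Longrightarrow> (j, b) \<in> diagram_nodes Xs \<Longrightarrow>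
      perm_order (f (i, a) \<circ> f (j, b)) = (if i = j then cox_matrix (Xs ! i) a b else 2)"
    using dia unfolding has_diagram_def by (fastforce split: prod.splits)
  define p where "p x = inv (crefl w) (f x)" for x
  have fp: "f x = crefl w (p x)" "p x \<in> J" if "x \<in> diagram_nodes Xs" for x
  proof -
    have "f x \<in> crefl w ` J" using bij that by (auto simp: bij_betw_def)
    then obtain j where j: "j \<in> J" "f x = crefl w j" by blast
    then have "p x = j" unfolding p_def by (simp add: inv_f_f[OF crefl_inj[OF w]])
    then show "f x = crefl w (p x)" "p x \<in> J" using j by simp_all
  qed
  have pinj: "inj_on p (diagram_nodes Xs)"
  proof (rule inj_onI)
    fix x y assume "x \<in> diagram_nodes Xs" "y \<in> diagram_nodes Xs" "p x = p y"
    then show "x = y" using fp(1) bij by (metis bij_betw_def inj_onD)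
  qed
  have pim: "p ` diagram_nodes Xs = J"
  proof
    show "J \<subseteq> p ` diagram_nodes Xs"
    proof
      fix j assume "j \<in> J"
      then have "crefl w j \<in> f ` diagram_nodes Xs" using bij by (auto simp: bij_betw_def)
      then obtain x where x: "x \<in> diagram_nodes Xs" "crefl w j = f x" by blast
      then have "p x = j" using fp(1)[OF x(1)] injD[OF crefl_inj[OF w]] by metis
      then show "j \<in> p ` diagram_nodes Xs" using x(1) by blast
    qed
  qed (use fp in blast)
  have cmp: "cm (p (i, a)) (p (j, b)) = (if i = j then cox_matrix (Xs ! i) a b else 2)"
    if "(i, a) \<in> diagram_nodes Xs" "(j, b) \<in> diagram_nodes Xs" for i a j b
    using ord[OF that] fp(1)[OF that(1)] fp(1)[OF that(2)] perm_order_crefl[OF w] by simp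
  have node: "(i, a) \<in> diagram_nodes Xs \<longleftrightarrow> i < length Xs \<and> a < irr_rank (Xs ! i)" for i a
    by (simp add: diagram_nodes_def)
  have "\<exists>I. snd I \<ge> 1 \<and> (\<lambda>a. p (i, a)) ` {..<irr_rank (Xs ! i)} = set (ivl I) \<and> Xs ! i = ityp I" if i: "i < length Xs" for i
  proof (rule subdiagram_interval)
    show "is_group_irr (Xs ! i)" using T Xs i unfolding is_group_type_def by (metis nth_mem set_mset_mset)
    show "inj_on (\<lambda>a. p (i, a)) {..<irr_rank (Xs ! i)}"
    proof (rule inj_onI)
      fix a b assume "a \<in> {..<irr_rank (Xs ! i)}" "b \<in> {..<irr_rank (Xs ! i)}" "p (i, a) = p (i, b)"
      then show "a = b" using inj_onD[OF pinj, of "(i, a)" "(i, b)"] i by (simp add: node)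
    qed
    show "cm (p (i, a)) (p (i, b)) = cox_matrix (Xs ! i) a b" if "a < irr_rank (Xs ! i)" "b < irr_rank (Xs ! i)" for a b
      using cmp[of i a i b] i that by (simp add: node)
  qed
  then obtain I where I: "\<And>i. i < length Xs \<Longrightarrow> snd (I i) \<ge> 1 \<and>
      (\<lambda>a. p (i, a)) ` {..<irr_rank (Xs ! i)} = set (ivl (I i)) \<and> Xs ! i = ityp (I i)" by metis
  define Is where "Is = map I [0..<length Xs]"
  have len: "length Is = length Xs" and nth: "\<And>i. i < length Xs \<Longrightarrow> Is ! i = I i" by (simp_all add: Is_def)
  have mem: "\<exists>a. x = p (i, a) \<and> (i, a) \<in> diagram_nodes Xs" if i: "i < length Xs" and x: "x \<in> set (ivl (I i))" for i x
  proof -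
    have "x \<in> (\<lambda>a. p (i, a)) ` {..<irr_rank (Xs ! i)}" using I[OF i] x by metis
    then obtain a where "a < irr_rank (Xs ! i)" "x = p (i, a)" by blast
    then show ?thesis using i node by blast
  qed
  have un: "set (concat (map ivl Is)) = J"
  proof -
    have "set (concat (map ivl Is)) = (\<Union>i<length Xs. set (ivl (I i)))" by (simp add: Is_def atLeast0LessThan)
    also have "\<dots> = (\<Union>i<length Xs. (\<lambda>a. p (i, a)) ` {..<irr_rank (Xs ! i)})" 
    proof (rule SUP_cong[OF HOL.refl])
      fix i assume "i \<in> {..<length Xs}"
      then show "set (ivl (I i)) = (\<lambda>a. p (i, a)) ` {..<irr_rank (Xs ! i)}" using I[of i] by (metis lessThan_iff)
    qed
    also have "\<dots> = p ` diagram_nodes Xs" by (auto simp: diagram_nodes_def)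
    finally show ?thesis using pim by simp
  qed
  have "interval_system n Is"
  proof (rule interval_systemI)
    show pos: "\<forall>K\<in>set Is. snd K \<ge> 1" using I by (auto simp: Is_def)
    show "\<forall>K\<in>set Is. fst K + snd K \<le> n"
    proof
      fix K assume K: "K \<in> set Is"
      then have "snd K \<ge> 1" using pos by blast
      then have "fst K + snd K - 1 \<in> set (ivl K)" by (auto simp: ivl_def)
      then have "fst K + snd K - 1 \<in> J" using K un by auto
      then have "fst K + snd K - 1 < n" using J by auto
      then show "fst K + snd K \<le> n" by linarith
    qed
    fix i j x y assume ij: "i < length Is" "j < length Is" "i \<noteq> j" "x \<in> set (ivl (Is ! i))" "y \<in> set (ivl (Is ! j))"
    then obtain a b where "x = p (i, a)" "(i, a) \<in> diagram_nodes Xs" "y = p (j, b)" "(j, b) \<in> diagram_nodes Xs"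
      using mem[of i x] mem[of j y] nth len by metis
    then show "cm x y = 2" using cmp[of i a j b] ij(3) by simp
  qed
  moreover have "Xs = map ityp Is"
    using I len nth by (intro nth_equalityI) auto
  ultimately show ?thesis using un Xs by blast
qed

lemma prod_crefl:
  assumes "w \<in> W_B n"
  shows "prod_perm (map (crefl w) js) = w \<circ> prod_perm (map (\<lambda>p. reflection (spair p)) js) \<circ> inv w"
  unfolding conj_prod_perm[OF W_B_bij[OF assms]] map_map
  by (intro arg_cong[of _ _ prod_perm] map_cong) (simp_all add: crefl_def comp_def)

text \<open>The simple system that produces u as a Coxeter element and the one that carries the
  diagram may be different; they generate the same subgroup, so \<open>Lam_coxeter_element\<close>
  allows u to be replaced by the product over the second one.\<close>

lemma group_type_cycle_type:
  assumes "has_group_type n u T" and T: "is_group_type T"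
  shows "T = conv (ctype (Lam n u)) \<and> num_B (Lam n u) \<le> 1"
proof -
  obtain P where P: "u \<in> coxeter_elements n P" "subgroup_has_type n P T"
    using assms(1) unfolding has_group_type_def by blast
  obtain ss where ss: "u = prod_perm ss" "distinct ss" "set ss \<in> simple_systems n P"
    using P(1) unfolding coxeter_elements_def by blast
  obtain R where R: "R \<in> simple_systems n P" "has_diagram R T" using P(2) unfolding subgroup_has_type_def by blast
  obtain v J where v: "v \<in> W_B n" "J \<subseteq> {..<n}" "set ss = crefl v ` J"
    using ss(3) unfolding simple_systems_def parabolic_systems_eq by blast
  obtain js where js: "distinct js" "set js = J" "ss = map (crefl v) js"
    using crefl_list[OF v(1) ss(2) v(3)] by blast
  obtain w K where w: "w \<in> W_B n" "K \<subseteq> {..<n}" "R = crefl w ` K"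
    using R(1) unfolding simple_systems_def parabolic_systems_eq by blast
  obtain Is where Is: "interval_system n Is" "set (concat (map ivl Is)) = K" "T = mset (map ityp Is)"
    using diagram_interval_system[OF w(1,2) R(2)[unfolded w(3)] T] by blast
  let ?ks = "concat (map ivl Is)"
  have gen: "gen_by (crefl v ` set js) = gen_by (crefl w ` set ?ks)"
    using ss(3) R(1) v(3) w(3) js(2) Is(2) unfolding simple_systems_def by simp
  have "Lam n u = Lam n (prod_perm (map (crefl w) ?ks))" unfolding ss(1) js(3)
    by (rule Lam_coxeter_element[OF v(1) js(1) _ w(1) interval_list(1)[OF Is(1)] _ gen])
      (use js(2) v(2) Is(2) w(2) in simp_all)
  also have "prod_perm (map (crefl w) ?ks) = w \<circ> prod_perm (map cyc (map icyc Is)) \<circ> inv w"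
    unfolding interval_prod[OF Is(1)] by (rule prod_crefl[OF w(1)])
  also have "Lam n \<dots> = Lam n (prod_perm (map cyc (map icyc Is)))"
    by (rule Lam_conj[OF w(1) realisesD(1)[OF cycles_of_realises[OF interval_cycles[OF Is(1)]]]])
  finally have L: "Lam n u = Lam n (prod_perm (map cyc (map icyc Is)))" .
  show ?thesis unfolding L Is(3) using interval_type[OF Is(1)] interval_num_B[OF Is(1)] by simp
qed

subsection \<open>Realising a cycle type\<close>

text \<open>Lays the cycles on consecutive letters, s of which are already used. A type A cycle with
  k letters takes the k - 1 nodes s + 1, ..., s + k - 1, leaving the node s as a gap; a type B cycle
  has to come first, at s = 0, where it takes the nodes 0, ..., k - 1.\<close>

fun intervals :: "nat \<Rightarrow> (bool \<times> int list) list \<Rightarrow> (nat \<times> nat) list" where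
  "intervals s [] = []"
| "intervals s (c # L) = (if fst c then (s, length (snd c)) else (Suc s, length (snd c) - 1)) #
     intervals (s + length (snd c)) L"

definition shape :: "(bool \<times> int list) list \<Rightarrow> (bool \<times> nat) list" where
  "shape L = map (\<lambda>c. (fst c, length (snd c))) L"

lemma intervals_A:
  assumes "\<forall>c\<in>set L. \<not> fst c \<and> length (snd c) \<ge> 2"
  shows "shape (map icyc (intervals s L)) = shape L \<and>
    concat (map snd (map icyc (intervals s L))) = map int [Suc s..<Suc (s + length (concat (map snd L)))] \<and>
    (\<forall>I\<in>set (intervals s L). snd I \<ge> 1)"
  using assms
proof (induction L arbitrary: s)
  case (Cons c L)
  let ?k = "length (snd c)"
  have c: "\<not> fst c" "?k \<ge> 2" using Cons.prems by auto
  have IH: "shape (map icyc (intervals (s + ?k) L)) = shape L"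
    "concat (map snd (map icyc (intervals (s + ?k) L))) = map int [Suc (s + ?k)..<Suc (s + ?k + length (concat (map snd L)))]"
    "\<forall>I\<in>set (intervals (s + ?k) L). snd I \<ge> 1"
    using Cons.IH[of "s + ?k"] Cons.prems by auto
  have ic: "icyc (Suc s, ?k - 1) = (False, map int [Suc s..<Suc (s + ?k)])"
  proof -
    have e: "Suc s + (?k - 1) = s + ?k" using c(2) by simp
    show ?thesis unfolding icyc_def fst_conv snd_conv e by (simp del: upt_Suc)
  qed
  have u: "[Suc s..<Suc (s + ?k + m)] = [Suc s..<Suc (s + ?k)] @ [Suc (s + ?k)..<Suc (s + ?k + m)]" for m
    using upt_add_eq_append[of "Suc s" "Suc (s + ?k)" m] by simp
  have iv: "intervals s (c # L) = (Suc s, ?k - 1) # intervals (s + ?k) L" using c(1) by simp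
  have ln: "length (concat (map snd (c # L))) = ?k + length (concat (map snd L))" by simp
  show ?case
  proof (intro conjI)
    show "shape (map icyc (intervals s (c # L))) = shape (c # L)"
      unfolding iv list.map ic using IH(1) c(1) by (simp add: shape_def del: upt_Suc)
    show "concat (map snd (map icyc (intervals s (c # L)))) = map int [Suc s..<Suc (s + length (concat (map snd (c # L))))]"
      unfolding iv ln add.assoc[symmetric] u unfolding list.map concat.simps ic snd_conv IH(2) map_append ..
    show "\<forall>I\<in>set (intervals s (c # L)). snd I \<ge> 1" unfolding iv using IH(3) c(2) by simp
  qed
qed (simp add: shape_def)

lemma intervals_AB:
  assumes A: "\<forall>c\<in>set LA. \<not> fst c \<and> length (snd c) \<ge> 2" and B: "\<forall>c\<in>set LB. fst c \<and> snd c \<noteq> []" "length LB \<le> 1"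
  defines "L \<equiv> LB @ LA"
  shows "shape (map icyc (intervals 0 L)) = shape L \<and>
    concat (map snd (map icyc (intervals 0 L))) = map int [1..<Suc (length (concat (map snd L)))] \<and>
    (\<forall>I\<in>set (intervals 0 L). snd I \<ge> 1)"
proof (cases LB)
  case Nil
  then show ?thesis using intervals_A[OF A, of 0] by (simp add: L_def)
next
  case (Cons c LB')
  then have L: "L = c # LA" and c: "fst c" "snd c \<noteq> []" using B by (auto simp: L_def)
  let ?k = "length (snd c)"
  have k: "?k \<ge> 1" using c(2) by (cases "snd c") auto
  note IH = intervals_A[OF A, of ?k]
  have ic: "icyc (0, ?k) = (True, map int [1..<Suc ?k])" by (simp add: icyc_def)
  have u: "[1..<Suc (?k + m)] = [1..<Suc ?k] @ [Suc ?k..<Suc (?k + m)]" for m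
    using upt_add_eq_append[of 1 "Suc ?k" m] by simp
  have iv: "intervals 0 L = (0, ?k) # intervals ?k LA" using c(1) by (simp add: L)
  have ln: "length (concat (map snd L)) = ?k + length (concat (map snd LA))" by (simp add: L)
  show ?thesis
  proof (intro conjI)
    show "shape (map icyc (intervals 0 L)) = shape L"
      unfolding iv using IH c(1) k by (simp add: shape_def ic L del: upt_Suc)
    show "concat (map snd (map icyc (intervals 0 L))) = map int [1..<Suc (length (concat (map snd L)))]"
      unfolding iv ln u unfolding list.map concat.simps ic snd_conv map_append using IH by simp
    show "\<forall>I\<in>set (intervals 0 L). snd I \<ge> 1" unfolding iv using IH k by simp
  qed
qed

lemma shape_concat_eq:
  "shape L = shape M \<Longrightarrow> concat (map snd L) = concat (map snd M) \<Longrightarrow> L = M"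
proof (induction L arbitrary: M)
  case (Cons c L)
  then obtain d M' where M: "M = d # M'" by (cases M) (auto simp: shape_def)
  have "length (snd c) = length (snd d)" "fst c = fst d" "shape L = shape M'" using Cons.prems(1) by (simp_all add: M shape_def)
  then show ?case using Cons by (simp add: M prod_eq_iff)
qed (simp add: shape_def)

lemma conj_shape: "shape (conj_cycles g L) = shape L"
  by (simp add: shape_def conj_cycles_def comp_def)

lemma interval_diagram:
  assumes w: "w \<in> W_B n" and sys: "interval_system n Is"
  shows "has_diagram (crefl w ` set (concat (map ivl Is))) (mset (map ityp Is))"
  unfolding has_diagram_def
proof (rule exI[of _ "map ityp Is"], rule exI[of _ "\<lambda>(i, a). crefl w (fst (Is ! i) + a)"], intro conjI)
  let ?N = "diagram_nodes (map ityp Is)" and ?p = "\<lambda>(i, a). fst (Is ! i) + a"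
  have rank: "irr_rank (ityp I) = snd I" for I by (simp add: ityp_def)
  have node: "(i, a) \<in> ?N \<longleftrightarrow> i < length Is \<and> a < snd (Is ! i)" for i a
    by (auto simp: diagram_nodes_def rank)
  have mem: "?p (i, a) \<in> set (ivl (Is ! i))" if "(i, a) \<in> ?N" for i a
    using that by (simp add: node ivl_def)
  have cmp: "cm (?p (i, a)) (?p (j, b)) = (if i = j then cox_matrix (ityp (Is ! i)) a b else 2)"
    if n: "(i, a) \<in> ?N" "(j, b) \<in> ?N" for i a j b
  proof (cases "i = j")
    case True
    \<comment> \<open>The interval with the single node 0 is labelled A_1; having one node it has no
      bond to compare.\<close>
    have "snd (Is ! i) \<ge> 2 \<or> (a = 0 \<and> b = 0)" using n True by (auto simp: node)
    then show ?thesis using True by (auto simp: cm_eq cox_matrix_def ityp_def min_def max_def)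
  next
    case False
    then show ?thesis using interval_separated[OF sys _ _ False mem[OF n(1)] mem[OF n(2)]] n by (simp add: node)
  qed
  have inj: "inj_on ?p ?N"
  proof (rule inj_onI)
    fix x y assume n: "x \<in> ?N" "y \<in> ?N" and e: "?p x = ?p y"
    obtain i a j b where xy: "x = (i, a)" "y = (j, b)" by (cases x, cases y)
    have "cm (?p (i, a)) (?p (j, b)) = 1" using e by (simp add: xy cm_eq)
    then have "i = j" using cmp[OF n[unfolded xy]] by (simp split: if_splits)
    then show "x = y" using e by (simp add: xy)
  qed
  have im: "?p ` ?N = set (concat (map ivl Is))"
  proof
    show "?p ` ?N \<subseteq> set (concat (map ivl Is))"
    proof
      fix x assume "x \<in> ?p ` ?N"
      then obtain y where y: "y \<in> ?N" "x = ?p y" by blast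
      obtain i a where "y = (i, a)" by (cases y)
      then have ia: "(i, a) \<in> ?N" "x = ?p (i, a)" using y by simp_all
      then have "x \<in> set (ivl (Is ! i))" using mem by simp
      moreover have "Is ! i \<in> set Is" using ia by (simp add: node)
      ultimately show "x \<in> set (concat (map ivl Is))" by auto
    qed
    show "set (concat (map ivl Is)) \<subseteq> ?p ` ?N"
    proof
      fix x assume "x \<in> set (concat (map ivl Is))"
      then obtain I where "I \<in> set Is" "x \<in> set (ivl I)" by auto
      then obtain i where i: "i < length Is" "x \<in> set (ivl (Is ! i))" by (metis in_set_conv_nth)
      then have "(i, x - fst (Is ! i)) \<in> ?N" "?p (i, x - fst (Is ! i)) = x" by (auto simp: node ivl_def)
      then show "x \<in> ?p ` ?N" by (metis imageI)
    qed
  qed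
  show "bij_betw (\<lambda>(i, a). crefl w (fst (Is ! i) + a)) ?N (crefl w ` set (concat (map ivl Is)))"
  proof -
    have "bij_betw ?p ?N (set (concat (map ivl Is)))" using inj im by (simp add: bij_betw_def)
    moreover have "bij_betw (crefl w) (set (concat (map ivl Is))) (crefl w ` set (concat (map ivl Is)))"
      using inj_on_subset[OF crefl_inj[OF w]] by (simp add: bij_betw_def)
    ultimately have "bij_betw (crefl w \<circ> ?p) ?N (crefl w ` set (concat (map ivl Is)))" by (rule bij_betw_trans)
    moreover have "crefl w \<circ> ?p = (\<lambda>(i, a). crefl w (fst (Is ! i) + a))" by (auto simp: fun_eq_iff)
    ultimately show ?thesis by simp
  qed
  show "\<forall>(i, a)\<in>?N. \<forall>(j, b)\<in>?N.
     perm_order ((case (i, a) of (i, a) \<Rightarrow> crefl w (fst (Is ! i) + a)) \<circ> (case (j, b) of (j, b) \<Rightarrow> crefl w (fst (Is ! j) + b))) =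
     (if i = j then cox_matrix (map ityp Is ! i) a b else 2)"
  proof (clarify)
    fix i a j b assume n: "(i, a) \<in> ?N" "(j, b) \<in> ?N"
    then show "perm_order (crefl w (fst (Is ! i) + a) \<circ> crefl w (fst (Is ! j) + b)) =
       (if i = j then cox_matrix (map ityp Is ! i) a b else 2)"
      using cmp[OF n] by (simp add: perm_order_crefl[OF w] node)
  qed
qed simp

text \<open>With the type B cycle, if any, in front, the cycles are laid on 1, 2, ... as an interval
  system. A signed permutation g carries this model to the cycles of u, so u is a Coxeter element of
  the conjugate of a standard parabolic subgroup. A second type B cycle would find no room at the
  node 0.\<close>

lemma cycle_type_group_type:
  assumes W: "u \<in> W_B n" and B: "num_B (Lam n u) \<le> 1"
  shows "has_group_type n u (conv (ctype (Lam n u)))"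
proof -
  obtain L0 where L0: "cycles_of n L0" "nontrivial L0" "u = prod_perm (map cyc L0)" using exists_cycles[OF W] by blast
  define LA LB where "LA = filter (\<lambda>c. \<not> fst c) L0" and "LB = filter fst L0"
  define L where "L = LB @ LA"
  have ms: "mset L0 = mset L" unfolding L_def LA_def LB_def by (simp add: mset_filter)
  have L: "cycles_of n L" "u = prod_perm (map cyc L)"
    using cycles_of_perm[OF ms L0(1)] prod_cyc_perm[OF ms L0(1)] L0(3) by simp_all
  have "num_B (Lam n u) = length LB"
    unfolding L0(3) realisesD(5)[OF cycles_of_realises[OF L0(1)]] num_B_def LB_def
    by (simp add: comp_def filter_mset_image_mset flip: mset_map mset_filter)
  then have lB: "length LB \<le> 1" using B by simp
  define Is where "Is = intervals 0 L"
  have cA: "\<forall>c\<in>set LA. \<not> fst c \<and> length (snd c) \<ge> 2" using L0(2) by (auto simp: LA_def nontrivial_def)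
  have cB: "\<forall>c\<in>set LB. fst c \<and> snd c \<noteq> []" using L0(1) by (auto simp: LB_def cycles_of_def)
  let ?xs = "concat (map snd L)"
  let ?N = "length ?xs"
  have sh: "shape (map icyc Is) = shape L" and cc: "concat (map snd (map icyc Is)) = map int [1..<Suc ?N]"
    and pos: "\<forall>I\<in>set Is. snd I \<ge> 1"
    using intervals_AB[OF cA cB lB] unfolding Is_def L_def by blast+
  have N: "?N \<le> n" by (rule cycles_of_length[OF L(1)])
  have sys: "interval_system n Is" unfolding interval_system_def cycles_of_def cc
  proof (intro conjI)
    show "sdist (map int [1..<Suc ?N])" by (intro sdist_map_int) (simp_all del: upt_Suc)
    show "set (map int [1..<Suc ?N]) \<subseteq> signed_letters n" using N by (auto simp: signed_letters_def simp del: upt_Suc)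
    show "\<forall>c\<in>set (map icyc Is). snd c \<noteq> []" using pos by (auto simp: icyc_def)
  qed (rule pos)
  have xs: "sdist ?xs" "set ?xs \<subseteq> signed_letters n" using L(1) unfolding cycles_of_def by blast+
  obtain g where g: "g \<in> W_B n" "\<forall>i<?N. g (int i + 1) = ?xs ! i" using exists_W_B_extending[OF xs] by blast
  have "map g (map int [1..<Suc ?N]) = ?xs"
    using g(2) by (intro nth_equalityI) (simp_all add: nth_upt add.commute del: upt_Suc)
  then have "concat (map snd (conj_cycles g (map icyc Is))) = ?xs"
    unfolding cc[symmetric] by (simp add: conj_cycles_def map_concat comp_def)
  then have "conj_cycles g (map icyc Is) = L" using sh by (intro shape_concat_eq) (simp_all only: conj_shape)
  then have ug: "u = g \<circ> prod_perm (map cyc (map icyc Is)) \<circ> inv g"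
    using conj_cycles(2)[OF g(1) interval_cycles[OF sys]] L(2) by simp
  let ?ks = "concat (map ivl Is)"
  have us: "u = prod_perm (map (crefl g) ?ks)"
    unfolding ug interval_prod[OF sys] by (rule prod_crefl[OF g(1), symmetric])
  let ?R = "crefl g ` set ?ks"
  have R: "?R \<in> parabolic_systems n" using interval_list(2)[OF sys] g(1) unfolding parabolic_systems_eq by blast
  then have RS: "?R \<in> simple_systems n (gen_by ?R)" by (simp add: simple_systems_def)
  have "distinct (map (crefl g) ?ks)"
    using interval_list(1)[OF sys] inj_on_subset[OF crefl_inj[OF g(1)]] by (simp add: distinct_map)
  then have 1: "u \<in> coxeter_elements n (gen_by ?R)"
    unfolding coxeter_elements_def mem_Collect_eq us
    by (intro exI[of _ "map (crefl g) ?ks"] conjI HOL.refl) (simp_all only: set_map RS)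
  have 2: "gen_by ?R \<in> parabolic_subgroups n" using R by (simp add: parabolic_subgroups_def)
  have 3: "subgroup_has_type n (gen_by ?R) (mset (map ityp Is))"
    using RS interval_diagram[OF g(1) sys] unfolding subgroup_has_type_def by blast
  have 4: "conv (ctype (Lam n u)) = mset (map ityp Is)"
    unfolding ug Lam_conj[OF g(1) realisesD(1)[OF cycles_of_realises[OF interval_cycles[OF sys]]]]
    by (rule interval_type[OF sys])
  show ?thesis unfolding has_group_type_def 4 using 1 2 3 by blast
qed

lemma has_group_type_iff:
  assumes "u \<in> W_B n" "is_group_type T"
  shows "has_group_type n u T \<longleftrightarrow> T = conv (ctype (Lam n u)) \<and> num_B (Lam n u) \<le> 1"
  using group_type_cycle_type[OF _ assms(2)] cycle_type_group_type[OF assms(1)] by blast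

section \<open>The decomposition numbers\<close>

lemma conv_simps: "conv {#} = {#}" "conv (add_mset X M) = add_mset (if X = Type_B 1 then Type_A 1 else X) (conv M)"
  "conv (M + N) = conv M + conv N"
  by (simp_all add: conv_def)

lemma rk_conv: "rk (conv T) = rk T"
  by (induction T) (auto simp: conv_def rk_def)

lemma conv_id: "Type_B 1 \<notin># T \<Longrightarrow> conv T = T"
  by (induction T) (auto simp: conv_simps)

lemma nB_simps: "nB {#} = 0" "nB (add_mset X M) = (if snd (lam_irr X) then Suc (nB M) else nB M)"
  "nB (M + N) = nB M + nB N"
  by (simp_all add: nB_def)

lemma nB_conv_0: "nB T = 0 \<Longrightarrow> conv T = T"
proof (rule conv_id, rule notI)
  assume "nB T = 0" "Type_B 1 \<in># T"
  then show False by (auto dest!: multi_member_split simp: nB_simps)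
qed

lemma nB_A_type: "nB (A_type n m) = 0"
proof -
  have "filter_mset (\<lambda>X. snd (lam_irr X)) (A_type n m) = {#}"
    unfolding filter_mset_eq_empty using set_A_type[of _ n m] by fastforce
  then show ?thesis by (simp add: nB_def)
qed

lemma nB_ctype_Lam:
  assumes "w \<in> W_B n" shows "nB (ctype (Lam n w)) = num_B (Lam n w)"
proof -
  have "lamT n (ctype (Lam n w)) = Lam n w"
    using lamT_ctype[of "Lam n w"] Lam_pos[OF assms] sum_fst_Lam[OF assms] by simp
  then show ?thesis using num_B_lamT[of n "ctype (Lam n w)"] by (simp add: nB_def)
qed

lemma finite_decompositions: "finite (decompositions n h Ts)"
proof -
  have "finite {cs. set cs \<subseteq> W_B n \<and> length cs = length Ts}"
    by (rule finite_lists_length_eq[OF finite_W_B])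
  then show ?thesis by (rule rev_finite_subset) (auto simp: decompositions_def)
qed

text \<open>A group-theoretic type hides whether an A_1 is combinatorially a B_1. Resolving this for
  the factors of a decomposition gives types Ts', and combined rank n leaves exactly one type B
  label in them.\<close>

lemma group_decompositions:
  assumes n: "n \<ge> 1" and Ts: "\<forall>T\<in>set Ts. is_group_type T" and rank: "(\<Sum>i<length Ts. rk (Ts ! i)) = n"
  shows "decompositions n (has_group_type n) Ts =
    (\<Union>Ts'\<in>{Ts'. map conv Ts' = Ts \<and> (\<Sum>T\<leftarrow>Ts'. nB T) = 1}. decompositions n has_comb_type Ts')"
proof (intro set_eqI iffI)
  fix cs assume cs: "cs \<in> decompositions n (has_group_type n) Ts"
  define Ts' where "Ts' = map (\<lambda>c. ctype (Lam n c)) cs"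
  have W: "set cs \<subseteq> W_B n" and len: "length cs = length Ts"
    and le: "abs_le n (prod_perm cs) (cox n)" "(\<Sum>c\<leftarrow>cs. abs_length n c) = abs_length n (prod_perm cs)"
    and ht: "\<And>i. i < length Ts \<Longrightarrow> has_group_type n (cs ! i) (Ts ! i)"
    using cs unfolding decompositions_def by auto
  have cW: "cs ! i \<in> W_B n" if "i < length Ts" for i using that W len by (auto simp: subset_iff)
  have gt: "is_group_type (Ts ! i)" if "i < length Ts" for i using Ts that by simp
  have "Ts ! i = conv (ctype (Lam n (cs ! i)))" if "i < length Ts" for i
    using has_group_type_iff[OF cW[OF that] gt[OF that]] ht[OF that] by blast
  then have cv: "map conv Ts' = Ts" using len by (intro nth_equalityI) (auto simp: Ts'_def)
  have "has_comb_type (cs ! i) (Ts' ! i)" if "i < length Ts'" for i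
    using has_comb_type_iff[OF cW] that len by (simp add: Ts'_def)
  then have cs': "cs \<in> decompositions n has_comb_type Ts'"
    using W le unfolding decompositions_def by (simp add: Ts'_def)
  have "(\<Sum>i<length Ts'. rk (Ts' ! i)) = (\<Sum>i<length Ts. rk (Ts ! i))"
    unfolding cv[symmetric] by (simp add: rk_conv)
  then have "(\<Sum>T\<leftarrow>Ts'. nB T) = 1" using comb_decomposition_one_B(1)[OF n cs'] rank by simp
  then show "cs \<in> (\<Union>Ts'\<in>{Ts'. map conv Ts' = Ts \<and> (\<Sum>T\<leftarrow>Ts'. nB T) = 1}. decompositions n has_comb_type Ts')"
    using cs' cv by blast
next
  fix cs assume "cs \<in> (\<Union>Ts'\<in>{Ts'. map conv Ts' = Ts \<and> (\<Sum>T\<leftarrow>Ts'. nB T) = 1}. decompositions n has_comb_type Ts')"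
  then obtain Ts' where Ts': "map conv Ts' = Ts" "(\<Sum>T\<leftarrow>Ts'. nB T) = 1" and cs: "cs \<in> decompositions n has_comb_type Ts'"
    by blast
  have len': "length Ts' = length Ts" using Ts'(1) by (metis length_map)
  have W: "set cs \<subseteq> W_B n" and len: "length cs = length Ts"
    and le: "abs_le n (prod_perm cs) (cox n)" "(\<Sum>c\<leftarrow>cs. abs_length n c) = abs_length n (prod_perm cs)"
    and ht: "\<And>i. i < length Ts \<Longrightarrow> has_comb_type (cs ! i) (Ts' ! i)"
    using cs len' unfolding decompositions_def by auto
  have "has_group_type n (cs ! i) (Ts ! i)" if i: "i < length Ts" for i
  proof -
    have cW: "cs ! i \<in> W_B n" using i W len by (auto simp: subset_iff)
    have ct: "Ts' ! i = ctype (Lam n (cs ! i))" using has_comb_type_iff[OF cW] ht[OF i] by blast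
    \<comment> \<open>One type B label in all leaves at most one per factor, as
      \<open>has_group_type\<close> demands.\<close>
    have "nB (Ts' ! i) \<le> (\<Sum>T\<leftarrow>Ts'. nB T)" using i len' by (intro member_le_sum_list) simp_all
    then have "num_B (Lam n (cs ! i)) \<le> 1" using Ts'(2) nB_ctype_Lam[OF cW] ct by simp
    moreover have "Ts ! i = conv (ctype (Lam n (cs ! i)))" using Ts'(1) i len' ct by (metis nth_map)
    ultimately show ?thesis using cycle_type_group_type[OF cW] by simp
  qed
  then show "cs \<in> decompositions n (has_group_type n) Ts" using W len le unfolding decompositions_def by simp
qed

lemma comb_decompositions_disjoint:
  assumes "cs \<in> decompositions n has_comb_type Ts" "cs \<in> decompositions n has_comb_type Us"
  shows "Ts = Us"
proof (rule nth_equalityI)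
  show len: "length Ts = length Us" using assms by (simp add: decompositions_def)
  fix i assume i: "i < length Ts"
  have "length cs = length Ts" "set cs \<subseteq> W_B n" using assms(1) by (simp_all add: decompositions_def)
  then have cW: "cs ! i \<in> W_B n" using i by (auto simp: subset_iff)
  have "has_comb_type (cs ! i) (Ts ! i)" "has_comb_type (cs ! i) (Us ! i)"
    using assms i len by (simp_all add: decompositions_def)
  then show "Ts ! i = Us ! i" using has_comb_type_iff[OF cW] by simp
qed

lemma in_sum_list: "T \<in> set Ts \<Longrightarrow> X \<in># T \<Longrightarrow> X \<in># sum_list Ts" for X :: irr_type
  by (induction Ts) auto

lemma nB_sum_list: "nB (sum_list Ts) = (\<Sum>T\<leftarrow>Ts. nB T)"
  by (induction Ts) (simp_all add: nB_simps)

text \<open>The visible B_\<alpha> is already the only type B label, so no A_1 can stand for a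
  B_1.\<close>

lemma conv_list_one_B:
  assumes cv: "map conv Ts' = Ts" and one: "(\<Sum>T\<leftarrow>Ts'. nB T) = 1" and B: "T \<in> set Ts" "Type_B \<alpha> \<in># T" "\<alpha> \<ge> 2"
  shows "Ts' = Ts"
proof -
  obtain T' where T': "T' \<in> set Ts'" "T = conv T'" using cv B(1) by auto
  have "Type_B \<alpha> \<in># T'" using B(2,3) unfolding T'(2) conv_def by (auto split: if_splits)
  then have 1: "Type_B \<alpha> \<in># sum_list Ts'" using T'(1) in_sum_list by blast
  have "Type_B 1 \<notin># U" if U: "U \<in> set Ts'" for U
  proof
    assume "Type_B 1 \<in># U"
    then have 2: "Type_B 1 \<in># sum_list Ts'" using U in_sum_list by blast
    obtain M where M: "sum_list Ts' = add_mset (Type_B \<alpha>) M" using 1 by (meson multi_member_split)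
    then have "Type_B 1 \<in># M" using 2 B(3) by simp
    then obtain N where "M = add_mset (Type_B 1) N" by (meson multi_member_split)
    then have "nB (sum_list Ts') \<ge> 2" by (simp add: M nB_simps)
    then show False using one by (simp add: nB_sum_list)
  qed
  then have "map conv Ts' = map id Ts'" by (intro map_cong) (auto intro: conv_id)
  then show ?thesis using cv by simp
qed

text \<open>With no visible type B label, the single one in Ts' must be a B_1 that became an A_1 in
  one of the types.\<close>

lemma conv_list_all_A:
  assumes Ts: "\<forall>T\<in>set Ts. nB T = 0" and cv: "map conv Ts' = Ts" and one: "(\<Sum>T\<leftarrow>Ts'. nB T) = 1"
  shows "\<exists>j<length Ts. Type_A 1 \<in># Ts ! j \<and> Ts' = Ts[j := add_mset (Type_B 1) (Ts ! j - {#Type_A 1#})]"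
proof -
  let ?d = "length Ts"
  have len: "length Ts' = ?d" using cv by (metis length_map)
  have cvi: "conv (Ts' ! i) = Ts ! i" if "i < ?d" for i using cv len that by (metis nth_map)
  have s: "(\<Sum>i<?d. nB (Ts' ! i)) = 1" using one by (simp add: sum_list_sum_nth atLeast0LessThan len)
  then have "\<exists>j<?d. nB (Ts' ! j) \<noteq> 0" by (metis lessThan_iff sum.neutral zero_neq_one)
  then obtain j where j: "j < ?d" "nB (Ts' ! j) \<noteq> 0" by blast
  have "(\<Sum>i<?d. nB (Ts' ! i)) = nB (Ts' ! j) + (\<Sum>i\<in>{..<?d} - {j}. nB (Ts' ! i))"
    using j by (intro sum.remove) auto
  then have nj: "nB (Ts' ! j) = 1" and "(\<Sum>i\<in>{..<?d} - {j}. nB (Ts' ! i)) = 0" using s j by linarith+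
  then have eq: "Ts' ! i = Ts ! i" if "i < ?d" "i \<noteq> j" for i
    using that nB_conv_0[of "Ts' ! i"] cvi[OF that(1)] by simp
  have "filter_mset (\<lambda>X. snd (lam_irr X)) (Ts' ! j) \<noteq> {#}" using nj unfolding nB_def by (metis size_empty zero_neq_one)
  then obtain X where "X \<in># filter_mset (\<lambda>X. snd (lam_irr X)) (Ts' ! j)" by (meson multiset_nonemptyE)
  then have X: "X \<in># Ts' ! j" "snd (lam_irr X)" by auto
  obtain M where M: "Ts' ! j = add_mset X M" using X(1) by (meson multi_member_split)
  have "nB M = 0" using nj X(2) by (simp add: M nB_simps)
  then have "conv M = M" by (rule nB_conv_0)
  then have tj: "Ts ! j = add_mset (if X = Type_B 1 then Type_A 1 else X) M" using cvi[OF j(1)] by (simp add: M conv_simps)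
  have "nB (Ts ! j) = 0" using Ts j(1) by simp
  then have X1: "X = Type_B 1" using X(2) by (auto simp: tj nB_simps split: if_splits)
  have "Ts' = Ts[j := add_mset (Type_B 1) (Ts ! j - {#Type_A 1#})]"
    using eq M j(1) len by (intro nth_equalityI) (auto simp: nth_list_update tj X1)
  then show ?thesis using j(1) tj X1 by auto
qed

lemma group_type_A_type: "is_group_type (A_type n m)"
  unfolding is_group_type_def using set_A_type[of _ n m] by fastforce

lemma N_B_one_B:
  assumes n: "n \<ge> 1" and ty: "types_one_B n j \<alpha> m Ts" and \<alpha>: "\<alpha> \<ge> 2" and rank: "(\<Sum>i<length Ts. rk (Ts ! i)) = n"
  shows "N_B n Ts = N_B_comb n Ts"
proof -
  have j: "j < length Ts" and T: "\<And>i. i < length Ts \<Longrightarrow> Ts ! i = (if i = j then {#Type_B \<alpha>#} else {#}) + A_type n (m i)"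
    using ty by (auto simp: types_one_B_def)
  have g: "\<forall>T\<in>set Ts. is_group_type T"
  proof
    fix U assume "U \<in> set Ts"
    then obtain i where "i < length Ts" "U = Ts ! i" by (metis in_set_conv_nth)
    then show "is_group_type U" using T[of i] group_type_A_type[of n "m i"] \<alpha> by (auto simp: is_group_type_def)
  qed
  have B: "Ts ! j \<in> set Ts" "Type_B \<alpha> \<in># Ts ! j" using j by (rule nth_mem) (simp add: T[OF j])
  have mem: "Type_B 1 \<notin># U" if "U \<in> set Ts" for U
  proof
    assume 1: "Type_B 1 \<in># U"
    then have "is_group_irr (Type_B 1)" using g that unfolding is_group_type_def by blast
    then show False by simp
  qed
  have nBi: "nB (Ts ! i) = (if i = j then 1 else 0)" if "i < length Ts" for i
    unfolding T[OF that] by (simp add: nB_simps nB_A_type)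
  have "(\<Sum>T\<leftarrow>Ts. nB T) = (\<Sum>i<length Ts. nB (Ts ! i))" by (simp add: sum_list_sum_nth atLeast0LessThan)
  also have "\<dots> = (\<Sum>i<length Ts. if i = j then 1 else 0)" using nBi by (intro sum.cong) auto
  finally have one: "(\<Sum>T\<leftarrow>Ts. nB T) = 1" using j by simp
  have id: "map conv Ts = Ts" by (rule map_idI) (rule conv_id[OF mem])
  have "{Ts'. map conv Ts' = Ts \<and> (\<Sum>T\<leftarrow>Ts'. nB T) = 1} = {Ts}"
    using conv_list_one_B[OF _ _ B \<alpha>] id one by blast
  then show ?thesis using group_decompositions[OF n g rank] by (simp add: N_B_def N_B_comb_def)
qed

section \<open>The formula for types without type B labels\<close>

lemma recip_fact_add_1: "k + 1 \<noteq> 0 \<Longrightarrow> recip_fact (k + 1) = recip_fact k / (of_int k + 1)"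
proof (cases "k \<ge> 0")
  case True
  then have "nat (k + 1) = Suc (nat k)" by simp
  then show ?thesis using True by (simp add: recip_fact_def add.commute)
qed (simp add: recip_fact_def)

lemma multinomial_m0:
  assumes "rk T \<le> n"
  shows "multinomial (n - rk T) n m = fact (n - rk T) / (\<Prod>s=1..n. fact (m s)) * recip_fact (m0 n T m)"
  using assms by (simp add: multinomial_def m0_def of_nat_diff)

text \<open>Turning one A_1 into B_1 keeps the rank and lowers m_1 by one, hence raises m_0 by one;
  the factor m_1 comes from (m_1 - 1)! in the denominator.\<close>

lemma multinomial_pred:
  assumes n: "n \<ge> 1" and m: "m 1 \<ge> 1" and rk: "rk T \<le> n"
  shows "multinomial (n - rk T) n (m(1 := m 1 - 1)) =
    real (m 1) * (fact (n - rk T) / (\<Prod>s=1..n. fact (m s)) * recip_fact (m0 n T m + 1))"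
proof -
  let ?m = "m(1 := m 1 - 1)"
  have s: "{1..n} = insert 1 {2..n}" using n by auto
  have "(\<Prod>s=1..n. fact (m s) :: real) = fact (m 1) * (\<Prod>s=2..n. fact (m s))" unfolding s by simp
  moreover have "(\<Prod>s=1..n. fact (?m s) :: real) = fact (m 1 - 1) * (\<Prod>s=2..n. fact (?m s))" unfolding s by simp
  moreover have "(\<Prod>s=2..n. fact (?m s) :: real) = (\<Prod>s=2..n. fact (m s))" by (intro prod.cong) auto
  moreover have "(fact (m 1) :: real) = real (m 1) * fact (m 1 - 1)" using m by (simp add: fact_reduce)
  ultimately have p: "(\<Prod>s=1..n. fact (m s) :: real) = real (m 1) * (\<Prod>s=1..n. fact (?m s))" by simp
  have "(\<Sum>s=1..n. m s) = m 1 + (\<Sum>s=2..n. m s)" unfolding s by simp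
  moreover have "(\<Sum>s=1..n. ?m s) = (m 1 - 1) + (\<Sum>s=2..n. ?m s)" unfolding s by simp
  moreover have "(\<Sum>s=2..n. ?m s) = (\<Sum>s=2..n. m s)" by (intro sum.cong) auto
  ultimately have "(\<Sum>s=1..n. m s) = (\<Sum>s=1..n. ?m s) + 1" using m by linarith
  then have "m0 n T ?m = m0 n T m + 1" by (simp add: m0_def)
  moreover have "(\<Prod>s=1..n. fact (?m s) :: real) \<noteq> 0" by simp
  ultimately show ?thesis unfolding multinomial_m0[OF rk] p using m by simp
qed

lemma A_type_remove:
  assumes "n \<ge> 1" "m 1 \<ge> 1"
  shows "A_type n m = add_mset (Type_A 1) (A_type n (m(1 := m 1 - 1)))"
proof -
  have s: "{1..n} = insert 1 {2..n}" using assms(1) by auto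
  have "(\<Sum>s=2..n. replicate_mset ((m(1 := m 1 - 1)) s) (Type_A s)) = (\<Sum>s=2..n. replicate_mset (m s) (Type_A s))"
    by (intro sum.cong) auto
  moreover obtain k where "m 1 = Suc k" using assms(2) by (cases "m 1") auto
  ultimately show ?thesis unfolding A_type_def s by simp
qed

lemma A_type_mem:
  assumes "n \<ge> 1" shows "Type_A 1 \<in># A_type n m \<longleftrightarrow> m 1 \<ge> 1"
proof
  assume *: "Type_A 1 \<in># A_type n m"
  show "m 1 \<ge> 1"
  proof (rule ccontr)
    assume "\<not> m 1 \<ge> 1"
    moreover have "Type_A 1 \<notin># A_type r m" if m: "m 1 = 0" for r
    proof (induction r)
      case (Suc r)
      then show ?case using m by (cases r) (auto simp: A_type_0 A_type_Suc)
    qed (simp add: A_type_0)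
    ultimately show False using * by simp
  qed
qed (simp add: A_type_remove[OF assms])

text \<open>The sum runs over the type T_j that contains the hidden B_1. Which of the equal labels
  A_1 in T_j is replaced does not matter, so j alone indexes the combinatorial types, and part (i)
  with \<alpha> = 1 gives each summand.\<close>

lemma N_B_all_A:
  assumes n: "n \<ge> 1" and ty: "types_all_A n m Ts" and rank: "(\<Sum>i<length Ts. rk (Ts ! i)) = n"
  shows "real (N_B n Ts) = real n ^ (length Ts - 1) *
    (\<Sum>j<length Ts. real (m j 1) *
       (fact (n - rk (Ts ! j)) / (\<Prod>s = 1..n. fact (m j s)) * recip_fact (m0 n (Ts ! j) (m j) + 1)) *
       (\<Prod>i\<in>{..<length Ts} - {j}. 1 / (real n - real (rk (Ts ! i))) * multinomial (n - rk (Ts ! i)) n (m i)))"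
proof -
  let ?d = "length Ts"
  define F where "F j = real (m j 1) *
       (fact (n - rk (Ts ! j)) / (\<Prod>s = 1..n. fact (m j s)) * recip_fact (m0 n (Ts ! j) (m j) + 1)) *
       (\<Prod>i\<in>{..<?d} - {j}. 1 / (real n - real (rk (Ts ! i))) * multinomial (n - rk (Ts ! i)) n (m i))" for j
  have T: "Ts ! i = A_type n (m i)" if "i < ?d" for i using ty that by (simp add: types_all_A_def)
  have nB0: "\<forall>T\<in>set Ts. nB T = 0" and g: "\<forall>T\<in>set Ts. is_group_type T"
    using T nB_A_type group_type_A_type by (auto simp: in_set_conv_nth)
  have rkle: "rk (Ts ! i) \<le> n" if "i < ?d" for i
    unfolding rank[symmetric] using that by (intro member_le_sum) auto
  define U where "U j = Ts[j := add_mset (Type_B 1) (Ts ! j - {#Type_A 1#})]" for j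
  define S where "S = {j. j < ?d \<and> m j 1 \<ge> 1}"
  have Uj: "U j ! j = add_mset (Type_B 1) (A_type n ((m j)(1 := m j 1 - 1)))" if "j \<in> S" for j
    using that T[of j] A_type_remove[OF n, of "m j"] by (simp add: U_def S_def)
  have Ui: "U j ! i = Ts ! i" if "i \<noteq> j" for i j using that by (simp add: U_def)
  have lU: "length (U j) = ?d" for j by (simp add: U_def)
  have Uset: "{Ts'. map conv Ts' = Ts \<and> (\<Sum>T\<leftarrow>Ts'. nB T) = 1} = U ` S"
  proof (intro set_eqI iffI)
    fix Ts' assume "Ts' \<in> {Ts'. map conv Ts' = Ts \<and> (\<Sum>T\<leftarrow>Ts'. nB T) = 1}"
    then obtain j where j: "j < ?d" "Type_A 1 \<in># Ts ! j" "Ts' = U j"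
      using conv_list_all_A[OF nB0, of Ts'] unfolding U_def by blast
    then have "j \<in> S" using T[OF j(1)] A_type_mem[OF n] by (simp add: S_def)
    then show "Ts' \<in> U ` S" using j(3) by blast
  next
    fix Ts' assume "Ts' \<in> U ` S"
    then obtain j where j: "j \<in> S" "Ts' = U j" by blast
    then have jd: "j < ?d" "m j 1 \<ge> 1" by (simp_all add: S_def)
    have "conv (U j ! i) = Ts ! i" if i: "i < ?d" for i
    proof (cases "i = j")
      case True
      show ?thesis unfolding True Uj[OF j(1)] conv_simps nB_conv_0[OF nB_A_type] T[OF jd(1)] A_type_remove[of n "m j", OF n jd(2)] by simp
    next
      case False
      then show ?thesis using Ui[OF False] nB_conv_0[of "Ts ! i"] nB0 i by simp
    qed
    then have 1: "map conv (U j) = Ts" by (intro nth_equalityI) (simp_all add: lU)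
    have "nB (U j ! i) = (if i = j then 1 else 0)" if i: "i < ?d" for i
      using Uj[OF j(1)] Ui[of i j] nB0 i by (auto simp: nB_simps nB_A_type)
    then have "(\<Sum>i<?d. nB (U j ! i)) = (\<Sum>i<?d. if i = j then 1 else 0)" by (intro sum.cong) auto
    also have "\<dots> = 1" using jd(1) by simp
    finally have "(\<Sum>T\<leftarrow>U j. nB T) = 1" by (simp add: sum_list_sum_nth atLeast0LessThan lU)
    then show "Ts' \<in> {Ts'. map conv Ts' = Ts \<and> (\<Sum>T\<leftarrow>Ts'. nB T) = 1}" using 1 j(2) by simp
  qed
  have inj: "inj_on U S"
  proof (rule inj_onI, rule ccontr)
    fix j k assume jk: "j \<in> S" "k \<in> S" "U j = U k" "j \<noteq> k"
    then have "nB (U j ! j) = nB (Ts ! j)" using Ui[of j k] by simp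
    moreover have "nB (Ts ! j) = 0" using jk(1) nB0 by (simp add: S_def)
    ultimately show False using Uj[OF jk(1)] by (simp add: nB_simps)
  qed
  have summand: "real (N_B_comb n (U j)) = real n ^ (?d - 1) * F j" if j: "j \<in> S" for j
  proof -
    let ?m = "m(j := (m j)(1 := m j 1 - 1))"
    have jd: "j < ?d" "m j 1 \<ge> 1" using j by (simp_all add: S_def)
    have rkU: "rk (U j ! i) = rk (Ts ! i)" if "i < ?d" for i
    proof (cases "i = j")
      case True
      show ?thesis unfolding True Uj[OF j] T[OF jd(1)] A_type_remove[of n "m j", OF n jd(2)] by (simp add: rk_def)
    qed (simp add: Ui)
    have "types_one_B n j 1 ?m (U j)" unfolding types_one_B_def lU using jd(1) Uj[OF j] Ui T by auto
    then have "real (N_B_comb n (U j)) = real n ^ (length (U j) - 1) * multinomial (n - rk (U j ! j)) n (?m j) *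
       (\<Prod>i\<in>{..<length (U j)} - {j}. 1 / (real n - real (rk (U j ! i))) * multinomial (n - rk (U j ! i)) n (?m i))"
      by (rule N_B_comb_one_B[OF n]) (simp_all add: lU rkU rank)
    also have "(\<Prod>i\<in>{..<length (U j)} - {j}. 1 / (real n - real (rk (U j ! i))) * multinomial (n - rk (U j ! i)) n (?m i)) =
       (\<Prod>i\<in>{..<?d} - {j}. 1 / (real n - real (rk (Ts ! i))) * multinomial (n - rk (Ts ! i)) n (m i))"
      unfolding lU by (intro prod.cong) (auto simp: Ui)
    also have "multinomial (n - rk (U j ! j)) n (?m j) =
       real (m j 1) * (fact (n - rk (Ts ! j)) / (\<Prod>s = 1..n. fact (m j s)) * recip_fact (m0 n (Ts ! j) (m j) + 1))"
      unfolding rkU[OF jd(1)] using multinomial_pred[of n "m j" "Ts ! j", OF n jd(2) rkle[OF jd(1)]] by simp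
    finally show ?thesis by (simp add: F_def lU mult.assoc)
  qed
  have "N_B n Ts = card (\<Union>j\<in>S. decompositions n has_comb_type (U j))"
    unfolding N_B_def group_decompositions[OF n g rank] Uset by simp
  also have "\<dots> = (\<Sum>j\<in>S. N_B_comb n (U j))" unfolding N_B_comb_def
  proof (rule card_UN_disjoint)
    show "finite S" by (simp add: S_def)
    show "\<forall>j\<in>S. \<forall>k\<in>S. j \<noteq> k \<longrightarrow> decompositions n has_comb_type (U j) \<inter> decompositions n has_comb_type (U k) = {}"
      using comb_decompositions_disjoint inj_onD[OF inj] by blast
  qed (simp add: finite_decompositions)
  finally have "real (N_B n Ts) = (\<Sum>j\<in>S. real (N_B_comb n (U j)))" by simp
  also have "\<dots> = (\<Sum>j\<in>S. real n ^ (?d - 1) * F j)" using summand by (intro sum.cong) auto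
  also have "\<dots> = real n ^ (?d - 1) * (\<Sum>j\<in>S. F j)" by (simp add: sum_distrib_left)
  \<comment> \<open>Types without A_1 contribute 0 because of the factor m_1.\<close>
  also have "(\<Sum>j\<in>S. F j) = (\<Sum>j<?d. F j)"
  proof (rule sum.mono_neutral_left)
    show "\<forall>j\<in>{..<?d} - S. F j = 0" by (auto simp: S_def F_def)
  qed (auto simp: S_def)
  finally show ?thesis by (simp only: F_def)
qed

text \<open>The full product has the additional factor 1 / (n - rk T_j) and m_0! in place of (m_0 +
  1)! for i = j; the fraction in the summand corrects both.\<close>

lemma all_A_product_form:
  assumes j: "j < d" and rk: "rk (Ts ! j) < n" and z: "m0 n (Ts ! j) (m j) + 1 \<noteq> 0"
  shows "real (m j 1) *
       (fact (n - rk (Ts ! j)) / (\<Prod>s = 1..n. fact (m j s)) * recip_fact (m0 n (Ts ! j) (m j) + 1)) *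
       (\<Prod>i\<in>{..<d} - {j}. 1 / (real n - real (rk (Ts ! i))) * multinomial (n - rk (Ts ! i)) n (m i)) =
    (\<Prod>i<d. 1 / (real n - real (rk (Ts ! i))) * multinomial (n - rk (Ts ! i)) n (m i)) *
    (real (m j 1) * (real n - real (rk (Ts ! j))) / (real_of_int (m0 n (Ts ! j) (m j)) + 1))"
proof -
  have "(\<Prod>i<d. 1 / (real n - real (rk (Ts ! i))) * multinomial (n - rk (Ts ! i)) n (m i)) =
    1 / (real n - real (rk (Ts ! j))) * multinomial (n - rk (Ts ! j)) n (m j) *
    (\<Prod>i\<in>{..<d} - {j}. 1 / (real n - real (rk (Ts ! i))) * multinomial (n - rk (Ts ! i)) n (m i))"
    using j by (intro prod.remove) auto
  moreover have "multinomial (n - rk (Ts ! j)) n (m j) =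
    fact (n - rk (Ts ! j)) / (\<Prod>s=1..n. fact (m j s)) * recip_fact (m0 n (Ts ! j) (m j))"
    using rk by (intro multinomial_m0) simp
  moreover have "real n - real (rk (Ts ! j)) \<noteq> 0" using rk by simp
  ultimately show ?thesis unfolding recip_fact_add_1[OF z] by simp
qed

lemma A_type_add: "n \<ge> 1 \<Longrightarrow> add_mset (Type_A 1) (A_type n m) = A_type n (m(1 := Suc (m 1)))"
  using A_type_remove[of n "m(1 := Suc (m 1))"] by simp

text \<open>A decomposition would give combinatorial types of the form in (i). Read as
  group-theoretic types these have the form in (i) for \<alpha> \<ge> 2 and the form in (ii) for
  \<alpha> = 1, with m_1 raised by one in the type that contains B_1.\<close>

lemma N_B_other:
  assumes n: "n \<ge> 1" and g: "\<forall>T\<in>set Ts. is_group_type T" and rank: "(\<Sum>i<length Ts. rk (Ts ! i)) = n"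
    and nB: "\<not> (\<exists>j \<alpha> m. \<alpha> \<ge> 2 \<and> types_one_B n j \<alpha> m Ts)" and nA: "\<not> (\<exists>m. types_all_A n m Ts)"
  shows "N_B n Ts = 0"
proof -
  have False if Ts': "map conv Ts' = Ts" "(\<Sum>T\<leftarrow>Ts'. nB T) = 1" and cs: "cs \<in> decompositions n has_comb_type Ts'" for Ts' cs
  proof -
    have len: "length Ts' = length Ts" using Ts'(1) by (metis length_map)
    have cvi: "conv (Ts' ! i) = Ts ! i" if "i < length Ts" for i using Ts'(1) len that by (metis nth_map)
    have ct: "\<forall>T\<in>set Ts'. is_comb_type T"
    proof
      fix T assume "T \<in> set Ts'"
      then obtain i where "i < length Ts'" "T = Ts' ! i" by (metis in_set_conv_nth)
      then have "has_comb_type (cs ! i) T" using cs by (simp add: decompositions_def)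
      then show "is_comb_type T" unfolding has_comb_type_def is_comb_type_def by fastforce
    qed
    have "(\<Sum>i<length Ts'. rk (Ts' ! i)) = n"
      using rank cvi rk_conv by (metis (no_types, lifting) len lessThan_iff sum.cong)
    then obtain j \<alpha> m where ty: "\<alpha> \<ge> 1" "types_one_B n j \<alpha> m Ts'"
      using comb_type_one_B[OF ct _ Ts'(2)] by blast
    have j: "j < length Ts" and T: "\<And>i. i < length Ts \<Longrightarrow> Ts' ! i = (if i = j then {#Type_B \<alpha>#} else {#}) + A_type n (m i)"
      using ty(2) by (auto simp: types_one_B_def len)
    have T': "Ts ! i = (if i = j then {#if \<alpha> = 1 then Type_A 1 else Type_B \<alpha>#} else {#}) + A_type n (m i)"
      if "i < length Ts" for i
      using cvi[OF that] T[OF that] by (auto simp: conv_simps nB_conv_0[OF nB_A_type])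
    show False
    proof (cases "\<alpha> = 1")
      case True
      then have "types_all_A n (m(j := (m j)(1 := Suc (m j 1)))) Ts"
        unfolding types_all_A_def using T' A_type_add[OF n] by auto
      then show False using nA by blast
    next
      case False
      then have "types_one_B n j \<alpha> m Ts" unfolding types_one_B_def using T' j by auto
      then show False using nB ty(1) False by (metis Suc_1 le_antisym not_less_eq_eq)
    qed
  qed
  then have "decompositions n (has_group_type n) Ts = {}" unfolding group_decompositions[OF n g rank] by blast
  then show ?thesis by (simp add: N_B_def)
qed

lemma N_B_comb_other:
  assumes n: "n \<ge> 1" and ct: "\<forall>T\<in>set Ts. is_comb_type T" and rank: "(\<Sum>i<length Ts. rk (Ts ! i)) = n"
    and nB: "\<not> (\<exists>j \<alpha> m. \<alpha> \<ge> 1 \<and> types_one_B n j \<alpha> m Ts)"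
  shows "N_B_comb n Ts = 0"
proof -
  have "decompositions n has_comb_type Ts = {}"
    using comb_decomposition_one_B(1)[OF n _ rank] comb_type_one_B[OF ct rank] nB by blast
  then show ?thesis by (simp add: N_B_comb_def)
qed

theorem theorem4:
  fixes n d :: nat and Ts :: "refl_type list"
  assumes "n \<ge> 1" and "d \<ge> 1" and "length Ts = d"
    and "(\<Sum>i<d. rk (Ts ! i)) = n"
  shows
    \<comment> \<open>(i)\<close>
    "(\<forall>j \<alpha> m. \<alpha> \<ge> 1 \<and> types_one_B n j \<alpha> m Ts \<longrightarrow>
        (let F = real n ^ (d - 1) * multinomial (n - rk (Ts ! j)) n (m j) *
                 (\<Prod>i\<in>{..<d} - {j}. 1 / (real n - real (rk (Ts ! i))) *
                                        multinomial (n - rk (Ts ! i)) n (m i))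
         in real (N_B_comb n Ts) = F \<and> (\<alpha> \<ge> 2 \<longrightarrow> real (N_B n Ts) = F)))
     \<and>
     \<comment> \<open>(ii): the formula as displayed, whenever no denominator in it vanishes\<close>
     (\<forall>m. types_all_A n m Ts \<and> (\<forall>i<d. rk (Ts ! i) \<noteq> n \<and> m0 n (Ts ! i) (m i) + 1 \<noteq> 0) \<longrightarrow>
        real (N_B n Ts) =
          real n ^ (d - 1) *
          (\<Prod>i<d. 1 / (real n - real (rk (Ts ! i))) * multinomial (n - rk (Ts ! i)) n (m i)) *
          (\<Sum>j<d. real (m j 1) * (real n - real (rk (Ts ! j))) /
                    (real_of_int (m0 n (Ts ! j) (m j)) + 1)))
     \<and>
     \<comment> \<open>(ii) in general: the same formula, with the product multiplied into the sum and the
        \<open>j\<close>-th factor \<open>1 / (m\<^sub>0! (m\<^sub>0 + 1))\<close> read as \<open>1 / (m\<^sub>0 + 1)!\<close>\<close>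
     (\<forall>m. types_all_A n m Ts \<longrightarrow>
        real (N_B n Ts) =
          real n ^ (d - 1) *
          (\<Sum>j<d. real (m j 1) *
                    (fact (n - rk (Ts ! j)) / (\<Prod>s = 1..n. fact (m j s)) *
                     recip_fact (m0 n (Ts ! j) (m j) + 1)) *
                    (\<Prod>i\<in>{..<d} - {j}. 1 / (real n - real (rk (Ts ! i))) *
                                           multinomial (n - rk (Ts ! i)) n (m i))))
     \<and>
     \<comment> \<open>(iii)\<close>
     ((\<forall>T\<in>set Ts. is_group_type T) \<and>
        \<not> (\<exists>j \<alpha> m. \<alpha> \<ge> 2 \<and> types_one_B n j \<alpha> m Ts) \<and> \<not> (\<exists>m. types_all_A n m Ts) \<longrightarrow>
        N_B n Ts = 0)
     \<and>
     ((\<forall>T\<in>set Ts. is_comb_type T) \<and>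
        \<not> (\<exists>j \<alpha> m. \<alpha> \<ge> 1 \<and> types_one_B n j \<alpha> m Ts) \<longrightarrow>
        N_B_comb n Ts = 0)"
proof (intro conjI allI impI, goal_cases)
  have rank: "(\<Sum>i<length Ts. rk (Ts ! i)) = n" using assms by simp
  case (1 j \<alpha> m)
  then have ty: "types_one_B n j \<alpha> m Ts" and \<alpha>: "\<alpha> \<ge> 1" by simp_all
  show ?case
    using N_B_comb_one_B[OF assms(1) ty \<alpha> rank] N_B_one_B[OF assms(1) ty _ rank] assms(3) by (simp add: Let_def)
next
  case (2 m)
  have rank: "(\<Sum>i<length Ts. rk (Ts ! i)) = n" using assms by simp
  \<comment> \<open>No rank exceeds the total n, and equality is excluded because the displayed
    formula divides by n - rk T_i.\<close>
  have "rk (Ts ! i) < n" if "i < d" for i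
  proof -
    have "rk (Ts ! i) \<le> (\<Sum>i<d. rk (Ts ! i))" using that by (intro member_le_sum) auto
    then show ?thesis using 2 that assms(4) by (simp add: le_neq_implies_less)
  qed
  then have "(\<Sum>j<d. real (m j 1) *
       (fact (n - rk (Ts ! j)) / (\<Prod>s = 1..n. fact (m j s)) * recip_fact (m0 n (Ts ! j) (m j) + 1)) *
       (\<Prod>i\<in>{..<d} - {j}. 1 / (real n - real (rk (Ts ! i))) * multinomial (n - rk (Ts ! i)) n (m i))) =
    (\<Sum>j<d. (\<Prod>i<d. 1 / (real n - real (rk (Ts ! i))) * multinomial (n - rk (Ts ! i)) n (m i)) *
       (real (m j 1) * (real n - real (rk (Ts ! j))) / (real_of_int (m0 n (Ts ! j) (m j)) + 1)))"
    using 2 by (intro sum.cong[OF HOL.refl] all_A_product_form) simp_all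
  moreover have "types_all_A n m Ts" using 2 by simp
  ultimately show ?case
    using N_B_all_A[OF assms(1) _ rank, of m] unfolding assms(3) by (simp only: sum_distrib_left[symmetric] mult.assoc)
next
  case (3 m)
  have rank: "(\<Sum>i<length Ts. rk (Ts ! i)) = n" using assms by simp
  show ?case using N_B_all_A[OF assms(1) 3 rank] unfolding assms(3) .
next
  case 4
  have rank: "(\<Sum>i<length Ts. rk (Ts ! i)) = n" using assms by simp
  show ?case
    by (rule N_B_other[OF assms(1) 4[THEN conjunct1] rank 4[THEN conjunct2, THEN conjunct1] 4[THEN conjunct2, THEN conjunct2]])
next
  case 5
  have rank: "(\<Sum>i<length Ts. rk (Ts ! i)) = n" using assms by simp
  show ?case by (rule N_B_comb_other[OF assms(1) 5[THEN conjunct1] rank 5[THEN conjunct2]])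
qed

end
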